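(* Under the standing assumptions (A1)–(A5) listed in the context, there exists $r_0>0$ such that for any fixed $r\in(0,r_0)$ the following holds. For $\mu_0\in\mathcal{P}([d])$ consider the discounted mean field game system, for $t\ge0$, $x\in[d]$, $$\begin{cases}-\frac{d}{dt}u^r_x(t)=-ru^r_x(t)+H(x,\Delta_xu^r(t))+F(x,\mu^r(t)),\\ \frac{d}{dt}\mu^r_x(t)=\sum_{y\in[d]}\mu^r_y(t)\gamma^*_x(y,\Delta_yu^r(t)),\\ \mu^r_x(0)=\mu_{0,x},\end{cases}\qquad(\mathrm{MFG}_r)$$ where $u^r:[0,\infty)\to\mathbb{R}^d$ and $\mu^r:[0,\infty)\to\mathcal{P}([d])$. (i) The system $(\mathrm{MFG}_r)$ admits a unique solution. (ii) There exist $\gamma,r_0>0$ and $C>0$, independent of $\mu_0$, such that for any $r\in(0,r_0)$ and $t\ge0$, $$|\mu^r(t)-\bar\mu^r|+|u^r(t)-\bar u^r|\le Ce^{-\gamma t},$$ where $(\bar u^r,\bar\mu^r)\in(0,\infty)^d\times\mathcal{P}([d])$ is the unique solution of the stationary system $-r\bar u^r_x+H(x,\Delta_x\bar u^r)+F(x,\bar\mu^r)=0$, $\sum_{y\in[d]}\bar\mu^r_y\gamma^*_x(y,\Delta_y\bar u^r)=0$, $x\in[d]$. (iii) Let $(u^r,\mu^r)$ and $(\tilde u^r,\tilde\mu^r)$ be solutions of $(\mathrm{MFG}_r)$ where the initial data $\mu_0:=\mu^r(0)$ and $\tilde\mu_0:=\tilde\mu^r(0)$ are allowed to differ. Then there exist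 $C,\gamma>0$, independent of $\mu_0,\tilde\mu_0$, such that for all $r\in(0,r_0)$ and $t\ge0$, $$|\mu^r(t)-\tilde\mu^r(t)|+|u^r(t)-\tilde u^r(t)|\le Ce^{-\gamma t}|\mu_0-\tilde\mu_0|.$$ (iv) (With initial datum $\mu_0=e_{x_0}$, the law of the fixed initial state $x_0\in[d]$ of the representative player.) Any solution $(u^r,\mu^r)$ of $(\mathrm{MFG}_r)$ gives rise to a discounted mean field equilibrium $(\alpha^r,\mu^r)$, where $\alpha^r_{xy}(t):=\gamma^*_y(x,\Delta_xu^r(t))$. Conversely, any discounted mean field equilibrium $(\tilde\alpha^r,\tilde\mu^r)$ naturally corresponds to the solution $(\tilde u^r,\tilde\mu^r)$ of $(\mathrm{MFG}_r)$, where $\tilde u^r_x(t):=e^{rt}J_r(t,x,\tilde\alpha^r,\tilde\mu^r)$.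
   Context: Notation. $d\ge2$ is a fixed integer, $[d]=\{1,\dots,d\}$, $|\cdot|$ is the Euclidean norm, $\mathcal{P}([d])=\{\eta\in[0,\infty)^d:\sum_x\eta_x=1\}$. For $p\in\mathbb{R}^d$, $\Delta_xp=(p_y-p_x)_{y\in[d]}$. With $(e_i)$ the standard basis of $\mathbb{R}^d$ and $e_{yz}=e_z-e_y$, a function $K:\mathcal{P}([d])\to\mathbb{R}$ is differentiable if for any distinct $y,z\in[d]$ there is a function $D^\eta_{yz}K$ with $D^\eta_{yz}K(\eta)=\lim_{h\to0^+}\frac{K(\eta+he_{yz})-K(\eta)}{h}$; $D^\eta K=(D^\eta_{yz}K)_{y,z}$, and $\mathcal{C}^1(\mathcal{P}([d]))$ is the set of continuously differentiable $K$. Data and standing assumptions. $f(x,a)$ and $F(x,\eta)$ ($x\in[d]$, $\eta\in\mathcal{P}([d])$) are real-valued measurable running costs, and $f(x,a)$ does not depend on $a_x$. (A1) The action set is $\mathbb{A}=[\mathfrak{a}_l,\mathfrak{a}_u]$ with $0<\mathfrak{a}_l<\mathfrak{a}_u<\infty$. A rate vector at $x$ is $a\in\mathbb{R}^d$ with $a_y\in\mathbb{A}$ for $y\ne x$ and $a_x=-\sum_{y\ne x}a_y$. The Hamiltonian is $H(x,p)=\inf_a\{f(x,a)+a\cdot p\}$, the infimum being over rate vectors at $x$. (A2) For each $(x,p)\in[d]\times\mathbb{R}^d$ there is a unique minimizing rate vector $\gamma^*(x,p)=\arg\min_a\{f(x,a)+a\cdot p\}$, and $\gamma^*$ is measurable;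 $\gamma^*_y(x,p)$ is its $y$-th component. (A3) For any $x\in[d]$, $F(x,\cdot)\in\mathcal{C}^1(\mathcal{P}([d]))$ and $D^\eta F(x,\cdot)$ is Lipschitz. (A4) $\sum_x(F(x,\eta)-F(x,\hat\eta))(\eta_x-\hat\eta_x)\ge0$ for all $\eta,\hat\eta\in\mathcal{P}([d])$. (A5) $H$ is $\mathcal{C}^2$ with respect to $p$. Moreover, on any compact set $[-K,K]$ (of values of $p$), $D_pH$ and $D^2_{pp}H$ (gradient and Hessian in $p$) are Lipschitz in $p$ and there exists $C_{2,H}>0$ such that $D^2_{pp}H(x,p)\le-C_{2,H}$. Controls and equilibria. A Markovian control is a measurable $\alpha:[0,\infty)\times[d]\to\mathbb{R}^d$ with $\alpha(t,x)=(\alpha_{xy}(t))_{y\in[d]}$ a rate vector at $x$ for each $t$; $\mathcal{A}$ is the set of these. $X^\alpha$ is the jump process of the representative player on $[d]$ that at time $t$ jumps from $x$ to $y\ne x$ at rate $\alpha_{xy}(t)$, with $X^\alpha_0=x_0$ a fixed state. For a flow $\mu:[0,\infty)\to\mathcal{P}([d])$, $$J_r(\alpha,\mu)=\mathbb{E}\Big[\int_0^\infty e^{-rt}\{f(X^\alpha_t,\alpha(t,X^\alpha_t))+F(X^\alpha_t,\mu(t))\}dt\Big],$$ $$J_r(t_0,x,\alpha,\mu)=\mathbb{E}\Big[\int_{t_0}^\infty e^{-rt}\{f(X^\alpha_t,\alpha(t,X^\alpha_t))+F(X^\alpha_t,\mu(t))\}dt\,\Big|\,X^\alpha_{t_0}=x\Big].$$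 A pair $(\tilde\alpha,\tilde\mu)\in\mathcal{A}\times\mathcal{C}^1([0,\infty),\mathcal{P}([d]))$ is a discounted mean field equilibrium (starting at $x_0$) if $X^{\tilde\alpha}_0=x_0$, the law of $X^{\tilde\alpha}_t$ is $\tilde\mu(t)$ for all $t\ge0$, and $J_r(\tilde\alpha,\tilde\mu)=\min_{\alpha'\in\mathcal{A}}J_r(\alpha',\tilde\mu)$.
   Formalization: Solutions of (MFG_r) are required to have bounded u^r, since u^r+ce^{rt}(1,…,1) also solves the system; the stationary solution is unique in R^d×P([d]), and its positivity is claimed only when f+F>0, since subtracting a constant from f shifts it by a negative constant. *)

theory Defs
  imports "HOL-Probability.Probability"
begin

text \<open>The state space \<open>[d]\<close> is a finite type \<open>'n\<close>, so \<open>d = CARD('n)\<close>. Functions of time have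
  type \<open>real \<Rightarrow> _\<close>; only their values on \<open>[0,\<infinity>)\<close> matter.\<close>

section \<open>Simplex and calculus on it\<close>

definition prob_simplex :: "(real^'n) set" where
  "prob_simplex = {\<eta>. (\<forall>x. 0 \<le> \<eta> $ x) \<and> (\<Sum>x\<in>UNIV. \<eta> $ x) = 1}"

definition Delta :: "'n \<Rightarrow> real^'n \<Rightarrow> real^'n" where
  "Delta x p = (\<chi> y. p $ y - p $ x)"

text \<open>\<open>D y z \<eta>\<close> is the one-sided derivative of \<open>K\<close> at \<open>\<eta>\<close> in direction \<open>e\<^sub>z - e\<^sub>y\<close>, through
  points of the simplex. If \<open>\<eta>\<^sub>y = 0\<close> no such point exists, the limit is void, and
  \<open>D y z \<eta>\<close> is determined by continuity in \<open>simplex_C1\<close>.\<close>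

definition simplex_deriv ::
  "(real^'n \<Rightarrow> real) \<Rightarrow> ('n \<Rightarrow> 'n \<Rightarrow> real^'n \<Rightarrow> real) \<Rightarrow> bool" where
  "simplex_deriv K D \<longleftrightarrow>
     (\<forall>y z. y \<noteq> z \<longrightarrow> (\<forall>\<eta>\<in>prob_simplex.
        ((\<lambda>h. (K (\<eta> + h *\<^sub>R (axis z 1 - axis y 1)) - K \<eta>) / h) \<longlongrightarrow> D y z \<eta>)
          (at 0 within {h. 0 < h \<and> \<eta> + h *\<^sub>R (axis z 1 - axis y 1) \<in> prob_simplex})))"

definition simplex_C1 ::
  "(real^'n \<Rightarrow> real) \<Rightarrow> ('n \<Rightarrow> 'n \<Rightarrow> real^'n \<Rightarrow> real) \<Rightarrow> bool" where
  "simplex_C1 K D \<longleftrightarrow>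
     simplex_deriv K D \<and> (\<forall>y z. y \<noteq> z \<longrightarrow> continuous_on prob_simplex (D y z))"

definition C1_flow :: "(real \<Rightarrow> real^'n) \<Rightarrow> bool" where
  "C1_flow \<mu> \<longleftrightarrow>
     (\<forall>t\<ge>0. \<mu> t \<in> prob_simplex) \<and>
     (\<exists>\<mu>'. continuous_on {0..} \<mu>' \<and>
        (\<forall>t\<ge>0. (\<mu> has_vector_derivative \<mu>' t) (at t within {0..})))"

section \<open>Rates and Hamiltonian\<close>

definition rate_vectors :: "real \<Rightarrow> real \<Rightarrow> 'n \<Rightarrow> (real^'n) set" where
  "rate_vectors al au x =
     {a. (\<forall>y. y \<noteq> x \<longrightarrow> a $ y \<in> {al..au}) \<and> a $ x = - (\<Sum>y\<in>UNIV - {x}. a $ y)}"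

definition hamiltonian ::
  "real \<Rightarrow> real \<Rightarrow> ('n \<Rightarrow> real^'n \<Rightarrow> real) \<Rightarrow> 'n \<Rightarrow> real^'n \<Rightarrow> real" where
  "hamiltonian al au f x p = (INF a\<in>rate_vectors al au x. f x a + a \<bullet> p)"

definition is_minimizer ::
  "real \<Rightarrow> real \<Rightarrow> ('n \<Rightarrow> real^'n \<Rightarrow> real) \<Rightarrow> 'n \<Rightarrow> real^'n \<Rightarrow> real^'n \<Rightarrow> bool" where
  "is_minimizer al au f x p = is_arg_min (\<lambda>a. f x a + a \<bullet> p) (\<lambda>a. a \<in> rate_vectors al au x)"

definition gamma_star ::
  "real \<Rightarrow> real \<Rightarrow> ('n \<Rightarrow> real^'n \<Rightarrow> real) \<Rightarrow> 'n \<Rightarrow> real^'n \<Rightarrow> real^'n" where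
  "gamma_star al au f x p = arg_min (\<lambda>a. f x a + a \<bullet> p) (\<lambda>a. a \<in> rate_vectors al au x)"

text \<open>The components of a rate vector sum to zero, so \<open>H(x, p + c(1,\<dots>,1)) = H(x, p)\<close> and the
  Hessian always annihilates \<open>(1,\<dots>,1)\<close>. The bound \<open>D\<^sup>2H \<le> -C\<close> is therefore imposed on the
  hyperplane \<open>\<xi>\<^sub>x = 0\<close> containing all vectors \<open>Delta x p\<close>; on all of \<open>\<real>\<^sup>d\<close> it could never
  hold.\<close>

definition regular_hamiltonian :: "('n \<Rightarrow> real^'n \<Rightarrow> real) \<Rightarrow> bool" where
  "regular_hamiltonian H \<longleftrightarrow>
     (\<exists>DH :: 'n \<Rightarrow> real^'n \<Rightarrow> real^'n. \<exists>D2H :: 'n \<Rightarrow> real^'n \<Rightarrow> real^'n^'n.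
        (\<forall>x p. (H x has_derivative (\<lambda>\<xi>. DH x p \<bullet> \<xi>)) (at p)) \<and>
        (\<forall>x p. (DH x has_derivative (\<lambda>\<xi>. D2H x p *v \<xi>)) (at p)) \<and>
        (\<forall>x. continuous_on UNIV (D2H x)) \<and>
        (\<forall>K>0. let B = {p. \<forall>i. p $ i \<in> {-K..K}} in
           (\<exists>L. \<forall>x. L-lipschitz_on B (DH x) \<and> L-lipschitz_on B (D2H x)) \<and>
           (\<exists>C>0. \<forall>x. \<forall>p\<in>B. \<forall>\<xi>. \<xi> $ x = 0 \<longrightarrow> \<xi> \<bullet> (D2H x p *v \<xi>) \<le> - C * (norm \<xi>)\<^sup>2)))"

section \<open>The mean field game systems\<close>

text \<open>Boundedness of \<open>u\<close> is the condition at infinity of the backward equation: without it,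
  \<open>u + c e\<^sup>r\<^sup>t (1,\<dots>,1)\<close> solves the system together with \<open>u\<close>, for every constant \<open>c\<close>.\<close>

definition mfg_solution ::
  "real \<Rightarrow> real \<Rightarrow> ('n \<Rightarrow> real^'n \<Rightarrow> real) \<Rightarrow> ('n \<Rightarrow> real^'n \<Rightarrow> real) \<Rightarrow> real \<Rightarrow> real^'n \<Rightarrow>
   (real \<Rightarrow> real^'n) \<Rightarrow> (real \<Rightarrow> real^'n) \<Rightarrow> bool" where
  "mfg_solution al au f F r \<mu>0 u \<mu> \<longleftrightarrow>
     bounded (u ` {0..}) \<and>
     (\<forall>t\<ge>0. \<mu> t \<in> prob_simplex) \<and>
     (\<forall>t\<ge>0. \<forall>x. ((\<lambda>s. u s $ x) has_real_derivative
        - (- r * u t $ x + hamiltonian al au f x (Delta x (u t)) + F x (\<mu> t)))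
        (at t within {0..})) \<and>
     (\<forall>t\<ge>0. \<forall>x. ((\<lambda>s. \<mu> s $ x) has_real_derivative
        (\<Sum>y\<in>UNIV. \<mu> t $ y * gamma_star al au f y (Delta y (u t)) $ x))
        (at t within {0..})) \<and>
     \<mu> 0 = \<mu>0"

definition stationary_solution ::
  "real \<Rightarrow> real \<Rightarrow> ('n \<Rightarrow> real^'n \<Rightarrow> real) \<Rightarrow> ('n \<Rightarrow> real^'n \<Rightarrow> real) \<Rightarrow> real \<Rightarrow>
   real^'n \<Rightarrow> real^'n \<Rightarrow> bool" where
  "stationary_solution al au f F r u \<mu> \<longleftrightarrow>
     \<mu> \<in> prob_simplex \<and>
     (\<forall>x. - r * u $ x + hamiltonian al au f x (Delta x u) + F x \<mu> = 0) \<and>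
     (\<forall>x. (\<Sum>y\<in>UNIV. \<mu> $ y * gamma_star al au f y (Delta y u) $ x) = 0)"

section \<open>Controls, jump processes and costs\<close>

definition controls :: "real \<Rightarrow> real \<Rightarrow> (real \<Rightarrow> 'n \<Rightarrow> real^'n) set" where
  "controls al au =
     {\<alpha>. (\<forall>x. (\<lambda>t. \<alpha> t x) \<in> borel_measurable (restrict_space borel {0..})) \<and>
          (\<forall>t\<ge>0. \<forall>x. \<alpha> t x \<in> rate_vectors al au x)}"

text \<open>The process is realised by thinning a marked Poisson process. Its points arrive at rate
  \<open>d \<cdot> au\<close> and carry independent marks \<open>(y, v)\<close>, with \<open>y\<close> uniform on the states and \<open>v\<close> uniform
  on \<open>[0, au]\<close>; hence the points with target \<open>y\<close> form a Poisson process of rate \<open>au\<close>. A point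
  with marks \<open>(y, v)\<close> at time \<open>t\<close> moves the process from \<open>x\<close> to \<open>y\<close> if \<open>v \<le> \<alpha> t x $ y\<close>, so that
  jumps from \<open>x\<close> to \<open>y \<noteq> x\<close> occur at rate \<open>\<alpha> t x $ y \<le> au\<close>. For \<open>y = x\<close> nothing happens.\<close>

definition jump_noise :: "real \<Rightarrow> (real \<times> 'n \<times> real) stream measure" where
  "jump_noise au =
     stream_space
       (density lborel (\<lambda>e. ennreal (exponential_density (real CARD('n) * au) e)) \<Otimes>\<^sub>M
        (uniform_count_measure (UNIV :: 'n set) \<Otimes>\<^sub>M uniform_measure lborel {0..au}))"

text \<open>Time and state after \<open>k\<close> points, when the process is in \<open>x\<close> at time \<open>s\<close>. The gaps \<open>e\<close>
  are almost surely positive; \<open>max 0 e\<close> keeps the arrival times in \<open>[0,\<infinity>)\<close>, where controls are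
  measurable, for every noise path.\<close>

primrec jump_chain ::
  "(real \<Rightarrow> 'n \<Rightarrow> real^'n) \<Rightarrow> real \<Rightarrow> 'n \<Rightarrow> (real \<times> 'n \<times> real) stream \<Rightarrow> nat \<Rightarrow> real \<times> 'n"
where
  "jump_chain \<alpha> s x \<omega> 0 = (s, x)"
| "jump_chain \<alpha> s x \<omega> (Suc k) =
     (case jump_chain \<alpha> s x \<omega> k of (t, z) \<Rightarrow>
      case \<omega> !! k of (e, y, v) \<Rightarrow>
        (t + max 0 e, if v \<le> \<alpha> (t + max 0 e) z $ y then y else z))"

text \<open>State at time \<open>t \<ge> s\<close> of the process that is in \<open>x\<close> at time \<open>s\<close>.\<close>

definition jump_process ::
  "(real \<Rightarrow> 'n \<Rightarrow> real^'n) \<Rightarrow> real \<Rightarrow> 'n \<Rightarrow> (real \<times> 'n \<times> real) stream \<Rightarrow> real \<Rightarrow> 'n" where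
  "jump_process \<alpha> s x \<omega> t =
     snd (jump_chain \<alpha> s x \<omega> (LEAST k. t < fst (jump_chain \<alpha> s x \<omega> (Suc k))))"

definition running_cost ::
  "('n \<Rightarrow> real^'n \<Rightarrow> real) \<Rightarrow> ('n \<Rightarrow> real^'n \<Rightarrow> real) \<Rightarrow> real \<Rightarrow> (real \<Rightarrow> 'n \<Rightarrow> real^'n) \<Rightarrow>
   (real \<Rightarrow> real^'n) \<Rightarrow> real \<Rightarrow> 'n \<Rightarrow> real" where
  "running_cost f F r \<alpha> \<mu> t x = exp (- r * t) * (f x (\<alpha> t x) + F x (\<mu> t))"

text \<open>\<open>cost au f F r t0 x \<alpha> \<mu>\<close> is \<open>J\<^sub>r(t0, x, \<alpha>, \<mu>)\<close>: conditioning on \<open>X\<^sub>t\<^sub>0 = x\<close> means running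
  the Markov process from \<open>x\<close> at time \<open>t0\<close>. Costs are bounded below but possibly unbounded
  above, so the expectation is taken in the extended sense, as expected positive part minus
  expected negative part (note that \<open>ennreal\<close> sends negative numbers to \<open>0\<close>).\<close>

definition cost ::
  "real \<Rightarrow> ('n \<Rightarrow> real^'n \<Rightarrow> real) \<Rightarrow> ('n \<Rightarrow> real^'n \<Rightarrow> real) \<Rightarrow> real \<Rightarrow> real \<Rightarrow> 'n \<Rightarrow>
   (real \<Rightarrow> 'n \<Rightarrow> real^'n) \<Rightarrow> (real \<Rightarrow> real^'n) \<Rightarrow> ereal" where
  "cost au f F r t0 x \<alpha> \<mu> =
     enn2ereal (\<integral>\<^sup>+\<omega>. (\<integral>\<^sup>+t\<in>{t0..}.
       ennreal (running_cost f F r \<alpha> \<mu> t (jump_process \<alpha> t0 x \<omega> t)) \<partial>lborel) \<partial>jump_noise au) -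
     enn2ereal (\<integral>\<^sup>+\<omega>. (\<integral>\<^sup>+t\<in>{t0..}.
       ennreal (- running_cost f F r \<alpha> \<mu> t (jump_process \<alpha> t0 x \<omega> t)) \<partial>lborel) \<partial>jump_noise au)"

definition mf_equilibrium ::
  "real \<Rightarrow> real \<Rightarrow> ('n \<Rightarrow> real^'n \<Rightarrow> real) \<Rightarrow> ('n \<Rightarrow> real^'n \<Rightarrow> real) \<Rightarrow> real \<Rightarrow> 'n \<Rightarrow>
   (real \<Rightarrow> 'n \<Rightarrow> real^'n) \<Rightarrow> (real \<Rightarrow> real^'n) \<Rightarrow> bool" where
  "mf_equilibrium al au f F r x0 \<alpha> \<mu> \<longleftrightarrow>
     \<alpha> \<in> controls al au \<and> C1_flow \<mu> \<and>
     (\<forall>t\<ge>0. \<forall>x. \<P>(\<omega> in jump_noise au. jump_process \<alpha> 0 x0 \<omega> t = x) = \<mu> t $ x) \<and>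
     (\<forall>\<alpha>'\<in>controls al au. cost au f F r 0 x0 \<alpha> \<mu> \<le> cost au f F r 0 x0 \<alpha>' \<mu>)"

end

theory Submission
  imports Defs "HOL-Real_Asymp.Real_Asymp"
begin

text \<open>The proof rests on two contractions that do not degenerate as the discount rate \<open>r\<close> tends to
  \<open>0\<close>. Forwards in time, two densities moved by the same rates approach each other in \<open>l\<^sub>1\<close> at rate
  \<open>CARD('n) * al\<close>, because every rate is at least \<open>al\<close> (\<open>forward_l1_dini\<close>). Backwards in time, the
  Hamilton-Jacobi-Bellman equation averages over the states: the maximum norm of a difference of
  value functions contracts only at rate \<open>r\<close>, but its oscillation contracts at rate \<open>r + 2 * al\<close>
  (\<open>backward_point\<close>). Value functions enter the system through their differences \<open>Delta x u\<close>, so the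
  second rate is the one that counts. In particular, bounded solutions have differences in a fixed
  cube, where the Hamiltonian is uniformly strongly concave and its gradient, which is the minimiser
  \<open>gamma_star\<close>, is uniformly Lipschitz.

  The two equations are coupled by Lasry-Lions duality: for two solutions, the pairing
  \<open>\<phi> = (u - u') \<bullet> (\<mu> - \<mu>')\<close> satisfies \<open>\<phi>' \<le> r * \<phi> - c * (osc (u - u'))\<^sup>2\<close> (\<open>duality\<close>). A bounded
  \<open>\<phi>\<close> of this kind cannot be negative (\<open>duality_nonneg\<close>), and for small \<open>r\<close> and a suitable \<open>\<epsilon>\<close> the
  functional \<open>\<phi> + \<epsilon> * (l1 (\<mu> - \<mu>'))\<^sup>2\<close> decays exponentially. Backward comparison carries the decay
  over to \<open>u - u'\<close> (\<open>exponential_stability\<close>). This is part (iii), and it contains uniqueness in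
  part (i).

  For existence the initial density is fixed and the initial value \<open>v\<close> of \<open>u\<close> is varied. By duality on
  \<open>[0,T]\<close> the map from \<open>v\<close> to \<open>u(T)\<close> is injective, and by the maximum principle it is proper; invariance
  of domain makes it surjective, so \<open>u(T) = 0\<close> can be reached, with a bound independent of \<open>T\<close>. As \<open>T\<close>
  grows, compactness yields a bounded solution (\<open>shooting\<close>, \<open>bounded_sol_exists\<close>). By stability, the
  map from initial densities to densities at a large time is a contraction; its fixed point starts a
  periodic solution, and stability forces that solution to be constant (\<open>constant_solution_exists\<close>).
  Part (ii) is stability relative to the constant solution.

  For part (iv), conditioning on the first candidate jump turns expectations over paths into renewal
  equations (\<open>first_step\<close>), which have unique decaying solutions (\<open>renewal_comparison\<close>). Checking that
  the value function solves the right one proves Dynkin's formula, and with it that every control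
  costs the value function plus its expected total slack, the slack being the nonnegative gap in the
  minimisation defining the Hamiltonian (\<open>cost_eq\<close>). So feedback through \<open>gamma_star\<close> is optimal, and
  an optimal control coincides with it at almost all times, since every state is occupied with
  positive probability (\<open>optimal_of_cost\<close>). Under this feedback the law of the process solves the
  forward equation, because its pairing with the transition probabilities, which solve the backward
  equation, is constant (\<open>law_eq_forward_solution\<close>).\<close>

section \<open>One-sided derivative bounds\<close>

text \<open>Maxima and absolute values are only one-sidedly differentiable, and only bounds on their growth
  are needed. Growth is measured away from \<open>t\<close>: with \<open>S = {t..}\<close> it is the upper right Dini derivative
  that is bounded by \<open>D\<close>, with \<open>S = {..t}\<close> it is the growth when time runs backwards.\<close>

definition dini_le :: "(real \<Rightarrow> real) \<Rightarrow> real \<Rightarrow> real set \<Rightarrow> real \<Rightarrow> bool" where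
  "dini_le V t S D \<longleftrightarrow> (\<forall>e>0. eventually (\<lambda>s. V s \<le> V t + \<bar>s - t\<bar> * (D + e)) (at t within S))"

lemma dini_le_mono: "dini_le V t S D \<Longrightarrow> D \<le> D' \<Longrightarrow> dini_le V t S D'"
  unfolding dini_le_def
proof (intro allI impI)
  fix e :: real
  assume a: "\<forall>e>0. eventually (\<lambda>s. V s \<le> V t + \<bar>s - t\<bar> * (D + e)) (at t within S)" "D \<le> D'" "0 < e"
  then have "eventually (\<lambda>s. V s \<le> V t + \<bar>s - t\<bar> * (D + e)) (at t within S)" by auto
  then show "eventually (\<lambda>s. V s \<le> V t + \<bar>s - t\<bar> * (D' + e)) (at t within S)"
    by (rule eventually_mono) (smt (verit) a(2) abs_ge_zero mult_left_mono)
qed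

text \<open>To bound a nonlinear function of \<open>V\<close> it suffices to bound its value on lines through \<open>V t\<close> that
  lie above \<open>V\<close>.\<close>

lemma dini_le_dominated:
  assumes "\<And>e. e > 0 \<Longrightarrow> \<exists>W D'. eventually (\<lambda>s. V s \<le> W s) (at t within S) \<and> W t = V t \<and>
    dini_le W t S D' \<and> D' \<le> D + e"
  shows "dini_le V t S D"
  unfolding dini_le_def
proof (intro allI impI)
  fix e :: real assume "0 < e"
  then obtain W D' where W: "eventually (\<lambda>s. V s \<le> W s) (at t within S)" "W t = V t"
    "dini_le W t S D'" "D' \<le> D + e/2" using assms[of "e/2"] by auto
  have "eventually (\<lambda>s. W s \<le> W t + \<bar>s - t\<bar> * (D' + e/2)) (at t within S)"
    using W(3) \<open>0 < e\<close> unfolding dini_le_def by (metis half_gt_zero)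
  with W(1) show "eventually (\<lambda>s. V s \<le> V t + \<bar>s - t\<bar> * (D + e)) (at t within S)"
  proof eventually_elim
    case (elim s)
    have "\<bar>s - t\<bar> * (D' + e/2) \<le> \<bar>s - t\<bar> * (D + e)"
      using W(4) by (intro mult_left_mono) auto
    with elim W(2) show ?case by linarith
  qed
qed

lemma dini_le_right_deriv:
  assumes "(V has_real_derivative D) (at t within {t..})"
  shows "dini_le V t {t..} D"
  unfolding dini_le_def
proof (intro allI impI)
  fix e :: real assume "0 < e"
  have "((\<lambda>s. (V s - V t) / (s - t)) \<longlongrightarrow> D) (at t within {t..})"
    using assms by (simp add: has_field_derivative_iff)
  then have "eventually (\<lambda>s. (V s - V t) / (s - t) < D + e) (at t within {t..})"
    using \<open>0 < e\<close> by (intro order_tendstoD) auto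
  moreover have "eventually (\<lambda>s. s \<in> {t..} \<and> s \<noteq> t) (at t within {t..})"
    by (auto simp: eventually_at_filter)
  ultimately show "eventually (\<lambda>s. V s \<le> V t + \<bar>s - t\<bar> * (D + e)) (at t within {t..})"
  proof eventually_elim
    case (elim s)
    then have "s - t > 0" by auto
    with elim(1) have "V s - V t < (D + e) * (s - t)" by (simp add: pos_divide_less_eq)
    with \<open>s - t > 0\<close> show ?case by (simp add: algebra_simps)
  qed
qed

lemma dini_le_left_deriv:
  assumes "(V has_real_derivative D) (at t within {..t})"
  shows "dini_le V t {..t} (- D)"
  unfolding dini_le_def
proof (intro allI impI)
  fix e :: real assume "0 < e"
  have "((\<lambda>s. (V s - V t) / (s - t)) \<longlongrightarrow> D) (at t within {..t})"
    using assms by (simp add: has_field_derivative_iff)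
  then have "eventually (\<lambda>s. (V s - V t) / (s - t) > D - e) (at t within {..t})"
    using \<open>0 < e\<close> by (intro order_tendstoD) auto
  moreover have "eventually (\<lambda>s. s \<in> {..t} \<and> s \<noteq> t) (at t within {..t})"
    by (auto simp: eventually_at_filter)
  ultimately show "eventually (\<lambda>s. V s \<le> V t + \<bar>s - t\<bar> * (- D + e)) (at t within {..t})"
  proof eventually_elim
    case (elim s)
    then have "s - t < 0" by auto
    with elim(1) have "V s - V t < (D - e) * (s - t)" by (simp add: neg_less_divide_eq)
    with \<open>s - t < 0\<close> show ?case by (simp add: algebra_simps)
  qed
qed

lemma dini_le_add:
  assumes "dini_le V t S D" "dini_le W t S E"
  shows "dini_le (\<lambda>s. V s + W s) t S (D + E)"
  unfolding dini_le_def
proof (intro allI impI)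
  fix e :: real assume "0 < e"
  then have "eventually (\<lambda>s. V s \<le> V t + \<bar>s - t\<bar> * (D + e/2)) (at t within S)"
    "eventually (\<lambda>s. W s \<le> W t + \<bar>s - t\<bar> * (E + e/2)) (at t within S)"
    using assms unfolding dini_le_def by (metis half_gt_zero)+
  then show "eventually (\<lambda>s. V s + W s \<le> V t + W t + \<bar>s - t\<bar> * (D + E + e)) (at t within S)"
    by eventually_elim (simp add: algebra_simps)
qed

lemma dini_le_const: "dini_le (\<lambda>s. c) t S 0"
  unfolding dini_le_def by (auto intro!: always_eventually)

lemma dini_le_sum:
  assumes "finite I" "\<And>i. i \<in> I \<Longrightarrow> dini_le (V i) t S (D i)"
  shows "dini_le (\<lambda>s. \<Sum>i\<in>I. V i s) t S (\<Sum>i\<in>I. D i)"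
  using assms by (induction I) (auto simp: dini_le_const intro!: dini_le_add)

lemma dini_le_cmult:
  assumes "dini_le V t S D" "c \<ge> 0"
  shows "dini_le (\<lambda>s. c * V s) t S (c * D)"
proof (cases "c = 0")
  case True then show ?thesis by (simp add: dini_le_const)
next
  case False
  with assms have c: "c > 0" by auto
  show ?thesis unfolding dini_le_def
  proof (intro allI impI)
    fix e :: real assume "0 < e"
    then have "eventually (\<lambda>s. V s \<le> V t + \<bar>s - t\<bar> * (D + e/c)) (at t within S)"
      using assms c unfolding dini_le_def by (meson divide_pos_pos)
    then show "eventually (\<lambda>s. c * V s \<le> c * V t + \<bar>s - t\<bar> * (c * D + e)) (at t within S)"
    proof eventually_elim
      case (elim s)
      have "c * V s \<le> c * (V t + \<bar>s - t\<bar> * (D + e/c))" using elim c by simp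
      also have "\<dots> = c * V t + \<bar>s - t\<bar> * (c * D + e)" using c by (simp add: field_simps)
      finally show ?case .
    qed
  qed
qed

text \<open>Only the functions attaining the maximum at \<open>t\<close> matter for its derivative: the others stay
  strictly below it near \<open>t\<close>.\<close>

lemma dini_le_Max:
  assumes I: "finite I" "I \<noteq> {}"
    and cont: "\<And>i. i \<in> I \<Longrightarrow> ((\<lambda>s. V i s) \<longlongrightarrow> V i t) (at t within S)"
    and D: "\<And>i. i \<in> I \<Longrightarrow> (\<forall>j\<in>I. V j t \<le> V i t) \<Longrightarrow> dini_le (V i) t S D"
  shows "dini_le (\<lambda>s. MAX i\<in>I. V i s) t S D"
  unfolding dini_le_def
proof (intro allI impI)
  fix e :: real assume e: "0 < e"
  let ?M = "MAX i\<in>I. V i t"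
  have "eventually (\<lambda>s. V i s \<le> ?M + \<bar>s - t\<bar> * (D + e)) (at t within S)" if i: "i \<in> I" for i
  proof (cases "\<forall>j\<in>I. V j t \<le> V i t")
    case True
    then have "?M = V i t" using I i by (intro Max_eqI) auto
    then show ?thesis using D[OF i True] e unfolding dini_le_def by simp
  next
    case False
    then have less: "V i t < ?M" using I i by (meson Max_ge dual_order.strict_trans1 finite_imageI
      imageI linorder_not_le)
    have "((\<lambda>s. V i s - \<bar>s - t\<bar> * (D + e)) \<longlongrightarrow> V i t - \<bar>t - t\<bar> * (D + e)) (at t within S)"
      by (intro tendsto_intros cont i)
    then have "eventually (\<lambda>s. V i s - \<bar>s - t\<bar> * (D + e) < ?M) (at t within S)"
      using less by (intro order_tendstoD) auto
    then show ?thesis by eventually_elim simp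
  qed
  then have "eventually (\<lambda>s. \<forall>i\<in>I. V i s \<le> ?M + \<bar>s - t\<bar> * (D + e)) (at t within S)"
    using I by (simp add: eventually_ball_finite)
  then show "eventually (\<lambda>s. (MAX i\<in>I. V i s) \<le> ?M + \<bar>s - t\<bar> * (D + e)) (at t within S)"
    by eventually_elim (use I in auto)
qed

lemma dini_le_abs:
  assumes "((\<lambda>s. g s) \<longlongrightarrow> g t) (at t within S)"
    and "0 \<le> g t \<Longrightarrow> dini_le g t S D" "g t \<le> 0 \<Longrightarrow> dini_le (\<lambda>s. - g s) t S D"
  shows "dini_le (\<lambda>s. \<bar>g s\<bar>) t S D"
proof -
  have "dini_le (\<lambda>s. MAX i\<in>{True,False}. (if i then g s else - g s)) t S D"
  proof (rule dini_le_Max)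
    fix i :: bool
    show "((\<lambda>s. if i then g s else - g s) \<longlongrightarrow> (if i then g t else - g t)) (at t within S)"
      using assms(1) by (cases i) (auto intro!: tendsto_minus)
    assume "\<forall>j\<in>{True, False}. (if j then g t else - g t) \<le> (if i then g t else - g t)"
    then show "dini_le (\<lambda>s. if i then g s else - g s) t S D"
      using assms(2,3) by (cases i) auto
  qed auto
  moreover have "(MAX i\<in>{True,False}. (if i then g s else - g s)) = \<bar>g s\<bar>" for s
    by (auto simp: max_def abs_if)
  ultimately show ?thesis by simp
qed

lemma dini_le_square:
  assumes "dini_le V t {t..} D" "\<And>s. 0 \<le> V s"
  shows "dini_le (\<lambda>s. (V s)\<^sup>2) t {t..} (2 * V t * D)"
proof (rule dini_le_dominated)
  fix e :: real assume e: "0 < e"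
  define e' where "e' = e / (2 * V t + 1)"
  have V: "2 * V t + 1 > 0" using assms(2)[of t] by auto
  have e': "e' > 0" using e V by (simp add: e'_def)
  have "2 * V t * e' \<le> e" using V e by (simp add: e'_def field_simps)
  let ?W = "\<lambda>s. (V t + (s - t) * (D + e'))\<^sup>2"
  have "eventually (\<lambda>s. V s \<le> V t + \<bar>s - t\<bar> * (D + e')) (at t within {t..})"
    using assms(1) e' unfolding dini_le_def by simp
  moreover have "eventually (\<lambda>s. s \<in> {t..}) (at t within {t..})"
    by (auto simp: eventually_at_filter)
  ultimately have ev: "eventually (\<lambda>s. (V s)\<^sup>2 \<le> ?W s) (at t within {t..})"
  proof eventually_elim
    case (elim s)
    then show ?case using assms(2) by (intro power_mono) auto
  qed
  have "(?W has_real_derivative 2 * V t * (D + e')) (at t within {t..})"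
    by (auto intro!: derivative_eq_intros)
  then have "dini_le ?W t {t..} (2 * V t * (D + e'))" by (rule dini_le_right_deriv)
  with ev show "\<exists>W D'. eventually (\<lambda>s. (V s)\<^sup>2 \<le> W s) (at t within {t..}) \<and> W t = (V t)\<^sup>2 \<and>
      dini_le W t {t..} D' \<and> D' \<le> 2 * V t * D + e"
    using \<open>2 * V t * e' \<le> e\<close> by (intro exI[of _ ?W] exI) (auto simp: algebra_simps)
qed

lemma dini_le_exp_mult:
  assumes "dini_le V t {t..} D"
  shows "dini_le (\<lambda>s. exp (k * s) * V s) t {t..} (exp (k * t) * (k * V t + D))"
proof (rule dini_le_dominated)
  fix e :: real assume e: "0 < e"
  define e' where "e' = e / exp (k * t)"
  have e': "e' > 0" using e by (simp add: e'_def)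
  let ?W = "\<lambda>s. exp (k * s) * (V t + (s - t) * (D + e'))"
  have "eventually (\<lambda>s. V s \<le> V t + \<bar>s - t\<bar> * (D + e')) (at t within {t..})"
    using assms(1) e' unfolding dini_le_def by simp
  moreover have "eventually (\<lambda>s. s \<in> {t..}) (at t within {t..})"
    by (auto simp: eventually_at_filter)
  ultimately have ev: "eventually (\<lambda>s. exp (k * s) * V s \<le> ?W s) (at t within {t..})"
    by eventually_elim simp
  have "(?W has_real_derivative exp (k * t) * (k * V t + (D + e'))) (at t within {t..})"
    by (auto intro!: derivative_eq_intros simp: algebra_simps)
  then have "dini_le ?W t {t..} (exp (k * t) * (k * V t + (D + e')))" by (rule dini_le_right_deriv)
  moreover have "exp (k * t) * (k * V t + (D + e')) = exp (k * t) * (k * V t + D) + e"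
    by (simp add: e'_def field_simps)
  ultimately show "\<exists>W D'. eventually (\<lambda>s. exp (k * s) * V s \<le> W s) (at t within {t..}) \<and>
      W t = exp (k * t) * V t \<and> dini_le W t {t..} D' \<and> D' \<le> exp (k * t) * (k * V t + D) + e"
    using ev by (intro exI[of _ ?W] exI) auto
qed

text \<open>Otherwise \<open>V\<close> would rise above a line of small positive slope through its starting point, and the
  last point below that line would contradict the bound.\<close>

lemma dini_le_nonincreasing:
  fixes V :: "real \<Rightarrow> real"
  assumes ab: "a \<le> b" and cont: "continuous_on {a..b} V"
    and D: "\<And>t. a \<le> t \<Longrightarrow> t < b \<Longrightarrow> dini_le V t {t..} 0"
  shows "V b \<le> V a"
proof (rule field_le_epsilon)
  fix e0 :: real assume e0: "0 < e0"
  define e where "e = e0 / (b - a + 1)"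
  have e: "0 < e" using ab e0 by (simp add: e_def)
  have "e * (b - a) \<le> e0" using ab e0 by (simp add: e_def field_simps)
  have "V b - V a - e * (b - a) \<le> 0"
  proof (rule ccontr)
    assume neg: "\<not> V b - V a - e * (b - a) \<le> 0"
    define h where "h t = V t - V a - e * (t - a)" for t
    have ch: "continuous_on {a..b} h" unfolding h_def by (intro continuous_intros cont)
    let ?A = "{t\<in>{a..b}. h t \<le> 0}"
    have "closed ?A"
      using continuous_closed_preimage[OF ch closed_atLeastAtMost closed_atMost[of 0]]
      by (simp add: vimage_def Int_def conj_commute)
    moreover have "bounded ?A" by (rule bounded_subset[of "{a..b}"]) auto
    ultimately have "compact ?A" by (simp add: compact_eq_bounded_closed)
    moreover have "a \<in> ?A" using ab by (auto simp: h_def)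
    ultimately obtain c where c: "c \<in> ?A" "\<And>t. t \<in> ?A \<Longrightarrow> t \<le> c"
      using compact_attains_sup[of ?A] by blast
    have "c < b" using c(1) neg unfolding h_def by (cases "c = b") auto
    have "eventually (\<lambda>s. V s \<le> V c + \<bar>s - c\<bar> * (0 + e)) (at c within {c..})"
      using D[of c] c(1) \<open>c < b\<close> e unfolding dini_le_def by auto
    moreover have "at c within {c..} = at_right c"
      by (auto simp: at_within_def intro!: arg_cong2[where f=inf] arg_cong[where f=principal])
    ultimately have "eventually (\<lambda>s. V s \<le> V c + \<bar>s - c\<bar> * e) (at_right c)" by simp
    moreover have "eventually (\<lambda>s. s \<in> {c<..<b}) (at_right c)"
      using \<open>c < b\<close> by (rule eventually_at_right_real)
    ultimately have "eventually (\<lambda>s. False) (at_right c)"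
    proof eventually_elim
      case (elim s)
      then have "h s \<le> h c" by (auto simp: h_def algebra_simps)
      then have "s \<in> ?A" using elim(2) c(1) by auto
      then show False using c(2)[of s] elim(2) by auto
    qed
    then show False by simp
  qed
  then show "V b \<le> V a + e0" using \<open>e * (b - a) \<le> e0\<close> by linarith
qed

lemma dini_le_exp_bound:
  assumes "a \<le> b" "continuous_on {a..b} V"
    and "\<And>t. a \<le> t \<Longrightarrow> t < b \<Longrightarrow> dini_le V t {t..} (k * V t)"
  shows "V b \<le> exp (k * (b - a)) * V a"
proof -
  have "exp (- k * b) * V b \<le> exp (- k * a) * V a"
  proof (rule dini_le_nonincreasing[of a b "\<lambda>t. exp (- k * t) * V t"])
    show "continuous_on {a..b} (\<lambda>t. exp (- k * t) * V t)" by (intro continuous_intros assms)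
    show "dini_le (\<lambda>t. exp (- k * t) * V t) t {t..} 0" if "a \<le> t" "t < b" for t
      using dini_le_exp_mult[OF assms(3)[OF that], of "-k"] by simp
  qed (fact assms)
  then have "exp (k * b) * (exp (- k * b) * V b) \<le> exp (k * b) * (exp (- k * a) * V a)"
    by simp
  then show ?thesis by (simp add: exp_minus exp_diff algebra_simps divide_simps)
qed

lemma dini_le_reverse:
  assumes "dini_le V (T - t) {..T - t} D"
  shows "dini_le (\<lambda>s. V (T - s)) t {t..} D"
  unfolding dini_le_def
proof (intro allI impI)
  fix e :: real assume "0 < e"
  then have *: "eventually (\<lambda>s. V s \<le> V (T - t) + \<bar>s - (T - t)\<bar> * (D + e)) (at (T - t) within {..T - t})"
    using assms unfolding dini_le_def by blast
  have "filterlim (\<lambda>s. T - s) (at (T - t) within {..T - t}) (at t within {t..})"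
    by (auto simp: filterlim_at eventually_at_filter intro!: tendsto_eq_intros)
  from eventually_compose_filterlim[OF * this]
  show "eventually (\<lambda>s. V (T - s) \<le> V (T - t) + \<bar>s - t\<bar> * (D + e)) (at t within {t..})"
    by (simp add: abs_minus_commute)
qed

text \<open>\<open>k / (l + g) * exp (- g * s)\<close> solves the differential equation that belongs to the bound; what \<open>V\<close>
  exceeds it by at the end point \<open>T\<close> is damped by \<open>exp (- l * (T - t))\<close>.\<close>

lemma backward_comparison:
  assumes l: "l + g > 0" and tT: "0 \<le> t" "t \<le> T"
    and cont: "continuous_on {0..T} V"
    and D: "\<And>s. 0 < s \<Longrightarrow> s \<le> T \<Longrightarrow> dini_le V s {..s} (- l * V s + k * exp (- g * s))"
    and k: "k \<ge> 0"
  shows "V t \<le> k / (l + g) * exp (- g * t) + exp (- l * (T - t)) * max 0 (V T)"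
proof -
  define B where "B = k / (l + g)"
  have B: "(l + g) * B = k" "B \<ge> 0" using l k by (auto simp: B_def)
  define W where "W = (\<lambda>s. V (T - s) - B * exp (- g * (T - s)))"
  have "W (T - t) \<le> exp (- l * (T - t - 0)) * W 0"
  proof (rule dini_le_exp_bound)
    show "0 \<le> T - t" using tT by simp
    show "continuous_on {0..T - t} W" unfolding W_def
      by (intro continuous_intros continuous_on_compose2[OF cont]) (use tT in auto)
    fix s assume s: "0 \<le> s" "s < T - t"
    have 1: "dini_le (\<lambda>s. V (T - s)) s {s..} (- l * V (T - s) + k * exp (- g * (T - s)))"
      by (rule dini_le_reverse, rule D) (use s tT in auto)
    have 2: "dini_le (\<lambda>s. - (B * exp (- g * (T - s)))) s {s..} (- B * g * exp (- g * (T - s)))"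
      by (rule dini_le_right_deriv) (auto intro!: derivative_eq_intros)
    have "- l * V (T - s) + k * exp (- g * (T - s)) + (- B * g * exp (- g * (T - s))) = - l * W s"
      unfolding W_def B(1)[symmetric] by (simp add: algebra_simps)
    with dini_le_add[OF 1 2] show "dini_le W s {s..} (- l * W s)"
      by (simp add: W_def)
  qed
  moreover have "W 0 \<le> max 0 (V T)"
    using mult_nonneg_nonneg[OF B(2), of "exp (- g * T)"] by (simp add: W_def)
  ultimately have "W (T - t) \<le> exp (- l * (T - t)) * max 0 (V T)"
    by (smt (verit) exp_ge_zero mult_left_mono)
  then show ?thesis by (simp add: W_def B_def)
qed

text \<open>For bounded functions the contribution of the end point disappears as \<open>T\<close> tends to infinity.\<close>

lemma backward_comparison_infinite:
  assumes l: "l > 0" "l + g > 0" and t: "0 \<le> t"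
    and cont: "continuous_on {0..} V"
    and D: "\<And>s. 0 < s \<Longrightarrow> dini_le V s {..s} (- l * V s + k * exp (- g * s))"
    and k: "k \<ge> 0" and bd: "\<And>s. 0 \<le> s \<Longrightarrow> V s \<le> R"
  shows "V t \<le> k / (l + g) * exp (- g * t)"
proof -
  have "V t \<le> k / (l + g) * exp (- g * t) + exp (- l * (T - t)) * max 0 R" if "T \<ge> t" for T
  proof -
    have "V t \<le> k / (l + g) * exp (- g * t) + exp (- l * (T - t)) * max 0 (V T)"
      by (rule backward_comparison) (use l t that D k in \<open>auto intro: continuous_on_subset[OF cont]\<close>)
    also have "exp (- l * (T - t)) * max 0 (V T) \<le> exp (- l * (T - t)) * max 0 R"
      using bd[of T] t that by (intro mult_left_mono) auto
    finally show ?thesis by simp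
  qed
  then have ev: "eventually (\<lambda>T. V t \<le> k / (l + g) * exp (- g * t) + exp (- l * (T - t)) * max 0 R) at_top"
    by (auto simp: eventually_at_top_linorder)
  have "((\<lambda>T. exp (- l * (T - t))) \<longlongrightarrow> 0) at_top"
    using l(1) by real_asymp
  then have "((\<lambda>T. k / (l + g) * exp (- g * t) + exp (- l * (T - t)) * max 0 R) \<longlongrightarrow>
      k / (l + g) * exp (- g * t) + 0 * max 0 R) at_top"
    by (intro tendsto_intros) simp
  from tendsto_lowerbound[OF this ev] show ?thesis by simp
qed

section \<open>Ordinary differential equations\<close>

lemma at_within_Icc_eq_atLeast:
  fixes t b :: real
  assumes "t < b" shows "at t within {a..b} = at t within {a..}"
  by (rule at_within_nhd[of _ "{..<b}"]) (use assms in auto)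

lemma dini_le_norm:
  fixes z :: "real \<Rightarrow> 'a::real_normed_vector"
  assumes "(z has_vector_derivative z') (at t within {t..})"
  shows "dini_le (\<lambda>s. norm (z s)) t {t..} (norm z')"
  unfolding dini_le_def
proof (intro allI impI)
  fix e :: real assume e: "0 < e"
  have "eventually (\<lambda>s. norm (z s - z t - (s - t) *\<^sub>R z') \<le> e * norm (s - t)) (at t within {t..})"
    using assms e unfolding has_vector_derivative_def has_derivative_within_alt2 by blast
  then show "eventually (\<lambda>s. norm (z s) \<le> norm (z t) + \<bar>s - t\<bar> * (norm z' + e)) (at t within {t..})"
  proof eventually_elim
    case (elim s)
    have "norm (z s) \<le> norm (z t) + norm (z s - z t - (s - t) *\<^sub>R z') + norm ((s - t) *\<^sub>R z')"
      by (smt (verit) diff_add_cancel norm_triangle_ineq)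
    with elim show ?case by (simp add: distrib_left mult.commute)
  qed
qed

lemma gronwall_norm:
  fixes z :: "real \<Rightarrow> 'a::real_normed_vector"
  assumes "0 \<le> T" "continuous_on {0..T} z"
    and "\<And>t. 0 \<le> t \<Longrightarrow> t < T \<Longrightarrow> (z has_vector_derivative z' t) (at t within {t..})"
    and "\<And>t. 0 \<le> t \<Longrightarrow> t < T \<Longrightarrow> norm (z' t) \<le> L * norm (z t)"
  shows "norm (z T) \<le> exp (L * T) * norm (z 0)"
proof -
  have "norm (z T) \<le> exp (L * (T - 0)) * norm (z 0)"
    by (rule dini_le_exp_bound[OF assms(1), of "\<lambda>t. norm (z t)"])
      (use assms(2) dini_le_mono[OF dini_le_norm[OF assms(3)] assms(4)] in \<open>auto intro!: continuous_intros\<close>)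
  then show ?thesis by simp
qed

text \<open>Picard iteration in the weighted norm \<open>sup exp (- k * t) * norm (x t)\<close>. With \<open>k\<close> twice the
  Lipschitz constant the iteration contracts by \<open>1/2\<close> on the whole half-line at once.\<close>

lemma picard_global:
  fixes G :: "real \<Rightarrow> 'a::banach \<Rightarrow> 'a"
  assumes cont: "continuous_on ({0..} \<times> UNIV) (\<lambda>(t, x). G t x)"
    and lip: "\<And>t x y. 0 \<le> t \<Longrightarrow> norm (G t x - G t y) \<le> L * norm (x - y)"
    and growth: "\<And>t x. 0 \<le> t \<Longrightarrow> norm (G t x) \<le> A + B * norm x" and AB: "A \<ge> 0" "B \<ge> 0"
  shows "\<exists>x. x 0 = x0 \<and> (\<forall>t\<ge>0. (x has_vector_derivative G t (x t)) (at t within {0..}))"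
proof -
  define k where "k = 2 * max L 1"
  have k: "k > 0" "L / k \<le> 1/2" by (auto simp: k_def field_simps max_def)
  define g where "g y s = G s (exp (k * s) *\<^sub>R apply_bcontfun y s)" for y :: "real \<Rightarrow>\<^sub>C 'a" and s
  \<comment> \<open>The bounded function \<open>y\<close> stands for the solution multiplied by \<open>exp (- k * t)\<close>, extended
    constantly to negative times.\<close>
  define P where "P y t = exp (- k * max 0 t) *\<^sub>R (x0 + integral {0..max 0 t} (g y))" for y t
  have exp_int: "((\<lambda>s. exp (k * s)) has_integral (exp (k * t) / k - 1 / k)) {0..t}" if "t \<ge> 0" for t
  proof -
    have "((\<lambda>s. exp (k * s) / k) has_vector_derivative exp (k * s)) (at s within {0..t})" for s
      unfolding has_real_derivative_iff_has_vector_derivative[symmetric]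
      using k by (auto intro!: derivative_eq_intros)
    from fundamental_theorem_of_calculus[OF that this] show ?thesis by simp
  qed
  have cg: "continuous_on {0..t} (g y)" for y t
  proof -
    have "continuous_on {0..t} (\<lambda>s. (s, exp (k * s) *\<^sub>R apply_bcontfun y s))"
      by (intro continuous_intros continuous_on_apply_bcontfun)
    from continuous_on_compose2[OF cont this]
    have "continuous_on {0..t} (\<lambda>s. G s (exp (k * s) *\<^sub>R apply_bcontfun y s))" by (simp add: image_subset_iff)
    moreover have "g y = (\<lambda>s. G s (exp (k * s) *\<^sub>R apply_bcontfun y s))" by (auto simp: g_def)
    ultimately show ?thesis by metis
  qed
  have ig: "g y integrable_on {0..t}" for y t
    by (rule integrable_continuous_real[OF cg])
  have gbound: "norm (g y s) \<le> (A + B * norm y) * exp (k * s)" if "s \<ge> 0" for y s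
  proof -
    have "norm (g y s) \<le> A + B * (exp (k * s) * norm (apply_bcontfun y s))"
      using growth[OF that, of "exp (k * s) *\<^sub>R apply_bcontfun y s"] by (simp add: g_def)
    also have "\<dots> \<le> A * exp (k * s) + B * (exp (k * s) * norm y)"
    proof (rule add_mono)
      show "A \<le> A * exp (k * s)" using mult_left_mono[of 1 "exp (k * s)" A] AB k that by simp
      show "B * (exp (k * s) * norm (apply_bcontfun y s)) \<le> B * (exp (k * s) * norm y)"
        using AB by (intro mult_left_mono norm_bounded) auto
    qed
    finally show ?thesis by (simp add: algebra_simps)
  qed
  have Pb: "P y \<in> bcontfun" for y
  proof -
    have "continuous_on {0..} (\<lambda>t. integral {0..t} (g y))"
    proof (clarsimp simp: continuous_on_eq_continuous_within)
      fix t :: real assume "0 \<le> t"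
      have "continuous_on {0..t+1} (\<lambda>t. integral {0..t} (g y))"
        by (rule indefinite_integral_continuous_1[OF ig])
      then have "continuous (at t within {0..t+1}) (\<lambda>t. integral {0..t} (g y))"
        using \<open>0 \<le> t\<close> by (auto simp: continuous_on_eq_continuous_within)
      then show "continuous (at t within {0..}) (\<lambda>t. integral {0..t} (g y))"
        by (simp add: at_within_Icc_eq_atLeast)
    qed
    then have "continuous_on UNIV (\<lambda>t. integral {0..max 0 t} (g y))"
      by (rule continuous_on_compose2[where f = "\<lambda>t. max 0 t"]) (auto intro!: continuous_intros)
    then have c: "continuous_on UNIV (P y)"
      unfolding P_def[abs_def] by (intro continuous_intros)
    have "norm (P y t) \<le> norm x0 + (A + B * norm y) / k" for t
    proof -
      let ?t = "max 0 t"
      have t: "?t \<ge> 0" by simp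
      have "norm (integral {0..?t} (g y)) \<le> integral {0..?t} (\<lambda>s. (A + B * norm y) * exp (k * s))"
        by (rule integral_norm_bound_integral[OF ig])
          (use gbound has_integral_mult_right[OF exp_int[OF t]] in \<open>auto simp: has_integral_iff\<close>)
      also have "\<dots> = (A + B * norm y) * (exp (k * ?t) / k - 1 / k)"
        using has_integral_mult_right[OF exp_int[OF t], of "A + B * norm y"] by (rule integral_unique)
      also have "\<dots> \<le> (A + B * norm y) * (exp (k * ?t) / k)"
        using AB k by (intro mult_left_mono) auto
      finally have 1: "norm (integral {0..?t} (g y)) \<le> (A + B * norm y) / k * exp (k * ?t)" by simp
      have "norm (P y t) \<le> exp (- k * ?t) * (norm x0 + (A + B * norm y) / k * exp (k * ?t))"
        unfolding P_def using 1
        by (auto intro!: mult_left_mono order_trans[OF norm_triangle_ineq] add_mono)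
      also have "\<dots> = exp (- k * ?t) * norm x0 + (A + B * norm y) / k"
        by (simp add: exp_minus field_simps)
      also have "exp (- k * ?t) * norm x0 \<le> norm x0"
        using k by (intro mult_left_le_one_le) auto
      finally show ?thesis by simp
    qed
    then have "bounded (range (P y))" by (auto simp: bounded_iff)
    with c show ?thesis by (simp add: bcontfun_def)
  qed
  define PP where "PP y = Bcontfun (P y)" for y
  have PP: "apply_bcontfun (PP y) t = P y t" for y t
    using Pb by (simp add: PP_def Bcontfun_inverse)
  have "dist (PP y) (PP z) \<le> 1/2 * dist y z" for y z
  proof (rule dist_bound)
    fix t :: real
    let ?t = "max 0 t"
    have t: "?t \<ge> 0" by simp
    have L0: "L * norm (u::'a) \<le> (k/2) * norm u" for u
      using k by (intro mult_right_mono) (auto simp: k_def)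
    have "norm (integral {0..?t} (\<lambda>s. g y s - g z s)) \<le>
        integral {0..?t} (\<lambda>s. (k/2 * dist y z) * exp (k * s))"
    proof (rule integral_norm_bound_integral)
      show "(\<lambda>s. g y s - g z s) integrable_on {0..?t}" by (intro integrable_diff ig)
      show "(\<lambda>s. (k/2 * dist y z) * exp (k * s)) integrable_on {0..?t}"
        using has_integral_mult_right[OF exp_int[OF t]] by (auto simp: has_integral_iff)
      fix s assume "s \<in> {0..?t}"
      then have "norm (g y s - g z s) \<le> L * norm (exp (k * s) *\<^sub>R apply_bcontfun y s - exp (k * s) *\<^sub>R apply_bcontfun z s)"
        unfolding g_def by (intro lip) auto
      also have "\<dots> \<le> k/2 * norm (exp (k * s) *\<^sub>R apply_bcontfun y s - exp (k * s) *\<^sub>R apply_bcontfun z s)"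
        by (rule L0)
      also have "\<dots> = k/2 * (exp (k * s) * dist (apply_bcontfun y s) (apply_bcontfun z s))"
        by (simp add: scaleR_diff_right[symmetric] dist_norm)
      also have "\<dots> \<le> k/2 * (exp (k * s) * dist y z)"
        using k by (intro mult_left_mono dist_bounded) auto
      finally show "norm (g y s - g z s) \<le> k/2 * dist y z * exp (k * s)" by (simp add: algebra_simps)
    qed
    also have "\<dots> = (k/2 * dist y z) * (exp (k * ?t) / k - 1 / k)"
      using has_integral_mult_right[OF exp_int[OF t], of "k/2 * dist y z"] by (rule integral_unique)
    also have "\<dots> \<le> (k/2 * dist y z) * (exp (k * ?t) / k)"
      using k by (intro mult_left_mono) auto
    also have "\<dots> = 1/2 * dist y z * exp (k * ?t)" using k by simp
    finally have *: "norm (integral {0..?t} (g y) - integral {0..?t} (g z)) \<le> 1/2 * dist y z * exp (k * ?t)"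
      by (simp add: integral_diff[OF ig ig])
    have "dist (apply_bcontfun (PP y) t) (apply_bcontfun (PP z) t) =
        exp (- k * ?t) * norm (integral {0..?t} (g y) - integral {0..?t} (g z))"
      unfolding PP P_def dist_norm by (simp add: scaleR_diff_right[symmetric])
    also have "\<dots> \<le> exp (- k * ?t) * (1/2 * dist y z * exp (k * ?t))"
      using * by (intro mult_left_mono) auto
    also have "\<dots> = 1/2 * dist y z" by (simp add: exp_minus field_simps)
    finally show "dist (apply_bcontfun (PP y) t) (apply_bcontfun (PP z) t) \<le> 1/2 * dist y z" .
  qed
  then have "\<exists>!y. PP y = y" using banach_fix_type[of "1/2" PP] by simp
  then obtain y where y: "PP y = y" by blast
  define x where "x t = exp (k * t) *\<^sub>R apply_bcontfun y t" for t
  have gx: "g y s = G s (x s)" for s by (simp add: g_def x_def)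
  have xeq: "x t = x0 + integral {0..t} (g y)" if "t \<ge> 0" for t
  proof -
    have "apply_bcontfun y t = P y t" using PP[of y t] y by simp
    then show ?thesis using that by (simp add: x_def P_def exp_minus)
  qed
  have "x 0 = x0" using xeq[of 0] by simp
  moreover have "(x has_vector_derivative G t (x t)) (at t within {0..})" if t: "t \<ge> 0" for t
  proof -
    have "((\<lambda>t. x0 + integral {0..t} (g y)) has_vector_derivative (0 + g y t)) (at t within {0..t+1})"
      using t by (intro has_vector_derivative_add has_vector_derivative_const
        integral_has_vector_derivative cg) auto
    then have "((\<lambda>t. x0 + integral {0..t} (g y)) has_vector_derivative g y t) (at t within {0..})"
      by (simp add: at_within_Icc_eq_atLeast)
    then have "(x has_vector_derivative g y t) (at t within {0..})"
      by (rule has_vector_derivative_transform[rotated 2]) (use xeq t in auto)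
    then show ?thesis by (simp only: gx)
  qed
  ultimately show ?thesis by blast
qed

lemma has_vector_derivative_right:
  "(x has_vector_derivative D) (at t within {0..}) \<Longrightarrow> 0 \<le> (t::real) \<Longrightarrow>
    (x has_vector_derivative D) (at t within {t..})"
  by (erule has_vector_derivative_within_subset) auto

lemma ode_continuous_on:
  "(\<And>t. 0 \<le> (t::real) \<Longrightarrow> (x has_vector_derivative x' t) (at t within {0..})) \<Longrightarrow> continuous_on {0..} x"
  by (auto simp: continuous_on_eq_continuous_within intro!: has_vector_derivative_continuous)

lemma ode_growth:
  fixes x :: "real \<Rightarrow> 'a::real_normed_vector"
  assumes "0 \<le> T" "continuous_on {0..T} x"
    and "\<And>t. 0 \<le> t \<Longrightarrow> t < T \<Longrightarrow> (x has_vector_derivative x' t) (at t within {t..})"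
    and "\<And>t. 0 \<le> t \<Longrightarrow> t < T \<Longrightarrow> norm (x' t) \<le> A + B * norm (x t)" and AB: "A \<ge> 0" "B \<ge> 0"
  shows "norm (x T) + 1 \<le> exp ((A + B) * T) * (norm (x 0) + 1)"
proof -
  have "norm (x T) + 1 \<le> exp ((A + B) * (T - 0)) * (norm (x 0) + 1)"
  proof (rule dini_le_exp_bound[OF assms(1), of "\<lambda>t. norm (x t) + 1"])
    show "continuous_on {0..T} (\<lambda>t. norm (x t) + 1)" by (intro continuous_intros assms)
    fix t assume t: "0 \<le> t" "t < T"
    have "A + B * norm (x t) \<le> (A + B) * (norm (x t) + 1)" using AB by (simp add: algebra_simps)
    with assms(4)[OF t] have "norm (x' t) + 0 \<le> (A + B) * (norm (x t) + 1)" by linarith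
    then show "dini_le (\<lambda>s. norm (x s) + 1) t {t..} ((A + B) * (norm (x t) + 1))"
      by (rule dini_le_mono[OF dini_le_add[OF dini_le_norm[OF assms(3)[OF t]] dini_le_const]])
  qed
  then show ?thesis by simp
qed

text \<open>Linear growth rules out explosion and also keeps trajectories bounded in terms of their initial
  values, so that a local Lipschitz condition suffices.\<close>

locale ode =
  fixes G :: "real \<Rightarrow> 'a::euclidean_space \<Rightarrow> 'a" and A B :: real
  assumes cont: "continuous_on ({0..} \<times> UNIV) (\<lambda>(t, x). G t x)"
    and local_lipschitz: "\<And>T R. \<exists>L\<ge>0. \<forall>t\<in>{0..T}. \<forall>x\<in>cball 0 R. \<forall>y\<in>cball 0 R.
      norm (G t x - G t y) \<le> L * norm (x - y)"
    and growth: "\<And>t x. 0 \<le> t \<Longrightarrow> norm (G t x) \<le> A + B * norm x"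
    and AB: "A \<ge> 0" "B \<ge> 0"
begin

definition sol_on :: "real \<Rightarrow> (real \<Rightarrow> 'a) \<Rightarrow> bool" where
  "sol_on T x \<longleftrightarrow> continuous_on {0..T} x \<and>
    (\<forall>t\<in>{0..<T}. (x has_vector_derivative G t (x t)) (at t within {t..}))"

definition sol :: "(real \<Rightarrow> 'a) \<Rightarrow> bool" where
  "sol x \<longleftrightarrow> (\<forall>t\<ge>0. (x has_vector_derivative G t (x t)) (at t within {0..}))"

lemma sol_sol_on: "sol x \<Longrightarrow> sol_on T x"
  unfolding sol_def sol_on_def
  using ode_continuous_on[of x "\<lambda>t. G t (x t)"]
  by (auto intro: continuous_on_subset has_vector_derivative_right)

lemma sol_on_subset: "sol_on T x \<Longrightarrow> T' \<le> T \<Longrightarrow> sol_on T' x"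
  unfolding sol_on_def by (auto intro: continuous_on_subset)

lemma sol_on_bound:
  assumes "sol_on T x" "0 \<le> t" "t \<le> T"
  shows "norm (x t) \<le> exp ((A + B) * T) * (norm (x 0) + 1)"
proof -
  have "norm (x t) + 1 \<le> exp ((A + B) * t) * (norm (x 0) + 1)"
    by (rule ode_growth[where x' = "\<lambda>t. G t (x t)"])
      (use sol_on_subset[OF assms(1,3)] assms(2) growth AB in \<open>auto simp: sol_on_def\<close>)
  also have "\<dots> \<le> exp ((A + B) * T) * (norm (x 0) + 1)"
    using AB assms by (intro mult_right_mono) (auto intro!: mult_left_mono)
  finally show ?thesis by simp
qed

text \<open>By the growth bound, all solutions involved stay in one ball up to time \<open>T\<close>. There the field has a
  single Lipschitz constant, and Gronwall's inequality applies.\<close>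

lemma sol_on_dependence:
  "\<exists>L. \<forall>x y t. sol_on T x \<longrightarrow> sol_on T y \<longrightarrow> norm (x 0) \<le> R \<longrightarrow> norm (y 0) \<le> R \<longrightarrow> t \<in> {0..T} \<longrightarrow>
     norm (x t - y t) \<le> exp (L * t) * norm (x 0 - y 0)"
proof -
  let ?R = "exp ((A + B) * T) * (R + 1)"
  obtain L where L: "\<forall>t\<in>{0..T}. \<forall>x\<in>cball 0 ?R. \<forall>y\<in>cball 0 ?R. norm (G t x - G t y) \<le> L * norm (x - y)"
    using local_lipschitz by blast
  have "norm (x t - y t) \<le> exp (L * t) * norm (x 0 - y 0)"
    if x: "sol_on T x" "norm (x 0) \<le> R" and y: "sol_on T y" "norm (y 0) \<le> R" and t: "t \<in> {0..T}" for x y t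
  proof (rule gronwall_norm[of t "\<lambda>t. x t - y t"])
    show "continuous_on {0..t} (\<lambda>t. x t - y t)"
      using x y t unfolding sol_on_def by (intro continuous_intros) (auto intro: continuous_on_subset)
    fix s assume s: "0 \<le> s" "s < t"
    show "((\<lambda>t. x t - y t) has_vector_derivative G s (x s) - G s (y s)) (at s within {s..})"
      using x y s t unfolding sol_on_def by (intro has_vector_derivative_diff) auto
    have bd: "norm (z s) \<le> ?R" if "sol_on T z" "norm (z 0) \<le> R" for z
    proof -
      have "norm (z s) \<le> exp ((A + B) * T) * (norm (z 0) + 1)"
        by (rule sol_on_bound[OF that(1)]) (use s t in auto)
      also have "\<dots> \<le> ?R" using that by simp
      finally show ?thesis .
    qed
    then show "norm (G s (x s) - G s (y s)) \<le> L * norm (x s - y s)"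
      using L s t bd[OF x] bd[OF y] by auto
  qed (use t in auto)
  then show ?thesis by blast
qed

lemma sol_on_unique:
  assumes "sol_on T x" "sol_on T y" "x 0 = y 0" "t \<in> {0..T}"
  shows "x t = y t"
  using sol_on_dependence[of T "norm (x 0)"] assms by force

text \<open>On \<open>[0,n]\<close> the growth bound confines the solution to a ball; freezing the field outside the
  ball and after time \<open>n\<close> makes it globally Lipschitz there. The solutions so obtained agree where
  they overlap.\<close>

lemma sol_exists: "\<exists>x. sol x \<and> x 0 = x0"
proof -
  define R where "R n = exp ((A + B) * real n) * (norm x0 + 1)" for n :: nat
  have "\<exists>x. x 0 = x0 \<and> continuous_on {0..real n} x \<and>
      (\<forall>t\<in>{0..<real n}. (x has_vector_derivative G t (x t)) (at t within {0..}))" for n :: nat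
  proof -
    let ?c = "closest_point (cball (0::'a) (R n))"
    have R: "R n > 0" by (simp add: R_def add_pos_nonneg add.commute)
    then have ne: "cball (0::'a) (R n) \<noteq> {}" by auto
    have c_in: "?c x \<in> cball 0 (R n)" for x by (rule closest_point_in_set) (use ne in auto)
    have c_norm: "norm (?c x) \<le> norm x" for x
      using closest_point_lipschitz[of "cball (0::'a) (R n)" x 0] ne R closest_point_self[of 0 "cball (0::'a) (R n)"]
      by (simp add: dist_norm)
    have c_lip: "norm (?c x - ?c y) \<le> norm (x - y)" for x y
      using closest_point_lipschitz[of "cball (0::'a) (R n)" x y] ne by (simp add: dist_norm)
    let ?G = "\<lambda>t x. G (min t (real n)) (?c x)"
    obtain L where L: "L \<ge> 0" "\<forall>t\<in>{0..real n}. \<forall>x\<in>cball 0 (R n). \<forall>y\<in>cball 0 (R n).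
        norm (G t x - G t y) \<le> L * norm (x - y)" using local_lipschitz by blast
    have "\<exists>x. x 0 = x0 \<and> (\<forall>t\<ge>0. (x has_vector_derivative ?G t (x t)) (at t within {0..}))"
    proof (rule picard_global)
      show "continuous_on ({0..} \<times> UNIV) (\<lambda>(t, x). ?G t x)"
      proof -
        have "continuous_on ({0..} \<times> UNIV) (\<lambda>z::real\<times>'a. (min (fst z) (real n), ?c (snd z)))"
          by (intro continuous_intros continuous_on_compose2[OF continuous_on_closest_point[of "cball (0::'a) (R n)" UNIV]])
            (use ne in auto)
        from continuous_on_compose2[OF cont this]
        have "continuous_on ({0..} \<times> UNIV) (\<lambda>z::real\<times>'a. G (min (fst z) (real n)) (?c (snd z)))"
          by (auto simp: image_subset_iff)
        then show ?thesis by (simp add: case_prod_beta)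
      qed
      fix t :: real assume t: "0 \<le> t"
      show "norm (?G t x) \<le> A + B * norm x" for x
        using growth[of "min t (real n)" "?c x"] t mult_left_mono[OF c_norm[of x] AB(2)] by simp
      show "norm (?G t x - ?G t y) \<le> L * norm (x - y)" for x y
      proof -
        have "norm (?G t x - ?G t y) \<le> L * norm (?c x - ?c y)" using L(2) c_in t by simp
        also have "\<dots> \<le> L * norm (x - y)" using L(1) c_lip by (intro mult_left_mono) auto
        finally show ?thesis .
      qed
    qed (use AB in auto)
    then obtain x where x: "x 0 = x0" "\<And>t. t \<ge> 0 \<Longrightarrow> (x has_vector_derivative ?G t (x t)) (at t within {0..})" by blast
    have cx: "continuous_on {0..} x" using x(2) by (rule ode_continuous_on)
    have bd: "norm (x t) \<le> R n" if "t \<in> {0..real n}" for t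
    proof -
      have "norm (x t) + 1 \<le> exp ((A + B) * t) * (norm (x 0) + 1)"
      proof (rule ode_growth[where x' = "\<lambda>t. ?G t (x t)"])
        fix s assume s: "0 \<le> s" "s < t"
        show "norm (?G s (x s)) \<le> A + B * norm (x s)"
          using growth[of "min s (real n)" "?c (x s)"] s mult_left_mono[OF c_norm[of "x s"] AB(2)] by simp
        show "(x has_vector_derivative ?G s (x s)) (at s within {s..})"
          by (rule has_vector_derivative_right) (use x s in auto)
      qed (use that AB cx in \<open>auto intro: continuous_on_subset\<close>)
      also have "\<dots> \<le> R n"
        unfolding R_def using x(1) AB that by (intro mult_mono) (auto intro!: mult_left_mono)
      finally show ?thesis by simp
    qed
    have "(x has_vector_derivative G t (x t)) (at t within {0..})" if t: "t \<in> {0..<real n}" for t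
    proof -
      have "?c (x t) = x t" by (rule closest_point_self) (use bd t in auto)
      then have "?G t (x t) = G t (x t)" using t by simp
      then show ?thesis using x(2)[of t] t by simp
    qed
    moreover have "continuous_on {0..real n} x" using cx by (rule continuous_on_subset) auto
    ultimately show ?thesis using x(1) by blast
  qed
  then obtain X where X0: "\<And>n. X n 0 = x0" "\<And>n. continuous_on {0..real n} (X n)"
      "\<And>n t. t \<in> {0..<real n} \<Longrightarrow> (X n has_vector_derivative G t (X n t)) (at t within {0..})" by metis
  have X: "\<And>n. X n 0 = x0" "\<And>n. sol_on (real n) (X n)"
    unfolding sol_on_def using X0 by (auto intro!: has_vector_derivative_right)
  have agree: "X m t = X n t" if "0 \<le> t" "t \<le> real m" "t \<le> real n" for m n t
    by (rule sol_on_unique[of "min (real m) (real n)"])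
      (use X that sol_on_subset[OF X(2)] in auto)
  define x where "x t = X (nat \<lceil>t\<rceil> + 1) t" for t
  have xX: "x t = X n t" if "0 \<le> t" "t \<le> real n" for t n
    unfolding x_def by (rule agree) (use that in linarith)+
  have "(x has_vector_derivative G t (x t)) (at t within {0..})" if t: "t \<ge> 0" for t
  proof -
    define n where "n = nat \<lceil>t\<rceil> + 2"
    have tn: "t < real n" by (simp add: n_def) linarith
    have "(X n has_vector_derivative G t (X n t)) (at t within {0..})" using X0(3) t tn by simp
    then show ?thesis
      unfolding xX[OF t less_imp_le[OF tn]]
      by (rule has_vector_derivative_transform_within[of _ _ _ _ "real n - t"])
        (use t tn xX[of _ n] in \<open>auto simp: dist_real_def\<close>)
  qed
  moreover have "x 0 = x0" using xX[of 0 0] X(1) by simp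
  ultimately show ?thesis unfolding sol_def by blast
qed

definition flow :: "'a \<Rightarrow> real \<Rightarrow> 'a" where
  "flow x0 = (SOME x. sol x \<and> x 0 = x0)"

lemma flow: "sol (flow x0)" "flow x0 0 = x0"
  using someI_ex[OF sol_exists[of x0]] by (auto simp: flow_def)

lemma flow_continuous:
  assumes "t \<ge> 0" shows "continuous_on UNIV (\<lambda>x0. flow x0 t)"
proof (clarsimp simp: continuous_on_eq_continuous_at)
  fix a :: 'a
  obtain L where L: "\<forall>x y s. sol_on t x \<longrightarrow> sol_on t y \<longrightarrow> norm (x 0) \<le> norm a + 1 \<longrightarrow> norm (y 0) \<le> norm a + 1 \<longrightarrow>
      s \<in> {0..t} \<longrightarrow> norm (x s - y s) \<le> exp (L * s) * norm (x 0 - y 0)"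
    using sol_on_dependence by blast
  have "eventually (\<lambda>b. b \<in> ball a 1) (at a)" by (rule eventually_at_in_open') auto
  then have "eventually (\<lambda>b. norm (flow b t - flow a t) \<le> exp (L * t) * norm (b - a)) (at a)"
  proof eventually_elim
    case (elim b)
    have "norm b \<le> norm a + 1"
      using elim norm_triangle_ineq2[of b a] by (simp add: dist_norm norm_minus_commute)
    moreover have "sol_on t (flow b)" "sol_on t (flow a)" using flow sol_sol_on by auto
    ultimately show ?case using L[rule_format, of "flow b" "flow a" t] flow(2) assms by auto
  qed
  moreover have "((\<lambda>b. exp (L * t) * norm (b - a)) \<longlongrightarrow> exp (L * t) * norm (a - a)) (at a)"
    by (intro tendsto_intros)
  ultimately have "((\<lambda>b. flow b t - flow a t) \<longlongrightarrow> 0) (at a)"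
    by (intro Lim_null_comparison[of "\<lambda>b. flow b t - flow a t" "\<lambda>b. exp (L * t) * norm (b - a)"]) auto
  then show "isCont (\<lambda>x0. flow x0 t) a" by (simp add: isCont_def LIM_zero_iff)
qed

end

text \<open>The range is open by invariance of domain and closed by properness, hence everything.\<close>

lemma proper_injective_surj:
  fixes f :: "'a::euclidean_space \<Rightarrow> 'a"
  assumes cont: "continuous_on UNIV f" and inj: "inj f"
    and proper: "\<And>v. norm v \<le> A + B * norm (f v)" and B: "B \<ge> 0"
  shows "surj f"
proof -
  have "open (range f)" using invariance_of_domain[OF cont open_UNIV inj] .
  moreover have "closed (range f)"
    unfolding closed_sequential_limits
  proof (intro allI impI)
    fix y l assume y: "(\<forall>n. y n \<in> range f) \<and> y \<longlonglongrightarrow> l"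
    then have "\<forall>n. \<exists>v. y n = f v" by auto
    then obtain v where v: "\<And>n. y n = f (v n)" by (auto dest!: choice)
    have "convergent y" using y unfolding convergent_def by blast
    then have "Bseq y" by (rule convergent_imp_Bseq)
    then obtain K where K: "\<And>n. norm (y n) \<le> K" unfolding Bseq_def by blast
    have "norm (v n) \<le> A + B * K" for n
      using proper[of "v n"] mult_left_mono[OF K[of n] B] unfolding v[of n] by linarith
    then have "y n \<in> f ` cball 0 (A + B * K)" for n using v by auto
    moreover have "closed (f ` cball 0 (A + B * K))"
      by (intro compact_imp_closed compact_continuous_image continuous_on_subset[OF cont]) auto
    ultimately have "l \<in> f ` cball 0 (A + B * K)"
      using y closed_sequentially[of "f ` cball 0 (A + B * K)" y l] by blast
    then show "l \<in> range f" by auto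
  qed
  ultimately show ?thesis using clopen[of "range f"] by auto
qed

text \<open>The initial values that keep the trajectory in the ball up to time \<open>n\<close> form compact nested sets,
  which have a common element.\<close>

lemma bounded_trajectory:
  fixes \<psi> :: "'a::euclidean_space \<Rightarrow> real \<Rightarrow> 'a"
  assumes cont: "\<And>t. 0 \<le> t \<Longrightarrow> continuous_on UNIV (\<lambda>v. \<psi> v t)" and init: "\<And>v. \<psi> v 0 = v"
    and ex: "\<And>n::nat. \<exists>v. \<forall>t\<in>{0..real n}. norm (\<psi> v t) \<le> R"
  shows "\<exists>v. \<forall>t\<ge>0. norm (\<psi> v t) \<le> R"
proof -
  define C where "C n = {v. \<forall>t\<in>{0..real n}. norm (\<psi> v t) \<le> R}" for n
  have "\<Inter> (range C) \<noteq> {}"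
  proof (rule compact_nest)
    fix n
    have "C n \<subseteq> cball 0 R"
    proof
      fix v assume "v \<in> C n"
      then have "norm (\<psi> v 0) \<le> R" by (auto simp: C_def)
      then show "v \<in> cball 0 R" by (simp add: init)
    qed
    moreover have "C n = (\<Inter>t\<in>{0..real n}. {v. norm (\<psi> v t) \<le> R})" by (auto simp: C_def)
    then have "closed (C n)"
      using cont by (auto intro!: closed_INT closed_Collect_le continuous_intros)
    ultimately show "compact (C n)" by (meson bounded_cball bounded_subset compact_eq_bounded_closed)
    show "C n \<noteq> {}" using ex by (auto simp: C_def)
  qed (auto simp: C_def)
  then obtain v where v: "\<And>n. v \<in> C n" by auto
  have "norm (\<psi> v t) \<le> R" if "t \<ge> 0" for t
  proof -
    have "t \<in> {0..real (nat \<lceil>t\<rceil>)}" using that by auto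
    then show ?thesis using v[of "nat \<lceil>t\<rceil>"] unfolding C_def by blast
  qed
  then show ?thesis by blast
qed

section \<open>The simplex\<close>

definition l1 :: "real^'n::finite \<Rightarrow> real" where "l1 m = (\<Sum>x\<in>UNIV. \<bar>m $ x\<bar>)"

lemma l1_ge_0: "0 \<le> l1 m" by (simp add: l1_def sum_nonneg)

lemma norm_le_l1_vec: "norm m \<le> l1 m"
  unfolding l1_def by (rule norm_le_l1_cart)

lemma l1_le_card_norm: "l1 (m::real^'n) \<le> real CARD('n) * norm m"
proof -
  have "l1 m \<le> (\<Sum>x\<in>(UNIV::'n set). norm m)"
    unfolding l1_def by (intro sum_mono component_le_norm_cart)
  then show ?thesis by simp
qed

lemma prob_simplexD:
  assumes "\<eta> \<in> prob_simplex"
  shows "0 \<le> \<eta> $ x" "\<eta> $ x \<le> 1" "(\<Sum>x\<in>UNIV. \<eta> $ x) = 1"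
  using assms member_le_sum[of x UNIV "\<lambda>x. \<eta> $ x"] by (auto simp: prob_simplex_def)

lemma sum_diff_simplex:
  assumes "\<eta> \<in> prob_simplex" "\<eta>' \<in> prob_simplex"
  shows "(\<Sum>x\<in>UNIV. (\<eta> - \<eta>') $ x) = 0"
  using prob_simplexD(3)[OF assms(1)] prob_simplexD(3)[OF assms(2)] by (simp add: sum_subtractf)

lemma l1_simplex: "\<eta> \<in> prob_simplex \<Longrightarrow> l1 \<eta> = 1"
  using prob_simplexD(1,3)[of \<eta>] by (simp add: l1_def)

lemma convex_prob_simplex: "convex prob_simplex"
proof (rule convexI)
  fix x y :: "real^'n" and u v :: real
  assume "x \<in> prob_simplex" "y \<in> prob_simplex" "0 \<le> u" "0 \<le> v" "u + v = 1"
  then show "u *\<^sub>R x + v *\<^sub>R y \<in> prob_simplex"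
    by (auto simp: prob_simplex_def sum.distrib sum_distrib_left[symmetric])
qed

lemma compact_prob_simplex: "compact (prob_simplex :: (real^'n::finite) set)"
proof -
  have "prob_simplex = (\<Inter>x. {\<eta>::real^'n. 0 \<le> \<eta> $ x}) \<inter> {\<eta>. (\<Sum>x\<in>UNIV. \<eta> $ x) = 1}"
    by (auto simp: prob_simplex_def)
  also have "closed \<dots>"
    by (intro closed_Int closed_INT ballI closed_Collect_le closed_Collect_eq continuous_intros)
  finally have "closed (prob_simplex :: (real^'n) set)" .
  moreover have "bounded (prob_simplex :: (real^'n) set)"
    unfolding bounded_iff using norm_le_l1_vec l1_simplex by metis
  ultimately show ?thesis by (simp add: compact_eq_bounded_closed)
qed

lemma axis_in_simplex: "axis x 1 \<in> (prob_simplex :: (real^'n::finite) set)"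
  by (auto simp: prob_simplex_def axis_def)

section \<open>Differentiable functions on the simplex are Lipschitz\<close>

lemma simplex_deriv_line:
  fixes K :: "real^'n::finite \<Rightarrow> real"
  assumes D: "simplex_deriv K D" and yz: "y \<noteq> z"
    and seg: "\<And>h. 0 \<le> h \<Longrightarrow> h \<le> \<tau> \<Longrightarrow> \<eta> + h *\<^sub>R (axis z 1 - axis y 1) \<in> prob_simplex"
    and h: "0 \<le> h" "h < \<tau>"
  shows "((\<lambda>h. K (\<eta> + h *\<^sub>R (axis z 1 - axis y 1))) has_real_derivative
    D y z (\<eta> + h *\<^sub>R (axis z 1 - axis y 1))) (at h within {h..})"
proof -
  let ?e = "axis z 1 - axis y 1 :: real^'n"
  let ?\<eta> = "\<eta> + h *\<^sub>R ?e"
  have add: "?\<eta> + k *\<^sub>R ?e = \<eta> + (h + k) *\<^sub>R ?e" for k by (simp add: scaleR_add_left)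
  have "((\<lambda>k. (K (?\<eta> + k *\<^sub>R ?e) - K ?\<eta>) / k) \<longlongrightarrow> D y z ?\<eta>)
      (at 0 within {k. 0 < k \<and> ?\<eta> + k *\<^sub>R ?e \<in> prob_simplex})"
    using D yz seg h unfolding simplex_deriv_def by auto
  then have "((\<lambda>k. (K (?\<eta> + k *\<^sub>R ?e) - K ?\<eta>) / k) \<longlongrightarrow> D y z ?\<eta>) (at 0 within {0<..<\<tau> - h})"
    by (rule tendsto_within_subset) (use h in \<open>auto simp: add intro!: seg\<close>)
  also have "at 0 within {0<..<\<tau> - h} = at 0 within {0::real..}"
    by (rule at_within_nhd[of _ "{..<\<tau> - h}"]) (use h in auto)
  finally have *: "((\<lambda>k. (K (\<eta> + (h + k) *\<^sub>R ?e) - K ?\<eta>) / k) \<longlongrightarrow> D y z ?\<eta>) (at 0 within {0..})"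
    unfolding add .
  have "filterlim (\<lambda>s. s - h) (at 0 within {0..}) (at h within {h..})"
    by (auto simp: filterlim_at eventually_at_filter intro!: tendsto_eq_intros)
  from filterlim_compose[OF * this] show ?thesis
    by (simp add: has_field_derivative_iff)
qed

text \<open>Inside the segment, \<open>K\<close> has a right derivative and, seen from the other end, also a left
  derivative, which makes it continuous; a continuous function with bounded right derivative is
  Lipschitz.\<close>

lemma simplex_lipschitz_line:
  fixes K :: "real^'n::finite \<Rightarrow> real"
  assumes D: "simplex_deriv K D" and yz: "y \<noteq> z"
    and M: "\<And>y z \<eta>. y \<noteq> z \<Longrightarrow> \<eta> \<in> prob_simplex \<Longrightarrow> \<bar>D y z \<eta>\<bar> \<le> M"
    and \<tau>: "0 \<le> \<tau>" and \<eta>: "\<eta> \<in> prob_simplex" "\<eta> + \<tau> *\<^sub>R (axis z 1 - axis y 1) \<in> prob_simplex"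
  shows "\<bar>K (\<eta> + \<tau> *\<^sub>R (axis z 1 - axis y 1)) - K \<eta>\<bar> \<le> M * \<tau>"
proof -
  let ?e = "axis z 1 - axis y 1 :: real^'n"
  have seg: "\<eta> + h *\<^sub>R ?e \<in> prob_simplex" if "0 \<le> h" "h \<le> \<tau>" for h
  proof (cases "\<tau> = 0")
    case False
    have "(1 - h/\<tau>) *\<^sub>R \<eta> + (h/\<tau>) *\<^sub>R (\<eta> + \<tau> *\<^sub>R ?e) \<in> prob_simplex"
      using that False \<tau> by (intro convexD[OF convex_prob_simplex] \<eta>) (auto simp: field_simps)
    moreover have "(1 - h/\<tau>) *\<^sub>R \<eta> + (h/\<tau>) *\<^sub>R (\<eta> + \<tau> *\<^sub>R ?e) = \<eta> + h *\<^sub>R ?e"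
      using False by (simp add: algebra_simps)
    ultimately show ?thesis by simp
  qed (use that \<eta> in auto)
  define \<phi> where "\<phi> h = K (\<eta> + h *\<^sub>R ?e)" for h
  have right: "(\<phi> has_real_derivative D y z (\<eta> + h *\<^sub>R ?e)) (at h within {h..})" if "0 \<le> h" "h < \<tau>" for h
    unfolding \<phi>_def[abs_def] by (rule simplex_deriv_line[OF D yz seg that]) auto
  have left: "(\<phi> has_real_derivative - D z y (\<eta> + h *\<^sub>R ?e)) (at h within {..h})" if "0 < h" "h \<le> \<tau>" for h
  proof -
    let ?\<eta> = "\<eta> + \<tau> *\<^sub>R ?e" and ?f = "axis y 1 - axis z 1 :: real^'n"
    have eq: "?\<eta> + (\<tau> - h) *\<^sub>R ?f = \<eta> + h *\<^sub>R ?e" for h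
      by (simp add: vec_eq_iff algebra_simps)
    have seg': "?\<eta> + k *\<^sub>R ?f \<in> prob_simplex" if "0 \<le> k" "k \<le> \<tau>" for k
    proof -
      have *: "?\<eta> + k *\<^sub>R ?f = \<eta> + (\<tau> - k) *\<^sub>R ?e" using eq[of "\<tau> - k"] by simp
      show ?thesis unfolding * by (rule seg) (use that in auto)
    qed
    have "((\<lambda>k. K (?\<eta> + k *\<^sub>R ?f)) has_real_derivative D z y (?\<eta> + (\<tau> - h) *\<^sub>R ?f)) (at (\<tau> - h) within {\<tau> - h..})"
      by (rule simplex_deriv_line[OF D yz[symmetric] seg']) (use that in auto)
    then have "((\<lambda>k. K (?\<eta> + k *\<^sub>R ?f)) has_real_derivative D z y (\<eta> + h *\<^sub>R ?e)) (at (\<tau> - h) within (\<lambda>s. \<tau> - s) ` {..h})"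
      unfolding eq by (rule DERIV_subset) auto
    moreover have "((\<lambda>s. \<tau> - s) has_real_derivative - 1) (at h within {..h})"
      by (auto intro!: derivative_eq_intros)
    ultimately have "((\<lambda>s. K (?\<eta> + (\<tau> - s) *\<^sub>R ?f)) has_real_derivative - D z y (\<eta> + h *\<^sub>R ?e)) (at h within {..h})"
      using DERIV_image_chain[of "\<lambda>k. K (?\<eta> + k *\<^sub>R ?f)" _ "\<lambda>s. \<tau> - s"] by (fastforce simp: o_def)
    then show ?thesis unfolding eq \<phi>_def[abs_def] .
  qed
  have cont: "continuous_on {0..\<tau>} \<phi>"
    unfolding continuous_on_eq_continuous_within
  proof
    fix h assume h: "h \<in> {0..\<tau>}"
    have r: "continuous (at h within {h..\<tau>}) \<phi>"
    proof (cases "h < \<tau>")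
      case True
      have "continuous (at h within {h..}) \<phi>"
        using right[of h] h True by (intro DERIV_continuous) auto
      then show ?thesis by (rule continuous_within_subset) auto
    next
      case False
      then have "h = \<tau>" using h by auto
      then show ?thesis by (simp add: continuous_within at_within_def)
    qed
    have l: "continuous (at h within {0..h}) \<phi>"
    proof (cases "0 < h")
      case True
      have "continuous (at h within {..h}) \<phi>"
        using left[of h] h True by (intro DERIV_continuous) auto
      then show ?thesis by (rule continuous_within_subset) auto
    next
      case False
      then have "h = 0" using h by auto
      then show ?thesis by (simp add: continuous_within at_within_def)
    qed
    have "{0..\<tau>} = {0..h} \<union> {h..\<tau>}" using h by auto
    with l r show "continuous (at h within {0..\<tau>}) \<phi>"
      by (simp add: continuous_within Lim_within_Un)
  qed
  have bound: "s * \<phi> \<tau> - M * \<tau> \<le> s * \<phi> 0" if s: "s = 1 \<or> s = - 1" for s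
  proof -
    have "s * \<phi> \<tau> - M * \<tau> \<le> s * \<phi> 0 - M * 0"
    proof (rule dini_le_nonincreasing[OF \<tau>, of "\<lambda>h. s * \<phi> h - M * h"])
      show "continuous_on {0..\<tau>} (\<lambda>h. s * \<phi> h - M * h)" by (intro continuous_intros cont)
      fix h assume h: "0 \<le> h" "h < \<tau>"
      have "((\<lambda>h. s * \<phi> h - M * h) has_real_derivative s * D y z (\<eta> + h *\<^sub>R ?e) - M) (at h within {h..})"
        using right[OF h] by (auto intro!: derivative_eq_intros)
      then have "dini_le (\<lambda>h. s * \<phi> h - M * h) h {h..} (s * D y z (\<eta> + h *\<^sub>R ?e) - M)"
        by (rule dini_le_right_deriv)
      then show "dini_le (\<lambda>h. s * \<phi> h - M * h) h {h..} 0"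
        by (rule dini_le_mono) (use M[OF yz seg[of h]] h s in auto)
    qed
    then show ?thesis by simp
  qed
  from bound[of 1] bound[of "-1"] show ?thesis by (simp add: \<phi>_def abs_le_iff)
qed

text \<open>Mass is moved from one probability vector to the other in steps along the directions
  \<open>e\<^sub>z - e\<^sub>y\<close>; each step makes one more coordinate agree, and the total mass moved is at most the
  \<open>l\<^sub>1\<close> distance.\<close>

lemma simplex_lipschitz_l1:
  fixes K :: "real^'n::finite \<Rightarrow> real"
  assumes D: "simplex_deriv K D"
    and M: "\<And>y z \<eta>. y \<noteq> z \<Longrightarrow> \<eta> \<in> prob_simplex \<Longrightarrow> \<bar>D y z \<eta>\<bar> \<le> M" and M0: "0 \<le> M"
    and \<eta>: "\<eta> \<in> prob_simplex" "\<eta>' \<in> prob_simplex"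
  shows "\<bar>K \<eta> - K \<eta>'\<bar> \<le> M * l1 (\<eta> - \<eta>')"
  using \<eta>(1)
proof (induction "card {x. \<eta> $ x \<noteq> \<eta>' $ x}" arbitrary: \<eta> rule: less_induct)
  case less
  show ?case
  proof (cases "\<eta> = \<eta>'")
    case True then show ?thesis by (simp add: l1_def)
  next
    case False
    have s0: "(\<Sum>x\<in>UNIV. (\<eta> - \<eta>') $ x) = 0" by (rule sum_diff_simplex[OF less.prems \<eta>(2)])
    have "\<exists>y. (\<eta> - \<eta>') $ y > 0"
    proof (rule ccontr)
      assume "\<not> (\<exists>y. (\<eta> - \<eta>') $ y > 0)"
      then have *: "\<forall>x. (\<eta> - \<eta>') $ x \<le> 0" by (auto simp: not_less)
      then have "(\<Sum>x\<in>UNIV. - (\<eta> - \<eta>') $ x) = 0 \<longleftrightarrow> (\<forall>x\<in>UNIV. - (\<eta> - \<eta>') $ x = 0)"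
        by (intro sum_nonneg_eq_0_iff) auto
      with s0 have "\<forall>x. (\<eta> - \<eta>') $ x = 0" by (simp add: sum_negf del: vector_minus_component)
      then have "\<eta> = \<eta>'" by (simp add: vec_eq_iff)
      with False show False by simp
    qed
    moreover have "\<exists>z. (\<eta> - \<eta>') $ z < 0"
    proof (rule ccontr)
      assume "\<not> (\<exists>y. (\<eta> - \<eta>') $ y < 0)"
      then have *: "\<forall>x. (\<eta> - \<eta>') $ x \<ge> 0" by (auto simp: not_less)
      then have "(\<Sum>x\<in>UNIV. (\<eta> - \<eta>') $ x) = 0 \<longleftrightarrow> (\<forall>x\<in>UNIV. (\<eta> - \<eta>') $ x = 0)"
        by (intro sum_nonneg_eq_0_iff) auto
      with s0 have "\<eta> = \<eta>'" by (simp add: vec_eq_iff)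
      with False show False by simp
    qed
    ultimately obtain y z where y: "\<eta> $ y > \<eta>' $ y" and z: "\<eta> $ z < \<eta>' $ z" by auto
    then have yz: "y \<noteq> z" by auto
    define \<tau> where "\<tau> = min (\<eta> $ y - \<eta>' $ y) (\<eta>' $ z - \<eta> $ z)"
    have \<tau>: "\<tau> > 0" "\<tau> \<le> \<eta> $ y - \<eta>' $ y" "\<tau> \<le> \<eta>' $ z - \<eta> $ z" using y z by (auto simp: \<tau>_def)
    define \<zeta> where "\<zeta> = \<eta> + \<tau> *\<^sub>R (axis z 1 - axis y 1)"
    have \<zeta>x: "\<zeta> $ x = (if x = y then \<eta> $ y - \<tau> else if x = z then \<eta> $ z + \<tau> else \<eta> $ x)" for x
      using yz by (auto simp: \<zeta>_def axis_def)
    have split: "(\<Sum>x\<in>UNIV. g x) = g y + (g z + (\<Sum>x\<in>UNIV - {y} - {z}. g x))" for g :: "'n \<Rightarrow> real"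
      using yz by (simp add: sum.remove[of UNIV y] sum.remove[of "UNIV - {y}" z])
    have rest: "(\<Sum>x\<in>UNIV - {y} - {z}. g (\<zeta> $ x) x) = (\<Sum>x\<in>UNIV - {y} - {z}. g (\<eta> $ x) x)" for g :: "real \<Rightarrow> 'n \<Rightarrow> real"
      by (intro sum.cong) (auto simp: \<zeta>x)
    have "(\<Sum>x\<in>UNIV. \<zeta> $ x) = (\<Sum>x\<in>UNIV. \<eta> $ x)"
      unfolding split rest[of "\<lambda>v x. v"] using yz by (simp add: \<zeta>x)
    moreover have "0 \<le> \<zeta> $ x" for x
      using prob_simplexD(1)[OF less.prems, of x] prob_simplexD(1)[OF \<eta>(2), of y] \<tau> by (auto simp: \<zeta>x)
    ultimately have \<zeta>: "\<zeta> \<in> prob_simplex" using less.prems by (simp add: prob_simplex_def)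
    have "{x. \<zeta> $ x \<noteq> \<eta>' $ x} \<subseteq> {x. \<eta> $ x \<noteq> \<eta>' $ x}" using y z by (auto simp: \<zeta>x)
    moreover have "{x. \<zeta> $ x \<noteq> \<eta>' $ x} \<noteq> {x. \<eta> $ x \<noteq> \<eta>' $ x}"
    proof (cases "\<tau> = \<eta> $ y - \<eta>' $ y")
      case True
      then have "\<zeta> $ y = \<eta>' $ y" by (simp add: \<zeta>x)
      then have "y \<notin> {x. \<zeta> $ x \<noteq> \<eta>' $ x}" "y \<in> {x. \<eta> $ x \<noteq> \<eta>' $ x}" using y by simp_all
      then show ?thesis by blast
    next
      case False
      then have "\<zeta> $ z = \<eta>' $ z" using yz by (simp add: \<zeta>x \<tau>_def min_def split: if_splits)
      then have "z \<notin> {x. \<zeta> $ x \<noteq> \<eta>' $ x}" "z \<in> {x. \<eta> $ x \<noteq> \<eta>' $ x}" using z by simp_all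
      then show ?thesis by blast
    qed
    ultimately have "card {x. \<zeta> $ x \<noteq> \<eta>' $ x} < card {x. \<eta> $ x \<noteq> \<eta>' $ x}"
      by (intro psubset_card_mono) auto
    from less.hyps[OF this \<zeta>] have IH: "\<bar>K \<zeta> - K \<eta>'\<bar> \<le> M * l1 (\<zeta> - \<eta>')" .
    have step: "\<bar>K \<zeta> - K \<eta>\<bar> \<le> M * \<tau>"
      unfolding \<zeta>_def by (rule simplex_lipschitz_line[OF D yz M _ less.prems])
        (use \<tau> \<zeta> in \<open>auto simp: \<zeta>_def\<close>)
    have "l1 (\<zeta> - \<eta>') + 2 * \<tau> = l1 (\<eta> - \<eta>')"
      unfolding l1_def split vector_minus_component rest[of "\<lambda>v x. \<bar>v - \<eta>' $ x\<bar>"]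
      using yz \<tau> by (simp add: \<zeta>x)
    then have "M * l1 (\<zeta> - \<eta>') + 2 * (M * \<tau>) = M * l1 (\<eta> - \<eta>')"
      by (metis (no_types) distrib_left mult.left_commute)
    moreover have "0 \<le> M * \<tau>" using M0 \<tau> by simp
    ultimately show ?thesis using IH step by linarith
  qed
qed

lemma simplex_C1_lipschitz:
  fixes K :: "real^'n::finite \<Rightarrow> real"
  assumes "simplex_C1 K D"
  shows "\<exists>M\<ge>0. \<forall>\<eta>\<in>prob_simplex. \<forall>\<eta>'\<in>prob_simplex. \<bar>K \<eta> - K \<eta>'\<bar> \<le> M * l1 (\<eta> - \<eta>')"
proof -
  have "\<exists>B\<ge>0. \<forall>\<eta>\<in>prob_simplex. y \<noteq> z \<longrightarrow> \<bar>D y z \<eta>\<bar> \<le> B" for y z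
  proof (cases "y = z")
    case False
    then have "continuous_on prob_simplex (D y z)" using assms by (auto simp: simplex_C1_def)
    then have "bounded (D y z ` prob_simplex)"
      by (intro compact_imp_bounded compact_continuous_image compact_prob_simplex)
    then obtain B where "\<forall>\<eta>\<in>prob_simplex. norm (D y z \<eta>) \<le> B" by (auto simp: bounded_iff)
    then show ?thesis by (intro exI[of _ "max B 0"]) (auto simp: le_max_iff_disj)
  qed auto
  then obtain B where B: "\<And>y z. B y z \<ge> 0" "\<And>y z \<eta>. \<eta> \<in> prob_simplex \<Longrightarrow> y \<noteq> z \<Longrightarrow> \<bar>D y z \<eta>\<bar> \<le> B y z"
    by metis
  define M where "M = (\<Sum>y\<in>UNIV. \<Sum>z\<in>UNIV. B y z)"
  have "B y z \<le> M" for y z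
  proof -
    have "B y z \<le> (\<Sum>z\<in>UNIV. B y z)" using B(1) by (intro member_le_sum) auto
    also have "\<dots> \<le> M" unfolding M_def
      by (rule member_le_sum[of y UNIV "\<lambda>y. \<Sum>z\<in>UNIV. B y z"]) (use B(1) in \<open>auto intro: sum_nonneg\<close>)
    finally show ?thesis .
  qed
  then have "\<bar>D y z \<eta>\<bar> \<le> M" if "y \<noteq> z" "\<eta> \<in> prob_simplex" for y z \<eta>
    using B(2)[OF that(2,1)] order_trans by blast
  moreover have "M \<ge> 0" unfolding M_def using B(1) by (intro sum_nonneg) auto
  ultimately show ?thesis
    using simplex_lipschitz_l1[of K D M] assms by (auto simp: simplex_C1_def)
qed

section \<open>The Hamiltonian\<close>

lemma gamma_star_minimizes:
  assumes "\<exists>!a. is_minimizer al au f x p a"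
  shows "gamma_star al au f x p \<in> rate_vectors al au x"
    and "a \<in> rate_vectors al au x \<Longrightarrow>
      f x (gamma_star al au f x p) + gamma_star al au f x p \<bullet> p \<le> f x a + a \<bullet> p"
    and "is_minimizer al au f x p b \<Longrightarrow> gamma_star al au f x p = b"
proof -
  have m: "is_minimizer al au f x p (gamma_star al au f x p)"
    unfolding gamma_star_def arg_min_def
    using assms someI_ex[of "is_minimizer al au f x p"] by (auto simp: is_minimizer_def)
  then show "gamma_star al au f x p \<in> rate_vectors al au x"
    and "a \<in> rate_vectors al au x \<Longrightarrow>
      f x (gamma_star al au f x p) + gamma_star al au f x p \<bullet> p \<le> f x a + a \<bullet> p"
    by (auto simp: is_minimizer_def is_arg_min_linorder)
  show "is_minimizer al au f x p b \<Longrightarrow> gamma_star al au f x p = b" using m assms by auto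
qed

lemma hamiltonian_eq:
  assumes "\<exists>!a. is_minimizer al au f x p a"
  shows "hamiltonian al au f x p = f x (gamma_star al au f x p) + gamma_star al au f x p \<bullet> p"
  unfolding hamiltonian_def
proof (rule cInf_eq_minimum)
  let ?g = "gamma_star al au f x p"
  show "f x ?g + ?g \<bullet> p \<in> (\<lambda>a. f x a + a \<bullet> p) ` rate_vectors al au x"
    using gamma_star_minimizes(1)[OF assms] by (rule imageI)
  show "f x ?g + ?g \<bullet> p \<le> c" if "c \<in> (\<lambda>a. f x a + a \<bullet> p) ` rate_vectors al au x" for c
    using that gamma_star_minimizes(2)[OF assms] by blast
qed

lemma hamiltonian_le:
  assumes "\<And>p. \<exists>!a. is_minimizer al au f x p a" "a \<in> rate_vectors al au x"
  shows "hamiltonian al au f x p \<le> f x a + a \<bullet> p"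
  unfolding hamiltonian_eq[OF assms(1)] by (rule gamma_star_minimizes(2)[OF assms])

lemma hamiltonian_supergradient:
  assumes "\<And>p. \<exists>!a. is_minimizer al au f x p a"
  shows "hamiltonian al au f x q \<le> hamiltonian al au f x p + gamma_star al au f x p \<bullet> (q - p)"
proof -
  have "hamiltonian al au f x q \<le> f x (gamma_star al au f x p) + gamma_star al au f x p \<bullet> q"
    by (rule hamiltonian_le[OF assms gamma_star_minimizes(1)[OF assms]])
  then show ?thesis using hamiltonian_eq[OF assms, of p] by (simp add: inner_diff_right)
qed

text \<open>The minimizer is a supergradient of the concave function \<open>H\<close>, so where \<open>H\<close> is differentiable
  it is the gradient.\<close>

lemma hamiltonian_gradient:
  assumes min: "\<And>p. \<exists>!a. is_minimizer al au f x p a"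
    and D: "(hamiltonian al au f x has_derivative (\<lambda>\<xi>. d \<bullet> \<xi>)) (at p)"
  shows "d = gamma_star al au f x p"
proof (rule vector_eq_rdot[THEN iffD1], rule allI)
  fix \<xi>
  let ?g = "gamma_star al au f x p"
  let ?h = "\<lambda>t. hamiltonian al au f x (p + t *\<^sub>R \<xi>) - ?g \<bullet> (t *\<^sub>R \<xi>)"
  have "((\<lambda>t. hamiltonian al au f x (p + t *\<^sub>R \<xi>)) has_derivative (\<lambda>t. d \<bullet> (t *\<^sub>R \<xi>))) (at 0)"
    by (rule has_derivative_compose[of "\<lambda>t. p + t *\<^sub>R \<xi>" "\<lambda>t. t *\<^sub>R \<xi>" 0 UNIV, simplified])
      (use D in \<open>auto intro!: derivative_eq_intros\<close>)
  then have "(?h has_derivative (\<lambda>t. d \<bullet> (t *\<^sub>R \<xi>) - ?g \<bullet> (t *\<^sub>R \<xi>))) (at 0)"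
    by (auto intro!: derivative_eq_intros)
  then have "(?h has_real_derivative (d \<bullet> \<xi> - ?g \<bullet> \<xi>)) (at 0)"
    by (rule has_derivative_imp_has_field_derivative) (simp add: algebra_simps)
  moreover have "?h t \<le> ?h 0" for t
    using hamiltonian_supergradient[OF min, of "p + t *\<^sub>R \<xi>" p] by simp
  ultimately have "d \<bullet> \<xi> - ?g \<bullet> \<xi> = 0"
    using DERIV_local_max[of ?h "d \<bullet> \<xi> - ?g \<bullet> \<xi>" 0 1] by auto
  then show "d \<bullet> \<xi> = ?g \<bullet> \<xi>" by simp
qed

lemma second_order_concave:
  fixes h :: "real \<Rightarrow> real"
  assumes h: "\<And>t. 0 \<le> t \<Longrightarrow> t \<le> 1 \<Longrightarrow> (h has_real_derivative h' t) (at t)"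
    and h': "\<And>t. 0 \<le> t \<Longrightarrow> t \<le> 1 \<Longrightarrow> (h' has_real_derivative h'' t) (at t)"
    and h'': "\<And>t. 0 \<le> t \<Longrightarrow> t \<le> 1 \<Longrightarrow> h'' t \<le> - c"
  shows "h 1 \<le> h 0 + h' 0 - c / 2"
proof -
  have 1: "h' t + c * t \<le> h' 0 + c * 0" if "0 \<le> t" "t \<le> 1" for t
  proof (rule DERIV_nonpos_imp_nonincreasing[OF that(1), of "\<lambda>t. h' t + c * t"])
    fix s assume "0 \<le> s" "s \<le> t"
    then show "\<exists>y. ((\<lambda>t. h' t + c * t) has_real_derivative y) (at s) \<and> y \<le> 0"
      using h'[of s] h''[of s] that by (intro exI[of _ "h'' s + c"]) (auto intro!: derivative_eq_intros)
  qed
  have "h 1 - h' 0 * 1 + c / 2 * 1\<^sup>2 \<le> h 0 - h' 0 * 0 + c / 2 * 0\<^sup>2"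
  proof (rule DERIV_nonpos_imp_nonincreasing[of 0 1 "\<lambda>t. h t - h' 0 * t + c / 2 * t\<^sup>2"])
    fix s :: real assume s: "0 \<le> s" "s \<le> 1"
    then show "\<exists>y. ((\<lambda>t. h t - h' 0 * t + c / 2 * t\<^sup>2) has_real_derivative y) (at s) \<and> y \<le> 0"
      using h[of s] 1[of s] by (intro exI[of _ "h' s - h' 0 + c * s"]) (auto intro!: derivative_eq_intros)
  qed simp
  then show ?thesis by simp
qed

definition cube :: "real \<Rightarrow> (real^'n::finite) set" where
  "cube K = {p. \<forall>i. \<bar>p $ i\<bar> \<le> K}"

lemma cube_alt: "{p. \<forall>i. p $ i \<in> {-K..K}} = cube K"
  unfolding cube_def by (intro Collect_cong all_cong1) auto

text \<open>The Hessian is only controlled in directions with vanishing \<open>x\<close>-component, hence the hypothesis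
  \<open>p $ x = q $ x\<close>; vectors of the form \<open>Delta x u\<close> all have \<open>x\<close>-component \<open>0\<close>.\<close>

lemma regular_strong_concavity:
  fixes H :: "'n::finite \<Rightarrow> real^'n \<Rightarrow> real"
  assumes H: "\<And>x p. (H x has_derivative (\<lambda>\<xi>. DH x p \<bullet> \<xi>)) (at p)"
    and DH: "\<And>x p. (DH x has_derivative (\<lambda>\<xi>. D2H x p *v \<xi>)) (at p)"
    and neg: "\<And>x p \<xi>. p \<in> cube K \<Longrightarrow> \<xi> $ x = 0 \<Longrightarrow> \<xi> \<bullet> (D2H x p *v \<xi>) \<le> - C * (norm \<xi>)\<^sup>2"
    and pq: "p \<in> cube K" "q \<in> cube K" "p $ x = q $ x"
  shows "H x q \<le> H x p + DH x p \<bullet> (q - p) - C / 2 * (norm (q - p))\<^sup>2"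
proof -
  let ?v = "q - p"
  have seg: "p + t *\<^sub>R ?v \<in> cube K" if "0 \<le> t" "t \<le> 1" for t
  proof -
    have "\<bar>(p + t *\<^sub>R ?v) $ i\<bar> \<le> K" for i
    proof -
      have "(p + t *\<^sub>R ?v) $ i = (1 - t) * p $ i + t * q $ i" by (simp add: algebra_simps)
      also have "\<bar>\<dots>\<bar> \<le> (1 - t) * K + t * K"
        using pq that by (intro order_trans[OF abs_triangle_ineq] add_mono)
          (auto simp: abs_mult cube_def intro!: mult_left_mono)
      finally show ?thesis by (simp add: algebra_simps)
    qed
    then show ?thesis by (simp add: cube_def)
  qed
  have line: "((\<lambda>t. p + t *\<^sub>R ?v) has_derivative (\<lambda>s. s *\<^sub>R ?v)) (at t)" for t
    by (auto intro!: derivative_eq_intros)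
  have "H x (p + 1 *\<^sub>R ?v) \<le> H x (p + 0 *\<^sub>R ?v) + DH x (p + 0 *\<^sub>R ?v) \<bullet> ?v - (C * (norm ?v)\<^sup>2) / 2"
  proof (rule second_order_concave[where h'' = "\<lambda>t. (D2H x (p + t *\<^sub>R ?v) *v ?v) \<bullet> ?v"])
    fix t :: real assume t: "0 \<le> t" "t \<le> 1"
    have "((\<lambda>t. H x (p + t *\<^sub>R ?v)) has_derivative (\<lambda>s. DH x (p + t *\<^sub>R ?v) \<bullet> (s *\<^sub>R ?v))) (at t)"
      by (rule has_derivative_compose[OF line H])
    then show "((\<lambda>t. H x (p + t *\<^sub>R ?v)) has_real_derivative DH x (p + t *\<^sub>R ?v) \<bullet> ?v) (at t)"
      by (rule has_derivative_imp_has_field_derivative) simp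
    have "((\<lambda>t. DH x (p + t *\<^sub>R ?v)) has_derivative (\<lambda>s. D2H x (p + t *\<^sub>R ?v) *v (s *\<^sub>R ?v))) (at t)"
      by (rule has_derivative_compose[OF line DH])
    then have "((\<lambda>t. DH x (p + t *\<^sub>R ?v) \<bullet> ?v) has_derivative (\<lambda>s. (D2H x (p + t *\<^sub>R ?v) *v (s *\<^sub>R ?v)) \<bullet> ?v)) (at t)"
      by (rule has_derivative_inner_left)
    then show "((\<lambda>t. DH x (p + t *\<^sub>R ?v) \<bullet> ?v) has_real_derivative (D2H x (p + t *\<^sub>R ?v) *v ?v) \<bullet> ?v) (at t)"
      by (rule has_derivative_imp_has_field_derivative) (simp add: matrix_vector_mult_scaleR)
    show "(D2H x (p + t *\<^sub>R ?v) *v ?v) \<bullet> ?v \<le> - (C * (norm ?v)\<^sup>2)"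
      using neg[OF seg[OF t], of ?v x] pq(3) by (simp add: inner_commute)
  qed
  then show ?thesis by simp
qed

section \<open>Oscillation and maximum norm\<close>

definition osc :: "real^'n::finite \<Rightarrow> real" where
  "osc w = (MAX z\<in>UNIV. w $ fst z - w $ snd z)"

definition supn :: "real^'n::finite \<Rightarrow> real" where
  "supn w = (MAX x\<in>UNIV. \<bar>w $ x\<bar>)"

lemma diff_le_osc: "w $ x - w $ y \<le> osc w"
  unfolding osc_def by (rule Max_ge) (auto intro!: image_eqI[of _ _ "(x, y)"])

lemma abs_diff_le_osc: "\<bar>w $ x - w $ y\<bar> \<le> osc w"
  using diff_le_osc[of w x y] diff_le_osc[of w y x] by linarith

lemma osc_ge_0: "0 \<le> osc w"
  using diff_le_osc[of w undefined undefined] by simp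

lemma osc_attained: "\<exists>x y. osc w = w $ x - w $ y"
proof -
  have "osc w \<in> range (\<lambda>z. w $ fst z - w $ snd z)"
    unfolding osc_def by (rule Max_in) auto
  then show ?thesis by auto
qed

lemma abs_le_supn: "\<bar>w $ x\<bar> \<le> supn w"
  unfolding supn_def by (rule Max_ge) auto

lemma supn_ge_0: "0 \<le> supn w"
  using abs_le_supn[of w undefined] by linarith

lemma supn_le: "(\<And>x. \<bar>w $ x\<bar> \<le> B) \<Longrightarrow> supn w \<le> B"
  unfolding supn_def by (rule Max.boundedI) auto

lemma supn_le_norm: "supn w \<le> norm w"
  by (rule supn_le) (rule component_le_norm_cart)

lemma norm_le_supn: "norm (w::real^'n::finite) \<le> real CARD('n) * supn w"
proof -
  have "norm w \<le> (\<Sum>x\<in>(UNIV::'n set). supn w)"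
    by (rule order_trans[OF norm_le_l1_cart]) (intro sum_mono abs_le_supn)
  then show ?thesis by simp
qed

lemma osc_le_supn: "osc w \<le> 2 * supn w"
proof -
  obtain x y where "osc w = w $ x - w $ y" using osc_attained by blast
  then show ?thesis using abs_le_supn[of w x] abs_le_supn[of w y] by linarith
qed

lemma continuous_on_osc: "continuous_on S w \<Longrightarrow> continuous_on S (\<lambda>t. osc (w t))"
proof -
  assume w: "continuous_on S w"
  have "continuous_on S (\<lambda>t. MAX z\<in>I. w t $ fst z - w t $ snd z)" if "finite I" "I \<noteq> {}" for I :: "('b \<times> 'b) set"
    using that
  proof (induction rule: finite_ne_induct)
    case (insert z I)
    then have "(MAX z\<in>insert z I. w t $ fst z - w t $ snd z) =
        max (w t $ fst z - w t $ snd z) (MAX z\<in>I. w t $ fst z - w t $ snd z)" for t by simp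
    then show ?case using insert w by (auto intro!: continuous_intros)
  qed (use w in \<open>auto intro!: continuous_intros\<close>)
  then show ?thesis unfolding osc_def by simp
qed

lemma continuous_on_supn: "continuous_on S w \<Longrightarrow> continuous_on S (\<lambda>t. supn (w t))"
proof -
  assume w: "continuous_on S w"
  have "continuous_on S (\<lambda>t. MAX z\<in>I. \<bar>w t $ z\<bar>)" if "finite I" "I \<noteq> {}" for I :: "'b set"
    using that
  proof (induction rule: finite_ne_induct)
    case (insert z I)
    then have "(MAX z\<in>insert z I. \<bar>w t $ z\<bar>) = max \<bar>w t $ z\<bar> (MAX z\<in>I. \<bar>w t $ z\<bar>)" for t by simp
    then show ?case using insert w by (auto intro!: continuous_intros)
  qed (use w in \<open>auto intro!: continuous_intros\<close>)
  then show ?thesis unfolding supn_def by simp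
qed

lemma Delta_nth [simp]: "Delta x p $ y = p $ y - p $ x"
  by (simp add: Delta_def)

lemma Delta_diff: "Delta x (p - q) = Delta x p - Delta x q"
  by (simp add: vec_eq_iff)

lemma Delta_in_cube: "Delta x w \<in> cube (osc w)"
  using abs_diff_le_osc[of w] by (auto simp: cube_def)

lemma osc_le_norm_Delta: "(osc w)\<^sup>2 \<le> 2 * (norm (Delta y w))\<^sup>2"
proof -
  obtain x z where xz: "osc w = w $ x - w $ z" using osc_attained by blast
  let ?v = "Delta y w"
  show ?thesis
  proof (cases "x = z")
    case True then show ?thesis using xz by simp
  next
    case False
    have "(osc w)\<^sup>2 = (?v $ x - ?v $ z)\<^sup>2" using xz by simp
    also have "\<dots> \<le> 2 * ((?v $ x)\<^sup>2 + (?v $ z)\<^sup>2)"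
      using sum_squares_ge_zero[of "?v $ x + ?v $ z" 0] by (simp add: power2_eq_square algebra_simps)
    also have "(?v $ x)\<^sup>2 + (?v $ z)\<^sup>2 = (\<Sum>i\<in>{x, z}. (?v $ i)\<^sup>2)" using False by simp
    also have "\<dots> \<le> (\<Sum>i\<in>UNIV. (?v $ i)\<^sup>2)" by (rule sum_mono2) auto
    also have "\<dots> = (norm ?v)\<^sup>2"
      unfolding power2_norm_eq_inner by (simp add: inner_vec_def power2_eq_square)
    finally show ?thesis by simp
  qed
qed

section \<open>Transition rates: contraction forwards and backwards in time\<close>

lemma rate_vectorsD:
  assumes "a \<in> rate_vectors al au x"
  shows "y \<noteq> x \<Longrightarrow> al \<le> a $ y" "y \<noteq> x \<Longrightarrow> a $ y \<le> au" "(\<Sum>y\<in>UNIV. a $ y) = 0"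
  using assms by (auto simp: rate_vectors_def sum.remove[of UNIV x])

lemma inner_Delta:
  assumes "a \<in> rate_vectors al au x"
  shows "a \<bullet> w = a \<bullet> Delta x w"
  using rate_vectorsD(3)[OF assms]
  by (simp add: inner_vec_def right_diff_distrib sum_subtractf flip: sum_distrib_right)

text \<open>All terms of the sum have the same sign, so a single one of them, for a transition of rate at
  least \<open>al\<close>, is a bound.\<close>

lemma rate_at_maximum:
  assumes a: "a \<in> rate_vectors al au x" and al: "0 \<le> al" and max: "\<And>y. w $ y \<le> w $ x"
  shows "a \<bullet> Delta x w \<le> - al * (w $ x - w $ y)"
proof -
  have nonpos: "a $ z * (w $ z - w $ x) \<le> 0" for z
    using rate_vectorsD(1)[OF a, of z] al max[of z] by (cases "z = x") (auto intro: mult_nonneg_nonpos)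
  have "a \<bullet> Delta x w = a $ y * (w $ y - w $ x) + (\<Sum>z\<in>UNIV - {y}. a $ z * (w $ z - w $ x))"
    by (simp add: inner_vec_def sum.remove[of UNIV y])
  also have "\<dots> \<le> a $ y * (w $ y - w $ x)" using sum_nonpos[of "UNIV - {y}", OF nonpos] by simp
  also have "\<dots> \<le> al * (w $ y - w $ x)"
    using rate_vectorsD(1)[OF a, of y] max[of y] by (cases "y = x") (auto intro: mult_right_mono_neg)
  finally show ?thesis by (simp add: algebra_simps)
qed

lemma rate_at_minimum:
  assumes a: "a \<in> rate_vectors al au x" and al: "0 \<le> al" and min: "\<And>y. w $ x \<le> w $ y"
  shows "al * (w $ y - w $ x) \<le> a \<bullet> Delta x w"
  using rate_at_maximum[OF a al, of "- w" y] min by (simp add: inner_vec_def algebra_simps sum_negf sum_subtractf)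

text \<open>Backwards in time, \<open>w' = r w - a \<cdot> Delta w - k\<close> is a discounted averaging. At a maximal or minimal
  component the averaging term has a favourable sign, which gives the rate \<open>r\<close> for the maximum norm;
  for the oscillation the direct transition between the extremal states, of rate at least \<open>al\<close>, adds
  \<open>2 * al\<close> even as \<open>r\<close> tends to \<open>0\<close>.\<close>

locale backward_point =
  fixes w :: "real \<Rightarrow> real^'n::finite" and r t al au \<kappa> :: real and a :: "'n \<Rightarrow> real^'n" and k :: "'n \<Rightarrow> real"
  assumes deriv: "\<And>x. ((\<lambda>s. w s $ x) has_real_derivative (r * w t $ x - a x \<bullet> Delta x (w t) - k x))
      (at t within {..t})"
    and rate: "\<And>x. a x \<in> rate_vectors al au x" and al: "0 \<le> al" and k: "\<And>x. \<bar>k x\<bar> \<le> \<kappa>"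
begin

lemma tendsto: "((\<lambda>s. w s $ x) \<longlongrightarrow> w t $ x) (at t within {..t})"
  using DERIV_continuous[OF deriv] by (simp add: continuous_within)

lemma supn_dini: "dini_le (\<lambda>s. supn (w s)) t {..t} (- r * supn (w t) + \<kappa>)"
  unfolding supn_def[of "w _", abs_def]
proof (subst supn_def[symmetric], rule dini_le_Max)
  fix x :: 'n
  assume "\<forall>y\<in>UNIV. \<bar>w t $ y\<bar> \<le> \<bar>w t $ x\<bar>"
  then have mx: "\<bar>w t $ y\<bar> \<le> \<bar>w t $ x\<bar>" for y by simp
  then have s: "supn (w t) = \<bar>w t $ x\<bar>"
    using abs_le_supn[of "w t" x] supn_le[of "w t", OF mx] by linarith
  show "dini_le (\<lambda>s. \<bar>w s $ x\<bar>) t {..t} (- r * supn (w t) + \<kappa>)"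
  proof (rule dini_le_abs[OF tendsto])
    assume pos: "0 \<le> w t $ x"
    have "w t $ y \<le> w t $ x" for y using mx[of y] pos by linarith
    from rate_at_maximum[OF rate al this, of x]
    have "- (r * w t $ x - a x \<bullet> Delta x (w t) - k x) \<le> - r * supn (w t) + \<kappa>"
      using k[of x] s pos by simp
    then show "dini_le (\<lambda>s. w s $ x) t {..t} (- r * supn (w t) + \<kappa>)"
      by (rule dini_le_mono[OF dini_le_left_deriv[OF deriv]])
  next
    assume neg: "w t $ x \<le> 0"
    have "w t $ x \<le> w t $ y" for y using mx[of y] neg by linarith
    from rate_at_minimum[OF rate al this, of x]
    have "- (- (r * w t $ x - a x \<bullet> Delta x (w t) - k x)) \<le> - r * supn (w t) + \<kappa>"
      using k[of x] s neg by simp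
    then show "dini_le (\<lambda>s. - w s $ x) t {..t} (- r * supn (w t) + \<kappa>)"
      by (rule dini_le_mono[OF dini_le_left_deriv[OF DERIV_minus[OF deriv]]])
  qed
qed (auto intro!: tendsto_rabs tendsto)

lemma osc_dini: "dini_le (\<lambda>s. osc (w s)) t {..t} (- (r + 2 * al) * osc (w t) + 2 * \<kappa>)"
  unfolding osc_def[of "w _", abs_def]
proof (subst osc_def[symmetric], rule dini_le_Max)
  fix z :: "'n \<times> 'n"
  let ?x = "fst z" and ?y = "snd z"
  assume "\<forall>z'\<in>UNIV. w t $ fst z' - w t $ snd z' \<le> w t $ ?x - w t $ ?y"
  then have mx: "w t $ x' - w t $ y' \<le> w t $ ?x - w t $ ?y" for x' y' by (metis UNIV_I fst_conv snd_conv)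
  have max: "w t $ x' \<le> w t $ ?x" for x' using mx[of x' ?y] by simp
  have min: "w t $ ?y \<le> w t $ y'" for y' using mx[of ?x y'] by simp
  obtain x' y' where "osc (w t) = w t $ x' - w t $ y'" using osc_attained by blast
  then have o: "osc (w t) = w t $ ?x - w t $ ?y"
    using mx[of x' y'] diff_le_osc[of "w t" ?x ?y] by linarith
  let ?D = "\<lambda>x. r * w t $ x - a x \<bullet> Delta x (w t) - k x"
  have D: "((\<lambda>s. w s $ ?x - w s $ ?y) has_real_derivative (?D ?x - ?D ?y)) (at t within {..t})"
    by (intro DERIV_diff deriv)
  have "- (?D ?x - ?D ?y) \<le> - (r + 2 * al) * osc (w t) + 2 * \<kappa>"
    unfolding o using rate_at_maximum[OF rate al max, of ?y] rate_at_minimum[OF rate al min, of ?x]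
      k[of ?x] k[of ?y] by (simp add: algebra_simps)
  then show "dini_le (\<lambda>s. w s $ ?x - w s $ ?y) t {..t} (- (r + 2 * al) * osc (w t) + 2 * \<kappa>)"
    by (rule dini_le_mono[OF dini_le_left_deriv[OF D]])
qed (auto intro!: tendsto_diff tendsto)

end

text \<open>Subtracting the constant \<open>al\<close> from all entries of the rate matrix does not change how a signed
  measure of total mass zero evolves. What remains has nonnegative off-diagonal entries and row sums
  \<open>- CARD('n) * al\<close>: a Markov generator, which does not increase \<open>l1\<close>, with killing at this rate.\<close>

lemma forward_l1_dini:
  fixes m :: "real \<Rightarrow> real^'n::finite" and A :: "'n \<Rightarrow> real^'n"
  assumes deriv: "\<And>x. ((\<lambda>s. m s $ x) has_real_derivative ((\<Sum>y\<in>UNIV. m t $ y * A y $ x) + b x))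
      (at t within {t..})"
    and rate: "\<And>y. A y \<in> rate_vectors al au y" and m0: "(\<Sum>x\<in>UNIV. m t $ x) = 0"
  shows "dini_le (\<lambda>s. l1 (m s)) t {t..} (- (real CARD('n) * al) * l1 (m t) + (\<Sum>x\<in>UNIV. \<bar>b x\<bar>))"
proof -
  define D where "D x = (\<Sum>y\<in>UNIV. m t $ y * A y $ x) + b x" for x
  \<comment> \<open>The sign of \<open>m t $ x\<close>, and where that vanishes the sign of its derivative, so that \<open>\<sigma> x * D x\<close>
    is the right derivative of \<open>\<bar>m t $ x\<bar>\<close>.\<close>
  define \<sigma> :: "'n \<Rightarrow> real" where
    "\<sigma> x = (if m t $ x > 0 then 1 else if m t $ x < 0 then - 1 else if D x \<ge> 0 then 1 else - 1)" for x
  have \<sigma>: "\<sigma> x = 1 \<or> \<sigma> x = - 1" "\<sigma> x * m t $ x = \<bar>m t $ x\<bar>" for x by (auto simp: \<sigma>_def)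
  have "dini_le (\<lambda>s. \<bar>m s $ x\<bar>) t {t..} (\<sigma> x * D x)" for x
  proof (rule dini_le_abs)
    have d: "((\<lambda>s. m s $ x) has_real_derivative D x) (at t within {t..})"
      using deriv by (simp add: D_def)
    show "((\<lambda>s. m s $ x) \<longlongrightarrow> m t $ x) (at t within {t..})"
      using DERIV_continuous[OF d] by (simp add: continuous_within)
    show "dini_le (\<lambda>s. m s $ x) t {t..} (\<sigma> x * D x)" if "0 \<le> m t $ x"
      by (rule dini_le_mono[OF dini_le_right_deriv[OF d]]) (use that in \<open>auto simp: \<sigma>_def\<close>)
    show "dini_le (\<lambda>s. - m s $ x) t {t..} (\<sigma> x * D x)" if "m t $ x \<le> 0"
      by (rule dini_le_mono[OF dini_le_right_deriv[OF DERIV_minus[OF d]]]) (use that in \<open>auto simp: \<sigma>_def\<close>)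
  qed
  then have dini: "dini_le (\<lambda>s. l1 (m s)) t {t..} (\<Sum>x\<in>UNIV. \<sigma> x * D x)"
    unfolding l1_def by (intro dini_le_sum) auto
  have y: "m t $ y * (\<Sum>x\<in>UNIV. \<sigma> x * (A y $ x - al)) \<le> - (real CARD('n) * al) * \<bar>m t $ y\<bar>" for y
  proof -
    have "m t $ y * (\<Sum>x\<in>UNIV. \<sigma> x * (A y $ x - al)) =
        \<bar>m t $ y\<bar> * (A y $ y - al) + (\<Sum>x\<in>UNIV - {y}. m t $ y * (\<sigma> x * (A y $ x - al)))"
      by (simp add: sum.remove[of UNIV y] sum_distrib_left distrib_left \<sigma>(2)[symmetric] mult_ac)
    also have "(\<Sum>x\<in>UNIV - {y}. m t $ y * (\<sigma> x * (A y $ x - al))) \<le> (\<Sum>x\<in>UNIV - {y}. \<bar>m t $ y\<bar> * (A y $ x - al))"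
    proof (rule sum_mono)
      fix x assume "x \<in> UNIV - {y}"
      then have "0 \<le> A y $ x - al" using rate_vectorsD(1)[OF rate, of x y] by simp
      moreover have "m t $ y * \<sigma> x \<le> \<bar>m t $ y\<bar>" using \<sigma>(1)[of x] by auto
      ultimately have "m t $ y * \<sigma> x * (A y $ x - al) \<le> \<bar>m t $ y\<bar> * (A y $ x - al)"
        by (intro mult_right_mono)
      then show "m t $ y * (\<sigma> x * (A y $ x - al)) \<le> \<bar>m t $ y\<bar> * (A y $ x - al)" by (simp add: mult_ac)
    qed
    also have "\<bar>m t $ y\<bar> * (A y $ y - al) + (\<Sum>x\<in>UNIV - {y}. \<bar>m t $ y\<bar> * (A y $ x - al)) =
        \<bar>m t $ y\<bar> * (\<Sum>x\<in>UNIV. A y $ x - al)"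
      by (simp add: sum.remove[of UNIV y] sum_distrib_left distrib_left)
    also have "(\<Sum>x\<in>UNIV. A y $ x - al) = - (real CARD('n) * al)"
      using rate_vectorsD(3)[OF rate, of y] by (simp add: sum_subtractf)
    finally show ?thesis by (simp add: mult_ac)
  qed
  have "(\<Sum>x\<in>UNIV. \<sigma> x * D x) = (\<Sum>x\<in>UNIV. \<Sum>y\<in>UNIV. \<sigma> x * (m t $ y * A y $ x)) + (\<Sum>x\<in>UNIV. \<sigma> x * b x)"
    by (simp add: D_def distrib_left sum.distrib sum_distrib_left)
  also have "(\<Sum>x\<in>UNIV. \<Sum>y\<in>UNIV. \<sigma> x * (m t $ y * A y $ x)) = (\<Sum>y\<in>UNIV. \<Sum>x\<in>UNIV. \<sigma> x * (m t $ y * A y $ x))"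
    by (rule sum.swap)
  also have "\<dots> = (\<Sum>y\<in>UNIV. m t $ y * (\<Sum>x\<in>UNIV. \<sigma> x * (A y $ x - al)) + (\<Sum>x\<in>UNIV. \<sigma> x) * al * m t $ y)"
    by (simp add: sum_distrib_left sum_distrib_right sum_subtractf right_diff_distrib mult_ac)
  also have "\<dots> = (\<Sum>y\<in>UNIV. m t $ y * (\<Sum>x\<in>UNIV. \<sigma> x * (A y $ x - al))) + (\<Sum>x\<in>UNIV. \<sigma> x) * al * (\<Sum>y\<in>UNIV. m t $ y)"
    by (simp only: sum.distrib sum_distrib_left)
  also have "\<dots> \<le> (\<Sum>y\<in>UNIV. - (real CARD('n) * al) * \<bar>m t $ y\<bar>)"
    unfolding m0 mult_zero_right add_0_right by (rule sum_mono, rule y)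
  also have "\<dots> = - (real CARD('n) * al) * l1 (m t)" by (simp add: l1_def sum_distrib_left)
  also have "(\<Sum>x\<in>UNIV. \<sigma> x * b x) \<le> (\<Sum>x\<in>UNIV. \<bar>b x\<bar>)"
  proof (rule sum_mono)
    fix x show "\<sigma> x * b x \<le> \<bar>b x\<bar>" using \<sigma>(1)[of x] by auto
  qed
  finally have "(\<Sum>x\<in>UNIV. \<sigma> x * D x) \<le> - (real CARD('n) * al) * l1 (m t) + (\<Sum>x\<in>UNIV. \<bar>b x\<bar>)" by simp
  with dini show ?thesis by (rule dini_le_mono)
qed

section \<open>The mean field game system: a priori estimates\<close>

text \<open>The assumptions on the Hamiltonian in the form used by the estimates. The gradient \<open>G x p\<close> is
  at the same time the vector of optimal rates, and this is what ties the backward to the forward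
  equation.\<close>

locale mfg =
  fixes H :: "'n::finite \<Rightarrow> real^'n \<Rightarrow> real" and G :: "'n \<Rightarrow> real^'n \<Rightarrow> real^'n"
    and F :: "'n \<Rightarrow> real^'n \<Rightarrow> real" and al au LF :: real
  assumes card: "CARD('n) \<ge> 2" and al: "0 < al" and au: "al < au"
    and G_rate: "G x p \<in> rate_vectors al au x"
    and H_deriv: "(H x has_derivative (\<lambda>\<xi>. G x p \<bullet> \<xi>)) (at p)"
    and H_strong: "\<exists>c>0. \<forall>x. \<forall>p\<in>cube K. \<forall>q\<in>cube K. p $ x = q $ x \<longrightarrow>
      H x q \<le> H x p + G x p \<bullet> (q - p) - c * (norm (q - p))\<^sup>2"
    and G_lip: "\<exists>L\<ge>0. \<forall>x. \<forall>p\<in>cube K. \<forall>q\<in>cube K. norm (G x p - G x q) \<le> L * norm (p - q)"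
    and LF: "0 \<le> LF"
    and F_lip: "\<eta> \<in> prob_simplex \<Longrightarrow> \<eta>' \<in> prob_simplex \<Longrightarrow> \<bar>F x \<eta> - F x \<eta>'\<bar> \<le> LF * l1 (\<eta> - \<eta>')"
    and F_mono: "\<eta> \<in> prob_simplex \<Longrightarrow> \<eta>' \<in> prob_simplex \<Longrightarrow>
      (\<Sum>x\<in>UNIV. (F x \<eta> - F x \<eta>') * (\<eta> $ x - \<eta>' $ x)) \<ge> 0"
begin

definition hjb :: "real \<Rightarrow> (real \<Rightarrow> real^'n) \<Rightarrow> (real \<Rightarrow> real^'n) \<Rightarrow> bool" where
  "hjb r u \<mu> \<longleftrightarrow> (\<forall>t\<ge>0. \<forall>x. ((\<lambda>s. u s $ x) has_real_derivative
     (r * u t $ x - H x (Delta x (u t)) - F x (\<mu> t))) (at t within {0..}))"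

definition kolmogorov :: "(real \<Rightarrow> real^'n) \<Rightarrow> (real \<Rightarrow> real^'n) \<Rightarrow> bool" where
  "kolmogorov u \<mu> \<longleftrightarrow> (\<forall>t\<ge>0. \<forall>x. ((\<lambda>s. \<mu> s $ x) has_real_derivative
     (\<Sum>y\<in>UNIV. \<mu> t $ y * G y (Delta y (u t)) $ x)) (at t within {0..}))"

definition simplex_flow :: "(real \<Rightarrow> real^'n) \<Rightarrow> bool" where
  "simplex_flow \<mu> \<longleftrightarrow> (\<forall>t\<ge>0. \<mu> t \<in> prob_simplex)"

definition sol :: "real \<Rightarrow> (real \<Rightarrow> real^'n) \<Rightarrow> (real \<Rightarrow> real^'n) \<Rightarrow> bool" where
  "sol r u \<mu> \<longleftrightarrow> simplex_flow \<mu> \<and> hjb r u \<mu> \<and> kolmogorov u \<mu>"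

lemma deriv_left:
  "(g has_real_derivative D) (at t within {0..}) \<Longrightarrow> 0 < t \<Longrightarrow>
    (g has_real_derivative D) (at t within {..(t::real)})"
proof -
  assume g: "(g has_real_derivative D) (at t within {0..})" and t: "0 < t"
  have "(g has_real_derivative D) (at t within {0..t})" using g by (rule DERIV_subset) auto
  moreover have "at t within {0..t} = at t within {..t}"
    by (rule at_within_nhd[of _ "{0<..}"]) (use t in auto)
  ultimately show ?thesis by simp
qed

lemma deriv_right:
  "(g has_real_derivative D) (at t within {0..}) \<Longrightarrow> 0 \<le> t \<Longrightarrow>
    (g has_real_derivative D) (at t within {(t::real)..})"
  by (erule DERIV_subset) auto

lemma continuous_from_components:
  "(\<And>t x. 0 \<le> t \<Longrightarrow> ((\<lambda>s. u s $ x) has_real_derivative u' t x) (at t within {0..})) \<Longrightarrow>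
    continuous_on {0::real..} (u :: real \<Rightarrow> real^'n)"
proof -
  assume *: "\<And>t x. 0 \<le> t \<Longrightarrow> ((\<lambda>s. u s $ x) has_real_derivative u' t x) (at t within {0..})"
  have "continuous_on {0..} (\<lambda>t. u t $ x)" for x
    unfolding continuous_on_eq_continuous_within
  proof
    fix t :: real assume "t \<in> {0..}"
    then show "continuous (at t within {0..}) (\<lambda>t. u t $ x)" using DERIV_continuous[OF *[of t x]] by simp
  qed
  then have "continuous_on {0..} (\<lambda>t. \<chi> x. u t $ x)" by (intro continuous_on_vec_lambda)
  then show "continuous_on {0..} u" by simp
qed

lemma hjb_continuous: "hjb r u \<mu> \<Longrightarrow> continuous_on {0..} u"
  unfolding hjb_def by (rule continuous_from_components) blast

lemma kolmogorov_continuous: "kolmogorov u \<mu> \<Longrightarrow> continuous_on {0..} \<mu>"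
  unfolding kolmogorov_def by (rule continuous_from_components) blast

lemma H_mean_value: "\<exists>a\<in>rate_vectors al au x. H x q - H x p = a \<bullet> (q - p)"
proof -
  have "\<exists>t\<in>{0<..<1}. H x (p + 1 *\<^sub>R (q - p)) - H x (p + 0 *\<^sub>R (q - p)) =
      G x (p + t *\<^sub>R (q - p)) \<bullet> ((1 - 0) *\<^sub>R (q - p))"
  proof (rule mvt_simple[of 0 1 "\<lambda>t. H x (p + t *\<^sub>R (q - p))" "\<lambda>t s. G x (p + t *\<^sub>R (q - p)) \<bullet> (s *\<^sub>R (q - p))"])
    fix t :: real
    have "((\<lambda>t. p + t *\<^sub>R (q - p)) has_derivative (\<lambda>s. s *\<^sub>R (q - p))) (at t within {0..1})"
      by (auto intro!: derivative_eq_intros)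
    from has_derivative_compose[OF this H_deriv]
    show "((\<lambda>t. H x (p + t *\<^sub>R (q - p))) has_derivative (\<lambda>s. G x (p + t *\<^sub>R (q - p)) \<bullet> (s *\<^sub>R (q - p)))) (at t within {0..1})" .
  qed simp
  then show ?thesis using G_rate by auto
qed

text \<open>The difference of two solutions of the Hamilton-Jacobi-Bellman equation along different flows
  solves a linear equation, because \<open>H\<close> is differentiable with rate vectors as gradients.\<close>

lemma hjb_diff_point:
  assumes u: "hjb r u \<mu>" "hjb r u' \<mu>'" and \<mu>: "simplex_flow \<mu>" "simplex_flow \<mu>'" and t: "0 < t"
  shows "dini_le (\<lambda>s. supn (u s - u' s)) t {..t} (- r * supn (u t - u' t) + LF * l1 (\<mu> t - \<mu>' t))"
    and "dini_le (\<lambda>s. osc (u s - u' s)) t {..t} (- (r + 2 * al) * osc (u t - u' t) + 2 * (LF * l1 (\<mu> t - \<mu>' t)))"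
proof -
  have "\<forall>x. \<exists>a. a \<in> rate_vectors al au x \<and>
      H x (Delta x (u t)) - H x (Delta x (u' t)) = a \<bullet> (Delta x (u t) - Delta x (u' t))"
    using H_mean_value by blast
  then obtain a where a: "\<And>x. a x \<in> rate_vectors al au x"
    "\<And>x. H x (Delta x (u t)) - H x (Delta x (u' t)) = a x \<bullet> (Delta x (u t) - Delta x (u' t))"
    by metis
  interpret backward_point "\<lambda>s. u s - u' s" r t al au "LF * l1 (\<mu> t - \<mu>' t)" a
    "\<lambda>x. F x (\<mu> t) - F x (\<mu>' t)"
  proof
    fix x
    have "((\<lambda>s. u s $ x - u' s $ x) has_real_derivative
       (r * u t $ x - H x (Delta x (u t)) - F x (\<mu> t)) - (r * u' t $ x - H x (Delta x (u' t)) - F x (\<mu>' t)))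
       (at t within {..t})"
      using u t unfolding hjb_def by (intro DERIV_diff deriv_left) auto
    moreover have "(r * u t $ x - H x (Delta x (u t)) - F x (\<mu> t)) - (r * u' t $ x - H x (Delta x (u' t)) - F x (\<mu>' t)) =
      r * (u t - u' t) $ x - a x \<bullet> Delta x (u t - u' t) - (F x (\<mu> t) - F x (\<mu>' t))"
      using a(2)[of x] by (simp add: Delta_diff algebra_simps)
    ultimately show "((\<lambda>s. (u s - u' s) $ x) has_real_derivative
      r * (u t - u' t) $ x - a x \<bullet> Delta x (u t - u' t) - (F x (\<mu> t) - F x (\<mu>' t))) (at t within {..t})"
      by simp
    show "\<bar>F x (\<mu> t) - F x (\<mu>' t)\<bar> \<le> LF * l1 (\<mu> t - \<mu>' t)"
      using \<mu> t by (intro F_lip) (auto simp: simplex_flow_def)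
  qed (use a al in auto)
  show "dini_le (\<lambda>s. supn (u s - u' s)) t {..t} (- r * supn (u t - u' t) + LF * l1 (\<mu> t - \<mu>' t))"
    by (rule supn_dini)
  show "dini_le (\<lambda>s. osc (u s - u' s)) t {..t} (- (r + 2 * al) * osc (u t - u' t) + 2 * (LF * l1 (\<mu> t - \<mu>' t)))"
    by (rule osc_dini)
qed

lemma F_bound: "\<exists>B\<ge>0. \<forall>x. \<forall>\<eta>\<in>prob_simplex. \<bar>H x 0 + F x \<eta>\<bar> \<le> B"
proof -
  let ?e = "axis undefined 1 :: real^'n"
  define B where "B = (\<Sum>x\<in>UNIV. \<bar>H x 0\<bar> + \<bar>F x ?e\<bar>) + LF * (real CARD('n) * 2)"
  have "\<bar>H x 0 + F x \<eta>\<bar> \<le> B" if \<eta>: "\<eta> \<in> prob_simplex" for x \<eta>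
  proof -
    have "l1 (\<eta> - ?e) \<le> (\<Sum>y\<in>(UNIV::'n set). 2)"
      unfolding l1_def
    proof (rule sum_mono)
      fix y show "\<bar>(\<eta> - ?e) $ y\<bar> \<le> 2"
        using prob_simplexD(1,2)[OF \<eta>, of y] by (auto simp: axis_def)
    qed
    then have "LF * l1 (\<eta> - ?e) \<le> LF * (real CARD('n) * 2)" using LF by (intro mult_left_mono) auto
    moreover have "\<bar>F x \<eta> - F x ?e\<bar> \<le> LF * l1 (\<eta> - ?e)" by (rule F_lip[OF \<eta> axis_in_simplex])
    moreover have "\<bar>H x 0\<bar> + \<bar>F x ?e\<bar> \<le> (\<Sum>x\<in>UNIV. \<bar>H x 0\<bar> + \<bar>F x ?e\<bar>)"
      by (rule member_le_sum[of x UNIV "\<lambda>x. \<bar>H x 0\<bar> + \<bar>F x ?e\<bar>"]) auto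
    ultimately show ?thesis unfolding B_def by linarith
  qed
  moreover have "B \<ge> 0" unfolding B_def using LF by (intro add_nonneg_nonneg sum_nonneg) auto
  ultimately show ?thesis by blast
qed

definition K0 :: real where
  "K0 = (SOME B. B \<ge> 0 \<and> (\<forall>x. \<forall>\<eta>\<in>prob_simplex. \<bar>H x 0 + F x \<eta>\<bar> \<le> B))"

lemma K0: "K0 \<ge> 0" "\<eta> \<in> prob_simplex \<Longrightarrow> \<bar>H x 0 + F x \<eta>\<bar> \<le> K0"
  using someI_ex[OF F_bound[simplified Bex_def]] unfolding K0_def by auto

lemma hjb_point:
  assumes u: "hjb r u \<mu>" and \<mu>: "simplex_flow \<mu>" and t: "0 < t"
  shows "dini_le (\<lambda>s. supn (u s)) t {..t} (- r * supn (u t) + K0)"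
    and "dini_le (\<lambda>s. osc (u s)) t {..t} (- (r + 2 * al) * osc (u t) + 2 * K0)"
proof -
  have "\<forall>x. \<exists>a. a \<in> rate_vectors al au x \<and> H x (Delta x (u t)) - H x 0 = a \<bullet> (Delta x (u t) - 0)"
    using H_mean_value by blast
  then obtain a where a: "\<And>x. a x \<in> rate_vectors al au x"
    "\<And>x. H x (Delta x (u t)) - H x 0 = a x \<bullet> (Delta x (u t) - 0)"
    by metis
  interpret backward_point u r t al au K0 a "\<lambda>x. H x 0 + F x (\<mu> t)"
  proof
    fix x
    have "((\<lambda>s. u s $ x) has_real_derivative (r * u t $ x - H x (Delta x (u t)) - F x (\<mu> t))) (at t within {..t})"
      using u t unfolding hjb_def by (intro deriv_left) auto
    then show "((\<lambda>s. u s $ x) has_real_derivative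
      r * u t $ x - a x \<bullet> Delta x (u t) - (H x 0 + F x (\<mu> t))) (at t within {..t})"
      using a(2)[of x] by (simp add: algebra_simps)
    show "\<bar>H x 0 + F x (\<mu> t)\<bar> \<le> K0"
      using \<mu> t by (intro K0) (auto simp: simplex_flow_def)
  qed (use a al in auto)
  show "dini_le (\<lambda>s. supn (u s)) t {..t} (- r * supn (u t) + K0)"
    by (rule supn_dini)
  show "dini_le (\<lambda>s. osc (u s)) t {..t} (- (r + 2 * al) * osc (u t) + 2 * K0)"
    by (rule osc_dini)
qed

lemma hjb_bound_finite:
  assumes r: "0 < r" and u: "hjb r u \<mu>" and \<mu>: "simplex_flow \<mu>" and t: "0 \<le> t" "t \<le> T"
  shows "supn (u t) \<le> K0 / r + supn (u T)"
proof -
  have "supn (u t) \<le> K0 / (r + 0) * exp (- 0 * t) + exp (- r * (T - t)) * max 0 (supn (u T))"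
    by (rule backward_comparison)
      (use r t K0 hjb_point(1)[OF u \<mu>] in \<open>auto intro!: continuous_on_supn continuous_on_subset[OF hjb_continuous[OF u]]\<close>)
  also have "exp (- r * (T - t)) * max 0 (supn (u T)) \<le> 1 * supn (u T)"
    using r t supn_ge_0[of "u T"] by (intro mult_mono) auto
  finally show ?thesis by simp
qed

text \<open>Direct transitions between the extremal states contract the oscillation at rate \<open>2 * al\<close>, so
  the bound, and all constants derived from it, are independent of the discount rate.\<close>

lemma hjb_osc_bound:
  assumes r: "0 < r" and u: "hjb r u \<mu>" and \<mu>: "simplex_flow \<mu>" and bd: "bounded (u ` {0..})" and t: "0 \<le> t"
  shows "osc (u t) \<le> K0 / al"
proof -
  obtain B where "\<forall>v\<in>u ` {0..}. norm v \<le> B" using bd unfolding bounded_iff by blast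
  then have B: "\<And>s. 0 \<le> s \<Longrightarrow> norm (u s) \<le> B" by auto
  have bdd: "osc (u s) \<le> 2 * B" if "0 \<le> s" for s
    using osc_le_supn[of "u s"] supn_le_norm[of "u s"] B[OF that] by linarith
  have "osc (u t) \<le> (2 * K0) / ((r + 2 * al) + 0) * exp (- 0 * t)"
  proof (rule backward_comparison_infinite[where R = "2 * B"])
    show "continuous_on {0..} (\<lambda>t. osc (u t))"
      using hjb_continuous[OF u] by (rule continuous_on_osc)
  qed (use r al K0 bdd t hjb_point(2)[OF u \<mu>] in auto)
  also have "\<dots> \<le> (2 * K0) / (2 * al)"
    using r al K0(1) divide_left_mono[of "2 * al" "r + 2 * al" "2 * K0"] by simp
  finally show ?thesis by simp
qed

text \<open>Lasry-Lions duality. In the derivative of the pairing the coupling contributes with a favourable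
  sign because it is monotone. The transport terms combine with the differences of the Hamiltonian
  into the gaps of two tangent inequalities, one at each solution and weighted with its density;
  strong concavity bounds each gap.\<close>

lemma duality:
  assumes u: "hjb r u \<mu>" "kolmogorov u \<mu>" "simplex_flow \<mu>"
    and u': "hjb r u' \<mu>'" "kolmogorov u' \<mu>'" "simplex_flow \<mu>'" and t: "0 \<le> t"
    and c: "\<forall>x. \<forall>p\<in>cube K. \<forall>q\<in>cube K. p $ x = q $ x \<longrightarrow>
      H x q \<le> H x p + G x p \<bullet> (q - p) - c * (norm (q - p))\<^sup>2" "0 \<le> c"
    and K: "\<And>x. Delta x (u t) \<in> cube K" "\<And>x. Delta x (u' t) \<in> cube K"
  defines "\<phi> \<equiv> \<lambda>s. (u s - u' s) \<bullet> (\<mu> s - \<mu>' s)"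
  shows "\<exists>D. (\<phi> has_real_derivative D) (at t within {0..}) \<and> D \<le> r * \<phi> t - c * (osc (u t - u' t))\<^sup>2"
proof -
  define w where "w = u t - u' t"
  define m where "m = \<mu> t - \<mu>' t"
  define Hu where "Hu x = H x (Delta x (u t))" for x
  define Hu' where "Hu' x = H x (Delta x (u' t))" for x
  define g where "g y = G y (Delta y (u t))" for y
  define g' where "g' y = G y (Delta y (u' t))" for y
  define dF where "dF x = F x (\<mu> t) - F x (\<mu>' t)" for x
  define D where "D = (\<Sum>x\<in>UNIV. w $ x * ((\<Sum>y\<in>UNIV. \<mu> t $ y * g y $ x) - (\<Sum>y\<in>UNIV. \<mu>' t $ y * g' y $ x)) +
      (r * w $ x - (Hu x - Hu' x) - dF x) * m $ x)"
  have "(\<phi> has_real_derivative D) (at t within {0..})"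
    unfolding \<phi>_def inner_vec_def D_def inner_real_def
  proof (intro DERIV_sum)
    fix x
    have "((\<lambda>s. u s $ x - u' s $ x) has_real_derivative
        (r * u t $ x - Hu x - F x (\<mu> t)) - (r * u' t $ x - Hu' x - F x (\<mu>' t))) (at t within {0..})"
      using u(1) u'(1) t unfolding hjb_def Hu_def Hu'_def by (intro DERIV_diff) auto
    then have 1: "((\<lambda>s. (u s - u' s) $ x) has_real_derivative (r * w $ x - (Hu x - Hu' x) - dF x)) (at t within {0..})"
      by (simp add: w_def dF_def algebra_simps)
    have 2: "((\<lambda>s. (\<mu> s - \<mu>' s) $ x) has_real_derivative
        ((\<Sum>y\<in>UNIV. \<mu> t $ y * g y $ x) - (\<Sum>y\<in>UNIV. \<mu>' t $ y * g' y $ x))) (at t within {0..})"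
      using u(2) u'(2) t unfolding kolmogorov_def g_def g'_def vector_minus_component by (intro DERIV_diff) auto
    show "((\<lambda>s. (u s - u' s) $ x * (\<mu> s - \<mu>' s) $ x) has_real_derivative
      w $ x * ((\<Sum>y\<in>UNIV. \<mu> t $ y * g y $ x) - (\<Sum>y\<in>UNIV. \<mu>' t $ y * g' y $ x)) +
      (r * w $ x - (Hu x - Hu' x) - dF x) * m $ x) (at t within {0..})"
      using DERIV_mult[OF 1 2] by (simp add: w_def m_def algebra_simps)
  qed
  moreover have "D \<le> r * \<phi> t - c * (osc w)\<^sup>2"
  proof -
    have swap: "(\<Sum>x\<in>UNIV. w $ x * (\<Sum>y\<in>UNIV. \<nu> $ y * h y $ x)) = (\<Sum>y\<in>UNIV. \<nu> $ y * (h y \<bullet> Delta y w))"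
      if "\<And>y. h y \<in> rate_vectors al au y" for \<nu> :: "real^'n" and h
    proof -
      have "(\<Sum>x\<in>UNIV. w $ x * (\<Sum>y\<in>UNIV. \<nu> $ y * h y $ x)) = (\<Sum>x\<in>UNIV. \<Sum>y\<in>UNIV. \<nu> $ y * (h y $ x * w $ x))"
        by (simp add: sum_distrib_left mult_ac)
      also have "\<dots> = (\<Sum>y\<in>UNIV. \<Sum>x\<in>UNIV. \<nu> $ y * (h y $ x * w $ x))" by (rule sum.swap)
      also have "\<dots> = (\<Sum>y\<in>UNIV. \<nu> $ y * (h y \<bullet> w))" by (simp add: inner_vec_def sum_distrib_left)
      finally show ?thesis using inner_Delta[OF that] by simp
    qed
    have "D = (\<Sum>x\<in>UNIV. w $ x * (\<Sum>y\<in>UNIV. \<mu> t $ y * g y $ x)) - (\<Sum>x\<in>UNIV. w $ x * (\<Sum>y\<in>UNIV. \<mu>' t $ y * g' y $ x)) +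
       (r * (\<Sum>x\<in>UNIV. w $ x * m $ x) - (\<Sum>x\<in>UNIV. (Hu x - Hu' x) * m $ x) - (\<Sum>x\<in>UNIV. dF x * m $ x))"
      unfolding D_def by (simp add: sum.distrib sum_subtractf algebra_simps sum_distrib_left)
    also have "(\<Sum>x\<in>UNIV. w $ x * m $ x) = \<phi> t" by (simp add: \<phi>_def w_def m_def inner_vec_def)
    also have "(\<Sum>x\<in>UNIV. w $ x * (\<Sum>y\<in>UNIV. \<mu> t $ y * g y $ x)) = (\<Sum>y\<in>UNIV. \<mu> t $ y * (g y \<bullet> Delta y w))"
      by (rule swap) (simp add: g_def G_rate)
    also have "(\<Sum>x\<in>UNIV. w $ x * (\<Sum>y\<in>UNIV. \<mu>' t $ y * g' y $ x)) = (\<Sum>y\<in>UNIV. \<mu>' t $ y * (g' y \<bullet> Delta y w))"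
      by (rule swap) (simp add: g'_def G_rate)
    finally have D: "D = r * \<phi> t - (\<Sum>x\<in>UNIV. dF x * m $ x) +
        (\<Sum>y\<in>UNIV. \<mu> t $ y * (g y \<bullet> Delta y w - (Hu y - Hu' y)) + \<mu>' t $ y * ((Hu y - Hu' y) - g' y \<bullet> Delta y w))"
      by (simp add: m_def sum.distrib sum_subtractf algebra_simps)
    have "(\<Sum>y\<in>UNIV. \<mu> t $ y * (g y \<bullet> Delta y w - (Hu y - Hu' y)) + \<mu>' t $ y * ((Hu y - Hu' y) - g' y \<bullet> Delta y w)) \<le>
        (\<Sum>y\<in>UNIV. - (c * (osc w)\<^sup>2 / 2) * (\<mu> t $ y + \<mu>' t $ y))"
    proof (rule sum_mono)
      fix y
      have eq: "Delta y (u t) - Delta y (u' t) = Delta y w" by (simp add: w_def Delta_diff)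
      have eq': "Delta y (u' t) - Delta y (u t) = - Delta y w" by (simp add: w_def Delta_diff)
      have o: "c * (osc w)\<^sup>2 / 2 \<le> c * (norm (Delta y w))\<^sup>2"
        using mult_left_mono[OF osc_le_norm_Delta[of w y] c(2)] by simp
      have 1: "g y \<bullet> Delta y w - (Hu y - Hu' y) \<le> - (c * (osc w)\<^sup>2 / 2)"
        using c(1)[THEN spec[of _ y], rule_format, OF K(1)[of y] K(2)[of y]] o unfolding eq' Hu_def Hu'_def g_def by simp
      have 2: "(Hu y - Hu' y) - g' y \<bullet> Delta y w \<le> - (c * (osc w)\<^sup>2 / 2)"
        using c(1)[THEN spec[of _ y], rule_format, OF K(2)[of y] K(1)[of y]] o unfolding eq Hu_def Hu'_def g'_def by simp
      have pos: "0 \<le> \<mu> t $ y" "0 \<le> \<mu>' t $ y"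
        using u(3) u'(3) t prob_simplexD(1) by (auto simp: simplex_flow_def)
      show "\<mu> t $ y * (g y \<bullet> Delta y w - (Hu y - Hu' y)) + \<mu>' t $ y * ((Hu y - Hu' y) - g' y \<bullet> Delta y w) \<le>
          - (c * (osc w)\<^sup>2 / 2) * (\<mu> t $ y + \<mu>' t $ y)"
        using mult_left_mono[OF 1 pos(1)] mult_left_mono[OF 2 pos(2)]
        by (simp add: algebra_simps add_divide_distrib)
    qed
    also have "\<dots> = - (c * (osc w)\<^sup>2 / 2) * ((\<Sum>y\<in>UNIV. \<mu> t $ y) + (\<Sum>y\<in>UNIV. \<mu>' t $ y))"
      by (simp only: sum_distrib_left sum.distrib[symmetric])
    also have "\<dots> = - c * (osc w)\<^sup>2"
      using u(3) u'(3) t by (simp add: simplex_flow_def prob_simplexD(3))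
    finally have "(\<Sum>y\<in>UNIV. \<mu> t $ y * (g y \<bullet> Delta y w - (Hu y - Hu' y)) + \<mu>' t $ y * ((Hu y - Hu' y) - g' y \<bullet> Delta y w))
        \<le> - c * (osc w)\<^sup>2" .
    moreover have "0 \<le> (\<Sum>x\<in>UNIV. dF x * m $ x)"
      using F_mono[of "\<mu> t" "\<mu>' t"] u(3) u'(3) t by (simp add: simplex_flow_def dF_def m_def)
    ultimately show ?thesis unfolding D by linarith
  qed
  ultimately show ?thesis unfolding w_def by blast
qed

text \<open>The difference of the densities moves with the rates of the first solution; the difference of
  the rates, acting on the second density, is a source.\<close>

lemma kolmogorov_diff_point:
  assumes u: "kolmogorov u \<mu>" "simplex_flow \<mu>" and u': "kolmogorov u' \<mu>'" "simplex_flow \<mu>'" and t: "0 \<le> t"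
    and L: "\<forall>x. \<forall>p\<in>cube K. \<forall>q\<in>cube K. norm (G x p - G x q) \<le> L * norm (p - q)" "0 \<le> L"
    and K: "\<And>x. Delta x (u t) \<in> cube K" "\<And>x. Delta x (u' t) \<in> cube K"
  shows "dini_le (\<lambda>s. l1 (\<mu> s - \<mu>' s)) t {t..} (- (real CARD('n) * al) * l1 (\<mu> t - \<mu>' t) +
    (real CARD('n))\<^sup>2 * L * osc (u t - u' t))"
proof -
  let ?g = "\<lambda>y. G y (Delta y (u t))" and ?g' = "\<lambda>y. G y (Delta y (u' t))"
  define b where "b x = (\<Sum>y\<in>UNIV. \<mu>' t $ y * (?g y - ?g' y) $ x)" for x
  have "dini_le (\<lambda>s. l1 (\<mu> s - \<mu>' s)) t {t..} (- (real CARD('n) * al) * l1 (\<mu> t - \<mu>' t) + (\<Sum>x\<in>UNIV. \<bar>b x\<bar>))"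
  proof (rule forward_l1_dini[where A = ?g])
    fix x
    have "((\<lambda>s. \<mu> s $ x - \<mu>' s $ x) has_real_derivative
        (\<Sum>y\<in>UNIV. \<mu> t $ y * ?g y $ x) - (\<Sum>y\<in>UNIV. \<mu>' t $ y * ?g' y $ x)) (at t within {t..})"
      using u(1) u'(1) t unfolding kolmogorov_def by (intro DERIV_diff deriv_right) auto
    moreover have "(\<Sum>y\<in>UNIV. \<mu> t $ y * ?g y $ x) - (\<Sum>y\<in>UNIV. \<mu>' t $ y * ?g' y $ x) =
        (\<Sum>y\<in>UNIV. (\<mu> t - \<mu>' t) $ y * ?g y $ x) + b x"
      by (simp add: b_def sum_subtractf[symmetric] sum.distrib[symmetric] algebra_simps)
    ultimately show "((\<lambda>s. (\<mu> s - \<mu>' s) $ x) has_real_derivative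
        (\<Sum>y\<in>UNIV. (\<mu> t - \<mu>' t) $ y * ?g y $ x) + b x) (at t within {t..})" by simp
    show "(\<Sum>x\<in>UNIV. (\<mu> t - \<mu>' t) $ x) = 0"
      using u(2) u'(2) t by (intro sum_diff_simplex) (auto simp: simplex_flow_def)
  qed (rule G_rate)
  moreover have "(\<Sum>x\<in>UNIV. \<bar>b x\<bar>) \<le> (real CARD('n))\<^sup>2 * L * osc (u t - u' t)"
  proof -
    let ?o = "osc (u t - u' t)"
    have y: "\<bar>(?g y - ?g' y) $ x\<bar> \<le> L * (real CARD('n) * ?o)" for x y
    proof -
      have "\<bar>(?g y - ?g' y) $ x\<bar> \<le> norm (?g y - ?g' y)" by (rule component_le_norm_cart)
      also have "\<dots> \<le> L * norm (Delta y (u t) - Delta y (u' t))" using L(1) K by blast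
      also have "norm (Delta y (u t) - Delta y (u' t)) \<le> (\<Sum>x\<in>(UNIV::'n set). ?o)"
        unfolding Delta_diff[symmetric]
        by (rule order_trans[OF norm_le_l1_cart], rule sum_mono) (use abs_diff_le_osc[of "u t - u' t"] in simp)
      finally show ?thesis using L(2) by (simp add: mult_left_mono)
    qed
    have "\<bar>b x\<bar> \<le> L * (real CARD('n) * ?o)" for x
    proof -
      have pos: "0 \<le> \<mu>' t $ y" for y using u'(2) t prob_simplexD(1) by (auto simp: simplex_flow_def)
      have "\<bar>b x\<bar> \<le> (\<Sum>y\<in>UNIV. \<bar>\<mu>' t $ y * (?g y - ?g' y) $ x\<bar>)" unfolding b_def by (rule sum_abs)
      also have "\<dots> \<le> (\<Sum>y\<in>UNIV. \<mu>' t $ y * (L * (real CARD('n) * ?o)))"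
        using pos y by (intro sum_mono) (auto simp: abs_mult intro!: mult_left_mono simp del: vector_minus_component)
      also have "\<dots> = (\<Sum>y\<in>UNIV. \<mu>' t $ y) * (L * (real CARD('n) * ?o))" by (simp only: sum_distrib_right)
      also have "\<dots> = L * (real CARD('n) * ?o)" using u'(2) t by (simp add: simplex_flow_def prob_simplexD(3))
      finally show ?thesis .
    qed
    then have "(\<Sum>x\<in>UNIV. \<bar>b x\<bar>) \<le> (\<Sum>x\<in>(UNIV::'n set). L * (real CARD('n) * ?o))" by (intro sum_mono)
    then show ?thesis by (simp add: power2_eq_square mult_ac)
  qed
  ultimately show ?thesis by (auto intro: dini_le_mono)
qed

end

section \<open>Exponential stability\<close>

text \<open>A vector of total mass zero does not see constants, so \<open>w\<close> may be shifted to vanish at some state.\<close>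

lemma pairing_le:
  fixes w m :: "real^'n::finite"
  assumes "(\<Sum>x\<in>UNIV. m $ x) = 0"
  shows "\<bar>w \<bullet> m\<bar> \<le> osc w * l1 m"
proof -
  fix z :: 'n
  have "w \<bullet> m = (\<Sum>x\<in>UNIV. (w $ x - w $ z) * m $ x) + w $ z * (\<Sum>x\<in>UNIV. m $ x)"
    by (simp add: inner_vec_def sum_distrib_left sum.distrib[symmetric] algebra_simps)
  also have "\<dots> = (\<Sum>x\<in>UNIV. (w $ x - w $ z) * m $ x)" using assms by simp
  also have "\<bar>\<dots>\<bar> \<le> (\<Sum>x\<in>UNIV. osc w * \<bar>m $ x\<bar>)"
    by (rule order_trans[OF sum_abs], rule sum_mono)
      (auto simp: abs_mult intro!: mult_right_mono abs_diff_le_osc)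
  finally show ?thesis by (simp add: l1_def sum_distrib_left)
qed

lemma osc_diff_le: "osc (v - w) \<le> osc v + osc w"
proof -
  obtain x y where "osc (v - w) = (v - w) $ x - (v - w) $ y" using osc_attained by blast
  then show ?thesis using diff_le_osc[of v x y] diff_le_osc[of w y x] by simp
qed

lemma cube_mono: "p \<in> cube K \<Longrightarrow> K \<le> K' \<Longrightarrow> p \<in> cube K'"
  unfolding cube_def by (auto intro: order_trans)

context mfg
begin

definition bounded_sol :: "real \<Rightarrow> (real \<Rightarrow> real^'n) \<Rightarrow> (real \<Rightarrow> real^'n) \<Rightarrow> bool" where
  "bounded_sol r u \<mu> \<longleftrightarrow> sol r u \<mu> \<and> bounded (u ` {0..})"

text \<open>Where it is negative, the pairing \<open>\<phi>\<close> would decrease exponentially because of \<open>\<phi>' \<le> r * \<phi>\<close>; but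
  it is bounded.\<close>

lemma duality_nonneg:
  assumes r: "0 < r" and u: "bounded_sol r u \<mu>" "bounded_sol r u' \<mu>'" and t: "0 \<le> t"
  shows "0 \<le> (u t - u' t) \<bullet> (\<mu> t - \<mu>' t)"
proof (rule ccontr)
  define \<phi> where "\<phi> s = (u s - u' s) \<bullet> (\<mu> s - \<mu>' s)" for s
  assume "\<not> 0 \<le> (u t - u' t) \<bullet> (\<mu> t - \<mu>' t)"
  then have neg: "\<phi> t < 0" by (simp add: \<phi>_def)
  have s: "hjb r u \<mu>" "kolmogorov u \<mu>" "simplex_flow \<mu>" "bounded (u ` {0..})"
    "hjb r u' \<mu>'" "kolmogorov u' \<mu>'" "simplex_flow \<mu>'" "bounded (u' ` {0..})"
    using u by (auto simp: bounded_sol_def sol_def)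
  let ?K = "K0 / al"
  obtain c where c: "c > 0" "\<forall>x. \<forall>p\<in>cube ?K. \<forall>q\<in>cube ?K. p $ x = q $ x \<longrightarrow>
      H x q \<le> H x p + G x p \<bullet> (q - p) - c * (norm (q - p))\<^sup>2" using H_strong by blast
  have K: "Delta x (u s) \<in> cube ?K" "Delta x (u' s) \<in> cube ?K" if "0 \<le> s" for x s
    using hjb_osc_bound[OF r s(1,3,4) that] hjb_osc_bound[OF r s(5,7,8) that] cube_mono[OF Delta_in_cube] by auto
  have D: "\<exists>D. (\<phi> has_real_derivative D) (at s within {0..}) \<and> D \<le> r * \<phi> s" if s0: "0 \<le> s" for s
  proof -
    obtain D where "(\<phi> has_real_derivative D) (at s within {0..})" "D \<le> r * \<phi> s - c * (osc (u s - u' s))\<^sup>2"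
      using duality[OF s(1-3) s(5-7) s0 c(2) less_imp_le[OF c(1)] K[OF s0]] unfolding \<phi>_def by blast
    moreover have "0 \<le> c * (osc (u s - u' s))\<^sup>2" using c by simp
    ultimately show ?thesis by (intro exI[of _ D]) auto
  qed
  have grow: "\<phi> T \<le> exp (r * (T - t)) * \<phi> t" if "t \<le> T" for T
  proof (rule dini_le_exp_bound[OF that])
    show "continuous_on {t..T} \<phi>"
      unfolding continuous_on_eq_continuous_within
    proof
      fix s assume "s \<in> {t..T}"
      then have "continuous (at s within {0..}) \<phi>" using D[of s] t DERIV_continuous by fastforce
      then show "continuous (at s within {t..T}) \<phi>" by (rule continuous_within_subset) (use t in auto)
    qed
    fix s assume "t \<le> s"
    then obtain D where "(\<phi> has_real_derivative D) (at s within {0..})" "D \<le> r * \<phi> s" using D[of s] t by auto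
    then show "dini_le \<phi> s {s..} (r * \<phi> s)"
      using deriv_right[of \<phi> D s] t \<open>t \<le> s\<close> dini_le_mono[OF dini_le_right_deriv] by auto
  qed
  define B where "B = 2 * ?K * 2"
  have B: "\<bar>\<phi> s\<bar> \<le> B" if "0 \<le> s" for s
  proof -
    have m: "\<mu> s \<in> prob_simplex" "\<mu>' s \<in> prob_simplex" using s that by (auto simp: simplex_flow_def)
    have "l1 (\<mu> s - \<mu>' s) \<le> l1 (\<mu> s) + l1 (\<mu>' s)"
      unfolding l1_def by (simp add: sum.distrib[symmetric]) (intro sum_mono abs_triangle_ineq4)
    then have 1: "l1 (\<mu> s - \<mu>' s) \<le> 2" using m by (simp add: l1_simplex)
    have 2: "osc (u s - u' s) \<le> 2 * ?K"
      using osc_diff_le[of "u s" "u' s"] hjb_osc_bound[OF r s(1,3,4) that] hjb_osc_bound[OF r s(5,7,8) that] by linarith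
    have "\<bar>\<phi> s\<bar> \<le> osc (u s - u' s) * l1 (\<mu> s - \<mu>' s)"
      unfolding \<phi>_def by (rule pairing_le) (rule sum_diff_simplex[OF m])
    also have "\<dots> \<le> B" unfolding B_def using 1 2 osc_ge_0[of "u s - u' s"]
      by (intro mult_mono) (auto intro: l1_ge_0 order_trans[OF osc_ge_0])
    finally show ?thesis .
  qed
  \<comment> \<open>By \<open>1 + x \<le> exp x\<close>, the value at this time is below \<open>- B\<close>.\<close>
  define T where "T = t + (B + 1) / (r * - \<phi> t)"
  have B0: "0 \<le> B" using B[OF t] abs_ge_zero order_trans by blast
  have rp: "0 < r * - \<phi> t" using r neg by (simp add: mult_pos_neg)
  then have T: "t \<le> T" using B0 divide_nonneg_pos[OF _ rp, of "B + 1"] unfolding T_def by simp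
  have "r * (T - t) * - \<phi> t = B + 1"
  proof -
    have "r * (T - t) * - \<phi> t = (T - t) * (r * - \<phi> t)" by simp
    also have "\<dots> = (B + 1) / (r * - \<phi> t) * (r * - \<phi> t)" by (simp add: T_def)
    also have "\<dots> = B + 1" using rp by (subst nonzero_eq_divide_eq[symmetric]) auto
    finally show ?thesis .
  qed
  moreover have "r * (T - t) * - \<phi> t \<le> exp (r * (T - t)) * - \<phi> t"
    using exp_ge_add_one_self[of "r * (T - t)"] neg by (intro mult_right_mono) linarith+
  ultimately have "\<phi> T \<le> - (B + 1)" using grow[OF T] by simp
  then show False using B[of T] T t by simp
qed

text \<open>The Lyapunov functional \<open>V = \<phi> + \<epsilon> * M\<^sup>2\<close>, with \<open>\<phi>\<close> the pairing and \<open>M\<close> the \<open>l\<^sub>1\<close> distance of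
  the densities, controls \<open>M\<close> because \<open>\<phi>\<close> is nonnegative. Duality dissipates the square of the
  oscillation \<open>Z\<close> of \<open>u - u'\<close>, the forward contraction dissipates \<open>M\<^sup>2\<close>, and \<open>\<phi> \<le> Z * M\<close> is absorbed
  by both if \<open>r\<close> is small. The initial value of \<open>V\<close> still involves \<open>u - u'\<close>; backward comparison bounds
  this by the supremum of \<open>M\<close>, hence by the square root of \<open>V\<close> itself, and the resulting quadratic
  inequality bounds \<open>V\<close> by the initial distance of the densities.\<close>

theorem exponential_stability:
  "\<exists>r0>0. \<exists>\<gamma>>0. \<exists>C>0. \<forall>r\<in>{0<..<r0}. \<forall>u \<mu> u' \<mu>'. bounded_sol r u \<mu> \<longrightarrow> bounded_sol r u' \<mu>' \<longrightarrow>
     (\<forall>t\<ge>0. l1 (\<mu> t - \<mu>' t) + supn (u t - u' t) \<le> C * exp (- \<gamma> * t) * l1 (\<mu> 0 - \<mu>' 0))"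
proof -
  let ?K = "K0 / al"
  define N where "N = real CARD('n)"
  have N: "N > 0" by (simp add: N_def)
  obtain c where c: "c > 0" "\<forall>x. \<forall>p\<in>cube ?K. \<forall>q\<in>cube ?K. p $ x = q $ x \<longrightarrow>
      H x q \<le> H x p + G x p \<bullet> (q - p) - c * (norm (q - p))\<^sup>2" using H_strong by blast
  obtain L where L: "L \<ge> 0" "\<forall>x. \<forall>p\<in>cube ?K. \<forall>q\<in>cube ?K. norm (G x p - G x q) \<le> L * norm (p - q)"
    using G_lip by blast
  define l where "l = N * al"
  define C1 where "C1 = N\<^sup>2 * L + 1"
  \<comment> \<open>\<open>\<epsilon>\<close> balances Young's inequality \<open>2 * \<epsilon> * C1 * Z * M \<le> \<epsilon> * l * M\<^sup>2 + c / 2 * Z\<^sup>2\<close>. Then at least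
    \<open>2 * k * (Z\<^sup>2 + M\<^sup>2)\<close> is dissipated, half of which absorbs \<open>r * \<phi>\<close> for \<open>r \<le> 2 * k\<close>, and
    \<open>V \<le> (1 + \<epsilon>) * (Z\<^sup>2 + M\<^sup>2)\<close> turns the other half into the decay rate \<open>2 * \<gamma>\<close> of \<open>V\<close>. \<open>P\<close> is the
    constant in the bound of \<open>Z\<close> by the supremum of \<open>M\<close>, and \<open>Y\<close> the one that results from the
    quadratic inequality.\<close>
  define \<epsilon> where "\<epsilon> = c * l / (2 * C1\<^sup>2)"
  define k where "k = min (c / 2) (\<epsilon> * l) / 2"
  define \<gamma> where "\<gamma> = k / (2 * (1 + \<epsilon>))"
  define P where "P = LF / al"
  define Y where "Y = P / \<epsilon> + 1"
  define C where "C = (1 + LF / \<gamma>) * Y"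
  have l: "l > 0" using N al by (simp add: l_def)
  have C1: "C1 > 0" using L by (simp add: C1_def add_nonneg_pos)
  have \<epsilon>: "\<epsilon> > 0" using c l C1 by (simp add: \<epsilon>_def)
  have k: "k > 0" "2 * k \<le> c / 2" "2 * k \<le> \<epsilon> * l" using c \<epsilon> l by (auto simp: k_def)
  have \<gamma>: "\<gamma> > 0" using k \<epsilon> by (simp add: \<gamma>_def)
  have \<gamma>k: "2 * \<gamma> * (1 + \<epsilon>) = k" using \<epsilon> by (simp add: \<gamma>_def field_simps)
  have P: "P \<ge> 0" using LF al by (simp add: P_def)
  have Y: "Y \<ge> 1" using P \<epsilon> by (simp add: Y_def)
  have C: "C > 0" using LF \<gamma> Y by (auto simp: C_def intro!: mult_pos_pos add_pos_nonneg)
  have main: "l1 (\<mu> t - \<mu>' t) + supn (u t - u' t) \<le> C * exp (- \<gamma> * t) * l1 (\<mu> 0 - \<mu>' 0)"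
    if r: "r \<in> {0<..<2*k}" and u: "bounded_sol r u \<mu>" "bounded_sol r u' \<mu>'" and t: "0 \<le> t" for r u \<mu> u' \<mu>' t
  proof -
    have r0: "r > 0" "r \<le> 2 * k" using r by auto
    have s: "hjb r u \<mu>" "kolmogorov u \<mu>" "simplex_flow \<mu>" "bounded (u ` {0..})"
      "hjb r u' \<mu>'" "kolmogorov u' \<mu>'" "simplex_flow \<mu>'" "bounded (u' ` {0..})"
      using u by (auto simp: bounded_sol_def sol_def)
    have K: "Delta x (u s) \<in> cube ?K" "Delta x (u' s) \<in> cube ?K" if "0 \<le> s" for x s
      using hjb_osc_bound[OF r0(1) s(1,3,4) that] hjb_osc_bound[OF r0(1) s(5,7,8) that] cube_mono[OF Delta_in_cube] by auto
    define Z where "Z s = osc (u s - u' s)" for s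
    define M where "M s = l1 (\<mu> s - \<mu>' s)" for s
    define W where "W s = supn (u s - u' s)" for s
    define \<phi> where "\<phi> s = (u s - u' s) \<bullet> (\<mu> s - \<mu>' s)" for s
    have O0: "0 \<le> Z s" and M0: "0 \<le> M s" and W0: "0 \<le> W s" for s
      by (auto simp: Z_def M_def W_def osc_ge_0 l1_ge_0 supn_ge_0)
    have \<phi>OM: "\<phi> s \<le> Z s * M s" if "0 \<le> s" for s
    proof -
      have "\<bar>\<phi> s\<bar> \<le> Z s * M s" unfolding \<phi>_def Z_def M_def
        by (rule pairing_le, rule sum_diff_simplex) (use s(3,7) that in \<open>auto simp: simplex_flow_def\<close>)
      then show ?thesis by simp
    qed
    have \<phi>0: "0 \<le> \<phi> s" if "0 \<le> s" for s unfolding \<phi>_def by (rule duality_nonneg[OF r0(1) u that])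
    define V where "V s = \<phi> s + \<epsilon> * (M s)\<^sup>2" for s
    have cu: "continuous_on {0..} (\<lambda>s. u s - u' s)" and cm: "continuous_on {0..} (\<lambda>s. \<mu> s - \<mu>' s)"
      using s hjb_continuous kolmogorov_continuous by (auto intro!: continuous_intros)
    have cM: "continuous_on {0..} M" unfolding M_def[abs_def] l1_def
      by (intro continuous_on_sum continuous_on_rabs continuous_on_component cm)
    have Vdecay: "V s \<le> exp (- 2 * \<gamma> * s) * V 0" if s0: "0 \<le> s" for s
    proof -
      have "V s \<le> exp (- 2 * \<gamma> * (s - 0)) * V 0"
      proof (rule dini_le_exp_bound[OF s0])
        show "continuous_on {0..s} V"
          unfolding V_def \<phi>_def
          by (intro continuous_intros continuous_on_subset[OF cu] continuous_on_subset[OF cm] continuous_on_subset[OF cM]) auto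
        fix \<tau> assume \<tau>: "0 \<le> \<tau>" "\<tau> < s"
        let ?Z = "Z \<tau>" and ?M = "M \<tau>"
        obtain D where D: "(\<phi> has_real_derivative D) (at \<tau> within {0..})" "D \<le> r * \<phi> \<tau> - c * ?Z\<^sup>2"
          using duality[OF s(1-3) s(5-7) \<tau>(1) c(2) less_imp_le[OF c(1)] K[OF \<tau>(1)]] unfolding \<phi>_def Z_def by blast
        have dM: "dini_le M \<tau> {\<tau>..} (- l * ?M + C1 * ?Z)"
        proof (rule dini_le_mono)
          show "dini_le M \<tau> {\<tau>..} (- (real CARD('n) * al) * ?M + (real CARD('n))\<^sup>2 * L * ?Z)"
            unfolding M_def Z_def by (rule kolmogorov_diff_point[OF s(2,3,6,7) \<tau>(1) L(2,1) K[OF \<tau>(1)]])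
          show "- (real CARD('n) * al) * ?M + (real CARD('n))\<^sup>2 * L * ?Z \<le> - l * ?M + C1 * ?Z"
            using O0[of \<tau>] by (simp add: l_def C1_def N_def distrib_right)
        qed
        have "dini_le V \<tau> {\<tau>..} (D + \<epsilon> * (2 * ?M * (- l * ?M + C1 * ?Z)))"
          unfolding V_def
          by (intro dini_le_add dini_le_cmult dini_le_square dini_le_right_deriv deriv_right D dM M0 \<tau> less_imp_le[OF \<epsilon>])
        moreover have "D + \<epsilon> * (2 * ?M * (- l * ?M + C1 * ?Z)) \<le> - 2 * \<gamma> * V \<tau>"
        proof -
          have "0 \<le> (l * ?M - C1 * ?Z)\<^sup>2" by simp
          then have "2 * (l * ?M) * (C1 * ?Z) \<le> (l * ?M)\<^sup>2 + (C1 * ?Z)\<^sup>2"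
            by (simp add: power2_diff)
          then have "\<epsilon> / l * (2 * (l * ?M) * (C1 * ?Z)) \<le> \<epsilon> / l * ((l * ?M)\<^sup>2 + (C1 * ?Z)\<^sup>2)"
            using \<epsilon> l by (intro mult_left_mono) auto
          moreover have "\<epsilon> / l * (2 * (l * ?M) * (C1 * ?Z)) = \<epsilon> * (2 * ?M * (C1 * ?Z))"
            using l by simp
          moreover have "\<epsilon> / l * ((l * ?M)\<^sup>2 + (C1 * ?Z)\<^sup>2) = \<epsilon> * l * ?M\<^sup>2 + c / 2 * ?Z\<^sup>2"
            using l C1 by (simp add: \<epsilon>_def power_mult_distrib field_simps power2_eq_square)
          ultimately have 1: "\<epsilon> * (2 * ?M * (C1 * ?Z)) \<le> \<epsilon> * l * ?M\<^sup>2 + c / 2 * ?Z\<^sup>2" by simp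
          have "2 * k * ?Z\<^sup>2 \<le> c / 2 * ?Z\<^sup>2" "2 * k * ?M\<^sup>2 \<le> \<epsilon> * l * ?M\<^sup>2"
            by (rule mult_right_mono[OF k(2)], simp) (rule mult_right_mono[OF k(3)], simp)
          then have 2: "\<epsilon> * (2 * ?M * (- l * ?M + C1 * ?Z)) - c * ?Z\<^sup>2 \<le> - 2 * k * (?Z\<^sup>2 + ?M\<^sup>2)"
            using 1 by (simp add: algebra_simps power2_eq_square)
          have amgm: "?Z * ?M \<le> (?Z\<^sup>2 + ?M\<^sup>2) / 2"
            using sum_squares_ge_zero[of "?Z - ?M" 0] by (simp add: power2_eq_square algebra_simps)
          have "r * \<phi> \<tau> \<le> 2 * k * \<phi> \<tau>" using r0 \<phi>0[OF \<tau>(1)] by (intro mult_right_mono)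
          also have "\<dots> \<le> 2 * k * ((?Z\<^sup>2 + ?M\<^sup>2) / 2)"
            using \<phi>OM[OF \<tau>(1)] amgm k(1) by (intro mult_left_mono) auto
          finally have 3: "r * \<phi> \<tau> \<le> k * (?Z\<^sup>2 + ?M\<^sup>2)" by simp
          have "V \<tau> \<le> (1 + \<epsilon>) * (?Z\<^sup>2 + ?M\<^sup>2)"
          proof -
            have "\<epsilon> * ?M\<^sup>2 \<le> \<epsilon> * (?Z\<^sup>2 + ?M\<^sup>2)" using \<epsilon> by (intro mult_left_mono) auto
            moreover have "\<phi> \<tau> \<le> ?Z\<^sup>2 + ?M\<^sup>2"
            proof -
              have "\<phi> \<tau> \<le> (?Z\<^sup>2 + ?M\<^sup>2) / 2" using \<phi>OM[OF \<tau>(1)] amgm by (rule order_trans)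
              also have "\<dots> \<le> ?Z\<^sup>2 + ?M\<^sup>2" by simp
              finally show ?thesis .
            qed
            ultimately have "\<phi> \<tau> + \<epsilon> * ?M\<^sup>2 \<le> (?Z\<^sup>2 + ?M\<^sup>2) + \<epsilon> * (?Z\<^sup>2 + ?M\<^sup>2)" by (intro add_mono)
            then show ?thesis unfolding V_def distrib_right[of 1 \<epsilon>] mult_1 .
          qed
          then have "2 * \<gamma> * V \<tau> \<le> 2 * \<gamma> * ((1 + \<epsilon>) * (?Z\<^sup>2 + ?M\<^sup>2))"
            using \<gamma> by (intro mult_left_mono) auto
          also have "\<dots> = k * (?Z\<^sup>2 + ?M\<^sup>2)" using \<gamma>k by (metis mult.assoc)
          finally show ?thesis using 2 3 D(2) by (simp add: algebra_simps)
        qed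
        ultimately show "dini_le V \<tau> {\<tau>..} (- 2 * \<gamma> * V \<tau>)" by (rule dini_le_mono)
      qed
      then show ?thesis by simp
    qed
    have V0: "0 \<le> V 0" using \<phi>0[of 0] \<epsilon> by (simp add: V_def)
    define Q where "Q = sqrt (V 0 / \<epsilon>)"
    have Q: "Q \<ge> 0" "Q\<^sup>2 = V 0 / \<epsilon>" using V0 \<epsilon> by (auto simp: Q_def)
    have MQ: "M s \<le> Q * exp (- \<gamma> * s)" if "0 \<le> s" for s
    proof (rule power2_le_imp_le)
      have "\<epsilon> * (M s)\<^sup>2 \<le> V s" using \<phi>0[OF that] by (simp add: V_def)
      also have "\<dots> \<le> exp (- 2 * \<gamma> * s) * V 0" by (rule Vdecay[OF that])
      finally have "(M s)\<^sup>2 \<le> exp (- 2 * \<gamma> * s) * Q\<^sup>2" using \<epsilon> by (simp add: Q(2) field_simps)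
      also have "\<dots> = (Q * exp (- \<gamma> * s))\<^sup>2"
        by (simp add: power_mult_distrib exp_double[symmetric] mult_ac)
      finally show "(M s)\<^sup>2 \<le> (Q * exp (- \<gamma> * s))\<^sup>2" .
    qed (use Q in auto)
    obtain R1 R2 where "\<forall>v\<in>u ` {0..}. norm v \<le> R1" "\<forall>v\<in>u' ` {0..}. norm v \<le> R2"
      using s(4,8) unfolding bounded_iff by blast
    then have R: "\<And>s. 0 \<le> s \<Longrightarrow> norm (u s) \<le> R1" "\<And>s. 0 \<le> s \<Longrightarrow> norm (u' s) \<le> R2" by auto
    have WR: "W s \<le> R1 + R2" if "0 \<le> s" for s
      unfolding W_def using supn_le_norm[of "u s - u' s"] norm_triangle_ineq4[of "u s" "u' s"] R[OF that] by linarith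
    have OR: "Z s \<le> 2 * (R1 + R2)" if "0 \<le> s" for s
      using osc_le_supn[of "u s - u' s"] WR[OF that] by (simp add: W_def Z_def)
    have OQ: "Z s \<le> P * Q * exp (- \<gamma> * s)" if "0 \<le> s" for s
    proof -
      have "Z s \<le> (2 * (LF * Q)) / ((r + 2 * al) + \<gamma>) * exp (- \<gamma> * s)"
      proof (rule backward_comparison_infinite[where R = "2 * (R1 + R2)"])
        show "continuous_on {0..} Z" unfolding Z_def[abs_def] by (rule continuous_on_osc[OF cu])
        fix \<tau> :: real assume \<tau>: "0 < \<tau>"
        have "LF * M \<tau> \<le> LF * (Q * exp (- \<gamma> * \<tau>))" using MQ[of \<tau>] \<tau> LF by (intro mult_left_mono) auto
        then show "dini_le Z \<tau> {..\<tau>} (- (r + 2 * al) * Z \<tau> + 2 * (LF * Q) * exp (- \<gamma> * \<tau>))"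
          using hjb_diff_point(2)[OF s(1,5,3,7) \<tau>] unfolding Z_def[abs_def] M_def
          by (rule_tac dini_le_mono) auto
      qed (use r0 al \<gamma> LF Q that OR in auto)
      also have "(2 * (LF * Q)) / ((r + 2 * al) + \<gamma>) \<le> (2 * (LF * Q)) / (2 * al)"
        by (rule divide_left_mono) (use r0 al \<gamma> LF Q in auto)
      also have "(2 * (LF * Q)) / (2 * al) = P * Q" by (simp add: P_def)
      finally show ?thesis by simp
    qed
    have WQ: "W s \<le> LF / \<gamma> * Q * exp (- \<gamma> * s)" if "0 \<le> s" for s
    proof -
      have "W s \<le> (LF * Q) / (r + \<gamma>) * exp (- \<gamma> * s)"
      proof (rule backward_comparison_infinite[where R = "R1 + R2"])
        show "continuous_on {0..} W" unfolding W_def[abs_def] by (rule continuous_on_supn[OF cu])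
        fix \<tau> :: real assume \<tau>: "0 < \<tau>"
        have "LF * M \<tau> \<le> LF * (Q * exp (- \<gamma> * \<tau>))" using MQ[of \<tau>] \<tau> LF by (intro mult_left_mono) auto
        then show "dini_le W \<tau> {..\<tau>} (- r * W \<tau> + LF * Q * exp (- \<gamma> * \<tau>))"
          using hjb_diff_point(1)[OF s(1,5,3,7) \<tau>] unfolding W_def[abs_def] M_def
          by (rule_tac dini_le_mono) auto
      qed (use r0 al \<gamma> LF Q that WR in auto)
      also have "(LF * Q) / (r + \<gamma>) \<le> (LF * Q) / \<gamma>"
        by (rule divide_left_mono) (use r0 \<gamma> LF Q in auto)
      finally show ?thesis by simp
    qed
    \<comment> \<open>\<open>Q\<^sup>2 \<le> P / \<epsilon> * Q * M 0 + (M 0)\<^sup>2\<close>, by the bounds on \<open>Z\<close> and \<open>\<phi>\<close> at time \<open>0\<close>.\<close>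
    have QY: "Q \<le> Y * M 0"
    proof (cases "Q \<le> M 0")
      case True
      then show ?thesis using Y mult_right_mono[OF Y M0[of 0]] by simp
    next
      case False
      have "\<phi> 0 \<le> (P * Q) * M 0"
        using \<phi>OM[of 0] OQ[of 0] M0[of 0] mult_right_mono[of "Z 0" "P * Q" "M 0"] by simp
      then have "V 0 / \<epsilon> \<le> ((P * Q) * M 0 + \<epsilon> * (M 0)\<^sup>2) / \<epsilon>"
        using \<epsilon> by (intro divide_right_mono) (auto simp: V_def)
      then have "Q\<^sup>2 \<le> P / \<epsilon> * Q * M 0 + (M 0)\<^sup>2" using Q(2) \<epsilon> by (simp add: add_divide_distrib)
      also have "(M 0)\<^sup>2 \<le> Q * M 0" using False M0[of 0] by (simp add: power2_eq_square mult_right_mono)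
      finally have "Q * Q \<le> Q * (Y * M 0)" by (simp add: Y_def power2_eq_square algebra_simps)
      moreover have "Q > 0" using False M0[of 0] by linarith
      ultimately show ?thesis by simp
    qed
    have "M t + W t \<le> (1 + LF / \<gamma>) * exp (- \<gamma> * t) * Q"
      using MQ[OF t] WQ[OF t] by (simp add: algebra_simps)
    also have "\<dots> \<le> (1 + LF / \<gamma>) * exp (- \<gamma> * t) * (Y * M 0)"
      using QY LF \<gamma> by (intro mult_left_mono) auto
    finally show ?thesis by (simp add: C_def M_def W_def mult_ac)
  qed
  show ?thesis
    by (rule exI[of _ "2 * k"], intro conjI exI[of _ \<gamma>] exI[of _ C]) (use k \<gamma> C main in auto)
qed

end

section \<open>Existence of solutions by shooting\<close>

text \<open>A trajectory with terminal value \<open>0\<close> exists for every horizon, since the map from initial to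
  terminal values is onto; the a priori bound and compactness then give a trajectory that is bounded
  for all times.\<close>

lemma shooting:
  fixes \<psi> :: "'a::euclidean_space \<Rightarrow> real \<Rightarrow> 'a"
  assumes cont: "\<And>t. 0 \<le> t \<Longrightarrow> continuous_on UNIV (\<lambda>v. \<psi> v t)" and init: "\<And>v. \<psi> v 0 = v"
    and inj: "\<And>T. 0 < T \<Longrightarrow> inj (\<lambda>v. \<psi> v T)"
    and apriori: "\<And>v t T. 0 \<le> t \<Longrightarrow> t \<le> T \<Longrightarrow> norm (\<psi> v t) \<le> R + B * norm (\<psi> v T)" and B: "0 \<le> B"
  shows "\<exists>v. \<forall>t\<ge>0. norm (\<psi> v t) \<le> R"
proof (rule bounded_trajectory[where \<psi> = \<psi>, OF cont init])
  fix n :: nat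
  let ?T = "real n + 1"
  have "surj (\<lambda>v. \<psi> v ?T)"
  proof (rule proper_injective_surj[where A = R and B = B])
    show "norm v \<le> R + B * norm (\<psi> v ?T)" for v using apriori[of 0 ?T v] by (simp add: init)
  qed (use cont inj B in auto)
  then obtain v where v: "\<psi> v ?T = 0" by (metis surjE)
  have "norm (\<psi> v t) \<le> R" if "t \<in> {0..real n}" for t using apriori[of t ?T v] v that by simp
  then show "\<exists>v. \<forall>t\<in>{0..real n}. norm (\<psi> v t) \<le> R" by blast
qed

context mfg
begin

lemma au0: "0 < au" using al au by simp

definition N :: real where "N = real CARD('n)"

lemma N: "N \<ge> 2" "N > 0" using card by (auto simp: N_def)

definition RB :: real where "RB = 2 * N * au"

lemma RB: "0 \<le> RB" using N au0 by (simp add: RB_def)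

lemma norm_rate_le: "a \<in> rate_vectors al au (x::'n) \<Longrightarrow> norm a \<le> RB"
proof -
  assume a: "a \<in> rate_vectors al au x"
  have y: "\<bar>a $ y\<bar> \<le> au" if "y \<noteq> x" for y using rate_vectorsD(1,2)[OF a that] al by simp
  have "\<bar>a $ x\<bar> = \<bar>\<Sum>y\<in>UNIV - {x}. a $ y\<bar>" using a by (simp add: rate_vectors_def)
  also have "\<dots> \<le> (\<Sum>y\<in>UNIV - {x}. au)" by (rule order_trans[OF sum_abs], rule sum_mono) (use y in auto)
  finally have x: "\<bar>a $ x\<bar> \<le> real (card (UNIV - {x})) * au" by simp
  have "norm a \<le> (\<Sum>y\<in>UNIV. \<bar>a $ y\<bar>)" by (rule norm_le_l1_cart)
  also have "\<dots> = \<bar>a $ x\<bar> + (\<Sum>y\<in>UNIV - {x}. \<bar>a $ y\<bar>)" by (simp add: sum.remove[of UNIV x])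
  also have "(\<Sum>y\<in>UNIV - {x}. \<bar>a $ y\<bar>) \<le> (\<Sum>y\<in>UNIV - {x}. au)" by (rule sum_mono) (use y in auto)
  also have "(\<Sum>y\<in>UNIV - {x}. au) = real (card (UNIV - {x})) * au" by simp
  finally have "norm a \<le> 2 * (real (card (UNIV - {x})) * au)" using x by linarith
  also have "real (card (UNIV - {x})) \<le> N" by (simp add: N_def card_Diff_singleton)
  finally show ?thesis using au0 by (simp add: RB_def mult_right_mono)
qed

lemma H_lipschitz: "\<bar>H x p - H x q\<bar> \<le> RB * norm (p - q)"
proof -
  obtain a where a: "a \<in> rate_vectors al au x" "H x p - H x q = a \<bullet> (p - q)" using H_mean_value by blast
  have "\<bar>a \<bullet> (p - q)\<bar> \<le> norm a * norm (p - q)" by (rule Cauchy_Schwarz_ineq2)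
  also have "\<dots> \<le> RB * norm (p - q)" using norm_rate_le[OF a(1)] by (rule mult_right_mono) simp
  finally show ?thesis using a(2) by simp
qed

lemma norm_Delta_le: "norm (Delta x (p::real^'n)) \<le> 2 * N * norm p"
proof -
  have "norm (Delta x p) \<le> (\<Sum>y\<in>(UNIV::'n set). 2 * norm p)"
  proof (rule order_trans[OF norm_le_l1_cart], rule sum_mono)
    fix y show "\<bar>Delta x p $ y\<bar> \<le> 2 * norm p"
      using component_le_norm_cart[of p y] component_le_norm_cart[of p x] by simp
  qed
  then show ?thesis by (simp add: N_def)
qed

lemma Delta_in_cube_norm: "norm p \<le> R \<Longrightarrow> Delta x p \<in> cube (2 * R)"
  by (rule cube_mono[OF Delta_in_cube]) (use osc_le_supn[of p] supn_le_norm[of p] in linarith)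

lemma G_continuous: "continuous_on UNIV (G x)"
proof (clarsimp simp: continuous_on_eq_continuous_at)
  fix p :: "real^'n"
  obtain L where L: "\<forall>x. \<forall>p'\<in>cube (norm p + 1). \<forall>q\<in>cube (norm p + 1). norm (G x p' - G x q) \<le> L * norm (p' - q)"
    using G_lip by blast
  have "eventually (\<lambda>q. q \<in> ball p 1) (at p)" by (rule eventually_at_in_open') auto
  then have "eventually (\<lambda>q. norm (G x q - G x p) \<le> L * norm (q - p)) (at p)"
  proof eventually_elim
    case (elim q)
    have "norm q \<le> norm p + 1" using elim norm_triangle_ineq2[of q p] by (simp add: dist_norm norm_minus_commute)
    then have "q \<in> cube (norm p + 1)" "p \<in> cube (norm p + 1)"
      using component_le_norm_cart[of q] component_le_norm_cart[of p] unfolding cube_def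
      by (auto intro: order_trans add_increasing2)
    then show ?case using L by blast
  qed
  moreover have "((\<lambda>q. L * norm (q - p)) \<longlongrightarrow> L * norm (p - p)) (at p)" by (intro tendsto_intros)
  ultimately have "((\<lambda>q. G x q - G x p) \<longlongrightarrow> 0) (at p)"
    by (intro Lim_null_comparison[of "\<lambda>q. G x q - G x p" "\<lambda>q. L * norm (q - p)"]) auto
  then show "isCont (G x) p" by (simp add: isCont_def LIM_zero_iff)
qed

lemma H_continuous: "continuous_on UNIV (H x)"
  by (rule has_derivative_continuous_on[where f' = "\<lambda>p \<xi>. G x p \<bullet> \<xi>"]) (use H_deriv has_derivative_at_withinI in blast)

lemma Delta_continuous: "continuous_on S u \<Longrightarrow> continuous_on S (\<lambda>t. Delta x (u t))"
  unfolding Delta_def by (intro continuous_intros)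

lemma F_continuous: "continuous_on prob_simplex (F x)"
proof (rule continuous_onI)
  fix \<eta> :: "real^'n" and e :: real assume \<eta>: "\<eta> \<in> prob_simplex" and e: "0 < e"
  define d where "d = e / (LF * N + 1)"
  have pos: "LF * N + 1 > 0" using LF N by (simp add: add_nonneg_pos)
  have d: "d > 0" "(LF * N) * d \<le> e"
  proof -
    show "d > 0" using e pos by (simp add: d_def)
    have "(LF * N + 1) * d = e" using pos by (simp add: d_def)
    then show "(LF * N) * d \<le> e" using \<open>d > 0\<close> by (simp add: distrib_right)
  qed
  have "dist (F x \<eta>') (F x \<eta>) \<le> e" if "\<eta>' \<in> prob_simplex" "dist \<eta>' \<eta> < d" for \<eta>'
  proof -
    have "\<bar>F x \<eta>' - F x \<eta>\<bar> \<le> LF * l1 (\<eta>' - \<eta>)" by (rule F_lip[OF that(1) \<eta>])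
    also have "\<dots> \<le> LF * (N * norm (\<eta>' - \<eta>))" using LF l1_le_card_norm[of "\<eta>' - \<eta>"] by (intro mult_left_mono) (auto simp: N_def)
    also have "\<dots> \<le> (LF * N) * d" using that LF N by (simp add: dist_norm mult.assoc mult_left_mono)
    finally show ?thesis using d(2) by (simp add: dist_real_def)
  qed
  then show "\<exists>d>0. \<forall>\<eta>'\<in>prob_simplex. dist \<eta>' \<eta> < d \<longrightarrow> dist (F x \<eta>') (F x \<eta>) \<le> e" using d(1) by blast
qed

definition hj :: "real \<Rightarrow> real^'n \<Rightarrow> real^'n \<Rightarrow> real^'n" where
  "hj r u \<eta> = (\<chi> x. r * u $ x - H x (Delta x u) - F x \<eta>)"

lemma hj_lipschitz:
  assumes "0 \<le> r" "\<eta> \<in> prob_simplex" "\<eta>' \<in> prob_simplex"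
  shows "norm (hj r u \<eta> - hj r u' \<eta>') \<le> N * (r + RB * (2 * N)) * norm (u - u') + N * (LF * N) * norm (\<eta> - \<eta>')"
proof -
  have "norm (hj r u \<eta> - hj r u' \<eta>') \<le>
      (\<Sum>x\<in>(UNIV::'n set). (r + RB * (2 * N)) * norm (u - u') + (LF * N) * norm (\<eta> - \<eta>'))"
  proof (rule order_trans[OF norm_le_l1_cart], rule sum_mono)
    fix x
    have "\<bar>H x (Delta x u) - H x (Delta x u')\<bar> \<le> RB * norm (Delta x (u - u'))"
      using H_lipschitz[of x "Delta x u" "Delta x u'"] by (simp add: Delta_diff)
    also have "\<dots> \<le> RB * (2 * N * norm (u - u'))" using RB by (intro mult_left_mono norm_Delta_le)
    finally have 1: "\<bar>H x (Delta x u) - H x (Delta x u')\<bar> \<le> RB * (2 * N) * norm (u - u')" by (simp add: mult.assoc)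
    have "\<bar>F x \<eta> - F x \<eta>'\<bar> \<le> LF * l1 (\<eta> - \<eta>')" by (rule F_lip[OF assms(2,3)])
    also have "\<dots> \<le> LF * (N * norm (\<eta> - \<eta>'))" using LF l1_le_card_norm[of "\<eta> - \<eta>'"] by (intro mult_left_mono) (auto simp: N_def)
    finally have 2: "\<bar>F x \<eta> - F x \<eta>'\<bar> \<le> LF * N * norm (\<eta> - \<eta>')" by (simp add: mult.assoc)
    have 3: "\<bar>r * u $ x - r * u' $ x\<bar> \<le> r * norm (u - u')"
      using component_le_norm_cart[of "u - u'" x] assms(1)
      by (simp add: abs_mult mult_left_mono flip: right_diff_distrib)
    have "(hj r u \<eta> - hj r u' \<eta>') $ x = (r * u $ x - r * u' $ x) - (H x (Delta x u) - H x (Delta x u')) - (F x \<eta> - F x \<eta>')"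
      by (simp add: hj_def)
    then show "\<bar>(hj r u \<eta> - hj r u' \<eta>') $ x\<bar> \<le> (r + RB * (2 * N)) * norm (u - u') + (LF * N) * norm (\<eta> - \<eta>')"
      unfolding distrib_right using 1 2 3 by linarith
  qed
  then show ?thesis by (simp add: N_def algebra_simps)
qed

lemma hj_growth:
  assumes "0 \<le> r" "\<eta> \<in> prob_simplex"
  shows "norm (hj r u \<eta>) \<le> N * K0 + N * (r + RB * (2 * N)) * norm u"
proof -
  have "norm (hj r 0 \<eta>) \<le> (\<Sum>x\<in>(UNIV::'n set). K0)"
  proof (rule order_trans[OF norm_le_l1_cart], rule sum_mono)
    fix x
    have "Delta x 0 = (0::real^'n)" by (simp add: vec_eq_iff)
    then show "\<bar>hj r 0 \<eta> $ x\<bar> \<le> K0" using K0(2)[OF assms(2), of x] by (simp add: hj_def)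
  qed
  moreover have "norm (hj r u \<eta>) \<le> norm (hj r u \<eta> - hj r 0 \<eta>) + norm (hj r 0 \<eta>)"
    by (metis diff_add_cancel norm_triangle_ineq)
  ultimately show ?thesis using hj_lipschitz[OF assms(1,2,2), of u 0] by (simp add: N_def)
qed

lemma hj_continuous:
  assumes "continuous_on S f" "continuous_on S g" "\<And>s. s \<in> S \<Longrightarrow> g s \<in> prob_simplex"
  shows "continuous_on S (\<lambda>s. hj r (f s) (g s))"
  unfolding hj_def
proof (intro continuous_on_vec_lambda continuous_on_diff continuous_on_mult continuous_on_const continuous_on_component assms)
  fix x
  show "continuous_on S (\<lambda>s. H x (Delta x (f s)))"
    by (rule continuous_on_compose2[OF H_continuous Delta_continuous[OF assms(1)]]) auto
  show "continuous_on S (\<lambda>s. F x (g s))"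
    by (rule continuous_on_compose2[OF F_continuous assms(2)]) (use assms(3) in auto)
qed

lemma hjb_iff: "hjb r u \<mu> \<longleftrightarrow> (\<forall>t\<ge>0. (u has_vector_derivative hj r (u t) (\<mu> t)) (at t within {0..}))"
  unfolding hjb_def hj_def has_vector_derivative_def has_field_derivative_def
    has_derivative_componentwise_within[of u]
  by (auto simp: Basis_vec_def inner_axis mult.commute[of "_ - _"] mult_commute_abs)

lemma hjb_apriori:
  assumes r: "0 < r" and u: "hjb r u \<mu>" and \<mu>: "simplex_flow \<mu>" and t: "0 \<le> t" "t \<le> T"
  shows "norm (u t) \<le> N * (K0 / r) + N * norm (u T)"
proof -
  have "norm (u t) \<le> N * supn (u t)" using norm_le_supn[of "u t"] by (simp add: N_def)
  also have "\<dots> \<le> N * (K0 / r + norm (u T))"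
    using hjb_bound_finite[OF r u \<mu> t] supn_le_norm[of "u T"] N by (intro mult_left_mono) auto
  finally show ?thesis by (simp add: distrib_left)
qed

lemma hjb_unique_backward:
  assumes r: "0 < r" and u: "hjb r u \<mu>" "hjb r u' \<mu>'" and \<mu>: "simplex_flow \<mu>" "simplex_flow \<mu>'"
    and eq: "\<And>s. 0 \<le> s \<Longrightarrow> s \<le> T \<Longrightarrow> \<mu> s = \<mu>' s" and T: "u T = u' T" and t: "0 \<le> t" "t \<le> T"
  shows "u t = u' t"
proof -
  have "supn (u t - u' t) \<le> 0 / (r + 0) * exp (- 0 * t) + exp (- r * (T - t)) * max 0 (supn (u T - u' T))"
  proof (rule backward_comparison)
    show "continuous_on {0..T} (\<lambda>t. supn (u t - u' t))"
      by (intro continuous_on_supn continuous_on_diff continuous_on_subset[OF hjb_continuous[OF u(1)]]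
          continuous_on_subset[OF hjb_continuous[OF u(2)]]) auto
    fix s assume s: "0 < s" "s \<le> T"
    show "dini_le (\<lambda>t. supn (u t - u' t)) s {..s} (- r * supn (u s - u' s) + 0 * exp (- 0 * s))"
      using hjb_diff_point(1)[OF u \<mu> s(1)] eq[of s] s by (simp add: l1_def)
  qed (use r t in auto)
  also have "supn (u T - u' T) = 0" using T by (simp add: supn_def)
  finally have "supn (u t - u' t) \<le> 0" by simp
  then have "(u t - u' t) $ x = 0" for x using abs_le_supn[of "u t - u' t" x] by linarith
  then show ?thesis by (simp add: vec_eq_iff)
qed

text \<open>Shooting along a given flow: solutions with equal terminal values coincide by the maximum
  principle, so the map from initial to terminal values is injective.\<close>

lemma hjb_exists:
  assumes r: "0 < r" and \<mu>: "simplex_flow \<mu>" "continuous_on {0..} \<mu>"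
  shows "\<exists>u. hjb r u \<mu> \<and> bounded (u ` {0..})"
proof -
  have p\<mu>: "\<And>t. 0 \<le> t \<Longrightarrow> \<mu> t \<in> prob_simplex" using \<mu> by (simp add: simplex_flow_def)
  interpret S: ode "\<lambda>t u. hj r u (\<mu> t)" "N * K0" "N * (r + RB * (2 * N))"
  proof
    show "continuous_on ({0..} \<times> UNIV) (\<lambda>(t, u). hj r u (\<mu> t))"
      unfolding case_prod_beta
      by (intro hj_continuous continuous_on_snd continuous_on_id continuous_on_compose2[OF \<mu>(2)] continuous_on_fst)
        (use p\<mu> in auto)
    show "\<exists>L\<ge>0. \<forall>t\<in>{0..T}. \<forall>x\<in>cball 0 R. \<forall>y\<in>cball 0 R. norm (hj r x (\<mu> t) - hj r y (\<mu> t)) \<le> L * norm (x - y)" for T R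
    proof -
      have "norm (hj r x (\<mu> t) - hj r y (\<mu> t)) \<le> N * (r + RB * (2 * N)) * norm (x - y)" if "0 \<le> t" for t x y
        using hj_lipschitz[OF less_imp_le[OF r] p\<mu>[OF that] p\<mu>[OF that], of x y] by simp
      then show ?thesis using r RB N by (intro exI[of _ "N * (r + RB * (2 * N))"]) auto
    qed
    show "norm (hj r x (\<mu> t)) \<le> N * K0 + N * (r + RB * (2 * N)) * norm x" if "0 \<le> t" for t x
      by (rule hj_growth) (use r p\<mu> that in auto)
  qed (use N K0(1) r RB in auto)
  have h: "hjb r (S.flow v) \<mu>" for v using S.flow(1)[of v] by (simp add: hjb_iff S.sol_def)
  have "\<exists>v. \<forall>t\<ge>0. norm (S.flow v t) \<le> N * (K0 / r)"
  proof (rule shooting[where \<psi> = S.flow, OF S.flow_continuous S.flow(2)])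
    show "norm (S.flow v t) \<le> N * (K0 / r) + N * norm (S.flow v T)" if "0 \<le> t" "t \<le> T" for v t T
      by (rule hjb_apriori[OF r h \<mu>(1) that])
    show "inj (\<lambda>v. S.flow v T)" if "0 < T" for T
    proof (rule injI)
      fix v v' assume "S.flow v T = S.flow v' T"
      then have "S.flow v 0 = S.flow v' 0"
        using hjb_unique_backward[OF r h[of v] h[of v'] \<mu>(1,1), of T 0] that by simp
      then show "v = v'" by (simp add: S.flow(2))
    qed
  qed (use N in auto)
  then obtain v where "\<forall>t\<ge>0. norm (S.flow v t) \<le> N * (K0 / r)" by blast
  then have "bounded (S.flow v ` {0..})" by (auto simp: bounded_iff)
  with h show ?thesis by blast
qed

lemma kolmogorov_iff: "kolmogorov u \<mu> \<longleftrightarrow>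
    (\<forall>t\<ge>0. (\<mu> has_vector_derivative (\<Sum>y\<in>UNIV. \<mu> t $ y *\<^sub>R G y (Delta y (u t)))) (at t within {0..}))"
  unfolding kolmogorov_def has_vector_derivative_def has_field_derivative_def
    has_derivative_componentwise_within[of \<mu>]
  by (auto simp: Basis_vec_def inner_axis mult_commute_abs inner_sum_left)

text \<open>The forward equation is linear in the density. That the solution started in a state stays in
  the simplex will follow from its identification with the law of a jump process.\<close>

lemma kolmogorov_exists:
  assumes u: "continuous_on {0..} u"
  shows "\<exists>\<mu>. kolmogorov u \<mu> \<and> \<mu> 0 = \<mu>0"
proof -
  let ?G = "\<lambda>t p. \<Sum>y\<in>UNIV. p $ y *\<^sub>R G y (Delta y (u t))"
  have b: "norm (?G t p) \<le> N * RB * norm p" for t p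
  proof -
    have "norm (?G t p) \<le> (\<Sum>y\<in>(UNIV::'n set). norm p * RB)"
      by (rule order_trans[OF norm_sum], rule sum_mono)
        (auto intro!: mult_mono component_le_norm_cart norm_rate_le[OF G_rate])
    then show ?thesis by (simp add: N_def mult_ac)
  qed
  interpret S: ode ?G 0 "N * RB"
  proof
    show "continuous_on ({0..} \<times> UNIV) (\<lambda>(t, p). ?G t p)"
      unfolding case_prod_beta
      by (intro continuous_on_sum continuous_on_scaleR continuous_on_component continuous_on_snd continuous_on_id
        continuous_on_compose2[OF G_continuous] Delta_continuous continuous_on_compose2[OF u] continuous_on_fst) auto
    show "\<exists>L\<ge>0. \<forall>t\<in>{0..T}. \<forall>x\<in>cball 0 R. \<forall>y\<in>cball 0 R. norm (?G t x - ?G t y) \<le> L * norm (x - y)" for T R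
    proof (intro exI[of _ "N * RB"] conjI ballI)
      fix t x y
      have "?G t x - ?G t y = ?G t (x - y)" by (simp add: sum_subtractf scaleR_diff_left)
      then show "norm (?G t x - ?G t y) \<le> N * RB * norm (x - y)" using b[of "x - y" t] by simp
    qed (use N RB in auto)
  qed (use b N RB in auto)
  show ?thesis using S.flow[of \<mu>0] unfolding kolmogorov_iff S.sol_def by blast
qed

text \<open>The forward-backward system as one ordinary differential equation. Clipping the densities to
  \<open>[0,1]\<close> and projecting onto the simplex makes the field linearly bounded on the whole space without
  affecting solutions that start in the simplex.\<close>

definition clip :: "real \<Rightarrow> real" where "clip s = max 0 (min 1 s)"

lemma clip: "0 \<le> clip s" "clip s \<le> 1" "\<bar>clip s - clip s'\<bar> \<le> \<bar>s - s'\<bar>" "s \<le> 0 \<Longrightarrow> clip s = 0"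
  "0 \<le> s \<Longrightarrow> s \<le> 1 \<Longrightarrow> clip s = s"
  by (auto simp: clip_def)

definition proj :: "real^'n \<Rightarrow> real^'n" where "proj = closest_point prob_simplex"

lemma proj: "proj \<eta> \<in> prob_simplex" "norm (proj \<eta> - proj \<eta>') \<le> norm (\<eta> - \<eta>')"
  "\<eta> \<in> prob_simplex \<Longrightarrow> proj \<eta> = \<eta>" "continuous_on S proj"
proof -
  have ne: "(prob_simplex :: (real^'n) set) \<noteq> {}" using axis_in_simplex by blast
  have cl: "closed (prob_simplex :: (real^'n) set)" using compact_prob_simplex by (rule compact_imp_closed)
  show "proj \<eta> \<in> prob_simplex" unfolding proj_def by (rule closest_point_in_set[OF cl ne])
  show "norm (proj \<eta> - proj \<eta>') \<le> norm (\<eta> - \<eta>')"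
    using closest_point_lipschitz[OF convex_prob_simplex cl ne, of \<eta> \<eta>'] by (simp add: proj_def dist_norm)
  show "\<eta> \<in> prob_simplex \<Longrightarrow> proj \<eta> = \<eta>" unfolding proj_def by (rule closest_point_self)
  show "continuous_on S proj" unfolding proj_def by (rule continuous_on_closest_point[OF convex_prob_simplex cl ne])
qed

definition fb :: "(real^'n) \<times> (real^'n) \<Rightarrow> real^'n" where
  "fb z = (\<Sum>y\<in>UNIV. clip (snd z $ y) *\<^sub>R G y (Delta y (fst z)))"

definition field :: "real \<Rightarrow> (real^'n) \<times> (real^'n) \<Rightarrow> (real^'n) \<times> (real^'n)" where
  "field r z = (hj r (fst z) (proj (snd z)), fb z)"

lemma norm_fst_snd_le: "norm (fst z) \<le> norm z" "norm (snd z) \<le> norm z"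
  using norm_fst_le[of "fst z" "snd z"] norm_snd_le[of "snd z" "fst z"] by simp_all

lemma norm_pair_le: "norm (a, b) \<le> norm a + norm b"
  by (simp add: norm_Pair sqrt_sum_squares_le_sum)

lemma fb_bound: "norm (fb z) \<le> N * RB"
proof -
  have "norm (fb z) \<le> (\<Sum>y\<in>(UNIV::'n set). 1 * RB)"
    unfolding fb_def by (rule order_trans[OF norm_sum], rule sum_mono)
      (unfold norm_scaleR, intro mult_mono norm_rate_le[OF G_rate], auto simp: clip(1,2) abs_of_nonneg)
  then show ?thesis by (simp add: N_def)
qed

lemma fb_lipschitz: "\<exists>L\<ge>0. \<forall>z\<in>cball 0 R. \<forall>z'\<in>cball 0 R. norm (fb z - fb z') \<le> L * norm (z - z')"
proof -
  obtain L where L: "L \<ge> 0" "\<forall>x. \<forall>p\<in>cube (2 * R). \<forall>q\<in>cube (2 * R). norm (G x p - G x q) \<le> L * norm (p - q)"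
    using G_lip by blast
  have "norm (fb z - fb z') \<le> N * (RB + L * (2 * N)) * norm (z - z')" if z: "z \<in> cball 0 R" "z' \<in> cball 0 R" for z z'
  proof -
    have n: "norm (fst z) \<le> R" "norm (fst z') \<le> R"
      using z norm_fst_snd_le(1)[of z] norm_fst_snd_le(1)[of z'] by auto
    have d: "norm (fst z - fst z') \<le> norm (z - z')" "norm (snd z - snd z') \<le> norm (z - z')"
      using norm_fst_snd_le[of "z - z'"] by auto
    have "fb z - fb z' = (\<Sum>y\<in>UNIV. (clip (snd z $ y) - clip (snd z' $ y)) *\<^sub>R G y (Delta y (fst z)) +
        clip (snd z' $ y) *\<^sub>R (G y (Delta y (fst z)) - G y (Delta y (fst z'))))"
      unfolding fb_def by (simp add: sum_subtractf[symmetric] algebra_simps)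
    also have "norm \<dots> \<le> (\<Sum>y\<in>(UNIV::'n set). (RB + L * (2 * N)) * norm (z - z'))"
    proof (rule order_trans[OF norm_sum], rule sum_mono, rule order_trans[OF norm_triangle_ineq])
      fix y
      have "\<bar>clip (snd z $ y) - clip (snd z' $ y)\<bar> \<le> \<bar>(snd z - snd z') $ y\<bar>"
        using clip(3)[of "snd z $ y" "snd z' $ y"] by simp
      also have "\<dots> \<le> norm (snd z - snd z')" by (rule component_le_norm_cart)
      finally have 1: "norm ((clip (snd z $ y) - clip (snd z' $ y)) *\<^sub>R G y (Delta y (fst z))) \<le> norm (z - z') * RB"
        using d(2) norm_rate_le[OF G_rate] by (auto intro!: mult_mono)
      have "norm (G y (Delta y (fst z)) - G y (Delta y (fst z'))) \<le> L * norm (Delta y (fst z) - Delta y (fst z'))"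
        using L(2) Delta_in_cube_norm n by blast
      also have "\<dots> \<le> L * (2 * N * norm (z - z'))"
        unfolding Delta_diff[symmetric] using L(1) norm_Delta_le[of y "fst z - fst z'"] d(1) N
        by (intro mult_left_mono) (auto intro: order_trans mult_left_mono)
      finally have "norm (clip (snd z' $ y) *\<^sub>R (G y (Delta y (fst z)) - G y (Delta y (fst z')))) \<le> 1 * (L * (2 * N * norm (z - z')))"
        unfolding norm_scaleR using clip(1,2)[of "snd z' $ y"] by (intro mult_mono) auto
      with 1 show "norm ((clip (snd z $ y) - clip (snd z' $ y)) *\<^sub>R G y (Delta y (fst z))) +
          norm (clip (snd z' $ y) *\<^sub>R (G y (Delta y (fst z)) - G y (Delta y (fst z')))) \<le> (RB + L * (2 * N)) * norm (z - z')"
        by (simp add: algebra_simps)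
    qed
    finally show ?thesis by (simp add: N_def)
  qed
  moreover have "N * (RB + L * (2 * N)) \<ge> 0" using N RB L by auto
  ultimately show ?thesis by blast
qed

lemma field_ode:
  assumes r: "0 < r"
  shows "ode (\<lambda>t. field r) (N * K0 + N * RB) (N * (r + RB * (2 * N)))"
proof
  show "continuous_on ({0..} \<times> UNIV) (\<lambda>(t::real, z). field r z)"
    unfolding case_prod_beta field_def fb_def clip_def
    by (intro continuous_on_Pair hj_continuous continuous_on_compose2[OF proj(4)[of UNIV]] continuous_on_sum
        continuous_on_scaleR continuous_on_max continuous_on_min continuous_on_const continuous_on_component
        continuous_on_compose2[OF G_continuous] Delta_continuous continuous_on_snd continuous_on_fst continuous_on_id)
      (auto simp: proj)
  show "\<exists>L\<ge>0. \<forall>t\<in>{0..T}. \<forall>x\<in>cball 0 R. \<forall>y\<in>cball 0 R. norm (field r x - field r y) \<le> L * norm (x - y)" for T R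
  proof -
    obtain L where L: "L \<ge> 0" "\<forall>z\<in>cball 0 R. \<forall>z'\<in>cball 0 R. norm (fb z - fb z') \<le> L * norm (z - z')"
      using fb_lipschitz by blast
    let ?A = "N * (r + RB * (2 * N))" and ?B = "N * (LF * N)"
    have A: "?A \<ge> 0" "?B \<ge> 0" using N r RB LF by auto
    have "norm (field r x - field r y) \<le> (?A + ?B + L) * norm (x - y)" if "x \<in> cball 0 R" "y \<in> cball 0 R" for x y
    proof -
      have d: "norm (fst x - fst y) \<le> norm (x - y)" "norm (snd x - snd y) \<le> norm (x - y)"
        using norm_fst_snd_le[of "x - y"] by auto
      have "norm (field r x - field r y) \<le>
          norm (hj r (fst x) (proj (snd x)) - hj r (fst y) (proj (snd y))) + norm (fb x - fb y)"
        using norm_pair_le by (simp add: field_def)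
      also have "norm (hj r (fst x) (proj (snd x)) - hj r (fst y) (proj (snd y))) \<le>
          ?A * norm (fst x - fst y) + ?B * norm (proj (snd x) - proj (snd y))"
        by (rule hj_lipschitz) (use r proj in auto)
      also have "\<dots> \<le> ?A * norm (x - y) + ?B * norm (x - y)"
        using d proj(2) A by (intro add_mono mult_left_mono) (auto intro: order_trans)
      also have "norm (fb x - fb y) \<le> L * norm (x - y)" using L(2) that by blast
      finally show ?thesis by (simp add: algebra_simps)
    qed
    then show ?thesis using A L(1) by (intro exI[of _ "?A + ?B + L"]) auto
  qed
  show "norm (field r z) \<le> N * K0 + N * RB + N * (r + RB * (2 * N)) * norm z" for z
  proof -
    have "norm (field r z) \<le> norm (hj r (fst z) (proj (snd z))) + norm (fb z)"
      unfolding field_def by (rule norm_pair_le)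
    also have "norm (hj r (fst z) (proj (snd z))) \<le> N * K0 + N * (r + RB * (2 * N)) * norm (fst z)"
      by (rule hj_growth) (use r proj in auto)
    also have "N * (r + RB * (2 * N)) * norm (fst z) \<le> N * (r + RB * (2 * N)) * norm z"
      using N r RB norm_fst_snd_le(1)[of z] by (intro mult_left_mono) auto
    finally show ?thesis using fb_bound[of z] by simp
  qed
qed (use N K0(1) r RB in auto)

text \<open>Clipping removes the outflow from a state whose component is not positive, so the negative part
  of the component cannot grow; the total mass is constant because rate vectors sum to \<open>0\<close>.\<close>

lemma simplex_invariant:
  assumes \<mu>: "\<And>t. 0 \<le> t \<Longrightarrow> (\<mu> has_vector_derivative fb (u t, \<mu> t)) (at t within {0..})"
    and init: "\<mu> 0 \<in> prob_simplex"
  shows "simplex_flow \<mu>"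
  unfolding simplex_flow_def
proof (intro allI impI)
  fix T :: real assume T: "0 \<le> T"
  have d: "((\<lambda>s. \<mu> s $ x) has_real_derivative (fb (u t, \<mu> t) $ x)) (at t within {0..})" if "0 \<le> t" for t x
    using bounded_linear.has_vector_derivative[OF bounded_linear_vec_nth \<mu>[OF that]]
    by (simp add: has_real_derivative_iff_has_vector_derivative)
  have c: "continuous_on {0..T} \<mu>"
    by (rule continuous_on_subset[OF ode_continuous_on[OF \<mu>]]) auto
  have "0 \<le> \<mu> T $ x" for x
  proof -
    \<comment> \<open>The negative part, written as a maximum of two smooth functions.\<close>
    define V where "V s = (MAX b\<in>{True, False}. (if b then - \<mu> s $ x else 0))" for s
    have V: "V s = max (- \<mu> s $ x) 0" for s by (simp add: V_def)
    have "V T \<le> V 0"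
    proof (rule dini_le_nonincreasing[OF T])
      show "continuous_on {0..T} V" unfolding V by (intro continuous_intros c)
      fix t assume t: "0 \<le> t" "t < T"
      have dt: "((\<lambda>s. \<mu> s $ x) has_real_derivative (fb (u t, \<mu> t) $ x)) (at t within {t..})"
        using d[OF t(1), of x] t by (intro deriv_right)
      show "dini_le V t {t..} 0"
        unfolding V_def
      proof (rule dini_le_Max)
        fix b :: bool
        show "((\<lambda>s. if b then - \<mu> s $ x else 0) \<longlongrightarrow> (if b then - \<mu> t $ x else 0)) (at t within {t..})"
          using DERIV_continuous[OF dt] by (cases b) (auto simp: continuous_within intro!: tendsto_minus)
        assume "\<forall>j\<in>{True, False}. (if j then - \<mu> t $ x else 0) \<le> (if b then - \<mu> t $ x else 0)"
        then have neg: "b \<Longrightarrow> \<mu> t $ x \<le> 0" by auto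
        show "dini_le (\<lambda>s. if b then - \<mu> s $ x else 0) t {t..} 0"
        proof (cases b)
          case True
          have "0 \<le> fb (u t, \<mu> t) $ x"
            unfolding fb_def sum_component
          proof (intro sum_nonneg)
            fix y
            show "0 \<le> (clip (snd (u t, \<mu> t) $ y) *\<^sub>R G y (Delta y (fst (u t, \<mu> t)))) $ x"
            proof (cases "y = x")
              case True
              with neg \<open>b\<close> show ?thesis by (simp add: clip(4))
            next
              case False
              then have "0 \<le> G y (Delta y (u t)) $ x"
                using rate_vectorsD(1)[OF G_rate, of x y "Delta y (u t)"] al by simp
              then show ?thesis using clip(1) by simp
            qed
          qed
          then have "dini_le (\<lambda>s. - \<mu> s $ x) t {t..} 0"
            by (intro dini_le_mono[OF dini_le_right_deriv[OF DERIV_minus[OF dt]]]) simp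
          then show ?thesis using True by simp
        qed (simp add: dini_le_const)
      qed auto
    qed
    then show ?thesis using prob_simplexD(1)[OF init, of x] by (simp add: V)
  qed
  moreover have "(\<Sum>x\<in>UNIV. \<mu> T $ x) = 1"
  proof (cases "T = 0")
    case True then show ?thesis using init prob_simplexD(3) by blast
  next
    case False
    have "((\<lambda>s. \<Sum>x\<in>UNIV. \<mu> s $ x) has_real_derivative 0) (at t within {0..T})" if "t \<in> {0..T}" for t
    proof -
      have "((\<lambda>s. \<Sum>x\<in>UNIV. \<mu> s $ x) has_real_derivative (\<Sum>x\<in>UNIV. fb (u t, \<mu> t) $ x)) (at t within {0..})"
        using d that by (intro DERIV_sum) auto
      also have "(\<Sum>x\<in>UNIV. fb (u t, \<mu> t) $ x) = 0"
        unfolding fb_def sum_component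
        by (subst sum.swap) (simp add: sum_distrib_left[symmetric] rate_vectorsD(3)[OF G_rate])
      finally show ?thesis by (rule DERIV_subset) auto
    qed
    then obtain k where k: "\<forall>t\<in>{0..T}. (\<Sum>x\<in>UNIV. \<mu> t $ x) = k"
      using has_field_derivative_zero_constant[of "{0..T}" "\<lambda>s. \<Sum>x\<in>UNIV. \<mu> s $ x"] by auto
    have "(\<Sum>x\<in>UNIV. \<mu> T $ x) = (\<Sum>x\<in>UNIV. \<mu> 0 $ x)" using k T by simp
    then show ?thesis using prob_simplexD(3)[OF init] by simp
  qed
  ultimately show "\<mu> T \<in> prob_simplex" by (simp add: prob_simplex_def)
qed

text \<open>Both boundary terms of the duality pairing vanish, hence the pairing vanishes on the whole interval
  and with it the dissipated oscillation of the difference. The densities then move with the same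
  rates.\<close>

lemma finite_horizon_unique:
  assumes r: "0 < r" and s: "sol r u \<mu>" "sol r u' \<mu>'" and T: "0 < T"
    and init: "\<mu> 0 = \<mu>' 0" and fin: "u T = u' T"
  shows "u 0 = u' 0"
proof -
  have s: "hjb r u \<mu>" "kolmogorov u \<mu>" "simplex_flow \<mu>" "hjb r u' \<mu>'" "kolmogorov u' \<mu>'" "simplex_flow \<mu>'"
    using s by (auto simp: sol_def)
  have cu: "continuous_on {0..T} u" "continuous_on {0..T} u'"
    using s(1,4) by (auto intro: continuous_on_subset[OF hjb_continuous])
  have "bounded (u ` {0..T} \<union> u' ` {0..T})"
    by (intro compact_imp_bounded compact_Un compact_continuous_image cu compact_Icc)
  then obtain R where "\<forall>v\<in>u ` {0..T} \<union> u' ` {0..T}. norm v \<le> R" unfolding bounded_iff by blast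
  then have K: "Delta x (u t) \<in> cube (2 * R)" "Delta x (u' t) \<in> cube (2 * R)" if "t \<in> {0..T}" for t x
    using that by (auto intro!: Delta_in_cube_norm)
  obtain c where c: "c > 0" "\<forall>x. \<forall>p\<in>cube (2 * R). \<forall>q\<in>cube (2 * R). p $ x = q $ x \<longrightarrow>
      H x q \<le> H x p + G x p \<bullet> (q - p) - c * (norm (q - p))\<^sup>2" using H_strong by blast
  obtain L where L: "L \<ge> 0" "\<forall>x. \<forall>p\<in>cube (2 * R). \<forall>q\<in>cube (2 * R). norm (G x p - G x q) \<le> L * norm (p - q)"
    using G_lip by blast
  define \<phi> where "\<phi> s = (u s - u' s) \<bullet> (\<mu> s - \<mu>' s)" for s
  have D: "\<exists>D. (\<phi> has_real_derivative D) (at t within {0..}) \<and> D \<le> r * \<phi> t - c * (osc (u t - u' t))\<^sup>2"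
    if t: "t \<in> {0..T}" for t
    unfolding \<phi>_def by (rule duality[OF s _ c(2) less_imp_le[OF c(1)] K[OF t]]) (use t in auto)
  have c\<phi>: "continuous_on {0..T} \<phi>"
    unfolding \<phi>_def by (intro continuous_intros cu continuous_on_subset[OF kolmogorov_continuous[OF s(2)]]
        continuous_on_subset[OF kolmogorov_continuous[OF s(5)]]) auto
  have mono: "\<phi> b \<le> exp (r * (b - a)) * \<phi> a" if "0 \<le> a" "a \<le> b" "b \<le> T" for a b
  proof (rule dini_le_exp_bound[OF that(2) continuous_on_subset[OF c\<phi>]])
    fix t assume t: "a \<le> t" "t < b"
    then have "t \<in> {0..T}" using that by auto
    from D[OF this] obtain D where D: "(\<phi> has_real_derivative D) (at t within {0..})"
      "D \<le> r * \<phi> t - c * (osc (u t - u' t))\<^sup>2" by blast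
    have "0 \<le> c * (osc (u t - u' t))\<^sup>2" using c by simp
    then show "dini_le \<phi> t {t..} (r * \<phi> t)"
      using D t that by (intro dini_le_mono[OF dini_le_right_deriv[OF deriv_right[OF D(1)]]]) auto
  qed (use that in auto)
  have \<phi>0: "\<phi> t = 0" if "t \<in> {0..T}" for t
  proof -
    have "\<phi> t \<le> 0" using mono[of 0 t] that init by (simp add: \<phi>_def)
    moreover have "0 \<le> exp (r * (T - t)) * \<phi> t" using mono[of t T] that fin by (simp add: \<phi>_def)
    ultimately show ?thesis by (smt (verit) exp_gt_zero zero_le_mult_iff)
  qed
  have O0: "osc (u t - u' t) = 0" if t: "t \<in> {0..T}" for t
  proof -
    obtain D where D: "(\<phi> has_real_derivative D) (at t within {0..})" "D \<le> r * \<phi> t - c * (osc (u t - u' t))\<^sup>2"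
      using D[OF t] by blast
    have "(\<phi> has_real_derivative D) (at t within {0..T})" using D(1) by (rule DERIV_subset) auto
    then have 1: "(\<phi> has_vector_derivative D) (at t within cbox 0 T)"
      by (simp add: has_real_derivative_iff_has_vector_derivative)
    have "((\<lambda>_. 0) has_vector_derivative 0) (at t within cbox 0 T)" by (rule has_vector_derivative_const)
    then have "(\<phi> has_vector_derivative 0) (at t within cbox 0 T)"
      by (rule has_vector_derivative_transform[rotated 2]) (use t \<phi>0 in auto)
    then have "D = 0" using vector_derivative_unique_within_closed_interval[OF _ _ 1] t T by auto
    then have "c * (osc (u t - u' t))\<^sup>2 \<le> 0" using D(2) \<phi>0[OF t] by simp
    then show ?thesis using c(1) by (simp add: mult_le_0_iff)
  qed
  have "\<mu> t = \<mu>' t" if t: "0 \<le> t" "t \<le> T" for t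
  proof -
    have "l1 (\<mu> t - \<mu>' t) \<le> exp (- (real CARD('n) * al) * (t - 0)) * l1 (\<mu> 0 - \<mu>' 0)"
    proof (rule dini_le_exp_bound[OF t(1)])
      show "continuous_on {0..t} (\<lambda>t. l1 (\<mu> t - \<mu>' t))"
        unfolding l1_def by (intro continuous_on_sum continuous_on_rabs continuous_on_component continuous_on_diff
          continuous_on_subset[OF kolmogorov_continuous[OF s(2)]]
          continuous_on_subset[OF kolmogorov_continuous[OF s(5)]]) auto
      fix q assume q: "0 \<le> q" "q < t"
      show "dini_le (\<lambda>t. l1 (\<mu> t - \<mu>' t)) q {q..} (- (real CARD('n) * al) * l1 (\<mu> q - \<mu>' q))"
        using kolmogorov_diff_point[OF s(2,3,5,6) q(1) L(2,1)] K[of q] O0[of q] q t by simp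
    qed
    moreover have "l1 (\<mu> 0 - \<mu>' 0) = 0" using init by (simp add: l1_def)
    ultimately have "norm (\<mu> t - \<mu>' t) \<le> 0" using norm_le_l1_vec[of "\<mu> t - \<mu>' t"]
      by (metis mult_zero_right order_trans)
    then show ?thesis by simp
  qed
  then show ?thesis using hjb_unique_backward[OF r s(1,4,3,6) _ fin, of 0] T by auto
qed

text \<open>Shooting for the full system: \<open>U v\<close> and \<open>M v\<close> are the costs and densities of the trajectory with
  initial costs \<open>v\<close> and initial density \<open>\<mu>0\<close>.\<close>

theorem bounded_sol_exists:
  assumes r: "0 < r" and \<mu>0: "\<mu>0 \<in> prob_simplex"
  shows "\<exists>u \<mu>. bounded_sol r u \<mu> \<and> \<mu> 0 = \<mu>0"
proof -
  interpret O: ode "\<lambda>t. field r" "N * K0 + N * RB" "N * (r + RB * (2 * N))" by (rule field_ode[OF r])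
  define U where "U v t = fst (O.flow (v, \<mu>0) t)" for v t
  define M where "M v t = snd (O.flow (v, \<mu>0) t)" for v t
  have deriv: "(O.flow (v, \<mu>0) has_vector_derivative field r (U v t, M v t)) (at t within {0..})" if "0 \<le> t" for v t
    using O.flow(1)[of "(v, \<mu>0)"] that by (simp add: O.sol_def U_def M_def)
  have dU: "(U v has_vector_derivative hj r (U v t) (proj (M v t))) (at t within {0..})" if "0 \<le> t" for v t
    using bounded_linear.has_vector_derivative[OF bounded_linear_fst deriv[OF that, of v]]
    by (simp add: field_def U_def[abs_def])
  have dM: "(M v has_vector_derivative fb (U v t, M v t)) (at t within {0..})" if "0 \<le> t" for v t
    using bounded_linear.has_vector_derivative[OF bounded_linear_snd deriv[OF that, of v]]
    by (simp add: field_def M_def[abs_def])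
  have init: "U v 0 = v" "M v 0 = \<mu>0" for v by (simp_all add: U_def M_def O.flow(2))
  have simplex: "simplex_flow (M v)" for v by (rule simplex_invariant[OF dM]) (use init \<mu>0 in auto)
  then have pM: "M v t \<in> prob_simplex" if "0 \<le> t" for v t using that by (simp add: simplex_flow_def)
  have sol: "sol r (U v) (M v)" for v
    unfolding sol_def hjb_iff kolmogorov_iff
    using simplex[of v] dU[of _ v] dM[of _ v] proj(3)[OF pM, of _ v] clip(5) prob_simplexD(1,2)[OF pM, of _ v]
    by (simp add: fb_def)
  have "\<exists>v. \<forall>t\<ge>0. norm (U v t) \<le> N * (K0 / r)"
  proof (rule shooting)
    show "continuous_on UNIV (\<lambda>v. U v t)" if "0 \<le> t" for t
      unfolding U_def by (intro continuous_on_fst continuous_on_compose2[OF O.flow_continuous[OF that]] continuous_intros) auto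
    show "norm (U v t) \<le> N * (K0 / r) + N * norm (U v T)" if "0 \<le> t" "t \<le> T" for v t T
      by (rule hjb_apriori[OF r _ simplex that]) (use sol in \<open>auto simp: sol_def\<close>)
    show "inj (\<lambda>v. U v T)" if "0 < T" for T
    proof (rule injI)
      fix v v' assume "U v T = U v' T"
      then show "v = v'" using finite_horizon_unique[OF r sol sol that, of v v'] by (simp add: init)
    qed
  qed (use N init in auto)
  then obtain v where "\<forall>t\<ge>0. norm (U v t) \<le> N * (K0 / r)" by blast
  then have "bounded (U v ` {0..})" by (auto simp: bounded_iff)
  with sol[of v] init show ?thesis unfolding bounded_sol_def by blast
qed

end

section \<open>Stationary solutions\<close>

context mfg
begin

lemma deriv_shift:
  assumes "(g has_real_derivative D) (at (t + \<tau>) within {0..})" "0 \<le> \<tau>"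
  shows "((\<lambda>s. g (s + \<tau>)) has_real_derivative D) (at t within {0..})"
proof -
  have "(g has_real_derivative D) (at (t + \<tau>) within (\<lambda>s. s + \<tau>) ` {0..})"
    by (rule DERIV_subset[OF assms(1)]) (use assms(2) in auto)
  moreover have "((\<lambda>s. s + \<tau>) has_real_derivative 1) (at t within {0..})"
    by (auto intro!: derivative_eq_intros)
  ultimately show ?thesis using DERIV_image_chain[of g D "\<lambda>s. s + \<tau>" t "{0..}" 1] by (simp add: o_def)
qed

lemma bounded_sol_shift:
  assumes "bounded_sol r u \<mu>" "0 \<le> \<tau>"
  shows "bounded_sol r (\<lambda>t. u (t + \<tau>)) (\<lambda>t. \<mu> (t + \<tau>))"
proof -
  have "bounded ((\<lambda>t. u (t + \<tau>)) ` {0..})"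
  proof (rule bounded_subset)
    show "bounded (u ` {0..})" using assms by (simp add: bounded_sol_def)
    show "(\<lambda>t. u (t + \<tau>)) ` {0..} \<subseteq> u ` {0..}" using assms(2) by (auto intro!: imageI)
  qed
  then show ?thesis
    using assms unfolding bounded_sol_def sol_def hjb_def kolmogorov_def simplex_flow_def
    by (auto intro!: deriv_shift)
qed

text \<open>Viewed as constant bounded solutions, stationary solutions are subject to the stability theorem.\<close>

lemma constant_bounded_sol_iff:
  "bounded_sol r (\<lambda>_. ub) (\<lambda>_. mb) \<longleftrightarrow> mb \<in> prob_simplex \<and>
    (\<forall>x. r * ub $ x - H x (Delta x ub) - F x mb = 0) \<and>
    (\<forall>x. (\<Sum>y\<in>UNIV. mb $ y * G y (Delta y ub) $ x) = 0)"
proof -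
  have iff: "(\<forall>t\<ge>0. ((\<lambda>_. c) has_real_derivative D) (at t within {0..})) \<longleftrightarrow> D = 0" for c D :: real
  proof
    assume a: "\<forall>t\<ge>0. ((\<lambda>_. c) has_real_derivative D) (at t within {0..})"
    \<comment> \<open>At an interior point of the half-line derivatives are unique.\<close>
    have "at (1::real) within {0..} = at 1" by (rule at_within_interior) simp
    then have "((\<lambda>_. c) has_real_derivative D) (at 1)" using a[rule_format, of 1] by simp
    then show "D = 0" using DERIV_const DERIV_unique by blast
  qed auto
  have "hjb r (\<lambda>_. ub) (\<lambda>_. mb) \<longleftrightarrow> (\<forall>x. r * ub $ x - H x (Delta x ub) - F x mb = 0)"
    unfolding hjb_def using iff by blast
  moreover have "kolmogorov (\<lambda>_. ub) (\<lambda>_. mb) \<longleftrightarrow> (\<forall>x. (\<Sum>y\<in>UNIV. mb $ y * G y (Delta y ub) $ x) = 0)"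
    unfolding kolmogorov_def using iff by blast
  moreover have "bounded ((\<lambda>_. ub) ` {0::real..})" by (auto simp: bounded_iff)
  ultimately show ?thesis by (auto simp: bounded_sol_def sol_def simplex_flow_def)
qed

text \<open>The time-\<open>T\<close> map on initial densities is a contraction for large \<open>T\<close>. The solution issuing from
  its fixed point is periodic, and by stability under time shifts it must be constant.\<close>

lemma constant_solution_exists:
  assumes r: "0 < r" and \<gamma>: "0 < \<gamma>"
    and stable: "\<And>u \<mu> u' \<mu>' t. bounded_sol r u \<mu> \<Longrightarrow> bounded_sol r u' \<mu>' \<Longrightarrow> 0 \<le> t \<Longrightarrow>
      l1 (\<mu> t - \<mu>' t) + supn (u t - u' t) \<le> C * exp (- \<gamma> * t) * l1 (\<mu> 0 - \<mu>' 0)"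
  shows "\<exists>ub mb. bounded_sol r (\<lambda>_. ub) (\<lambda>_. mb)"
proof -
  have "\<forall>m\<in>prob_simplex. \<exists>u \<mu>. bounded_sol r u \<mu> \<and> \<mu> 0 = m" using bounded_sol_exists[OF r] by blast
  then obtain U M where UM: "\<And>m. m \<in> prob_simplex \<Longrightarrow> bounded_sol r (U m) (M m)" "\<And>m. m \<in> prob_simplex \<Longrightarrow> M m 0 = m"
    by metis
  have decay: "((\<lambda>t. B * exp (- \<gamma> * t)) \<longlongrightarrow> 0) at_top" for B :: real
    using \<gamma> by real_asymp
  have "eventually (\<lambda>t. (\<bar>C\<bar> * N) * exp (- \<gamma> * t) < 1/2) at_top"
    by (rule order_tendstoD[OF decay]) simp
  then have "eventually (\<lambda>t. (\<bar>C\<bar> * N) * exp (- \<gamma> * t) < 1/2 \<and> 0 < t) at_top"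
    by (intro eventually_conj eventually_gt_at_top)
  then obtain T where T: "(\<bar>C\<bar> * N) * exp (- \<gamma> * T) < 1/2" "0 < T"
    using eventually_happens by fastforce
  have pM: "M m t \<in> prob_simplex" if "m \<in> prob_simplex" "0 \<le> t" for m t
    using UM(1)[OF that(1)] that(2) by (auto simp: bounded_sol_def sol_def simplex_flow_def)
  have "\<exists>!m\<in>prob_simplex. M m T = m"
  proof (rule Banach_fix[OF compact_imp_complete[OF compact_prob_simplex], where c = "1/2"])
    show "(prob_simplex :: (real^'n) set) \<noteq> {}" using axis_in_simplex by blast
    show "(\<lambda>m. M m T) ` prob_simplex \<subseteq> prob_simplex" using pM T by auto
    show "dist (M m T) (M m' T) \<le> 1/2 * dist m m'" if "m \<in> prob_simplex" "m' \<in> prob_simplex" for m m'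
    proof -
      have "dist (M m T) (M m' T) \<le> l1 (M m T - M m' T)" by (simp add: dist_norm norm_le_l1_vec)
      also have "\<dots> \<le> l1 (M m T - M m' T) + supn (U m T - U m' T)" by (simp add: supn_ge_0)
      also have "\<dots> \<le> C * exp (- \<gamma> * T) * l1 (m - m')"
        using stable[OF UM(1)[OF that(1)] UM(1)[OF that(2)], of T] T UM(2) that by simp
      also have "\<dots> \<le> \<bar>C\<bar> * exp (- \<gamma> * T) * (N * norm (m - m'))"
        using l1_le_card_norm[of "m - m'"] l1_ge_0[of "m - m'"] by (intro mult_mono) (auto simp: N_def)
      also have "\<dots> = (\<bar>C\<bar> * N * exp (- \<gamma> * T)) * dist m m'" by (simp add: dist_norm)
      also have "\<dots> \<le> 1/2 * dist m m'" using T(1) by (intro mult_right_mono) auto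
      finally show ?thesis .
    qed
  qed auto
  then obtain m where m: "m \<in> prob_simplex" "M m T = m" by blast
  define u where "u = U m"
  define \<mu> where "\<mu> = M m"
  have s: "bounded_sol r u \<mu>" and init: "\<mu> 0 = m" "\<mu> T = m" using UM m by (auto simp: u_def \<mu>_def)
  have zero: "u t = u' t \<and> \<mu> t = \<mu>' t" if "l1 (\<mu> t - \<mu>' t) + supn (u t - u' t) \<le> 0" for u u' \<mu> \<mu>' :: "real \<Rightarrow> real^'n" and t
  proof -
    have "l1 (\<mu> t - \<mu>' t) \<le> 0" "supn (u t - u' t) \<le> 0"
      using that l1_ge_0[of "\<mu> t - \<mu>' t"] supn_ge_0[of "u t - u' t"] by linarith+
    then have "norm (\<mu> t - \<mu>' t) \<le> 0" using norm_le_l1_vec[of "\<mu> t - \<mu>' t"] by linarith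
    moreover have "real CARD('n) * supn (u t - u' t) \<le> 0"
      using \<open>supn (u t - u' t) \<le> 0\<close> by (intro mult_nonneg_nonpos) auto
    then have "norm (u t - u' t) \<le> 0" using norm_le_supn[of "u t - u' t"] by linarith
    ultimately show ?thesis by simp
  qed
  have period: "u (t + T) = u t \<and> \<mu> (t + T) = \<mu> t" if "0 \<le> t" for t
  proof -
    have "l1 (\<mu> (t + T) - \<mu> t) + supn (u (t + T) - u t) \<le> C * exp (- \<gamma> * t) * l1 (\<mu> (0 + T) - \<mu> 0)"
      by (rule stable[OF bounded_sol_shift[OF s, of T] s that]) (use T in auto)
    then show ?thesis using init zero[of "\<lambda>t. \<mu> (t + T)" t \<mu> "\<lambda>t. u (t + T)" u] by (simp add: l1_def)
  qed
  have period_n: "u (t + real n * T) = u t \<and> \<mu> (t + real n * T) = \<mu> t" if "0 \<le> t" for t and n :: nat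
  proof (induction n)
    case (Suc n)
    have eq: "t + real (Suc n) * T = (t + real n * T) + T" by (simp add: algebra_simps)
    show ?case unfolding eq using period[of "t + real n * T"] Suc that T by simp
  qed simp
  \<comment> \<open>After \<open>n\<close> periods the distance of the solution from its shift by \<open>\<tau>\<close> is unchanged, but stability
    bounds it by a multiple of \<open>exp (- \<gamma> * n * T)\<close>.\<close>
  have const: "u \<tau> = u 0 \<and> \<mu> \<tau> = \<mu> 0" if \<tau>: "0 \<le> \<tau>" for \<tau>
  proof -
    let ?d = "l1 (\<mu> (0 + \<tau>) - \<mu> 0) + supn (u (0 + \<tau>) - u 0)"
    have le: "?d \<le> C * l1 (\<mu> (0 + \<tau>) - \<mu> 0) * exp (- \<gamma> * (real n * T))" for n :: nat
    proof -
      have "l1 (\<mu> (real n * T + \<tau>) - \<mu> (real n * T)) + supn (u (real n * T + \<tau>) - u (real n * T)) \<le>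
          C * exp (- \<gamma> * (real n * T)) * l1 (\<mu> (0 + \<tau>) - \<mu> 0)"
        by (rule stable[OF bounded_sol_shift[OF s \<tau>] s]) (use T in auto)
      then show ?thesis using period_n[of \<tau> n] period_n[of 0 n] \<tau> by (simp add: mult_ac add.commute)
    qed
    have "((\<lambda>n. C * l1 (\<mu> (0 + \<tau>) - \<mu> 0) * exp (- \<gamma> * (real n * T))) \<longlongrightarrow> 0) sequentially"
      using \<gamma> T(2) by real_asymp
    then have "?d \<le> 0" by (rule tendsto_lowerbound) (use le in auto)
    then show ?thesis using zero[of "\<lambda>t. \<mu> (t + \<tau>)" 0 \<mu> "\<lambda>t. u (t + \<tau>)" u] by simp
  qed
  have "bounded_sol r (\<lambda>_. u 0) (\<lambda>_. \<mu> 0)"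
  proof -
    have s': "hjb r u \<mu>" "kolmogorov u \<mu>" "simplex_flow \<mu>" using s by (auto simp: bounded_sol_def sol_def)
    have "hjb r (\<lambda>_. u 0) (\<lambda>_. \<mu> 0)"
      unfolding hjb_def
    proof (intro allI impI)
      fix t :: real and x assume t: "0 \<le> t"
      have "((\<lambda>s. u s $ x) has_real_derivative r * u 0 $ x - H x (Delta x (u 0)) - F x (\<mu> 0)) (at t within {0..})"
        using s'(1)[unfolded hjb_def, rule_format, OF t, of x]
        by (simp only: conjunct1[OF const[OF t]] conjunct2[OF const[OF t]])
      then show "((\<lambda>_. u 0 $ x) has_real_derivative r * u 0 $ x - H x (Delta x (u 0)) - F x (\<mu> 0)) (at t within {0..})"
        by (rule has_field_derivative_transform_within[of _ _ _ _ 1]) (use t in \<open>auto dest: const\<close>)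
    qed
    moreover have "kolmogorov (\<lambda>_. u 0) (\<lambda>_. \<mu> 0)"
      unfolding kolmogorov_def
    proof (intro allI impI)
      fix t :: real and x assume t: "0 \<le> t"
      have "((\<lambda>s. \<mu> s $ x) has_real_derivative (\<Sum>y\<in>UNIV. \<mu> 0 $ y * G y (Delta y (u 0)) $ x)) (at t within {0..})"
        using s'(2)[unfolded kolmogorov_def, rule_format, OF t, of x]
        by (simp only: conjunct1[OF const[OF t]] conjunct2[OF const[OF t]])
      then show "((\<lambda>_. \<mu> 0 $ x) has_real_derivative (\<Sum>y\<in>UNIV. \<mu> 0 $ y * G y (Delta y (u 0)) $ x)) (at t within {0..})"
        by (rule has_field_derivative_transform_within[of _ _ _ _ 1]) (use t in \<open>auto dest: const\<close>)
    qed
    moreover have "simplex_flow (\<lambda>_. \<mu> 0)" using s'(3) by (simp add: simplex_flow_def)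
    moreover have "bounded ((\<lambda>_. u 0) ` {0::real..})" by (auto simp: bounded_iff)
    ultimately show ?thesis by (simp add: bounded_sol_def sol_def)
  qed
  then show ?thesis by blast
qed

end

section \<open>The jump process: first-step analysis\<close>

text \<open>The chain is built by adding steps at its end, whereas first-step analysis removes them at its
  beginning; both are described by the map \<open>jump_step\<close> on starting points (\<open>jump_chain_shift\<close>).\<close>

definition jump_step ::
  "(real \<Rightarrow> 'n \<Rightarrow> real^'n) \<Rightarrow> real \<times> 'n \<Rightarrow> real \<times> 'n \<times> real \<Rightarrow> real \<times> 'n" where
  "jump_step \<alpha> p w = (case p of (t, z) \<Rightarrow> case w of (e, y, v) \<Rightarrow>
     (t + max 0 e, if v \<le> \<alpha> (t + max 0 e) z $ y then y else z))"

lemma jump_chain_Suc: "jump_chain \<alpha> s x \<omega> (Suc k) = jump_step \<alpha> (jump_chain \<alpha> s x \<omega> k) (\<omega> !! k)"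
  by (simp add: jump_step_def split: prod.splits)

lemma jump_chain_shift:
  "jump_chain \<alpha> s x (w ## \<omega>) (Suc k) =
    jump_chain \<alpha> (fst (jump_step \<alpha> (s, x) w)) (snd (jump_step \<alpha> (s, x) w)) \<omega> k"
proof (induction k)
  case 0 then show ?case by (simp add: jump_step_def split: prod.splits)
next
  case (Suc k)
  show ?case unfolding jump_chain_Suc[of \<alpha> s x "w ## \<omega>" "Suc k"] Suc.IH by (simp add: jump_chain_Suc del: jump_chain.simps(2))
qed

lemma jump_step_time: "fst p \<le> fst (jump_step \<alpha> p w)"
  by (simp add: jump_step_def split: prod.splits)

definition mark_measure :: "real \<Rightarrow> (real \<times> 'n::finite \<times> real) measure" where
  "mark_measure au = density lborel (\<lambda>e. ennreal (exponential_density (real CARD('n) * au) e)) \<Otimes>\<^sub>M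
     (uniform_count_measure UNIV \<Otimes>\<^sub>M uniform_measure lborel {0..au})"

lemma jump_noise_eq: "jump_noise au = stream_space (mark_measure au)"
  by (simp add: jump_noise_def mark_measure_def)

lemma sets_mark_measure [measurable_cong]:
  "sets (mark_measure au) = sets (borel \<Otimes>\<^sub>M (count_space UNIV \<Otimes>\<^sub>M borel) :: (real \<times> 'n::finite \<times> real) measure)"
  unfolding mark_measure_def by (intro sets_pair_measure_cong) (auto simp: sets_uniform_count_measure)

abbreviation state_space :: "(real \<times> 'n) measure" where
  "state_space \<equiv> borel \<Otimes>\<^sub>M count_space UNIV"

text \<open>If the arrival times accumulated before \<open>t\<close>, the state at \<open>t\<close> would be the arbitrary value of an
  undefined \<open>LEAST\<close>; paths on which this happens have to be shown negligible.\<close>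

definition alive :: "(real \<Rightarrow> 'n \<Rightarrow> real^'n) \<Rightarrow> real \<times> 'n \<Rightarrow> (real \<times> 'n \<times> real) stream \<Rightarrow> real \<Rightarrow> bool" where
  "alive \<alpha> p \<omega> t \<longleftrightarrow> (\<exists>k. t < fst (jump_chain \<alpha> (fst p) (snd p) \<omega> (Suc k)))"

definition state :: "(real \<Rightarrow> 'n \<Rightarrow> real^'n) \<Rightarrow> real \<times> 'n \<Rightarrow> (real \<times> 'n \<times> real) stream \<Rightarrow> real \<Rightarrow> 'n" where
  "state \<alpha> p \<omega> t = jump_process \<alpha> (fst p) (snd p) \<omega> t"

lemma alive_step:
  "alive \<alpha> p (w ## \<omega>) t \<longleftrightarrow> t < fst (jump_step \<alpha> p w) \<or> alive \<alpha> (jump_step \<alpha> p w) \<omega> t"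
proof -
  obtain s x where p: "p = (s, x)" by (cases p)
  let ?p = "jump_step \<alpha> (s, x) w"
  have "(\<exists>k. t < fst (jump_chain \<alpha> s x (w ## \<omega>) (Suc k))) \<longleftrightarrow> (\<exists>k. t < fst (jump_chain \<alpha> (fst ?p) (snd ?p) \<omega> k))"
    unfolding jump_chain_shift ..
  also have "\<dots> \<longleftrightarrow> t < fst ?p \<or> (\<exists>k. t < fst (jump_chain \<alpha> (fst ?p) (snd ?p) \<omega> (Suc k)))"
    by (metis fst_conv jump_chain.simps(1) not0_implies_Suc)
  finally show ?thesis unfolding alive_def p by simp
qed

lemma alive_of_less: "t < fst p \<Longrightarrow> alive \<alpha> p \<omega> t"
  unfolding alive_def
  by (rule exI[of _ 0]) (use jump_step_time[of p \<alpha> "\<omega> !! 0"] in \<open>simp add: jump_chain_Suc del: jump_chain.simps(2)\<close>)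

lemma state_step:
  assumes "t < fst (jump_step \<alpha> p w) \<or> alive \<alpha> (jump_step \<alpha> p w) \<omega> t"
  shows "state \<alpha> p (w ## \<omega>) t = (if t < fst (jump_step \<alpha> p w) then snd p else state \<alpha> (jump_step \<alpha> p w) \<omega> t)"
proof -
  obtain s x where p: "p = (s, x)" by (cases p)
  let ?p = "jump_step \<alpha> (s, x) w"
  let ?P = "\<lambda>k. t < fst (jump_chain \<alpha> s x (w ## \<omega>) (Suc k))"
  have P0: "?P 0 \<longleftrightarrow> t < fst ?p" unfolding jump_chain_shift by simp
  show ?thesis
  proof (cases "t < fst ?p")
    case True
    then have "(LEAST k. ?P k) = 0" using P0 by (intro Least_equality) auto
    then show ?thesis using True by (simp add: state_def jump_process_def p)
  next
    case False
    then obtain k where "t < fst (jump_chain \<alpha> (fst ?p) (snd ?p) \<omega> (Suc k))"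
      using assms unfolding p alive_def by auto
    then have "?P (Suc k)" unfolding jump_chain_shift .
    then have "(LEAST k. ?P k) = Suc (LEAST k. ?P (Suc k))"
      by (rule Least_Suc) (use False P0 in simp)
    then have "jump_process \<alpha> s x (w ## \<omega>) t = snd (jump_chain \<alpha> s x (w ## \<omega>) (Suc (LEAST k. ?P (Suc k))))"
      unfolding jump_process_def by simp
    also have "\<dots> = jump_process \<alpha> (fst ?p) (snd ?p) \<omega> t"
      unfolding jump_process_def jump_chain_shift ..
    finally show ?thesis using False by (simp add: state_def p)
  qed
qed

locale jump =
  fixes al au :: real and \<alpha> :: "real \<Rightarrow> 'n::finite \<Rightarrow> real^'n"
  assumes al: "0 \<le> al" and au: "0 < au"
    and \<alpha>_meas: "\<And>x. (\<lambda>t. \<alpha> t x) \<in> borel_measurable borel"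
    and \<alpha>_rate: "\<And>t x. \<alpha> t x \<in> rate_vectors al au x"
begin

definition \<Lambda> :: real where "\<Lambda> = real CARD('n) * au"

lemma \<Lambda>: "0 < \<Lambda>" using au by (simp add: \<Lambda>_def)

lemma \<alpha>_comp_meas [measurable]: "(\<lambda>t. \<alpha> t x $ y) \<in> borel_measurable borel"
  by (rule measurable_compose[OF \<alpha>_meas]) (intro borel_measurable_continuous_onI continuous_intros)

sublocale mark: prob_space "mark_measure au :: (real \<times> 'n \<times> real) measure"
  unfolding mark_measure_def
  by (intro prob_space_pair prob_space_exponential_density prob_space_uniform_count_measure prob_space_uniform_measure)
    (use au in auto)

sublocale noise: prob_space "jump_noise au :: (real \<times> 'n \<times> real) stream measure"
  unfolding jump_noise_eq by (rule mark.prob_space_stream_space)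

lemma sets_noise [measurable_cong]:
  "sets (jump_noise au) = sets (stream_space (borel \<Otimes>\<^sub>M (count_space UNIV \<Otimes>\<^sub>M borel)) :: (real \<times> 'n \<times> real) stream measure)"
  unfolding jump_noise_eq by (rule sets_stream_space_cong) (rule sets_mark_measure)

lemma rate_meas: "(\<lambda>(t, z, y). \<alpha> t z $ y) \<in> borel_measurable (borel \<Otimes>\<^sub>M count_space UNIV \<Otimes>\<^sub>M count_space UNIV)"
proof -
  let ?M = "borel \<Otimes>\<^sub>M count_space UNIV \<Otimes>\<^sub>M count_space UNIV :: (real \<times> 'n \<times> 'n) measure"
  have "(\<lambda>q. \<alpha> (fst q) z $ (snd (snd q))) \<in> borel_measurable ?M" for z
  proof (rule measurable_compose_countable[where f = "\<lambda>y q. \<alpha> (fst q) z $ y"])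
    show "(\<lambda>q. \<alpha> (fst q) z $ y) \<in> borel_measurable ?M" for y
      by (rule measurable_compose[OF measurable_fst \<alpha>_comp_meas])
  qed measurable
  then have "(\<lambda>q. \<alpha> (fst q) (fst (snd q)) $ (snd (snd q))) \<in> borel_measurable ?M"
    by (rule measurable_compose_countable[where f = "\<lambda>z q. \<alpha> (fst q) z $ (snd (snd q))"]) measurable
  then show ?thesis by (simp add: case_prod_beta')
qed

lemma jump_step_meas [measurable]:
  "(\<lambda>(p, w). jump_step \<alpha> p w) \<in> measurable (state_space \<Otimes>\<^sub>M mark_measure au) state_space"
proof -
  let ?M = "state_space \<Otimes>\<^sub>M mark_measure au :: ((real \<times> 'n) \<times> real \<times> 'n \<times> real) measure"
  let ?t = "\<lambda>q::(real \<times> 'n) \<times> real \<times> 'n \<times> real. fst (fst q) + max 0 (fst (snd q))"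
  have 1: "?t \<in> borel_measurable ?M" by measurable
  have z: "(\<lambda>q. snd (fst q)) \<in> measurable ?M (count_space UNIV)"
    and y: "(\<lambda>q. fst (snd (snd q))) \<in> measurable ?M (count_space UNIV)" by measurable
  have "(\<lambda>q. (?t q, snd (fst q), fst (snd (snd q)))) \<in> measurable ?M (borel \<Otimes>\<^sub>M count_space UNIV \<Otimes>\<^sub>M count_space UNIV)"
    using 1 z y by simp
  from measurable_compose[OF this rate_meas]
  have 2: "(\<lambda>q. \<alpha> (?t q) (snd (fst q)) $ (fst (snd (snd q)))) \<in> borel_measurable ?M" by simp
  have "(\<lambda>q. if snd (snd (snd q)) \<le> \<alpha> (?t q) (snd (fst q)) $ (fst (snd (snd q))) then fst (snd (snd q)) else snd (fst q))
      \<in> measurable ?M (count_space UNIV)"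
  proof (rule measurable_If[OF y z])
    have "(\<lambda>q. snd (snd (snd q))) \<in> borel_measurable ?M" by measurable
    from borel_measurable_le[OF this 2]
    show "{q\<in>space ?M. snd (snd (snd q)) \<le> \<alpha> (?t q) (snd (fst q)) $ (fst (snd (snd q)))} \<in> sets ?M" .
  qed
  with 1 have "(\<lambda>q. (?t q, if snd (snd (snd q)) \<le> \<alpha> (?t q) (snd (fst q)) $ (fst (snd (snd q))) then fst (snd (snd q)) else snd (fst q)))
      \<in> measurable ?M state_space" by simp
  then show ?thesis by (simp add: jump_step_def case_prod_beta' fun_eq_iff cong: measurable_cong)
qed

lemma jump_chain_meas [measurable]:
  "(\<lambda>(p, \<omega>). jump_chain \<alpha> (fst p) (snd p) \<omega> k) \<in> measurable (state_space \<Otimes>\<^sub>M jump_noise au) state_space"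
proof (induction k)
  case 0
  then show ?case by simp
next
  case (Suc k)
  have "(\<lambda>q. (jump_chain \<alpha> (fst (fst q)) (snd (fst q)) (snd q) k, snd q !! k))
      \<in> measurable (state_space \<Otimes>\<^sub>M jump_noise au) (state_space \<Otimes>\<^sub>M mark_measure au)"
  proof (rule measurable_Pair)
    show "(\<lambda>q. jump_chain \<alpha> (fst (fst q)) (snd (fst q)) (snd q) k) \<in> measurable (state_space \<Otimes>\<^sub>M jump_noise au) state_space"
      using Suc by (simp add: case_prod_beta')
    show "(\<lambda>q. snd q !! k) \<in> measurable (state_space \<Otimes>\<^sub>M jump_noise au) (mark_measure au)"
      unfolding jump_noise_eq by measurable
  qed
  from measurable_compose[OF this jump_step_meas]
  show ?case by (simp add: case_prod_beta' jump_chain_Suc del: jump_chain.simps(2))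
qed

abbreviation path_space :: "(((real \<times> 'n) \<times> (real \<times> 'n \<times> real) stream) \<times> real) measure" where
  "path_space \<equiv> (state_space \<Otimes>\<^sub>M jump_noise au) \<Otimes>\<^sub>M borel"

lemma chain_time_meas: "(\<lambda>q. fst (jump_chain \<alpha> (fst (fst (fst q))) (snd (fst (fst q))) (snd (fst q)) k)) \<in> borel_measurable path_space"
  using measurable_compose[OF measurable_compose[OF measurable_fst jump_chain_meas] measurable_fst]
  by (simp add: case_prod_beta')

lemma passed_meas: "Measurable.pred path_space
    (\<lambda>q. snd q < fst (jump_chain \<alpha> (fst (fst (fst q))) (snd (fst (fst q))) (snd (fst q)) k))"
  by (rule borel_measurable_pred_less[OF _ chain_time_meas]) measurable

lemma alive_meas: "Measurable.pred path_space (\<lambda>q. alive \<alpha> (fst (fst q)) (snd (fst q)) (snd q))"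
  unfolding alive_def by (intro pred_intros_countable passed_meas)

lemma state_meas: "(\<lambda>q. state \<alpha> (fst (fst q)) (snd (fst q)) (snd q)) \<in> measurable path_space (count_space UNIV)"
  unfolding state_def jump_process_def
proof (rule measurable_compose_countable[where f =
      "\<lambda>k q. snd (jump_chain \<alpha> (fst (fst (fst q))) (snd (fst (fst q))) (snd (fst q)) k)"])
  fix k
  show "(\<lambda>q. snd (jump_chain \<alpha> (fst (fst (fst q))) (snd (fst (fst q))) (snd (fst q)) k)) \<in> measurable path_space (count_space UNIV)"
    using measurable_compose[OF measurable_compose[OF measurable_fst jump_chain_meas] measurable_snd]
    by (simp add: case_prod_beta')
qed (intro measurable_Least passed_meas)

text \<open>Uniformization: candidate jumps to each state arrive at rate \<open>au\<close>; adding the total rate \<open>\<Lambda>\<close> to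
  the diagonal accounts for the rejected candidates.\<close>

definition rate :: "real \<Rightarrow> 'n \<Rightarrow> 'n \<Rightarrow> real" where
  "rate t x y = \<alpha> t x $ y + (if y = x then \<Lambda> else 0)"

text \<open>\<open>\<Lambda>\<close> times the expected value of \<open>g\<close> after a candidate jump out of \<open>x\<close> at time \<open>t\<close>.\<close>

definition mean :: "real \<Rightarrow> 'n \<Rightarrow> (real \<times> 'n \<Rightarrow> ennreal) \<Rightarrow> ennreal" where
  "mean t x g = (\<Sum>y\<in>UNIV. ennreal (rate t x y) * g (t, y))"

lemma rate_diag: "rate t x x = real CARD('n) * au - (\<Sum>y\<in>UNIV - {x}. \<alpha> t x $ y)"
  using \<alpha>_rate[of t x] by (simp add: rate_def rate_vectors_def \<Lambda>_def)

lemma rate_diag': "rate t x x = au + (\<Sum>y\<in>UNIV - {x}. au - \<alpha> t x $ y)"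
  by (simp add: rate_diag sum_subtractf card_Diff_singleton algebra_simps)

lemma rate_nonneg: "0 \<le> rate t x y"
proof (cases "y = x")
  case True
  have "0 \<le> (\<Sum>y\<in>UNIV - {x}. au - \<alpha> t x $ y)"
    using rate_vectorsD(2)[OF \<alpha>_rate] by (intro sum_nonneg) auto
  then show ?thesis using True rate_diag'[of t x] au by simp
next
  case False
  then show ?thesis using rate_vectorsD(1)[OF \<alpha>_rate, of y x t] al by (simp add: rate_def)
qed

lemma rate_sum: "(\<Sum>y\<in>UNIV. rate t x y) = \<Lambda>"
  using rate_vectorsD(3)[OF \<alpha>_rate, of t x] by (simp add: rate_def sum.distrib)

lemma rate_meas' [measurable]: "(\<lambda>t. rate t x y) \<in> borel_measurable borel"
  unfolding rate_def by measurable

lemma mean_meas: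
  assumes [measurable]: "\<And>y. (\<lambda>t. g (t, y)) \<in> borel_measurable borel"
  shows "(\<lambda>t. mean t x g) \<in> borel_measurable borel"
  unfolding mean_def by measurable

lemma mean_mono: "(\<And>y. g (t, y) \<le> h (t, y)) \<Longrightarrow> mean t x g \<le> mean t x h"
  unfolding mean_def by (intro sum_mono mult_left_mono) auto

lemma mean_const: "mean t x (\<lambda>q. c (fst q)) = ennreal \<Lambda> * c t"
  unfolding mean_def
  by (simp add: sum_distrib_right[symmetric] sum_ennreal rate_nonneg rate_sum)

lemma mean_add: "mean t x (\<lambda>q. g q + h q) = mean t x g + mean t x h"
  unfolding mean_def by (simp add: distrib_left sum.distrib)

lemma choice_integral:
  assumes a: "0 \<le> a" "a \<le> au"
  shows "(\<integral>\<^sup>+v. (if v \<le> a then c else d) \<partial>uniform_measure lborel {0..au}) = ennreal (a / au) * c + ennreal (1 - a / au) * d"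
proof -
  let ?U = "uniform_measure lborel {0..au}"
  have 1: "emeasure ?U {..a} = ennreal (a / au)"
  proof -
    have "{0..au} \<inter> {..a} = {0..a}" using a by auto
    then show ?thesis using a au by (simp add: divide_ennreal)
  qed
  have 2: "emeasure ?U {a<..} = ennreal (1 - a / au)"
  proof -
    have "{0..au} \<inter> {a<..} = {a<..au}" using a by auto
    then show ?thesis using a au by (simp add: divide_ennreal diff_divide_distrib)
  qed
  have "(\<integral>\<^sup>+v. (if v \<le> a then c else d) \<partial>?U) = (\<integral>\<^sup>+v. c * indicator {..a} v + d * indicator {a<..} v \<partial>?U)"
    by (intro nn_integral_cong) (auto split: split_indicator)
  also have "\<dots> = c * emeasure ?U {..a} + d * emeasure ?U {a<..}"
    by (subst nn_integral_add) (auto simp: nn_integral_cmult)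
  finally show ?thesis unfolding 1 2 by (simp add: mult.commute)
qed

text \<open>A candidate target is uniform among the \<open>CARD('n)\<close> states and accepted with probability
  \<open>\<alpha> t x $ y / au\<close>, so multiplication by \<open>\<Lambda>\<close> gives the rate \<open>\<alpha> t x $ y\<close>. Rejected candidates leave the
  process in \<open>x\<close> and account for the enlarged diagonal of \<open>rate\<close>.\<close>

lemma mark_integral:
  "ennreal \<Lambda> * (\<integral>\<^sup>+yv. g (t, if snd yv \<le> \<alpha> t x $ fst yv then fst yv else x)
      \<partial>(uniform_count_measure UNIV \<Otimes>\<^sub>M uniform_measure lborel {0..au})) = mean t x g"
proof -
  let ?U = "uniform_measure lborel {0..au}"
  let ?C = "uniform_count_measure (UNIV :: 'n set)"
  interpret U: prob_space ?U by (rule prob_space_uniform_measure) (use au in auto)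
  let ?f = "\<lambda>yv::'n\<times>real. g (t, if snd yv \<le> \<alpha> t x $ fst yv then fst yv else x)"
  have fm: "?f \<in> borel_measurable (?C \<Otimes>\<^sub>M ?U)"
  proof -
    have "(\<lambda>yv::'n\<times>real. if snd yv \<le> \<alpha> t x $ fst yv then fst yv else x) \<in> measurable (count_space UNIV \<Otimes>\<^sub>M borel) (count_space UNIV)"
    proof (rule measurable_If)
      have "(\<lambda>yv::'n\<times>real. \<alpha> t x $ fst yv) \<in> borel_measurable (count_space UNIV \<Otimes>\<^sub>M borel)"
        by (rule measurable_compose[OF measurable_fst]) simp
      then show "{yv\<in>space (count_space UNIV \<Otimes>\<^sub>M borel). snd yv \<le> \<alpha> t x $ fst yv} \<in> sets (count_space UNIV \<Otimes>\<^sub>M borel :: ('n\<times>real) measure)"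
        by (intro borel_measurable_le) measurable
    qed measurable
    from measurable_compose[OF this, of "\<lambda>y. g (t, y)" borel]
    have "?f \<in> borel_measurable (count_space UNIV \<Otimes>\<^sub>M borel)" by simp
    moreover have "sets (?C \<Otimes>\<^sub>M ?U) = sets (count_space UNIV \<Otimes>\<^sub>M borel :: ('n\<times>real) measure)"
      by (intro sets_pair_measure_cong) (auto simp: sets_uniform_count_measure)
    ultimately show ?thesis by (simp cong: measurable_cong_sets)
  qed
  have inner: "(\<integral>\<^sup>+v. ?f (y, v) \<partial>?U) = (if y = x then g (t, x) else
      ennreal (\<alpha> t x $ y / au) * g (t, y) + ennreal (1 - \<alpha> t x $ y / au) * g (t, x))" for y
  proof (cases "y = x")
    case True
    have "(\<integral>\<^sup>+v. ?f (y, v) \<partial>?U) = (\<integral>\<^sup>+v. g (t, x) \<partial>?U)" using True by (intro nn_integral_cong) auto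
    also have "\<dots> = g (t, x)" by (simp only: nn_integral_const U.emeasure_space_1 mult_1_right)
    finally show ?thesis using True by simp
  next
    case False
    have "(\<integral>\<^sup>+v. ?f (y, v) \<partial>?U) = (\<integral>\<^sup>+v. (if v \<le> \<alpha> t x $ y then g (t, y) else g (t, x)) \<partial>?U)"
      by (intro nn_integral_cong) auto
    also have "\<dots> = ennreal (\<alpha> t x $ y / au) * g (t, y) + ennreal (1 - \<alpha> t x $ y / au) * g (t, x)"
      by (rule choice_integral) (use rate_vectorsD(1,2)[OF \<alpha>_rate, of y x t] False al in auto)
    finally show ?thesis using False by simp
  qed
  have "(\<integral>\<^sup>+yv. ?f yv \<partial>(?C \<Otimes>\<^sub>M ?U)) = (\<integral>\<^sup>+y. (\<integral>\<^sup>+v. ?f (y, v) \<partial>?U) \<partial>?C)"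
    by (rule U.nn_integral_fst[OF fm, symmetric])
  also have "\<dots> = (\<Sum>y\<in>UNIV. ennreal (1 / real CARD('n)) * (\<integral>\<^sup>+v. ?f (y, v) \<partial>?U))"
    unfolding uniform_count_measure_def by (subst nn_integral_point_measure_finite) auto
  finally have eq: "(\<integral>\<^sup>+yv. ?f yv \<partial>(?C \<Otimes>\<^sub>M ?U)) = (\<Sum>y\<in>UNIV. ennreal (1 / real CARD('n)) * (\<integral>\<^sup>+v. ?f (y, v) \<partial>?U))" .
  have "ennreal \<Lambda> * (\<integral>\<^sup>+yv. ?f yv \<partial>(?C \<Otimes>\<^sub>M ?U)) =
      (\<Sum>y\<in>UNIV. ennreal \<Lambda> * (ennreal (1 / real CARD('n)) * (\<integral>\<^sup>+v. ?f (y, v) \<partial>?U)))"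
    unfolding eq by (rule sum_distrib_left)
  also have "\<dots> = (\<Sum>y\<in>UNIV. ennreal au * (\<integral>\<^sup>+v. ?f (y, v) \<partial>?U))"
  proof (intro sum.cong refl)
    fix y
    have *: "ennreal \<Lambda> * ennreal (1 / real CARD('n)) = ennreal au"
      using au by (subst ennreal_mult[symmetric]) (auto simp: \<Lambda>_def)
    show "ennreal \<Lambda> * (ennreal (1 / real CARD('n)) * (\<integral>\<^sup>+v. ?f (y, v) \<partial>?U)) = ennreal au * (\<integral>\<^sup>+v. ?f (y, v) \<partial>?U)"
      unfolding mult.assoc[symmetric] * ..
  qed
  also have "\<dots> = (\<Sum>y\<in>UNIV. (if y = x then 0 else ennreal (rate t x y) * g (t, y)) +
      ennreal (if y = x then au else au - \<alpha> t x $ y) * g (t, x))"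
  proof (intro sum.cong refl)
    fix y
    show "ennreal au * (\<integral>\<^sup>+v. ?f (y, v) \<partial>?U) = (if y = x then 0 else ennreal (rate t x y) * g (t, y)) +
      ennreal (if y = x then au else au - \<alpha> t x $ y) * g (t, x)"
    proof (cases "y = x")
      case False
      then have a: "0 \<le> \<alpha> t x $ y" "\<alpha> t x $ y \<le> au" using rate_vectorsD(1,2)[OF \<alpha>_rate, of y x t] al by auto
      have "ennreal au * ennreal (\<alpha> t x $ y / au) = ennreal (\<alpha> t x $ y)"
        using a au by (subst ennreal_mult[symmetric]) auto
      moreover have "ennreal au * ennreal (1 - \<alpha> t x $ y / au) = ennreal (au - \<alpha> t x $ y)"
        using a au by (subst ennreal_mult[symmetric]) (auto simp: field_simps)
      ultimately show ?thesis using False unfolding inner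
        by (simp add: distrib_left rate_def mult.assoc[symmetric])
    next
      case True
      then show ?thesis unfolding inner by simp
    qed
  qed
  also have "\<dots> = (\<Sum>y\<in>UNIV. if y = x then 0 else ennreal (rate t x y) * g (t, y)) +
      (\<Sum>y\<in>UNIV. ennreal (if y = x then au else au - \<alpha> t x $ y)) * g (t, x)"
    by (simp only: sum.distrib sum_distrib_right)
  also have "(\<Sum>y\<in>UNIV. ennreal (if y = x then au else au - \<alpha> t x $ y)) = ennreal (rate t x x)"
  proof -
    have "(\<Sum>y\<in>UNIV. ennreal (if y = x then au else au - \<alpha> t x $ y)) = ennreal (\<Sum>y\<in>UNIV. if y = x then au else au - \<alpha> t x $ y)"
      using rate_vectorsD(2)[OF \<alpha>_rate, of _ x t] au by (intro sum_ennreal) auto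
    also have "(\<Sum>y\<in>UNIV. if y = x then au else au - \<alpha> t x $ y) = rate t x x"
      unfolding rate_diag' by (simp add: sum.remove[of UNIV x])
    finally show ?thesis .
  qed
  also have "(\<Sum>y\<in>UNIV. if y = x then 0 else ennreal (rate t x y) * g (t, y)) + ennreal (rate t x x) * g (t, x) = mean t x g"
    unfolding mean_def by (simp add: sum.remove[of UNIV x] add.commute)
  finally show ?thesis .
qed

end

lemma nn_integral_exp_tail:
  assumes a: "0 < a"
  shows "(\<integral>\<^sup>+\<tau>. ennreal (a * exp (- a * (\<tau> - s))) * indicator {t<..} \<tau> \<partial>lborel) = ennreal (exp (- a * (t - s)))"
proof -
  have "(\<integral>\<^sup>+\<tau>. ennreal (a * exp (- a * (\<tau> - s))) * indicator {t<..} \<tau> \<partial>lborel) =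
      (\<integral>\<^sup>+\<tau>. ennreal (a * exp (- a * (\<tau> - s))) * indicator {t..} \<tau> \<partial>lborel)"
    by (rule nn_integral_cong_AE, rule AE_mp[OF AE_lborel_singleton[of t]]) (auto split: split_indicator)
  also have "\<dots> = ennreal (0 - (- exp (- a * (t - s))))"
  proof (rule nn_integral_FTC_atLeast[where F = "\<lambda>\<tau>. - exp (- a * (\<tau> - s))"])
    show "((\<lambda>\<tau>. - exp (- a * (\<tau> - s))) \<longlongrightarrow> 0) at_top" using a by real_asymp
    show "((\<lambda>\<tau>. - exp (- a * (\<tau> - s))) has_real_derivative a * exp (- a * (\<tau> - s))) (at \<tau>)" for \<tau>
      by (auto intro!: derivative_eq_intros)
  qed (use a in auto)
  finally show ?thesis by simp
qed

lemma nn_integral_exp_from: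
  assumes a: "0 < a" and c: "0 \<le> c"
  shows "(\<integral>\<^sup>+\<tau>. indicator {s..} \<tau> * ennreal (c * exp (- a * (\<tau> - s))) \<partial>lborel) = ennreal (c / a)"
proof -
  have "(\<integral>\<^sup>+\<tau>. indicator {s..} \<tau> * ennreal (c * exp (- a * (\<tau> - s))) \<partial>lborel) =
      (\<integral>\<^sup>+\<tau>. ennreal (c * exp (- a * (\<tau> - s))) * indicator {s..} \<tau> \<partial>lborel)"
    by (simp add: mult.commute)
  also have "\<dots> = ennreal (0 - (- (c / a) * exp (- a * (s - s))))"
  proof (rule nn_integral_FTC_atLeast[where F = "\<lambda>\<tau>. - (c / a) * exp (- a * (\<tau> - s))"])
    show "((\<lambda>\<tau>. - (c / a) * exp (- a * (\<tau> - s))) \<longlongrightarrow> 0) at_top" using a by real_asymp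
    show "((\<lambda>\<tau>. - (c / a) * exp (- a * (\<tau> - s))) has_real_derivative c * exp (- a * (\<tau> - s))) (at \<tau>)" for \<tau>
      using a by (auto intro!: derivative_eq_intros)
  qed (use a c in auto)
  finally show ?thesis by simp
qed

context jump
begin

definition expect :: "(real \<times> 'n \<Rightarrow> (real \<times> 'n \<times> real) stream \<Rightarrow> ennreal) \<Rightarrow> real \<times> 'n \<Rightarrow> ennreal" where
  "expect \<Psi> p = (\<integral>\<^sup>+\<omega>. \<Psi> p \<omega> \<partial>jump_noise au)"

lemma section_meas: "(\<lambda>t. (t, y)) \<in> measurable borel state_space"
  by measurable

lemma expect_meas:
  assumes "(\<lambda>(p, \<omega>). \<Psi> p \<omega>) \<in> borel_measurable (state_space \<Otimes>\<^sub>M jump_noise au)"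
  shows "(\<lambda>t. expect \<Psi> (t, y)) \<in> borel_measurable borel"
proof -
  have "expect \<Psi> \<in> borel_measurable state_space"
    unfolding expect_def[abs_def] using assms by (intro noise.borel_measurable_nn_integral) (simp add: case_prod_beta')
  from measurable_compose[OF section_meas this] show ?thesis .
qed

text \<open>Conditioning on the first candidate jump, whose time has the density \<open>\<Lambda> * exp (- \<Lambda> * (\<tau> - s))\<close> on
  \<open>[s,\<infinity>)\<close>. The term \<open>c\<close> is what the functional collects up to that time.\<close>

lemma first_step:
  assumes \<Psi>: "(\<lambda>(p, \<omega>). \<Psi> p \<omega>) \<in> borel_measurable (state_space \<Otimes>\<^sub>M jump_noise au)"
    and c [measurable]: "c \<in> borel_measurable borel"
    and step: "\<And>w \<omega>. \<Psi> (s, x) (w ## \<omega>) = c (fst (jump_step \<alpha> (s, x) w)) + \<Psi> (jump_step \<alpha> (s, x) w) \<omega>"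
  shows "expect \<Psi> (s, x) = (\<integral>\<^sup>+\<tau>. indicator {s..} \<tau> * (ennreal (\<Lambda> * exp (- \<Lambda> * (\<tau> - s))) * c \<tau> +
    ennreal (exp (- \<Lambda> * (\<tau> - s))) * mean \<tau> x (expect \<Psi>)) \<partial>lborel)"
proof -
  let ?D = "density lborel (\<lambda>e. ennreal (exponential_density (real CARD('n) * au) e))"
  let ?CU = "uniform_count_measure (UNIV :: 'n set) \<Otimes>\<^sub>M uniform_measure lborel {0..au}"
  interpret CU: prob_space ?CU
    by (intro prob_space_pair prob_space_uniform_count_measure prob_space_uniform_measure) (use au in auto)
  have Em: "expect \<Psi> \<in> borel_measurable state_space"
    unfolding expect_def[abs_def] using \<Psi> by (intro noise.borel_measurable_nn_integral) (simp add: case_prod_beta')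
  have sm: "(\<lambda>w. jump_step \<alpha> (s, x) w) \<in> measurable (mark_measure au) state_space"
  proof -
    have "(\<lambda>w. ((s, x), w)) \<in> measurable (mark_measure au) (state_space \<Otimes>\<^sub>M mark_measure au)" by measurable
    from measurable_compose[OF this jump_step_meas] show ?thesis by simp
  qed
  have \<Psi>sec: "(\<lambda>\<omega>. \<Psi> p \<omega>) \<in> borel_measurable (jump_noise au)" for p
  proof -
    have "(\<lambda>\<omega>. (p, \<omega>)) \<in> measurable (jump_noise au) (state_space \<Otimes>\<^sub>M jump_noise au)" by (simp add: space_pair_measure)
    from measurable_compose[OF this \<Psi>] show ?thesis by simp
  qed
  define h where "h w = c (fst (jump_step \<alpha> (s, x) w)) + expect \<Psi> (jump_step \<alpha> (s, x) w)" for w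
  have hm: "h \<in> borel_measurable (mark_measure au)"
    unfolding h_def[abs_def]
    by (intro borel_measurable_add measurable_compose[OF measurable_compose[OF sm measurable_fst] c]
        measurable_compose[OF sm Em])
  define I where "I \<tau> = (\<integral>\<^sup>+yv. expect \<Psi> (\<tau>, if snd yv \<le> \<alpha> \<tau> x $ fst yv then fst yv else x) \<partial>?CU)" for \<tau>
  have I: "ennreal \<Lambda> * I \<tau> = mean \<tau> x (expect \<Psi>)" for \<tau>
    unfolding I_def by (rule mark_integral)
  have [measurable]: "I \<in> borel_measurable borel"
  proof -
    have "ennreal (1 / \<Lambda>) * (ennreal \<Lambda> * I \<tau>) = I \<tau>" for \<tau>
      using \<Lambda> by (simp add: mult.assoc[symmetric] ennreal_mult[symmetric])
    then have "I = (\<lambda>\<tau>. ennreal (1 / \<Lambda>) * mean \<tau> x (expect \<Psi>))" unfolding I by (auto simp: fun_eq_iff)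
    then show ?thesis using mean_meas[of "expect \<Psi>" x, OF expect_meas[OF \<Psi>]] by simp
  qed
  have "expect \<Psi> (s, x) = (\<integral>\<^sup>+w. (\<integral>\<^sup>+\<omega>. \<Psi> (s, x) (w ## \<omega>) \<partial>jump_noise au) \<partial>mark_measure au)"
    unfolding expect_def jump_noise_eq
    by (rule mark.nn_integral_stream_space) (use \<Psi>sec in \<open>simp add: jump_noise_eq\<close>)
  also have "\<dots> = (\<integral>\<^sup>+w. h w \<partial>mark_measure au)"
  proof (intro nn_integral_cong)
    fix w
    show "(\<integral>\<^sup>+\<omega>. \<Psi> (s, x) (w ## \<omega>) \<partial>jump_noise au) = h w"
      unfolding step h_def expect_def
      by (subst nn_integral_add) (use \<Psi>sec noise.emeasure_space_1 in auto)
  qed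
  also have "\<dots> = (\<integral>\<^sup>+e. (\<integral>\<^sup>+yv. h (e, yv) \<partial>?CU) \<partial>?D)"
    unfolding mark_measure_def
    by (rule CU.nn_integral_fst[symmetric]) (use hm in \<open>simp add: mark_measure_def\<close>)
  also have "\<dots> = (\<integral>\<^sup>+e. c (s + max 0 e) + I (s + max 0 e) \<partial>?D)"
  proof (intro nn_integral_cong)
    fix e
    let ?\<tau> = "s + max 0 e"
    have h: "h (e, yv) = c ?\<tau> + expect \<Psi> (?\<tau>, if snd yv \<le> \<alpha> ?\<tau> x $ fst yv then fst yv else x)" for yv
      by (simp add: h_def jump_step_def case_prod_beta)
    have m: "(\<lambda>yv. expect \<Psi> (?\<tau>, if snd yv \<le> \<alpha> ?\<tau> x $ fst yv then fst yv else x)) \<in> borel_measurable ?CU"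
    proof -
      have "(\<lambda>yv. jump_step \<alpha> (s, x) (e, yv)) \<in> measurable ?CU state_space"
        using sm unfolding mark_measure_def by (rule measurable_compose[rotated]) (simp add: space_pair_measure)
      from measurable_compose[OF this Em] show ?thesis by (simp add: jump_step_def case_prod_beta)
    qed
    show "(\<integral>\<^sup>+yv. h (e, yv) \<partial>?CU) = c ?\<tau> + I ?\<tau>"
      unfolding h I_def by (subst nn_integral_add) (use m CU.emeasure_space_1 in auto)
  qed
  also have "\<dots> = (\<integral>\<^sup>+e. ennreal (exponential_density \<Lambda> e) * (c (s + max 0 e) + I (s + max 0 e)) \<partial>lborel)"
    unfolding \<Lambda>_def by (rule nn_integral_density) measurable
  also have "\<dots> = (\<integral>\<^sup>+e. indicator {s..} (s + 1 * e) * (ennreal (\<Lambda> * exp (- \<Lambda> * (s + 1 * e - s))) * (c (s + 1 * e) + I (s + 1 * e))) \<partial>lborel)"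
    by (intro nn_integral_cong) (auto simp: exponential_density_def mult.commute split: split_indicator)
  also have "\<dots> = (\<integral>\<^sup>+\<tau>. indicator {s..} \<tau> * (ennreal (\<Lambda> * exp (- \<Lambda> * (\<tau> - s))) * (c \<tau> + I \<tau>)) \<partial>lborel)"
    by (subst nn_integral_real_affine[of "\<lambda>\<tau>. indicator {s..} \<tau> * (ennreal (\<Lambda> * exp (- \<Lambda> * (\<tau> - s))) * (c \<tau> + I \<tau>))" 1 s]) simp_all
  also have "\<dots> = (\<integral>\<^sup>+\<tau>. indicator {s..} \<tau> * (ennreal (\<Lambda> * exp (- \<Lambda> * (\<tau> - s))) * c \<tau> +
    ennreal (exp (- \<Lambda> * (\<tau> - s))) * mean \<tau> x (expect \<Psi>)) \<partial>lborel)"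
  proof (intro nn_integral_cong)
    fix \<tau>
    have "ennreal (\<Lambda> * exp (- \<Lambda> * (\<tau> - s))) * I \<tau> = ennreal (exp (- \<Lambda> * (\<tau> - s))) * mean \<tau> x (expect \<Psi>)"
      unfolding I[symmetric] using \<Lambda> by (simp add: ennreal_mult mult_ac)
    then show "indicator {s..} \<tau> * (ennreal (\<Lambda> * exp (- \<Lambda> * (\<tau> - s))) * (c \<tau> + I \<tau>)) =
      indicator {s..} \<tau> * (ennreal (\<Lambda> * exp (- \<Lambda> * (\<tau> - s))) * c \<tau> + ennreal (exp (- \<Lambda> * (\<tau> - s))) * mean \<tau> x (expect \<Psi>))"
      by (simp only: distrib_left)
  qed
  finally show ?thesis .
qed

text \<open>Each iteration of the equation improves the exponential bound on the excess of the subsolution over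
  the supersolution by the factor \<open>\<Lambda> / (\<Lambda> + \<kappa>)\<close>.\<close>

lemma renewal_comparison:
  assumes \<kappa>: "0 < \<kappa>" and C: "0 \<le> C"
    and k: "\<And>x. (\<lambda>\<tau>. k \<tau> x) \<in> borel_measurable borel" and V: "\<And>y. (\<lambda>t. V (t, y)) \<in> borel_measurable borel"
    and sub: "\<And>s x. 0 \<le> s \<Longrightarrow> D (s, x) \<le>
      (\<integral>\<^sup>+\<tau>. indicator {s..} \<tau> * (ennreal (exp (- \<Lambda> * (\<tau> - s))) * (k \<tau> x + mean \<tau> x D)) \<partial>lborel)"
    and super: "\<And>s x. 0 \<le> s \<Longrightarrow>
      (\<integral>\<^sup>+\<tau>. indicator {s..} \<tau> * (ennreal (exp (- \<Lambda> * (\<tau> - s))) * (k \<tau> x + mean \<tau> x V)) \<partial>lborel) \<le> V (s, x)"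
    and bound: "\<And>s x. 0 \<le> s \<Longrightarrow> D (s, x) \<le> ennreal (C * exp (- \<kappa> * s))"
    and s: "0 \<le> s"
  shows "D (s, x) \<le> V (s, x)"
proof -
  define q where "q = \<Lambda> / (\<Lambda> + \<kappa>)"
  have q: "0 \<le> q" "q < 1" using \<Lambda> \<kappa> by (auto simp: q_def)
  have iter: "D (s, x) \<le> V (s, x) + ennreal (C * q ^ n * exp (- \<kappa> * s))" if "0 \<le> s" for n s x
    using that
  proof (induction n arbitrary: s x)
    case 0
    then show ?case using bound[of s x] by (simp add: add_increasing)
  next
    case (Suc n)
    let ?e = "\<lambda>\<tau>. ennreal (exp (- \<Lambda> * (\<tau> - s)))"
    let ?B = "C * q ^ n"
    have B: "0 \<le> ?B" using C q by simp
    have [measurable]: "(\<lambda>\<tau>. mean \<tau> x V) \<in> borel_measurable borel" by (rule mean_meas[OF V])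
    note [measurable] = k
    have "D (s, x) \<le> (\<integral>\<^sup>+\<tau>. indicator {s..} \<tau> * (?e \<tau> * (k \<tau> x + mean \<tau> x D)) \<partial>lborel)" by (rule sub[OF Suc.prems])
    also have "\<dots> \<le> (\<integral>\<^sup>+\<tau>. indicator {s..} \<tau> * (?e \<tau> * (k \<tau> x + mean \<tau> x V)) +
        indicator {s..} \<tau> * ennreal (\<Lambda> * ?B * exp (- \<kappa> * s) * exp (- (\<Lambda> + \<kappa>) * (\<tau> - s))) \<partial>lborel)"
    proof (intro nn_integral_mono)
      fix \<tau>
      show "indicator {s..} \<tau> * (?e \<tau> * (k \<tau> x + mean \<tau> x D)) \<le> indicator {s..} \<tau> * (?e \<tau> * (k \<tau> x + mean \<tau> x V)) +
        indicator {s..} \<tau> * ennreal (\<Lambda> * ?B * exp (- \<kappa> * s) * exp (- (\<Lambda> + \<kappa>) * (\<tau> - s)))"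
      proof (cases "s \<le> \<tau>")
        case True
        have "mean \<tau> x D \<le> mean \<tau> x (\<lambda>p. V p + ennreal (?B * exp (- \<kappa> * fst p)))"
          by (rule mean_mono) (use Suc.IH[of \<tau>] True Suc.prems in auto)
        also have "\<dots> = mean \<tau> x V + ennreal \<Lambda> * ennreal (?B * exp (- \<kappa> * \<tau>))"
          by (simp only: mean_add mean_const[of \<tau> x "\<lambda>t. ennreal (?B * exp (- \<kappa> * t))"])
        finally have "?e \<tau> * (k \<tau> x + mean \<tau> x D) \<le> ?e \<tau> * (k \<tau> x + mean \<tau> x V) + ?e \<tau> * (ennreal \<Lambda> * ennreal (?B * exp (- \<kappa> * \<tau>)))"
          unfolding distrib_left[symmetric] by (intro mult_left_mono) (auto simp: add.assoc intro: add_left_mono)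
        moreover have "?e \<tau> * (ennreal \<Lambda> * ennreal (?B * exp (- \<kappa> * \<tau>))) =
            ennreal (\<Lambda> * ?B * exp (- \<kappa> * s) * exp (- (\<Lambda> + \<kappa>) * (\<tau> - s)))"
        proof -
          have "exp (- \<Lambda> * (\<tau> - s)) * (\<Lambda> * (?B * exp (- \<kappa> * \<tau>))) = \<Lambda> * ?B * exp (- \<kappa> * s) * exp (- (\<Lambda> + \<kappa>) * (\<tau> - s))"
            by (simp add: mult_ac exp_add[symmetric]) (simp add: algebra_simps)
          then show ?thesis using \<Lambda> B by (simp add: ennreal_mult[symmetric])
        qed
        ultimately show ?thesis using True by simp
      qed simp
    qed
    also have "\<dots> = (\<integral>\<^sup>+\<tau>. indicator {s..} \<tau> * (?e \<tau> * (k \<tau> x + mean \<tau> x V)) \<partial>lborel) +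
        (\<integral>\<^sup>+\<tau>. indicator {s..} \<tau> * ennreal (\<Lambda> * ?B * exp (- \<kappa> * s) * exp (- (\<Lambda> + \<kappa>) * (\<tau> - s))) \<partial>lborel)"
      by (intro nn_integral_add) measurable
    also have "\<dots> \<le> V (s, x) + ennreal (\<Lambda> * ?B * exp (- \<kappa> * s) / (\<Lambda> + \<kappa>))"
      using super[OF Suc.prems, of x] nn_integral_exp_from[of "\<Lambda> + \<kappa>" "\<Lambda> * ?B * exp (- \<kappa> * s)" s] \<Lambda> \<kappa> B
      by (intro add_mono) auto
    also have "\<Lambda> * ?B * exp (- \<kappa> * s) / (\<Lambda> + \<kappa>) = C * q ^ Suc n * exp (- \<kappa> * s)" by (simp add: q_def)
    finally show ?case .
  qed
  show ?thesis
  proof (rule ennreal_le_epsilon)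
    fix e :: real assume e: "0 < e"
    have "(\<lambda>n. C * q ^ n * exp (- \<kappa> * s)) \<longlonglongrightarrow> C * 0 * exp (- \<kappa> * s)"
      by (intro tendsto_intros LIMSEQ_power_zero) (use q in auto)
    then have "eventually (\<lambda>n. C * q ^ n * exp (- \<kappa> * s) < e) sequentially"
      using e by (intro order_tendstoD) auto
    then obtain n where "C * q ^ n * exp (- \<kappa> * s) < e" by (auto simp: eventually_sequentially)
    then have "V (s, x) + ennreal (C * q ^ n * exp (- \<kappa> * s)) \<le> V (s, x) + ennreal e"
      by (intro add_left_mono ennreal_leI) simp
    with iter[OF s, of x n] show "D (s, x) \<le> V (s, x) + ennreal e" by (rule order_trans)
  qed
qed

text \<open>The probability that the process is not determined at \<open>t\<close> is a subsolution of the homogeneous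
  renewal equation. It vanishes for starting times after \<open>t\<close> and is therefore at most \<open>exp (t - s)\<close>, so
  the comparison with the solution \<open>0\<close> applies.\<close>

lemma expect_not_alive:
  assumes s: "0 \<le> s"
  shows "expect (\<lambda>p \<omega>. of_bool (\<not> alive \<alpha> p \<omega> t)) (s, x) = 0"
proof -
  let ?\<Psi> = "\<lambda>p \<omega>. of_bool (\<not> alive \<alpha> p \<omega> t) :: ennreal"
  have "(\<lambda>q. (q, t)) \<in> measurable (state_space \<Otimes>\<^sub>M jump_noise au) path_space" by (simp add: space_pair_measure)
  from measurable_compose[OF this alive_meas]
  have [measurable]: "Measurable.pred (state_space \<Otimes>\<^sub>M jump_noise au) (\<lambda>q. alive \<alpha> (fst q) (snd q) t)" by simp
  have meas: "(\<lambda>(p, \<omega>). ?\<Psi> p \<omega>) \<in> borel_measurable (state_space \<Otimes>\<^sub>M jump_noise au)"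
    unfolding case_prod_beta' by measurable
  have step: "?\<Psi> (s, x) (w ## \<omega>) = 0 + ?\<Psi> (jump_step \<alpha> (s, x) w) \<omega>" for s x w \<omega>
    unfolding alive_step using alive_of_less[of t "jump_step \<alpha> (s, x) w" \<alpha> \<omega>] by auto
  have "expect ?\<Psi> (s, x) \<le> 0"
  proof (rule renewal_comparison[of 1 "exp t" "\<lambda>_ _. 0" "\<lambda>_. 0"])
    show "expect ?\<Psi> (s, x) \<le> (\<integral>\<^sup>+\<tau>. indicator {s..} \<tau> * (ennreal (exp (- \<Lambda> * (\<tau> - s))) * (0 + mean \<tau> x (expect ?\<Psi>))) \<partial>lborel)" for s x
      by (subst first_step[OF meas _ step]) auto
    show "expect ?\<Psi> (s, x) \<le> ennreal (exp t * exp (- 1 * s))" for s x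
    proof (cases "s \<le> t")
      case True
      have "expect ?\<Psi> (s, x) \<le> (\<integral>\<^sup>+\<omega>. 1 \<partial>(jump_noise au :: (real \<times> 'n \<times> real) stream measure))" unfolding expect_def by (intro nn_integral_mono) simp
      also have "\<dots> = ennreal 1" using noise.emeasure_space_1 by simp
      also have "\<dots> \<le> ennreal (exp t * exp (- 1 * s))" using True by (intro ennreal_leI) (simp add: exp_add[symmetric])
      finally show ?thesis .
    next
      case False
      then have "?\<Psi> (s, x) \<omega> = 0" for \<omega> using alive_of_less[of t "(s, x)"] by auto
      then show ?thesis unfolding expect_def by simp
    qed
  qed (use s in \<open>auto simp: mean_def\<close>)
  then show ?thesis by simp
qed

lemma AE_alive:
  assumes s: "0 \<le> s"
  shows "AE \<omega> in jump_noise au. \<forall>t. alive \<alpha> (s, x) \<omega> t"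
proof -
  have "AE \<omega> in jump_noise au. alive \<alpha> (s, x) \<omega> t" for t :: real
  proof -
    have "(\<lambda>\<omega>. (((s, x), \<omega>), t)) \<in> measurable (jump_noise au) path_space" by (simp add: space_pair_measure)
    from measurable_compose[OF this alive_meas]
    have [measurable]: "Measurable.pred (jump_noise au) (\<lambda>\<omega>. alive \<alpha> (s, x) \<omega> t)" by simp
    have "AE \<omega> in jump_noise au. of_bool (\<not> alive \<alpha> (s, x) \<omega> t) = (0 :: ennreal)"
      using expect_not_alive[OF s, of t x] unfolding expect_def by (subst nn_integral_0_iff_AE[symmetric]) auto
    then show ?thesis by eventually_elim simp
  qed
  then have "AE \<omega> in jump_noise au. \<forall>m::nat. alive \<alpha> (s, x) \<omega> (real m)" by (simp add: AE_all_countable)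
  then show ?thesis
  proof eventually_elim
    case (elim \<omega>)
    show ?case
    proof
      fix t :: real
      have "alive \<alpha> (s, x) \<omega> (real (nat \<lceil>t\<rceil>))" using elim by blast
      then show "alive \<alpha> (s, x) \<omega> t" unfolding alive_def using real_nat_ceiling_ge[of t] by (meson order_le_less_trans)
    qed
  qed
qed

lemma space_noise: "space (jump_noise au) = (UNIV :: (real \<times> 'n \<times> real) stream set)"
  unfolding jump_noise_eq
  by (simp add: space_stream_space mark_measure_def space_pair_measure space_uniform_count_measure)

section \<open>Transition probabilities and expected costs\<close>

text \<open>As functionals of the starting point, transition probabilities and costs only count times after
  the starting time at which the process is determined. This makes the first-step decomposition hold
  on every path.\<close>

definition transition :: "real \<Rightarrow> 'n \<Rightarrow> real \<times> 'n \<Rightarrow> ennreal" where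
  "transition t y = expect (\<lambda>p \<omega>. of_bool (fst p \<le> t \<and> alive \<alpha> p \<omega> t \<and> state \<alpha> p \<omega> t = y))"

lemma transition_integrand_meas:
  "(\<lambda>(p, \<omega>). of_bool (fst p \<le> t \<and> alive \<alpha> p \<omega> t \<and> state \<alpha> p \<omega> t = y) :: ennreal)
    \<in> borel_measurable (state_space \<Otimes>\<^sub>M jump_noise au)"
proof -
  have "(\<lambda>q. (q, t)) \<in> measurable (state_space \<Otimes>\<^sub>M jump_noise au) path_space" by (simp add: space_pair_measure)
  from measurable_compose[OF this alive_meas] measurable_compose[OF this state_meas]
  have [measurable]: "Measurable.pred (state_space \<Otimes>\<^sub>M jump_noise au) (\<lambda>q. alive \<alpha> (fst q) (snd q) t)"
    "(\<lambda>q. state \<alpha> (fst q) (snd q) t) \<in> measurable (state_space \<Otimes>\<^sub>M jump_noise au) (count_space UNIV)" by simp_all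
  show ?thesis unfolding case_prod_beta' by measurable
qed

lemma transition_meas [measurable]: "(\<lambda>s. transition t y (s, x)) \<in> borel_measurable borel"
  unfolding transition_def by (rule expect_meas[OF transition_integrand_meas])

lemma transition_le_1: "transition t y p \<le> 1"
proof -
  have "transition t y p \<le> (\<integral>\<^sup>+\<omega>. 1 \<partial>(jump_noise au :: (real \<times> 'n \<times> real) stream measure))" unfolding transition_def expect_def by (intro nn_integral_mono) simp
  then show ?thesis using noise.emeasure_space_1 by simp
qed

lemma transition_after: "t < s \<Longrightarrow> transition t y (s, x) = 0"
  unfolding transition_def expect_def by simp

lemma transition_eq_prob:
  assumes "0 \<le> s" "s \<le> t"
  shows "transition t y (s, x) = ennreal (measure (jump_noise au) {\<omega> \<in> space (jump_noise au). state \<alpha> (s, x) \<omega> t = y})"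
proof -
  have "(\<lambda>\<omega>. (((s, x), \<omega>), t)) \<in> measurable (jump_noise au) path_space" by (simp add: space_pair_measure)
  from measurable_compose[OF this state_meas]
  have [measurable]: "(\<lambda>\<omega>. state \<alpha> (s, x) \<omega> t) \<in> measurable (jump_noise au) (count_space UNIV)" by simp
  have "transition t y (s, x) = (\<integral>\<^sup>+\<omega>. indicator {\<omega> \<in> space (jump_noise au). state \<alpha> (s, x) \<omega> t = y} \<omega> \<partial>jump_noise au)"
    unfolding transition_def expect_def
  proof (rule nn_integral_cong_AE)
    show "AE \<omega> in jump_noise au. of_bool (fst (s, x) \<le> t \<and> alive \<alpha> (s, x) \<omega> t \<and> state \<alpha> (s, x) \<omega> t = y) =
        (indicator {\<omega> \<in> space (jump_noise au). state \<alpha> (s, x) \<omega> t = y} \<omega> :: ennreal)"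
      using AE_alive[OF assms(1), of x] AE_space by eventually_elim (use assms in \<open>auto split: split_indicator\<close>)
  qed
  then show ?thesis by (simp add: noise.emeasure_eq_measure)
qed

lemma transition_renewal:
  assumes s: "s \<le> t"
  shows "transition t y (s, x) = of_bool (x = y) * ennreal (exp (- \<Lambda> * (t - s))) +
    (\<integral>\<^sup>+\<tau>. indicator {s..} \<tau> * (ennreal (exp (- \<Lambda> * (\<tau> - s))) * mean \<tau> x (transition t y)) \<partial>lborel)"
proof -
  let ?\<Psi> = "\<lambda>p \<omega>. of_bool (fst p \<le> t \<and> alive \<alpha> p \<omega> t \<and> state \<alpha> p \<omega> t = y) :: ennreal"
  let ?c = "\<lambda>\<tau>. of_bool (x = y) * indicator {t<..} \<tau> :: ennreal"
  have step: "?\<Psi> (s, x) (w ## \<omega>) = ?c (fst (jump_step \<alpha> (s, x) w)) + ?\<Psi> (jump_step \<alpha> (s, x) w) \<omega>" for w \<omega>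
  proof -
    let ?p = "jump_step \<alpha> (s, x) w"
    have sp: "s \<le> fst ?p" using jump_step_time[of "(s, x)" \<alpha> w] by simp
    show ?thesis
      using s sp alive_step[of \<alpha> "(s, x)" w \<omega> t] state_step[of t \<alpha> "(s, x)" w \<omega>]
      by (cases "t < fst ?p"; cases "alive \<alpha> ?p \<omega> t") (auto split: split_indicator)
  qed
  have "transition t y (s, x) = (\<integral>\<^sup>+\<tau>. indicator {s..} \<tau> * (ennreal (\<Lambda> * exp (- \<Lambda> * (\<tau> - s))) * ?c \<tau> +
      ennreal (exp (- \<Lambda> * (\<tau> - s))) * mean \<tau> x (transition t y)) \<partial>lborel)"
    unfolding transition_def by (rule first_step[OF transition_integrand_meas _ step]) measurable
  also have "\<dots> = (\<integral>\<^sup>+\<tau>. of_bool (x = y) * (ennreal (\<Lambda> * exp (- \<Lambda> * (\<tau> - s))) * indicator {t<..} \<tau>) +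
      indicator {s..} \<tau> * (ennreal (exp (- \<Lambda> * (\<tau> - s))) * mean \<tau> x (transition t y)) \<partial>lborel)"
    using s by (intro nn_integral_cong) (auto split: split_indicator)
  also have "\<dots> = of_bool (x = y) * (\<integral>\<^sup>+\<tau>. ennreal (\<Lambda> * exp (- \<Lambda> * (\<tau> - s))) * indicator {t<..} \<tau> \<partial>lborel) +
      (\<integral>\<^sup>+\<tau>. indicator {s..} \<tau> * (ennreal (exp (- \<Lambda> * (\<tau> - s))) * mean \<tau> x (transition t y)) \<partial>lborel)"
  proof -
    have [measurable]: "(\<lambda>\<tau>. mean \<tau> x (transition t y)) \<in> borel_measurable borel"
      by (rule mean_meas) (rule transition_meas)
    show ?thesis by (subst nn_integral_add) (auto simp: nn_integral_cmult)
  qed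
  finally show ?thesis by (simp only: nn_integral_exp_tail[OF \<Lambda>])
qed

definition running :: "(real \<Rightarrow> 'n \<Rightarrow> ennreal) \<Rightarrow> real \<times> 'n \<Rightarrow> ennreal" where
  "running k = expect (\<lambda>p \<omega>. \<integral>\<^sup>+t. of_bool (fst p \<le> t \<and> alive \<alpha> p \<omega> t) * k t (state \<alpha> p \<omega> t) \<partial>lborel)"

lemma cost_at_state_meas:
  fixes k :: "real \<Rightarrow> 'n \<Rightarrow> ennreal"
  assumes k: "\<And>x. (\<lambda>t. k t x) \<in> borel_measurable borel"
    and f: "f \<in> measurable M (count_space UNIV)" and g: "g \<in> measurable M borel"
  shows "(\<lambda>q. k (g q) (f q)) \<in> borel_measurable M"
  by (rule measurable_compose_countable[where f = "\<lambda>x q. k (g q) x", OF measurable_compose[OF g k] f])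

lemma running_integrand_meas:
  assumes k: "\<And>x. (\<lambda>t. k t x) \<in> borel_measurable borel"
  shows "(\<lambda>q. of_bool (fst (fst (fst q)) \<le> snd q \<and> alive \<alpha> (fst (fst q)) (snd (fst q)) (snd q)) *
    k (snd q) (state \<alpha> (fst (fst q)) (snd (fst q)) (snd q)) :: ennreal) \<in> borel_measurable path_space"
proof -
  have [measurable]: "Measurable.pred path_space (\<lambda>q. alive \<alpha> (fst (fst q)) (snd (fst q)) (snd q))" by (rule alive_meas)
  have [measurable]: "(\<lambda>q. k (snd q) (state \<alpha> (fst (fst q)) (snd (fst q)) (snd q))) \<in> borel_measurable path_space"
    by (rule cost_at_state_meas[OF k state_meas]) measurable
  show ?thesis by measurable
qed

lemma running_meas0:
  assumes k: "\<And>x. (\<lambda>t. k t x) \<in> borel_measurable borel"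
  shows "(\<lambda>(p, \<omega>). \<integral>\<^sup>+t. of_bool (fst p \<le> t \<and> alive \<alpha> p \<omega> t) * k t (state \<alpha> p \<omega> t) \<partial>lborel)
    \<in> borel_measurable (state_space \<Otimes>\<^sub>M jump_noise au)"
  unfolding case_prod_beta'
  by (rule lborel.borel_measurable_nn_integral) (use running_integrand_meas[OF k] in \<open>simp add: case_prod_beta' cong: measurable_cong_sets\<close>)

lemma running_meas:
  assumes k: "\<And>x. (\<lambda>t. k t x) \<in> borel_measurable borel"
  shows "(\<lambda>s. running k (s, x)) \<in> borel_measurable borel"
  unfolding running_def by (rule expect_meas[OF running_meas0[OF k]])

text \<open>The cost collected before the first candidate jump is an integral over cost times smaller than
  the jump time; exchanging the order of integration replaces the density of the jump time by its tail
  \<open>exp (- \<Lambda> * (t - s))\<close>.\<close>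

lemma running_renewal:
  assumes k: "\<And>x. (\<lambda>t. k t x) \<in> borel_measurable borel"
  shows "running k (s, x) =
    (\<integral>\<^sup>+\<tau>. indicator {s..} \<tau> * (ennreal (exp (- \<Lambda> * (\<tau> - s))) * (k \<tau> x + mean \<tau> x (running k))) \<partial>lborel)"
proof -
  let ?\<Psi> = "\<lambda>p \<omega>. \<integral>\<^sup>+t. of_bool (fst p \<le> t \<and> alive \<alpha> p \<omega> t) * k t (state \<alpha> p \<omega> t) \<partial>lborel"
  let ?c = "\<lambda>\<tau>. \<integral>\<^sup>+t. indicator {s..} t * of_bool (t < \<tau>) * k t x \<partial>lborel"
  note [measurable] = k
  have sec: "(\<lambda>t. of_bool (fst p \<le> t \<and> alive \<alpha> p \<omega> t) * k t (state \<alpha> p \<omega> t)) \<in> borel_measurable borel" for p \<omega>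
  proof -
    have "(\<lambda>t. ((p, \<omega>), t)) \<in> measurable borel path_space"
      by (simp add: space_pair_measure space_noise)
    from measurable_compose[OF this running_integrand_meas[OF k]] show ?thesis by simp
  qed
  have step: "?\<Psi> (s, x) (w ## \<omega>) = ?c (fst (jump_step \<alpha> (s, x) w)) + ?\<Psi> (jump_step \<alpha> (s, x) w) \<omega>" for w \<omega>
  proof -
    let ?p = "jump_step \<alpha> (s, x) w"
    have sp: "s \<le> fst ?p" using jump_step_time[of "(s, x)" \<alpha> w] by simp
    have "?\<Psi> (s, x) (w ## \<omega>) = (\<integral>\<^sup>+t. indicator {s..} t * of_bool (t < fst ?p) * k t x +
        of_bool (fst ?p \<le> t \<and> alive \<alpha> ?p \<omega> t) * k t (state \<alpha> ?p \<omega> t) \<partial>lborel)"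
    proof (intro nn_integral_cong)
      fix t
      show "of_bool (fst (s, x) \<le> t \<and> alive \<alpha> (s, x) (w ## \<omega>) t) * k t (state \<alpha> (s, x) (w ## \<omega>) t) =
        indicator {s..} t * of_bool (t < fst ?p) * k t x + of_bool (fst ?p \<le> t \<and> alive \<alpha> ?p \<omega> t) * k t (state \<alpha> ?p \<omega> t)"
        using sp alive_step[of \<alpha> "(s, x)" w \<omega> t] state_step[of t \<alpha> "(s, x)" w \<omega>]
        by (cases "t < fst ?p"; cases "alive \<alpha> ?p \<omega> t") (auto split: split_indicator)
    qed
    also have "\<dots> = ?c (fst ?p) + ?\<Psi> ?p \<omega>"
    proof -
      have [measurable]: "(\<lambda>t. of_bool (fst ?p \<le> t \<and> alive \<alpha> ?p \<omega> t) * k t (state \<alpha> ?p \<omega> t)) \<in> borel_measurable borel"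
        by (rule sec)
      show ?thesis by (rule nn_integral_add) measurable
    qed
    finally show ?thesis .
  qed
  have cm [measurable]: "?c \<in> borel_measurable borel" by measurable
  have "running k (s, x) = (\<integral>\<^sup>+\<tau>. indicator {s..} \<tau> * (ennreal (\<Lambda> * exp (- \<Lambda> * (\<tau> - s))) * ?c \<tau> +
      ennreal (exp (- \<Lambda> * (\<tau> - s))) * mean \<tau> x (running k)) \<partial>lborel)"
    unfolding running_def by (rule first_step[OF running_meas0[OF k] cm step])
  also have "\<dots> = (\<integral>\<^sup>+\<tau>. indicator {s..} \<tau> * (ennreal (\<Lambda> * exp (- \<Lambda> * (\<tau> - s))) * ?c \<tau>) \<partial>lborel) +
      (\<integral>\<^sup>+\<tau>. indicator {s..} \<tau> * (ennreal (exp (- \<Lambda> * (\<tau> - s))) * mean \<tau> x (running k)) \<partial>lborel)"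
  proof -
    have [measurable]: "(\<lambda>\<tau>. mean \<tau> x (running k)) \<in> borel_measurable borel"
      by (rule mean_meas) (rule running_meas[OF k])
    show ?thesis unfolding distrib_left by (rule nn_integral_add) measurable
  qed
  also have "(\<integral>\<^sup>+\<tau>. indicator {s..} \<tau> * (ennreal (\<Lambda> * exp (- \<Lambda> * (\<tau> - s))) * ?c \<tau>) \<partial>lborel) =
      (\<integral>\<^sup>+t. indicator {s..} t * (ennreal (exp (- \<Lambda> * (t - s))) * k t x) \<partial>lborel)"
  proof -
    have "(\<integral>\<^sup>+\<tau>. indicator {s..} \<tau> * (ennreal (\<Lambda> * exp (- \<Lambda> * (\<tau> - s))) * ?c \<tau>) \<partial>lborel) =
        (\<integral>\<^sup>+\<tau>. \<integral>\<^sup>+t. indicator {s..} \<tau> * (ennreal (\<Lambda> * exp (- \<Lambda> * (\<tau> - s))) * (indicator {s..} t * of_bool (t < \<tau>) * k t x)) \<partial>lborel \<partial>lborel)"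
      by (simp add: nn_integral_cmult)
    also have "\<dots> = (\<integral>\<^sup>+t. \<integral>\<^sup>+\<tau>. indicator {s..} \<tau> * (ennreal (\<Lambda> * exp (- \<Lambda> * (\<tau> - s))) * (indicator {s..} t * of_bool (t < \<tau>) * k t x)) \<partial>lborel \<partial>lborel)"
      by (rule lborel_pair.Fubini') measurable
    also have "\<dots> = (\<integral>\<^sup>+t. indicator {s..} t * (ennreal (exp (- \<Lambda> * (t - s))) * k t x) \<partial>lborel)"
    proof (intro nn_integral_cong)
      fix t
      have "(\<integral>\<^sup>+\<tau>. indicator {s..} \<tau> * (ennreal (\<Lambda> * exp (- \<Lambda> * (\<tau> - s))) * (indicator {s..} t * of_bool (t < \<tau>) * k t x)) \<partial>lborel) =
          (\<integral>\<^sup>+\<tau>. (indicator {s..} t * k t x) * (ennreal (\<Lambda> * exp (- \<Lambda> * (\<tau> - s))) * indicator {t<..} \<tau>) \<partial>lborel)"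
        by (intro nn_integral_cong) (auto split: split_indicator simp: mult_ac)
      also have "\<dots> = (indicator {s..} t * k t x) * ennreal (exp (- \<Lambda> * (t - s)))"
        by (subst nn_integral_cmult) (simp_all only: nn_integral_exp_tail[OF \<Lambda>], measurable)
      finally show "(\<integral>\<^sup>+\<tau>. indicator {s..} \<tau> * (ennreal (\<Lambda> * exp (- \<Lambda> * (\<tau> - s))) * (indicator {s..} t * of_bool (t < \<tau>) * k t x)) \<partial>lborel) =
        indicator {s..} t * (ennreal (exp (- \<Lambda> * (t - s))) * k t x)" by (simp add: mult_ac)
    qed
    finally show ?thesis .
  qed
  also have "(\<integral>\<^sup>+t. indicator {s..} t * (ennreal (exp (- \<Lambda> * (t - s))) * k t x) \<partial>lborel) +
      (\<integral>\<^sup>+\<tau>. indicator {s..} \<tau> * (ennreal (exp (- \<Lambda> * (\<tau> - s))) * mean \<tau> x (running k)) \<partial>lborel) =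
      (\<integral>\<^sup>+\<tau>. indicator {s..} \<tau> * (ennreal (exp (- \<Lambda> * (\<tau> - s))) * k \<tau> x) +
        indicator {s..} \<tau> * (ennreal (exp (- \<Lambda> * (\<tau> - s))) * mean \<tau> x (running k)) \<partial>lborel)"
  proof -
    have [measurable]: "(\<lambda>\<tau>. mean \<tau> x (running k)) \<in> borel_measurable borel"
      by (rule mean_meas) (rule running_meas[OF k])
    show ?thesis by (rule nn_integral_add[symmetric]) measurable
  qed
  finally show ?thesis by (simp only: distrib_left)
qed

lemma path_state_meas:
  assumes k: "\<And>x. (\<lambda>t. k t x) \<in> borel_measurable borel"
  shows "(\<lambda>t. of_bool (s \<le> t \<and> alive \<alpha> (s, x) \<omega> t) * k t (state \<alpha> (s, x) \<omega> t) :: ennreal) \<in> borel_measurable borel"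
proof -
  have "(\<lambda>t. (((s, x), \<omega>), t)) \<in> measurable borel path_space" by (simp add: space_pair_measure space_noise)
  from measurable_compose[OF this running_integrand_meas[OF k]] show ?thesis by simp
qed

lemma running_section_meas:
  assumes k: "\<And>x. (\<lambda>t. k t x) \<in> borel_measurable borel"
  shows "(\<lambda>\<omega>. \<integral>\<^sup>+t. of_bool (fst p \<le> t \<and> alive \<alpha> p \<omega> t) * k t (state \<alpha> p \<omega> t) \<partial>lborel) \<in> borel_measurable (jump_noise au)"
proof -
  have "(\<lambda>\<omega>. (p, \<omega>)) \<in> measurable (jump_noise au) (state_space \<Otimes>\<^sub>M jump_noise au)" by (simp add: space_pair_measure)
  from measurable_compose[OF this running_meas0[OF k]] show ?thesis by simp
qed

lemma running_eq:
  assumes s: "0 \<le> s"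
  shows "running k (s, x) = (\<integral>\<^sup>+\<omega>. (\<integral>\<^sup>+t\<in>{s..}. k t (state \<alpha> (s, x) \<omega> t) \<partial>lborel) \<partial>jump_noise au)"
  unfolding running_def expect_def
proof (rule nn_integral_cong_AE)
  show "AE \<omega> in jump_noise au. (\<integral>\<^sup>+t. of_bool (fst (s, x) \<le> t \<and> alive \<alpha> (s, x) \<omega> t) * k t (state \<alpha> (s, x) \<omega> t) \<partial>lborel) =
      (\<integral>\<^sup>+t\<in>{s..}. k t (state \<alpha> (s, x) \<omega> t) \<partial>lborel)"
    using AE_alive[OF s, of x]
    by eventually_elim (auto intro!: nn_integral_cong split: split_indicator)
qed

lemma running_add:
  assumes k: "\<And>x. (\<lambda>t. k t x) \<in> borel_measurable borel" and l: "\<And>x. (\<lambda>t. l t x) \<in> borel_measurable borel"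
  shows "running (\<lambda>t x. k t x + l t x) p = running k p + running l p"
proof -
  obtain s x where p: "p = (s, x)" by (cases p)
  have "(\<integral>\<^sup>+t. of_bool (s \<le> t \<and> alive \<alpha> p \<omega> t) * (k t (state \<alpha> p \<omega> t) + l t (state \<alpha> p \<omega> t)) \<partial>lborel) =
      (\<integral>\<^sup>+t. of_bool (s \<le> t \<and> alive \<alpha> p \<omega> t) * k t (state \<alpha> p \<omega> t) \<partial>lborel) +
      (\<integral>\<^sup>+t. of_bool (s \<le> t \<and> alive \<alpha> p \<omega> t) * l t (state \<alpha> p \<omega> t) \<partial>lborel)" for \<omega>
    unfolding distrib_left
    by (rule nn_integral_add) (use path_state_meas[OF k, of s x \<omega>] path_state_meas[OF l, of s x \<omega>] p in auto)
  then show ?thesis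
    unfolding running_def expect_def using running_section_meas[OF k, of p] running_section_meas[OF l, of p] p
    by (simp add: nn_integral_add)
qed

lemma running_cong:
  assumes "0 \<le> s" "\<And>t x. s \<le> t \<Longrightarrow> k t x = l t x"
  shows "running k (s, x) = running l (s, x)"
  unfolding running_eq[OF assms(1)] using assms(2)
  by (intro nn_integral_cong) (auto split: split_indicator)

lemma running_mono:
  assumes "0 \<le> s" "\<And>t x. s \<le> t \<Longrightarrow> k t x \<le> l t x"
  shows "running k (s, x) \<le> running l (s, x)"
  unfolding running_eq[OF assms(1)] using assms(2)
  by (intro nn_integral_mono) (auto split: split_indicator)

lemma running_exp:
  assumes s: "0 \<le> s" and r: "0 < r" and C: "0 \<le> C"
  shows "running (\<lambda>t x. ennreal (C * exp (- r * t))) (s, x) = ennreal (C / r * exp (- r * s))"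
proof -
  have "(\<integral>\<^sup>+t\<in>{s..}. ennreal (C * exp (- r * t)) \<partial>lborel) =
      (\<integral>\<^sup>+t. indicator {s..} t * ennreal ((C * exp (- r * s)) * exp (- r * (t - s))) \<partial>lborel)"
    by (intro nn_integral_cong) (simp add: mult.commute mult.assoc exp_add[symmetric] algebra_simps)
  also have "\<dots> = ennreal (C * exp (- r * s) / r)" using nn_integral_exp_from[OF r, of "C * exp (- r * s)" s] C by simp
  finally show ?thesis unfolding running_eq[OF s] using noise.emeasure_space_1 by simp
qed

lemma running_eq_0:
  assumes s: "0 \<le> s" and k: "AE t in lborel. 0 \<le> t \<longrightarrow> (\<forall>x. k t x = 0)"
  shows "running k (s, x) = 0"
proof -
  have "(\<integral>\<^sup>+t\<in>{s..}. k t (state \<alpha> (s, x) \<omega> t) \<partial>lborel) = (\<integral>\<^sup>+t. 0 \<partial>(lborel :: real measure))" for \<omega>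
    by (rule nn_integral_cong_AE) (use k s in \<open>auto split: split_indicator elim!: eventually_mono\<close>)
  then show ?thesis unfolding running_eq[OF s] by simp
qed

lemma transition_time_meas: "(\<lambda>t. transition t y p) \<in> borel_measurable borel"
proof -
  have "(\<lambda>q::real \<times> (real \<times> 'n \<times> real) stream. ((p, snd q), fst q)) \<in> measurable (borel \<Otimes>\<^sub>M jump_noise au) path_space"
    by (intro measurable_Pair measurable_const measurable_snd measurable_fst) (simp add: space_pair_measure)
  from measurable_compose[OF this alive_meas] measurable_compose[OF this state_meas]
  have [measurable]: "Measurable.pred (borel \<Otimes>\<^sub>M jump_noise au) (\<lambda>q. alive \<alpha> p (snd q) (fst q))"
    "(\<lambda>q. state \<alpha> p (snd q) (fst q)) \<in> measurable (borel \<Otimes>\<^sub>M jump_noise au) (count_space UNIV)" by simp_all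
  have "(\<lambda>(t, \<omega>). of_bool (fst p \<le> t \<and> alive \<alpha> p \<omega> t \<and> state \<alpha> p \<omega> t = y) :: ennreal) \<in> borel_measurable (borel \<Otimes>\<^sub>M jump_noise au)"
    unfolding case_prod_beta' by measurable
  then show ?thesis unfolding transition_def expect_def by (rule noise.borel_measurable_nn_integral)
qed

text \<open>By Tonelli's theorem, expected costs only involve the transition probabilities.\<close>

lemma running_transition:
  assumes k: "\<And>x. (\<lambda>t. k t x) \<in> borel_measurable borel"
  shows "running k p = (\<integral>\<^sup>+t. (\<Sum>y\<in>UNIV. transition t y p * k t y) \<partial>lborel)"
proof -
  interpret PS: pair_sigma_finite "lborel :: real measure" "jump_noise au :: (real \<times> 'n \<times> real) stream measure" ..
  let ?g = "\<lambda>\<omega> t. of_bool (fst p \<le> t \<and> alive \<alpha> p \<omega> t) * k t (state \<alpha> p \<omega> t)"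
  have m: "(\<lambda>(t, \<omega>). ?g \<omega> t) \<in> borel_measurable (lborel \<Otimes>\<^sub>M jump_noise au)"
  proof -
    have "(\<lambda>q::real \<times> (real \<times> 'n \<times> real) stream. ((p, snd q), fst q)) \<in> measurable (borel \<Otimes>\<^sub>M jump_noise au) path_space"
      by (intro measurable_Pair measurable_const measurable_snd measurable_fst) (simp add: space_pair_measure)
    from measurable_compose[OF this running_integrand_meas[OF k]]
    show ?thesis by (simp add: case_prod_beta' cong: measurable_cong_sets)
  qed
  have "running k p = (\<integral>\<^sup>+t. (\<integral>\<^sup>+\<omega>. ?g \<omega> t \<partial>jump_noise au) \<partial>lborel)"
    unfolding running_def expect_def by (rule PS.Fubini'[OF m])
  also have "\<dots> = (\<integral>\<^sup>+t. (\<Sum>y\<in>UNIV. transition t y p * k t y) \<partial>lborel)"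
  proof (intro nn_integral_cong)
    fix t
    let ?b = "\<lambda>y \<omega>. of_bool (fst p \<le> t \<and> alive \<alpha> p \<omega> t \<and> state \<alpha> p \<omega> t = y) :: ennreal"
    have bm: "?b y \<in> borel_measurable (jump_noise au)" for y
    proof -
      have "(\<lambda>\<omega>. (p, \<omega>)) \<in> measurable (jump_noise au) (state_space \<Otimes>\<^sub>M jump_noise au)" by (simp add: space_pair_measure)
      from measurable_compose[OF this transition_integrand_meas] show ?thesis unfolding case_prod_conv .
    qed
    have times_const: "(\<lambda>\<omega>. f \<omega> * c) \<in> borel_measurable (jump_noise au)"
      if [measurable]: "f \<in> borel_measurable (jump_noise au)" for f :: "_ \<Rightarrow> ennreal" and c by measurable
    have "(\<integral>\<^sup>+\<omega>. ?g \<omega> t \<partial>jump_noise au) = (\<integral>\<^sup>+\<omega>. (\<Sum>y\<in>UNIV. ?b y \<omega> * k t y) \<partial>jump_noise au)"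
    proof (intro nn_integral_cong)
      fix \<omega>
      have "(\<Sum>y\<in>UNIV. ?b y \<omega> * k t y) = (\<Sum>y\<in>UNIV. if y = state \<alpha> p \<omega> t then ?g \<omega> t else 0)"
        by (intro sum.cong) auto
      then show "?g \<omega> t = (\<Sum>y\<in>UNIV. ?b y \<omega> * k t y)" by simp
    qed
    also have "\<dots> = (\<Sum>y\<in>UNIV. \<integral>\<^sup>+\<omega>. ?b y \<omega> * k t y \<partial>jump_noise au)"
      by (rule nn_integral_sum) (rule times_const[OF bm])
    also have "\<dots> = (\<Sum>y\<in>UNIV. transition t y p * k t y)"
      unfolding transition_def expect_def by (intro sum.cong refl nn_integral_multc bm)
    finally show "(\<integral>\<^sup>+\<omega>. ?g \<omega> t \<partial>jump_noise au) = (\<Sum>y\<in>UNIV. transition t y p * k t y)" .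
  qed
  finally show ?thesis .
qed

text \<open>A direct jump to \<open>y\<close>, of rate at least \<open>al\<close>, followed by no further candidate up to time \<open>t\<close> has
  positive probability.\<close>

lemma transition_pos:
  assumes al: "0 < al" and st: "s < t"
  shows "0 < transition t y (s, x)"
proof (cases "x = y")
  case True
  have "0 < ennreal (exp (- \<Lambda> * (t - s)))" by simp
  also have "\<dots> \<le> transition t y (s, x)"
    unfolding transition_renewal[OF less_imp_le[OF st]] using True by simp
  finally show ?thesis .
next
  case False
  have diag: "ennreal (exp (- \<Lambda> * (t - \<tau>))) \<le> transition t y (\<tau>, y)" if "\<tau> \<le> t" for \<tau>
    unfolding transition_renewal[OF that] by simp
  have "0 < ennreal (al * exp (- \<Lambda> * (t - s)) * (t - s))" using al st by simp
  also have "\<dots> = (\<integral>\<^sup>+\<tau>. ennreal (al * exp (- \<Lambda> * (t - s))) * indicator {s..t} \<tau> \<partial>lborel)"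
    using al st by (subst nn_integral_cmult_indicator) (auto simp: ennreal_mult)
  also have "\<dots> \<le> (\<integral>\<^sup>+\<tau>. indicator {s..} \<tau> * (ennreal (exp (- \<Lambda> * (\<tau> - s))) * mean \<tau> x (transition t y)) \<partial>lborel)"
  proof (intro nn_integral_mono)
    fix \<tau>
    show "ennreal (al * exp (- \<Lambda> * (t - s))) * indicator {s..t} \<tau> \<le>
      indicator {s..} \<tau> * (ennreal (exp (- \<Lambda> * (\<tau> - s))) * mean \<tau> x (transition t y))"
    proof (cases "\<tau> \<in> {s..t}")
      case True
      have "ennreal al * ennreal (exp (- \<Lambda> * (t - \<tau>))) \<le> ennreal (rate \<tau> x y) * transition t y (\<tau>, y)"
        using rate_vectorsD(1)[OF \<alpha>_rate, of y x \<tau>] False True diag[of \<tau>]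
        by (intro mult_mono ennreal_leI) (auto simp: rate_def)
      also have "\<dots> \<le> mean \<tau> x (transition t y)"
        unfolding mean_def by (rule member_le_sum) auto
      finally have "ennreal (exp (- \<Lambda> * (\<tau> - s))) * (ennreal al * ennreal (exp (- \<Lambda> * (t - \<tau>)))) \<le>
          ennreal (exp (- \<Lambda> * (\<tau> - s))) * mean \<tau> x (transition t y)"
        by (intro mult_left_mono) auto
      moreover have "ennreal (exp (- \<Lambda> * (\<tau> - s))) * (ennreal al * ennreal (exp (- \<Lambda> * (t - \<tau>)))) = ennreal (al * exp (- \<Lambda> * (t - s)))"
      proof -
        have "exp (- \<Lambda> * (\<tau> - s)) * (al * exp (- \<Lambda> * (t - \<tau>))) = al * exp (- \<Lambda> * (t - s))"
          by (simp add: mult.left_commute exp_add[symmetric]) (simp add: algebra_simps)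
        then show ?thesis using al by (simp add: ennreal_mult[symmetric])
      qed
      ultimately show ?thesis using True by simp
    qed simp
  qed
  also have "\<dots> \<le> transition t y (s, x)"
    unfolding transition_renewal[OF less_imp_le[OF st]] by simp
  finally show ?thesis .
qed

text \<open>The renewal equation represents the transition probabilities as integrals from the starting time
  on. These do not see the null set on which the control differs from the continuous rates \<open>\<beta>\<close>, so they
  can be differentiated.\<close>

lemma kolmogorov_backward:
  fixes \<beta> :: "real \<Rightarrow> 'n \<Rightarrow> real^'n" and y :: 'n and t :: real
  assumes \<beta>: "\<And>x. continuous_on {0..} (\<lambda>\<tau>. \<beta> \<tau> x)" and eq: "AE \<tau> in lborel. 0 \<le> \<tau> \<longrightarrow> (\<forall>x. \<alpha> \<tau> x = \<beta> \<tau> x)"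
    and t: "0 \<le> t"
  defines "q \<equiv> \<lambda>s x. enn2real (transition t y (s, x))"
  shows "\<And>s x. s \<in> {0..t} \<Longrightarrow> ((\<lambda>s. q s x) has_real_derivative - (\<Sum>z\<in>UNIV. \<beta> s x $ z * q s z)) (at s within {0..t})"
    and "\<And>x. q t x = of_bool (x = y)"
proof -
  have q: "transition t y (s, x) = ennreal (q s x)" "0 \<le> q s x" "q s x \<le> 1" for s x
  proof -
    have "transition t y (s, x) \<noteq> \<top>" using transition_le_1[of t y "(s, x)"] by (auto simp: top_unique)
    then show "transition t y (s, x) = ennreal (q s x)" by (simp add: q_def less_top)
    show "q s x \<le> 1" unfolding q_def by (rule enn2real_leI) (use transition_le_1[of t y "(s, x)"] in auto)
    show "0 \<le> q s x" by (simp add: q_def)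
  qed
  have qm [measurable]: "(\<lambda>s. q s x) \<in> borel_measurable borel" for x unfolding q_def by measurable
  \<comment> \<open>The average \<open>mean \<tau> x\<close> of the transition probabilities, and its version with the continuous
    rates; \<open>g\<close> and \<open>g'\<close> below are these averages times \<open>exp (- \<Lambda> * \<tau>)\<close>.\<close>
  define B where "B \<tau> x = \<Lambda> * q \<tau> x + (\<Sum>z\<in>UNIV. \<alpha> \<tau> x $ z * q \<tau> z)" for \<tau> x
  define B' where "B' \<tau> x = \<Lambda> * q \<tau> x + (\<Sum>z\<in>UNIV. \<beta> \<tau> x $ z * q \<tau> z)" for \<tau> x
  have Bm [measurable]: "(\<lambda>\<tau>. B \<tau> x) \<in> borel_measurable borel" for x unfolding B_def by measurable
  have Bsum: "B \<tau> x = (\<Sum>z\<in>UNIV. rate \<tau> x z * q \<tau> z)" for \<tau> x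
    by (simp add: B_def rate_def distrib_right sum.distrib if_distrib[of "\<lambda>c. c * _"] cong: if_cong)
  have B0: "0 \<le> B \<tau> x" "B \<tau> x \<le> \<Lambda>" for \<tau> x
  proof -
    show "0 \<le> B \<tau> x" unfolding Bsum using rate_nonneg q by (intro sum_nonneg mult_nonneg_nonneg) auto
    have "B \<tau> x \<le> (\<Sum>z\<in>UNIV. rate \<tau> x z)"
      unfolding Bsum using rate_nonneg q(3) by (intro sum_mono mult_left_le) auto
    then show "B \<tau> x \<le> \<Lambda>" by (simp add: rate_sum)
  qed
  have meanB: "mean \<tau> x (transition t y) = ennreal (B \<tau> x)" for \<tau> x
  proof -
    have "mean \<tau> x (transition t y) = (\<Sum>z\<in>UNIV. ennreal (rate \<tau> x z * q \<tau> z))"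
      unfolding mean_def by (intro sum.cong) (auto simp: q(1) ennreal_mult[symmetric] rate_nonneg q(2))
    also have "\<dots> = ennreal (B \<tau> x)" unfolding Bsum using rate_nonneg q(2) by (intro sum_ennreal) auto
    finally show ?thesis .
  qed
  define g where "g x \<tau> = exp (- \<Lambda> * \<tau>) * B \<tau> x" for x \<tau>
  have gm [measurable]: "g x \<in> borel_measurable borel" for x unfolding g_def[abs_def] by measurable
  have gi: "set_integrable lborel {s..t} (g x)" if "0 \<le> s" for s x
    unfolding set_integrable_def
  proof (rule integrableI_bounded_set_indicator[where B = \<Lambda>])
    show "AE \<tau>\<in>{s..t} in lborel. norm (g x \<tau>) \<le> \<Lambda>"
    proof (rule AE_I2, rule impI)
      fix \<tau> assume "\<tau> \<in> {s..t}"
      then have "exp (- \<Lambda> * \<tau>) \<le> 1" using \<Lambda> that by simp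
      then have "exp (- \<Lambda> * \<tau>) * B \<tau> x \<le> 1 * \<Lambda>" using B0 \<Lambda> by (intro mult_mono) auto
      then show "norm (g x \<tau>) \<le> \<Lambda>" using B0(1)[of \<tau> x] by (simp add: g_def)
    qed
  qed (auto simp: emeasure_lborel_Icc_eq)
  have qI: "q s x = of_bool (x = y) * exp (- \<Lambda> * (t - s)) + exp (\<Lambda> * s) * integral {s..t} (g x)" if s: "s \<in> {0..t}" for s x
  proof -
    have "(\<integral>\<^sup>+\<tau>. indicator {s..} \<tau> * (ennreal (exp (- \<Lambda> * (\<tau> - s))) * mean \<tau> x (transition t y)) \<partial>lborel) =
        (\<integral>\<^sup>+\<tau>. ennreal (exp (\<Lambda> * s)) * ennreal (indicator {s..t} \<tau> *\<^sub>R g x \<tau>) \<partial>lborel)"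
    proof (intro nn_integral_cong)
      fix \<tau>
      have "B \<tau> x = 0" if "t < \<tau>" using transition_after[OF that] by (simp add: B_def q_def)
      moreover have "ennreal (exp (- \<Lambda> * (\<tau> - s))) * ennreal (B \<tau> x) = ennreal (exp (\<Lambda> * s)) * ennreal (g x \<tau>)"
      proof -
        have "exp (- \<Lambda> * (\<tau> - s)) * B \<tau> x = exp (\<Lambda> * s) * g x \<tau>"
          unfolding g_def mult.assoc[symmetric] exp_add[symmetric] by (simp add: algebra_simps)
        then show ?thesis using B0 by (simp add: ennreal_mult[symmetric] g_def)
      qed
      ultimately show "indicator {s..} \<tau> * (ennreal (exp (- \<Lambda> * (\<tau> - s))) * mean \<tau> x (transition t y)) =
          ennreal (exp (\<Lambda> * s)) * ennreal (indicator {s..t} \<tau> *\<^sub>R g x \<tau>)"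
        unfolding meanB by (auto split: split_indicator)
    qed
    also have "\<dots> = ennreal (exp (\<Lambda> * s)) * (\<integral>\<^sup>+\<tau>. ennreal (indicator {s..t} \<tau> *\<^sub>R g x \<tau>) \<partial>lborel)"
      by (rule nn_integral_cmult) measurable
    also have "(\<integral>\<^sup>+\<tau>. ennreal (indicator {s..t} \<tau> *\<^sub>R g x \<tau>) \<partial>lborel) = ennreal (LINT \<tau>|lborel. indicator {s..t} \<tau> *\<^sub>R g x \<tau>)"
      by (rule nn_integral_eq_integral) (use gi[of s x] s B0 in \<open>auto simp: set_integrable_def g_def split: split_indicator\<close>)
    also have "(LINT \<tau>|lborel. indicator {s..t} \<tau> *\<^sub>R g x \<tau>) = integral {s..t} (g x)"
      using set_borel_integral_eq_integral(2)[OF gi[of s x]] s by (simp add: set_lebesgue_integral_def)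
    finally have "ennreal (q s x) = ennreal (of_bool (x = y) * exp (- \<Lambda> * (t - s)) + exp (\<Lambda> * s) * integral {s..t} (g x))"
    proof -
      assume a: "(\<integral>\<^sup>+\<tau>. indicator {s..} \<tau> * (ennreal (exp (- \<Lambda> * (\<tau> - s))) * mean \<tau> x (transition t y)) \<partial>lborel) =
        ennreal (exp (\<Lambda> * s)) * ennreal (integral {s..t} (g x))"
      have I0: "0 \<le> integral {s..t} (g x)"
        using set_borel_integral_eq_integral(1)[OF gi[of s x]] s B0 by (intro integral_nonneg) (auto simp: g_def)
      have "ennreal (q s x) = transition t y (s, x)" by (simp add: q(1))
      also have "\<dots> = of_bool (x = y) * ennreal (exp (- \<Lambda> * (t - s))) + ennreal (exp (\<Lambda> * s)) * ennreal (integral {s..t} (g x))"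
        unfolding a[symmetric] by (rule transition_renewal) (use s in auto)
      also have "\<dots> = ennreal (of_bool (x = y) * exp (- \<Lambda> * (t - s)) + exp (\<Lambda> * s) * integral {s..t} (g x))"
        using I0 by (cases "x = y") (simp_all add: ennreal_mult ennreal_plus)
      finally show ?thesis .
    qed
    moreover have "0 \<le> of_bool (x = y) * exp (- \<Lambda> * (t - s)) + exp (\<Lambda> * s) * integral {s..t} (g x)"
      using set_borel_integral_eq_integral(1)[OF gi[of s x]] s B0
      by (intro add_nonneg_nonneg mult_nonneg_nonneg integral_nonneg) (auto simp: g_def)
    ultimately show ?thesis using q(2) by simp
  qed
  show qt: "q t x = of_bool (x = y)" for x using qI[of t x] t by simp
  have gint: "g x integrable_on {0..t}" for x using set_borel_integral_eq_integral(1)[OF gi[of 0 x]] by simp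
  have split: "integral {s..t} (g x) = integral {0..t} (g x) - integral {0..s} (g x)" if "s \<in> {0..t}" for s x
    using Henstock_Kurzweil_Integration.integral_combine[of 0 s t "g x"] gint that by simp
  have qI2: "q s x = of_bool (x = y) * exp (- \<Lambda> * (t - s)) +
      exp (\<Lambda> * s) * (integral {0..t} (g x) - integral {0..s} (g x))" if "s \<in> {0..t}" for s x
    unfolding qI[OF that] split[OF that] ..
  have cq: "continuous_on {0..t} (\<lambda>s. q s x)" for x
  proof -
    have "continuous_on {0..t} (\<lambda>s. of_bool (x = y) * exp (- \<Lambda> * (t - s)) +
        exp (\<Lambda> * s) * (integral {0..t} (g x) - integral {0..s} (g x)))"
      by (intro continuous_intros indefinite_integral_continuous_1 gint)
    then show ?thesis by (rule continuous_on_eq) (simp add: qI2)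
  qed
  define g' where "g' x \<tau> = exp (- \<Lambda> * \<tau>) * B' \<tau> x" for x \<tau>
  have cg': "continuous_on {0..t} (g' x)" for x
    unfolding g'_def B'_def
    by (intro continuous_intros cq continuous_on_subset[OF \<beta>]) auto
  have ig': "integral {0..s} (g x) = integral {0..s} (g' x)" if "s \<in> {0..t}" for s x
  proof -
    obtain Z where Z: "Z \<in> null_sets lborel" "{\<tau>. \<not> (0 \<le> \<tau> \<longrightarrow> (\<forall>x. \<alpha> \<tau> x = \<beta> \<tau> x))} \<subseteq> Z"
      using eq by (auto simp: eventually_ae_filter)
    show ?thesis
    proof (rule integral_spike)
      show "negligible Z" using Z(1) by (simp add: negligible_iff_null_sets null_sets_completionI)
      show "g' x \<tau> = g x \<tau>" if "\<tau> \<in> {0..s} - Z" for \<tau>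
      proof -
        have "\<alpha> \<tau> x = \<beta> \<tau> x" using that Z(2) by auto
        then show ?thesis by (simp add: g_def g'_def B_def B'_def)
      qed
    qed
  qed
  show "((\<lambda>s. q s x) has_real_derivative - (\<Sum>z\<in>UNIV. \<beta> s x $ z * q s z)) (at s within {0..t})" if s: "s \<in> {0..t}" for s x
  proof -
    have I: "((\<lambda>s. integral {0..s} (g' x)) has_real_derivative g' x s) (at s within {0..t})"
      using integral_has_vector_derivative[OF cg' s] by (simp add: has_real_derivative_iff_has_vector_derivative)
    have "((\<lambda>s. c * exp (- \<Lambda> * (t - s)) + exp (\<Lambda> * s) * (integral {0..t} (g x) - integral {0..s} (g' x)))
        has_real_derivative c * (exp (- \<Lambda> * (t - s)) * \<Lambda>) +
          (exp (\<Lambda> * s) * (0 - g' x s) + exp (\<Lambda> * s) * \<Lambda> * (integral {0..t} (g x) - integral {0..s} (g' x)))) (at s within {0..t})" for c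
      by (auto intro!: derivative_eq_intros I)
    from this[of "of_bool (x = y)"]
    have "((\<lambda>s. q s x) has_real_derivative of_bool (x = y) * (exp (- \<Lambda> * (t - s)) * \<Lambda>) +
          (exp (\<Lambda> * s) * (0 - g' x s) + exp (\<Lambda> * s) * \<Lambda> * (integral {0..t} (g x) - integral {0..s} (g' x)))) (at s within {0..t})"
      by (rule has_field_derivative_transform_within[of _ _ _ _ 1]) (use s in \<open>auto simp: qI2 ig'\<close>)
    also have "of_bool (x = y) * (exp (- \<Lambda> * (t - s)) * \<Lambda>) +
          (exp (\<Lambda> * s) * (0 - g' x s) + exp (\<Lambda> * s) * \<Lambda> * (integral {0..t} (g x) - integral {0..s} (g' x))) =
          \<Lambda> * q s x - exp (\<Lambda> * s) * g' x s"
      unfolding qI2[OF s] ig'[OF s] by (simp add: algebra_simps)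
    also have "exp (\<Lambda> * s) * g' x s = B' s x" by (simp add: g'_def mult.assoc[symmetric] exp_add[symmetric])
    finally show ?thesis by (simp add: B'_def)
  qed
qed

text \<open>Pairing a solution of the forward equation with the transition probabilities yields a constant;
  comparing its values at both end points identifies the law of the process.\<close>

lemma law_eq_forward_solution:
  fixes \<beta> :: "real \<Rightarrow> 'n \<Rightarrow> real^'n"
  assumes \<beta>: "\<And>x. continuous_on {0..} (\<lambda>\<tau>. \<beta> \<tau> x)" and eq: "AE \<tau> in lborel. 0 \<le> \<tau> \<longrightarrow> (\<forall>x. \<alpha> \<tau> x = \<beta> \<tau> x)"
    and t: "0 \<le> t"
    and p: "\<And>s x. 0 \<le> s \<Longrightarrow> ((\<lambda>s. p s $ x) has_real_derivative (\<Sum>z\<in>UNIV. p s $ z * \<beta> s z $ x)) (at s within {0..})"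
    and init: "p 0 = axis x0 1"
  shows "enn2real (transition t y (0, x0)) = p t $ y"
proof -
  define q where "q s x = enn2real (transition t y (s, x))" for s x
  note kb = kolmogorov_backward[OF \<beta> eq t, where y = y, folded q_def]
  define S where "S s = (\<Sum>x\<in>UNIV. p s $ x * q s x)" for s
  have "(S has_real_derivative 0) (at s within {0..t})" if s: "s \<in> {0..t}" for s
  proof -
    have "(S has_real_derivative (\<Sum>x\<in>UNIV. (\<Sum>z\<in>UNIV. p s $ z * \<beta> s z $ x) * q s x +
        (- (\<Sum>z\<in>UNIV. \<beta> s x $ z * q s z)) * p s $ x)) (at s within {0..t})"
      unfolding S_def[abs_def]
      by (intro DERIV_sum DERIV_mult kb(1)[OF s] DERIV_subset[OF p]) (use s in auto)
    also have "(\<Sum>x\<in>UNIV. (\<Sum>z\<in>UNIV. p s $ z * \<beta> s z $ x) * q s x + (- (\<Sum>z\<in>UNIV. \<beta> s x $ z * q s z)) * p s $ x) =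
        (\<Sum>x\<in>UNIV. \<Sum>z\<in>UNIV. p s $ z * \<beta> s z $ x * q s x) - (\<Sum>x\<in>UNIV. \<Sum>z\<in>UNIV. p s $ x * \<beta> s x $ z * q s z)"
      by (simp add: sum_subtractf sum_distrib_left mult_ac)
    also have "(\<Sum>x\<in>UNIV. \<Sum>z\<in>UNIV. p s $ z * \<beta> s z $ x * q s x) = (\<Sum>z\<in>UNIV. \<Sum>x\<in>UNIV. p s $ z * \<beta> s z $ x * q s x)"
      by (rule sum.swap)
    finally show ?thesis by simp
  qed
  then obtain c where c: "\<And>s. s \<in> {0..t} \<Longrightarrow> S s = c"
    using has_field_derivative_zero_constant[of "{0..t}" S] by auto
  have "S 0 = S t" using c[of 0] c[of t] t by simp
  moreover have "S 0 = q 0 x0"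
    unfolding S_def init axis_def by (simp add: if_distrib[of "\<lambda>c. c * _"] cong: if_cong)
  moreover have "S t = p t $ y"
    unfolding S_def kb(2) by (simp add: of_bool_def if_distrib[of "\<lambda>c. _ * c"] cong: if_cong)
  ultimately show ?thesis by (simp add: q_def)
qed

end

section \<open>Verification\<close>

text \<open>Controls are only constrained at nonnegative times; the extension is a control at all times and
  drives the same process from any nonnegative starting time.\<close>

definition ext :: "(real \<Rightarrow> 'b) \<Rightarrow> real \<Rightarrow> 'b" where "ext \<alpha> t = \<alpha> (max 0 t)"

lemma jump_of_control:
  assumes \<alpha>: "\<alpha> \<in> controls al au" and al: "0 \<le> al" "0 < au"
  shows "jump al au (ext \<alpha>)"
proof
  fix x
  have "(\<lambda>t. \<alpha> t x) \<in> borel_measurable (restrict_space borel {0..})" using \<alpha> by (simp add: controls_def)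
  moreover have "(\<lambda>t::real. max 0 t) \<in> measurable borel (restrict_space borel {0..})"
    by (rule measurable_restrict_space2) auto
  ultimately show "(\<lambda>t. ext \<alpha> t x) \<in> borel_measurable borel"
    unfolding ext_def by (rule measurable_compose[rotated])
  show "ext \<alpha> t x \<in> rate_vectors al au x" for t using \<alpha> by (simp add: controls_def ext_def)
qed (use al in auto)

lemma jump_chain_ext:
  assumes "0 \<le> s"
  shows "jump_chain (ext \<alpha>) s x \<omega> k = jump_chain \<alpha> s x \<omega> k \<and> 0 \<le> fst (jump_chain \<alpha> s x \<omega> k)"
proof (induction k)
  case (Suc k)
  obtain t z where tz: "jump_chain \<alpha> s x \<omega> k = (t, z)" by (cases "jump_chain \<alpha> s x \<omega> k")
  then have "0 \<le> t" using Suc by simp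
  then show ?case using Suc tz by (simp add: ext_def split: prod.splits)
qed (use assms in simp)

lemma state_ext:
  assumes "0 \<le> s" shows "state (ext \<alpha>) (s, x) \<omega> t = jump_process \<alpha> s x \<omega> t"
proof -
  have eq: "jump_chain (ext \<alpha>) s x \<omega> = jump_chain \<alpha> s x \<omega>"
    by (rule HOL.ext) (rule conjunct1[OF jump_chain_ext[OF assms]])
  show ?thesis unfolding state_def jump_process_def fst_conv snd_conv eq ..
qed

text \<open>The fundamental theorem of calculus on half-lines asks for two-sided derivatives; a linear
  extension to negative times provides the missing one at \<open>0\<close>.\<close>

lemma extend_derivative:
  fixes g :: "real \<Rightarrow> real"
  assumes g: "\<And>t. 0 \<le> t \<Longrightarrow> (g has_real_derivative g' t) (at t within {0..})"
  shows "\<exists>h. (\<forall>t\<ge>0. h t = g t \<and> (h has_real_derivative g' t) (at t))"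
proof (intro exI allI impI conjI)
  let ?h = "\<lambda>t. if 0 \<le> t then g t else g 0 + g' 0 * t"
  fix t :: real assume t: "0 \<le> t"
  show "?h t = g t" using t by simp
  have hr: "(?h has_real_derivative g' t) (at t within {0..})"
    by (rule has_field_derivative_transform_within[OF g[OF t], of 1]) (use t in auto)
  show "(?h has_real_derivative g' t) (at t)"
  proof (cases "t = 0")
    case False
    then have "at t within {0..} = at t" using t by (intro at_within_interior) simp
    then show ?thesis using hr by simp
  next
    case True
    have "((\<lambda>t. g 0 + g' 0 * t) has_real_derivative g' 0) (at 0 within {..0})"
      by (auto intro!: derivative_eq_intros)
    then have hl: "(?h has_real_derivative g' 0) (at 0 within {..0})"
      by (rule has_field_derivative_transform_within[of _ _ _ _ 1]) auto
    have "(?h has_real_derivative g' 0) (at 0 within {0..} \<union> {..0})"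
      using hr hl True unfolding has_field_derivative_iff Lim_within_Un by simp
    moreover have "{0::real..} \<union> {..0} = UNIV" by auto
    ultimately show ?thesis using True by simp
  qed
qed

text \<open>The control problem behind the Hamiltonian: \<open>H\<close> is the minimal value of \<open>f x a + a \<bullet> p\<close>, and
  \<open>G x p\<close> is the only minimiser.\<close>

locale game = mfg H G F al au LF
  for H :: "'n::finite \<Rightarrow> real^'n \<Rightarrow> real" and G F al au LF +
  fixes f :: "'n \<Rightarrow> real^'n \<Rightarrow> real"
  assumes f_meas: "f x \<in> borel_measurable borel"
    and H_le: "a \<in> rate_vectors al au x \<Longrightarrow> H x p \<le> f x a + a \<bullet> p"
    and H_eq: "H x p = f x (G x p) + G x p \<bullet> p"
    and G_unique: "a \<in> rate_vectors al au x \<Longrightarrow> f x a + a \<bullet> p = H x p \<Longrightarrow> a = G x p"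

text \<open>An arbitrary control is compared with a bounded solution \<open>v\<close> of the Hamilton-Jacobi-Bellman
  equation along an arbitrary flow \<open>\<mu>\<close>. The comparison thus covers deviations from an equilibrium: they
  leave the flow as it is, whatever the law of the deviating player.\<close>

locale verification = game +
  fixes r :: real and \<alpha> :: "real \<Rightarrow> 'a \<Rightarrow> real^'a" and \<mu> v :: "real \<Rightarrow> real^'a"
  assumes r: "0 < r" and \<alpha>: "\<alpha> \<in> controls al au" and \<mu>: "simplex_flow \<mu>" and \<mu>c: "continuous_on {0..} \<mu>"
    and v: "hjb r v \<mu>" and bd: "bounded (v ` {0..})"
begin

sublocale J: jump al au "ext \<alpha>"
  by (rule jump_of_control[OF \<alpha>]) (use al au0 in auto)

lemma pos_part_continuous:
  assumes "continuous_on {0..} g" shows "continuous_on UNIV (\<lambda>t::real. g (max 0 t))"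
  by (rule continuous_on_compose2[OF assms]) (auto intro!: continuous_intros)

lemma vc: "continuous_on UNIV (\<lambda>t. v (max 0 t))"
  by (rule pos_part_continuous[OF hjb_continuous[OF v]])

lemma Hc: "continuous_on UNIV (\<lambda>t. H x (Delta x (v (max 0 t))))"
  by (rule continuous_on_compose2[OF H_continuous Delta_continuous[OF vc]]) auto

lemma Fc: "continuous_on UNIV (\<lambda>t. F x (\<mu> (max 0 t)))"
  by (rule continuous_on_compose2[OF F_continuous pos_part_continuous[OF \<mu>c]])
    (use \<mu> in \<open>auto simp: simplex_flow_def\<close>)

definition Bv :: real where "Bv = (SOME B. \<forall>t\<ge>0. norm (v t) \<le> B)"

lemma Bv: "0 \<le> t \<Longrightarrow> norm (v t) \<le> Bv"
proof -
  obtain B where "\<forall>u\<in>v ` {0..}. norm u \<le> B" using bd unfolding bounded_iff by blast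
  then have "\<exists>B. \<forall>t\<ge>0. norm (v t) \<le> B" by auto
  from someI_ex[OF this] show "0 \<le> t \<Longrightarrow> norm (v t) \<le> Bv" unfolding Bv_def by blast
qed

lemma Bv0: "0 \<le> Bv" using Bv[of 0] norm_ge_zero order_trans by blast

text \<open>Adding \<open>C\<close> to the running cost makes it possible to work with nonnegative integrals: the first
  term in the maximum makes \<open>drift\<close> nonnegative, the second \<open>V\<close>.\<close>

definition C :: real where "C = max (K0 + 2 * (RB * (2 * N * Bv))) (r * Bv)"

lemma C0: "0 \<le> C" unfolding C_def using r Bv0 by (simp add: le_max_iff_disj)

lemma norm_Delta_v: "0 \<le> t \<Longrightarrow> norm (Delta x (v t)) \<le> 2 * N * Bv"
  using norm_Delta_le[of x "v t"] Bv[of t] N by (meson mult_left_mono order_trans less_imp_le mult_nonneg_nonneg zero_le_numeral)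

lemma rate_bound: "0 \<le> t \<Longrightarrow> \<bar>ext \<alpha> t x \<bullet> Delta x (v t)\<bar> \<le> RB * (2 * N * Bv)"
proof -
  assume t: "0 \<le> t"
  have "\<bar>ext \<alpha> t x \<bullet> Delta x (v t)\<bar> \<le> norm (ext \<alpha> t x) * norm (Delta x (v t))" by (rule Cauchy_Schwarz_ineq2)
  also have "\<dots> \<le> RB * (2 * N * Bv)"
    by (intro mult_mono norm_rate_le[OF J.\<alpha>_rate] norm_Delta_v t RB) simp
  finally show ?thesis .
qed

lemma HF_bound: "0 \<le> t \<Longrightarrow> \<bar>H x (Delta x (v t)) + F x (\<mu> t)\<bar> \<le> K0 + RB * (2 * N * Bv)"
proof -
  assume t: "0 \<le> t"
  have "\<bar>H x (Delta x (v t)) - H x 0\<bar> \<le> RB * norm (Delta x (v t))" using H_lipschitz[of x "Delta x (v t)" 0] by simp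
  also have "\<dots> \<le> RB * (2 * N * Bv)" by (rule mult_left_mono[OF norm_Delta_v[OF t] RB])
  finally show ?thesis using K0(2)[of "\<mu> t" x] \<mu> t by (auto simp: simplex_flow_def)
qed

text \<open>The running cost splits into a part \<open>drift\<close> whose expected total is known from Dynkin's formula
  for the value function, and a nonnegative part \<open>slack\<close> that measures the suboptimality of the
  control.\<close>

definition slack :: "real \<Rightarrow> 'a \<Rightarrow> real" where
  "slack t x = exp (- r * max 0 t) *
    (f x (ext \<alpha> t x) + ext \<alpha> t x \<bullet> Delta x (v (max 0 t)) - H x (Delta x (v (max 0 t))))"

definition drift :: "real \<Rightarrow> 'a \<Rightarrow> real" where
  "drift t x = exp (- r * max 0 t) *
    (H x (Delta x (v (max 0 t))) + F x (\<mu> (max 0 t)) - ext \<alpha> t x \<bullet> Delta x (v (max 0 t)) + C)"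

definition V :: "real \<times> 'a \<Rightarrow> real" where
  "V p = exp (- r * max 0 (fst p)) * (v (max 0 (fst p)) $ snd p + C / r)"

lemma \<alpha>_inner_meas: "(\<lambda>t. ext \<alpha> t x \<bullet> Delta x (v (max 0 t))) \<in> borel_measurable borel"
  by (intro borel_measurable_inner J.\<alpha>_meas borel_measurable_continuous_onI Delta_continuous vc)

lemma slack_meas: "(\<lambda>t. slack t x) \<in> borel_measurable borel"
proof -
  have [measurable]: "(\<lambda>t. f x (ext \<alpha> t x)) \<in> borel_measurable borel" by (rule measurable_compose[OF J.\<alpha>_meas f_meas])
  have [measurable]: "(\<lambda>t. ext \<alpha> t x \<bullet> Delta x (v (max 0 t))) \<in> borel_measurable borel"
    "(\<lambda>t. H x (Delta x (v (max 0 t)))) \<in> borel_measurable borel"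
    by (rule \<alpha>_inner_meas, rule borel_measurable_continuous_onI[OF Hc])
  show ?thesis unfolding slack_def by measurable
qed

lemma drift_meas: "(\<lambda>t. drift t x) \<in> borel_measurable borel"
proof -
  have [measurable]: "(\<lambda>t. ext \<alpha> t x \<bullet> Delta x (v (max 0 t))) \<in> borel_measurable borel"
    "(\<lambda>t. H x (Delta x (v (max 0 t)))) \<in> borel_measurable borel" "(\<lambda>t. F x (\<mu> (max 0 t))) \<in> borel_measurable borel"
    by (rule \<alpha>_inner_meas, rule borel_measurable_continuous_onI[OF Hc], rule borel_measurable_continuous_onI[OF Fc])
  show ?thesis unfolding drift_def by measurable
qed

lemma V_meas: "(\<lambda>t. V (t, x)) \<in> borel_measurable borel"
  unfolding V_def fst_conv snd_conv
  by (intro borel_measurable_continuous_onI continuous_intros vc)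

lemma slack_nonneg: "0 \<le> slack t x"
  unfolding slack_def using H_le[OF J.\<alpha>_rate, of x "Delta x (v (max 0 t))" t] by simp

lemma drift_bounds: "0 \<le> drift t x" "0 \<le> t \<Longrightarrow> drift t x \<le> 2 * C * exp (- r * t)"
proof -
  have e: "ext \<alpha> (max 0 t) = ext \<alpha> t" by (simp add: ext_def)
  have b: "\<bar>ext \<alpha> t x \<bullet> Delta x (v (max 0 t))\<bar> \<le> RB * (2 * N * Bv)"
    using rate_bound[of "max 0 t" x] unfolding e by simp
  have c: "\<bar>H x (Delta x (v (max 0 t))) + F x (\<mu> (max 0 t))\<bar> \<le> K0 + RB * (2 * N * Bv)"
    by (rule HF_bound) simp
  have C: "K0 + 2 * (RB * (2 * N * Bv)) \<le> C" by (simp add: C_def)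
  let ?X = "H x (Delta x (v (max 0 t))) + F x (\<mu> (max 0 t)) - ext \<alpha> t x \<bullet> Delta x (v (max 0 t)) + C"
  have X: "0 \<le> ?X" "?X \<le> 2 * C" using b c C by linarith+
  show "0 \<le> drift t x" unfolding drift_def using X(1) by (rule mult_nonneg_nonneg[OF exp_ge_zero])
  show "drift t x \<le> 2 * C * exp (- r * t)" if "0 \<le> t"
    using mult_left_mono[OF X(2), of "exp (- r * t)"] that unfolding drift_def by (simp add: mult.commute)
qed

lemma V_bounds: "0 \<le> V p" "0 \<le> s \<Longrightarrow> V (s, x) \<le> (Bv + C / r) * exp (- r * s)"
proof -
  have c: "Bv \<le> C / r" using r by (simp add: C_def field_simps)
  have b: "\<bar>v (max 0 t) $ y\<bar> \<le> Bv" for t y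
    using component_le_norm_cart[of "v (max 0 t)" y] Bv[of "max 0 t"] by simp
  show "0 \<le> V p" unfolding V_def using b[of "fst p" "snd p"] c by simp
  have "v (max 0 s) $ x + C / r \<le> Bv + C / r" using b[of s x] by simp
  from mult_left_mono[OF this, of "exp (- r * s)"]
  show "V (s, x) \<le> (Bv + C / r) * exp (- r * s)" if "0 \<le> s"
    using that unfolding V_def by (simp add: mult.commute)
qed

lemma sum_rate_V:
  assumes t: "0 \<le> t"
  shows "(\<Sum>y\<in>UNIV. J.rate t x y * V (t, y)) = J.\<Lambda> * V (t, x) + exp (- r * t) * (ext \<alpha> t x \<bullet> Delta x (v t))"
proof -
  have "(\<Sum>y\<in>UNIV. J.rate t x y * V (t, y)) = J.\<Lambda> * V (t, x) + (\<Sum>y\<in>UNIV. ext \<alpha> t x $ y * V (t, y))"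
    by (simp add: J.rate_def distrib_right sum.distrib if_distrib[of "\<lambda>c. c * _"] cong: if_cong)
  also have "(\<Sum>y\<in>UNIV. ext \<alpha> t x $ y * V (t, y)) =
      (\<Sum>y\<in>UNIV. exp (- r * t) * (ext \<alpha> t x $ y * v t $ y) + exp (- r * t) * (C / r) * ext \<alpha> t x $ y)"
    using t by (intro sum.cong) (simp_all add: V_def algebra_simps)
  also have "\<dots> = exp (- r * t) * (ext \<alpha> t x \<bullet> v t) + exp (- r * t) * (C / r) * (\<Sum>y\<in>UNIV. ext \<alpha> t x $ y)"
    unfolding sum.distrib by (simp only: sum_distrib_left[symmetric] inner_vec_def inner_real_def)
  also have "\<dots> = exp (- r * t) * (ext \<alpha> t x \<bullet> Delta x (v t))"
    using rate_vectorsD(3)[OF J.\<alpha>_rate] inner_Delta[OF J.\<alpha>_rate] by simp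
  finally show ?thesis .
qed

lemma mean_V:
  assumes t: "0 \<le> t"
  shows "J.mean t x (\<lambda>p. ennreal (V p)) = ennreal (J.\<Lambda> * V (t, x) + exp (- r * t) * (ext \<alpha> t x \<bullet> Delta x (v t)))"
proof -
  have "J.mean t x (\<lambda>p. ennreal (V p)) = (\<Sum>y\<in>UNIV. ennreal (J.rate t x y * V (t, y)))"
    unfolding J.mean_def by (simp add: ennreal_mult J.rate_nonneg V_bounds(1))
  also have "\<dots> = ennreal (\<Sum>y\<in>UNIV. J.rate t x y * V (t, y))"
    by (rule sum_ennreal) (simp add: J.rate_nonneg V_bounds(1))
  finally show ?thesis unfolding sum_rate_V[OF t] .
qed

text \<open>The terms with \<open>\<alpha>\<close> in \<open>drift\<close> and in the average of \<open>V\<close> cancel, and by the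
  Hamilton-Jacobi-Bellman equation the rest of the integrand is the derivative of
  \<open>- exp (- \<Lambda> * (\<tau> - s)) * V (\<tau>, x)\<close>.\<close>

lemma V_renewal:
  assumes s: "0 \<le> s"
  shows "(\<integral>\<^sup>+\<tau>. indicator {s..} \<tau> * (ennreal (exp (- J.\<Lambda> * (\<tau> - s))) *
    (ennreal (drift \<tau> x) + J.mean \<tau> x (\<lambda>p. ennreal (V p)))) \<partial>lborel) = ennreal (V (s, x))"
proof -
  obtain w where w: "\<And>t. 0 \<le> t \<Longrightarrow> w t = v t $ x"
    "\<And>t. 0 \<le> t \<Longrightarrow> (w has_real_derivative (r * v t $ x - H x (Delta x (v t)) - F x (\<mu> t))) (at t)"
    using extend_derivative[of "\<lambda>t. v t $ x" "\<lambda>t. r * v t $ x - H x (Delta x (v t)) - F x (\<mu> t)"] v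
    by (auto simp: hjb_def)
  define g where "g \<tau> = exp (- J.\<Lambda> * (\<tau> - s)) * (exp (- r * max 0 \<tau>) *
      (H x (Delta x (v (max 0 \<tau>))) + F x (\<mu> (max 0 \<tau>)) + C) + J.\<Lambda> * V (\<tau>, x))" for \<tau>
  have gm: "g \<in> borel_measurable borel"
  proof -
    have [measurable]: "(\<lambda>t. H x (Delta x (v (max 0 t)))) \<in> borel_measurable borel"
      "(\<lambda>t. F x (\<mu> (max 0 t))) \<in> borel_measurable borel" "(\<lambda>t. V (t, x)) \<in> borel_measurable borel"
      by (rule borel_measurable_continuous_onI[OF Hc], rule borel_measurable_continuous_onI[OF Fc], rule V_meas)
    show ?thesis unfolding g_def[abs_def] by measurable
  qed
  have "(\<integral>\<^sup>+\<tau>. indicator {s..} \<tau> * (ennreal (exp (- J.\<Lambda> * (\<tau> - s))) * (ennreal (drift \<tau> x) + J.mean \<tau> x (\<lambda>p. ennreal (V p)))) \<partial>lborel) =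
      (\<integral>\<^sup>+\<tau>. ennreal (g \<tau>) * indicator {s..} \<tau> \<partial>lborel)"
  proof (intro nn_integral_cong)
    fix \<tau>
    show "indicator {s..} \<tau> * (ennreal (exp (- J.\<Lambda> * (\<tau> - s))) * (ennreal (drift \<tau> x) + J.mean \<tau> x (\<lambda>p. ennreal (V p)))) =
        ennreal (g \<tau>) * indicator {s..} \<tau>"
    proof (cases "s \<le> \<tau>")
      case True
      then have \<tau>: "0 \<le> \<tau>" using s by simp
      have nn: "0 \<le> J.\<Lambda> * V (\<tau>, x) + exp (- r * \<tau>) * (ext \<alpha> \<tau> x \<bullet> Delta x (v \<tau>))"
      proof -
        have "0 \<le> (\<Sum>y\<in>UNIV. J.rate \<tau> x y * V (\<tau>, y))"
          by (intro sum_nonneg mult_nonneg_nonneg J.rate_nonneg V_bounds(1))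
        also note sum_rate_V[OF \<tau>]
        finally show ?thesis .
      qed
      have "g \<tau> = exp (- J.\<Lambda> * (\<tau> - s)) * (drift \<tau> x + (J.\<Lambda> * V (\<tau>, x) + exp (- r * \<tau>) * (ext \<alpha> \<tau> x \<bullet> Delta x (v \<tau>))))"
        unfolding g_def drift_def using \<tau> by (simp add: algebra_simps)
      then show ?thesis
        unfolding mean_V[OF \<tau>] using True nn drift_bounds(1)[of \<tau> x]
        by (simp add: ennreal_mult ennreal_plus)
    qed simp
  qed
  also have "\<dots> = ennreal (0 - (- (exp (- J.\<Lambda> * (s - s)) * exp (- r * s) * (w s + C / r))))"
  proof (rule nn_integral_FTC_atLeast[where F = "\<lambda>\<tau>. - (exp (- J.\<Lambda> * (\<tau> - s)) * exp (- r * \<tau>) * (w \<tau> + C / r))", OF gm])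
    fix \<tau> assume "s \<le> \<tau>"
    then have \<tau>: "0 \<le> \<tau>" using s by simp
    show "((\<lambda>\<tau>. - (exp (- J.\<Lambda> * (\<tau> - s)) * exp (- r * \<tau>) * (w \<tau> + C / r))) has_real_derivative g \<tau>) (at \<tau>)"
      using \<tau> r by (auto intro!: derivative_eq_intros w(2) simp: g_def V_def w(1) field_simps)
    have "0 \<le> H x (Delta x (v \<tau>)) + F x (\<mu> \<tau>) + C"
    proof -
      have "0 \<le> RB * (2 * N * Bv)" using RB N Bv0 by simp
      moreover have "K0 + 2 * (RB * (2 * N * Bv)) \<le> C" by (simp add: C_def)
      ultimately show ?thesis using HF_bound[OF \<tau>, of x] by linarith
    qed
    then have 1: "0 \<le> exp (- r * \<tau>) * (H x (Delta x (v \<tau>)) + F x (\<mu> \<tau>) + C)"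
      by (rule mult_nonneg_nonneg[OF exp_ge_zero])
    have 2: "0 \<le> J.\<Lambda> * V (\<tau>, x)" using J.\<Lambda> V_bounds(1)[of "(\<tau>, x)"] by simp
    have m: "max 0 \<tau> = \<tau>" using \<tau> by simp
    show "0 \<le> g \<tau>" unfolding g_def m by (rule mult_nonneg_nonneg[OF exp_ge_zero add_nonneg_nonneg[OF 1 2]])
  next
    have "((\<lambda>\<tau>. exp (- l * (\<tau> - s)) * c) \<longlongrightarrow> 0) at_top" if "0 < l" for l c :: real
      using that by real_asymp
    from this[OF J.\<Lambda>] have "((\<lambda>\<tau>. exp (- J.\<Lambda> * (\<tau> - s)) * (Bv + C / r)) \<longlongrightarrow> 0) at_top" .
    moreover have "eventually (\<lambda>\<tau>. norm (- (exp (- J.\<Lambda> * (\<tau> - s)) * exp (- r * \<tau>) * (w \<tau> + C / r))) \<le> exp (- J.\<Lambda> * (\<tau> - s)) * (Bv + C / r)) at_top"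
      using eventually_ge_at_top[of 0]
    proof eventually_elim
      case (elim \<tau>)
      have "\<bar>w \<tau> + C / r\<bar> \<le> Bv + C / r"
        using w(1)[OF elim] component_le_norm_cart[of "v \<tau>" x] Bv[OF elim] C0 r
        by (auto intro: order_trans[OF abs_triangle_ineq] simp: abs_of_nonneg)
      moreover have "exp (- r * \<tau>) \<le> 1" using r elim by simp
      ultimately have "exp (- r * \<tau>) * \<bar>w \<tau> + C / r\<bar> \<le> 1 * (Bv + C / r)" by (intro mult_mono) auto
      then show ?case by (simp add: abs_mult mult.assoc)
    qed
    ultimately show "((\<lambda>\<tau>. - (exp (- J.\<Lambda> * (\<tau> - s)) * exp (- r * \<tau>) * (w \<tau> + C / r))) \<longlongrightarrow> 0) at_top"
      by (rule Lim_null_comparison[rotated])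
  qed
  also have "0 - (- (exp (- J.\<Lambda> * (s - s)) * exp (- r * s) * (w s + C / r))) = V (s, x)"
    using s by (simp add: V_def w(1))
  finally show ?thesis .
qed

text \<open>Dynkin's formula, from uniqueness for the renewal equation.\<close>

lemma running_drift:
  assumes s: "0 \<le> s"
  shows "J.running (\<lambda>t x. ennreal (drift t x)) (s, x) = ennreal (V (s, x))"
proof (rule antisym)
  have dm: "(\<lambda>t. ennreal (drift t x)) \<in> borel_measurable borel" for x using drift_meas by measurable
  have Vm: "(\<lambda>t. ennreal (V (t, x))) \<in> borel_measurable borel" for x using V_meas by measurable
  show "J.running (\<lambda>t x. ennreal (drift t x)) (s, x) \<le> ennreal (V (s, x))"
  proof (rule J.renewal_comparison[OF r _ dm Vm _ _ _ s])
    show "0 \<le> 2 * C / r" using C0 r by simp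
    fix s x assume s: "0 \<le> (s::real)"
    show "J.running (\<lambda>t x. ennreal (drift t x)) (s, x) \<le> (\<integral>\<^sup>+\<tau>. indicator {s..} \<tau> *
        (ennreal (exp (- J.\<Lambda> * (\<tau> - s))) * (ennreal (drift \<tau> x) + J.mean \<tau> x (J.running (\<lambda>t x. ennreal (drift t x))))) \<partial>lborel)"
      by (rule eq_refl[OF J.running_renewal[OF dm]])
    show "(\<integral>\<^sup>+\<tau>. indicator {s..} \<tau> * (ennreal (exp (- J.\<Lambda> * (\<tau> - s))) * (ennreal (drift \<tau> x) + J.mean \<tau> x (\<lambda>p. ennreal (V p)))) \<partial>lborel)
        \<le> ennreal (V (s, x))" by (simp only: V_renewal[OF s] order_refl)
    have "J.running (\<lambda>t x. ennreal (drift t x)) (s, x) \<le> J.running (\<lambda>t x. ennreal (2 * C * exp (- r * t))) (s, x)"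
      by (rule J.running_mono[OF s]) (use drift_bounds(2) s in \<open>auto intro!: ennreal_leI\<close>)
    also have "\<dots> = ennreal (2 * C / r * exp (- r * s))" by (rule J.running_exp[OF s r]) (use C0 in simp)
    finally show "J.running (\<lambda>t x. ennreal (drift t x)) (s, x) \<le> ennreal (2 * C / r * exp (- r * s))" .
  qed
  show "ennreal (V (s, x)) \<le> J.running (\<lambda>t x. ennreal (drift t x)) (s, x)"
  proof (rule J.renewal_comparison[where D = "\<lambda>p. ennreal (V p)" and V = "J.running (\<lambda>t x. ennreal (drift t x))", OF r _ dm _ _ _ _ s])
    show "0 \<le> Bv + C / r" using C0 r Bv0 by simp
    show "(\<lambda>t. J.running (\<lambda>t x. ennreal (drift t x)) (t, y)) \<in> borel_measurable borel" for y by (rule J.running_meas[OF dm])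
    fix s x assume s: "0 \<le> (s::real)"
    show "(\<integral>\<^sup>+\<tau>. indicator {s..} \<tau> * (ennreal (exp (- J.\<Lambda> * (\<tau> - s))) * (ennreal (drift \<tau> x) +
        J.mean \<tau> x (J.running (\<lambda>t x. ennreal (drift t x))))) \<partial>lborel) \<le> J.running (\<lambda>t x. ennreal (drift t x)) (s, x)"
      by (rule eq_refl[OF J.running_renewal[OF dm, symmetric]])
    show "ennreal (V (s, x)) \<le> (\<integral>\<^sup>+\<tau>. indicator {s..} \<tau> * (ennreal (exp (- J.\<Lambda> * (\<tau> - s))) *
        (ennreal (drift \<tau> x) + J.mean \<tau> x (\<lambda>p. ennreal (V p)))) \<partial>lborel)" by (simp only: V_renewal[OF s] order_refl)
    show "ennreal (V (s, x)) \<le> ennreal ((Bv + C / r) * exp (- r * s))" by (rule ennreal_leI[OF V_bounds(2)[OF s]])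
  qed
qed

lemma running_cost_split:
  "0 \<le> t \<Longrightarrow> running_cost f F r \<alpha> \<mu> t x + C * exp (- r * t) = slack t x + drift t x"
  unfolding running_cost_def slack_def drift_def ext_def by (simp add: algebra_simps)

text \<open>Dynkin's formula evaluates the drift; what is left of the cost is the slack. The expected slack
  may be infinite, so the positive part \<open>A\<close> and the negative part \<open>B\<close> of the cost are compared with all
  terms on the side where they are added, and \<open>B\<close> is finite.\<close>

theorem cost_eq:
  assumes s: "0 \<le> s"
  shows "cost au f F r s x \<alpha> \<mu> = ereal (exp (- r * s) * v s $ x) + enn2ereal (J.running (\<lambda>t x. ennreal (slack t x)) (s, x))"
proof -
  define g where "g t x = slack t x + drift t x - C * exp (- r * max 0 t)" for t x
  have gm [measurable]: "(\<lambda>t. g t x) \<in> borel_measurable borel" for x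
  proof -
    have [measurable]: "(\<lambda>t. slack t x) \<in> borel_measurable borel" "(\<lambda>t. drift t x) \<in> borel_measurable borel"
      by (rule slack_meas, rule drift_meas)
    show ?thesis unfolding g_def by measurable
  qed
  have g: "running_cost f F r \<alpha> \<mu> t x = g t x" if "0 \<le> t" for t x
    using running_cost_split[OF that, of x] that by (simp add: g_def)
  define A where "A = J.running (\<lambda>t x. ennreal (g t x)) (s, x)"
  define B where "B = J.running (\<lambda>t x. ennreal (- g t x)) (s, x)"
  define S where "S = J.running (\<lambda>t x. ennreal (slack t x)) (s, x)"
  have cost: "cost au f F r s x \<alpha> \<mu> = enn2ereal A - enn2ereal B"
  proof -
    have "(\<integral>\<^sup>+\<omega>. (\<integral>\<^sup>+t\<in>{s..}. ennreal (running_cost f F r \<alpha> \<mu> t (jump_process \<alpha> s x \<omega> t)) \<partial>lborel) \<partial>jump_noise au) = A"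
      unfolding A_def J.running_eq[OF s] state_ext[OF s]
      by (intro nn_integral_cong) (use s in \<open>auto simp: g split: split_indicator\<close>)
    moreover have "(\<integral>\<^sup>+\<omega>. (\<integral>\<^sup>+t\<in>{s..}. ennreal (- running_cost f F r \<alpha> \<mu> t (jump_process \<alpha> s x \<omega> t)) \<partial>lborel) \<partial>jump_noise au) = B"
      unfolding B_def J.running_eq[OF s] state_ext[OF s]
      by (intro nn_integral_cong) (use s in \<open>auto simp: g split: split_indicator\<close>)
    ultimately show ?thesis unfolding cost_def by simp
  qed
  have m: "(\<lambda>t. ennreal (g t x)) \<in> borel_measurable borel" "(\<lambda>t. ennreal (- g t x)) \<in> borel_measurable borel"
    "(\<lambda>t. ennreal (C * exp (- r * t))) \<in> borel_measurable borel"
    "(\<lambda>t. ennreal (slack t x)) \<in> borel_measurable borel" "(\<lambda>t. ennreal (drift t x)) \<in> borel_measurable borel" for x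
    using slack_meas[of x] drift_meas[of x] by measurable
  have "J.running (\<lambda>t x. ennreal (g t x) + ennreal (C * exp (- r * t))) (s, x) =
      J.running (\<lambda>t x. ennreal (- g t x) + (ennreal (slack t x) + ennreal (drift t x))) (s, x)"
  proof (rule J.running_cong[OF s])
    fix t y assume "s \<le> t"
    then have t: "0 \<le> t" using s by simp
    have eq: "g t y + C * exp (- r * t) = slack t y + drift t y" using t by (simp add: g_def)
    have p: "0 \<le> C * exp (- r * t)" "0 \<le> slack t y + drift t y"
      using C0 slack_nonneg[of t y] drift_bounds(1)[of t y] by auto
    have "ennreal (g t y) + ennreal (C * exp (- r * t)) = ennreal (- g t y) + ennreal (slack t y + drift t y)"
    proof (cases "0 \<le> g t y")
      case True
      then show ?thesis using p eq by (simp add: ennreal_plus[symmetric] ennreal_neg del: ennreal_plus)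
    next
      case False
      then have "C * exp (- r * t) = - g t y + (slack t y + drift t y)" using eq by simp
      then show ?thesis using False p by (simp add: ennreal_plus[symmetric] ennreal_neg del: ennreal_plus)
    qed
    then show "ennreal (g t y) + ennreal (C * exp (- r * t)) = ennreal (- g t y) + (ennreal (slack t y) + ennreal (drift t y))"
      using slack_nonneg drift_bounds(1) by (simp add: ennreal_plus)
  qed
  then have sum: "A + ennreal (C / r * exp (- r * s)) = B + (S + ennreal (V (s, x)))"
  proof -
    have m45: "(\<lambda>t. ennreal (slack t x) + ennreal (drift t x)) \<in> borel_measurable borel" for x
      using m(4,5)[of x] by measurable
    show ?thesis
      using \<open>J.running (\<lambda>t x. ennreal (g t x) + ennreal (C * exp (- r * t))) (s, x) =
        J.running (\<lambda>t x. ennreal (- g t x) + (ennreal (slack t x) + ennreal (drift t x))) (s, x)\<close>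
      unfolding J.running_add[OF m(1) m(3)] J.running_add[OF m(2) m45] J.running_add[OF m(4) m(5)]
        J.running_exp[OF s r C0] running_drift[OF s] A_def B_def S_def .
  qed
  have Vs: "V (s, x) = exp (- r * s) * v s $ x + C / r * exp (- r * s)" using s by (simp add: V_def algebra_simps)
  have "B \<le> J.running (\<lambda>t x. ennreal (C * exp (- r * t))) (s, x)"
    unfolding B_def
  proof (rule J.running_mono[OF s], rule ennreal_leI)
    fix t y assume "s \<le> t"
    then show "- g t y \<le> C * exp (- r * t)"
      using s slack_nonneg[of t y] drift_bounds(1)[of t y] by (simp add: g_def)
  qed
  then have "B \<le> ennreal (C / r * exp (- r * s))" by (simp only: J.running_exp[OF s r C0])
  then have "B < \<top>" using le_less_trans ennreal_less_top by blast
  then obtain b where b: "B = ennreal b" "0 \<le> b" by (cases B) auto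
  define c where "c = C / r * exp (- r * s)"
  have c: "0 \<le> c" using C0 r by (simp add: c_def)
  show ?thesis
  proof (cases S)
    case top
    then have "A + ennreal c = \<top>" using sum by (simp add: c_def)
    then have "A = \<top>" by (simp add: ennreal_add_eq_top)
    then show ?thesis unfolding cost S_def[symmetric] using top b by simp
  next
    case (real h)
    have "A + ennreal c = ennreal (b + (h + V (s, x)))"
      using sum b real V_bounds(1) by (simp add: c_def ennreal_plus)
    moreover have "A < \<top>"
    proof -
      have "A + ennreal c < \<top>" using calculation by simp
      then show ?thesis using add.commute le_iff_add le_less_trans by metis
    qed
    then obtain a where a: "A = ennreal a" "0 \<le> a" by (cases A) auto
    ultimately have "ennreal (a + c) = ennreal (b + (h + V (s, x)))" using c by (simp add: ennreal_plus)
    then have "a + c = b + (h + V (s, x))"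
      by (subst (asm) ennreal_inj) (use a b c real V_bounds(1)[of "(s, x)"] in auto)
    then have "a - b = exp (- r * s) * v s $ x + h" unfolding Vs c_def by simp
    then show ?thesis unfolding cost S_def[symmetric] using a b real by simp
  qed
qed

lemma cost_of_optimal:
  assumes opt: "AE t in lborel. 0 \<le> t \<longrightarrow> (\<forall>x. \<alpha> t x = G x (Delta x (v t)))" and s: "0 \<le> s"
  shows "cost au f F r s x \<alpha> \<mu> = ereal (exp (- r * s) * v s $ x)"
proof -
  have "J.running (\<lambda>t x. ennreal (slack t x)) (s, x) = 0"
  proof (rule J.running_eq_0[OF s])
    show "AE t in lborel. 0 \<le> t \<longrightarrow> (\<forall>x. ennreal (slack t x) = 0)"
      using opt by eventually_elim (auto simp: slack_def ext_def H_eq)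
  qed
  then show ?thesis unfolding cost_eq[OF s] by (simp add: zero_ennreal.rep_eq)
qed

text \<open>A control that costs no more than the value function has no expected slack. Since every state
  is occupied with positive probability at every positive time, the slack then vanishes in every
  state at almost every time, and minimisers are unique.\<close>

lemma optimal_of_cost:
  assumes le: "cost au f F r 0 x0 \<alpha> \<mu> \<le> ereal (v 0 $ x0)"
  shows "AE t in lborel. 0 \<le> t \<longrightarrow> (\<forall>x. \<alpha> t x = G x (Delta x (v t)))"
proof -
  let ?k = "\<lambda>t x. ennreal (slack t x)"
  have km: "(\<lambda>t. ?k t x) \<in> borel_measurable borel" for x using slack_meas[of x] by measurable
  have "J.running ?k (0, x0) = 0"
  proof -
    have "ereal (v 0 $ x0) + enn2ereal (J.running ?k (0, x0)) \<le> ereal (v 0 $ x0)"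
      using le cost_eq[of 0 x0] by simp
    then have "enn2ereal (J.running ?k (0, x0)) \<le> 0" by (cases "enn2ereal (J.running ?k (0, x0))") auto
    then have "enn2ereal (J.running ?k (0, x0)) = enn2ereal 0"
      using enn2ereal_nonneg[of "J.running ?k (0, x0)"] by (simp add: zero_ennreal.rep_eq)
    then show ?thesis by (simp only: enn2ereal_inject)
  qed
  then have "(\<integral>\<^sup>+t. (\<Sum>y\<in>UNIV. J.transition t y (0, x0) * ?k t y) \<partial>lborel) = 0"
    using J.running_transition[OF km] by simp
  moreover have "(\<lambda>t. \<Sum>y\<in>UNIV. J.transition t y (0, x0) * ?k t y) \<in> borel_measurable lborel"
  proof -
    have [measurable]: "(\<lambda>t. J.transition t y (0, x0)) \<in> borel_measurable borel" "(\<lambda>t. ?k t y) \<in> borel_measurable borel" for y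
      by (rule J.transition_time_meas, rule km)
    show ?thesis by measurable
  qed
  ultimately have "AE t in lborel. (\<Sum>y\<in>UNIV. J.transition t y (0, x0) * ?k t y) = 0"
    by (subst (asm) nn_integral_0_iff_AE) auto
  moreover have "AE t in lborel. t \<noteq> (0::real)" by (rule AE_lborel_singleton)
  ultimately show ?thesis
  proof eventually_elim
    case (elim t)
    show ?case
    proof (intro impI allI)
      fix x assume "0 \<le> t"
      then have t: "0 < t" using elim(2) by simp
      have "J.transition t x (0, x0) * ?k t x = 0" using elim(1) by simp
      moreover have "0 < J.transition t x (0, x0)" by (rule J.transition_pos[OF al t])
      ultimately have "slack t x \<le> 0" by (auto simp: ennreal_eq_0_iff)
      then have "slack t x = 0" using slack_nonneg[of t x] by simp
      then have "f x (\<alpha> t x) + \<alpha> t x \<bullet> Delta x (v t) = H x (Delta x (v t))" using t by (simp add: slack_def ext_def)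
      moreover have "\<alpha> t x \<in> rate_vectors al au x" using \<alpha> t by (simp add: controls_def)
      ultimately show "\<alpha> t x = G x (Delta x (v t))" by (rule G_unique[rotated])
    qed
  qed
qed

end

section \<open>Equilibria\<close>

context game
begin

abbreviation feedback :: "(real \<Rightarrow> real^'n) \<Rightarrow> real \<Rightarrow> 'n \<Rightarrow> real^'n" where
  "feedback v \<equiv> \<lambda>t x. G x (Delta x (v t))"

lemma feedback_continuous: "continuous_on {0..} v \<Longrightarrow> continuous_on {0..} (\<lambda>t. feedback v t x)"
  by (rule continuous_on_compose2[OF G_continuous Delta_continuous]) auto

lemma feedback_control: "continuous_on {0..} v \<Longrightarrow> feedback v \<in> controls al au"
  unfolding controls_def
  by (auto intro!: borel_measurable_continuous_on_restrict feedback_continuous G_rate)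

lemma verificationI:
  assumes "0 < r" "\<alpha> \<in> controls al au" "simplex_flow \<mu>" "continuous_on {0..} \<mu>" "hjb r v \<mu>" "bounded (v ` {0..})"
  shows "verification H G F al au LF f r \<alpha> \<mu> v"
  by unfold_locales (fact assms)+

text \<open>The law is insensitive to changes of the control on a null set of times, so it may be computed
  with the continuous feedback rates.\<close>

lemma law_of_optimal:
  assumes \<alpha>: "\<alpha> \<in> controls al au" and v: "continuous_on {0..} v"
    and opt: "AE t in lborel. 0 \<le> t \<longrightarrow> (\<forall>x. \<alpha> t x = feedback v t x)"
    and p: "kolmogorov v p" "p 0 = axis x0 1" and t: "0 \<le> t"
  shows "\<P>(\<omega> in jump_noise au. jump_process \<alpha> 0 x0 \<omega> t = x) = p t $ x"
proof -
  interpret J: jump al au "ext \<alpha>" by (rule jump_of_control[OF \<alpha>]) (use al au0 in auto)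
  have "J.transition t x (0, x0) = ennreal (\<P>(\<omega> in jump_noise au. state (ext \<alpha>) (0, x0) \<omega> t = x))"
    by (rule J.transition_eq_prob[OF order_refl t])
  then have "enn2real (J.transition t x (0, x0)) = \<P>(\<omega> in jump_noise au. jump_process \<alpha> 0 x0 \<omega> t = x)"
    unfolding state_ext[OF order_refl] by (simp only: enn2real_ennreal[OF measure_nonneg])
  moreover have "enn2real (J.transition t x (0, x0)) = p t $ x"
  proof (rule J.law_eq_forward_solution[where \<beta> = "feedback v" and p = p, OF feedback_continuous[OF v] _ t _ p(2)])
    show "AE \<tau> in lborel. 0 \<le> \<tau> \<longrightarrow> (\<forall>x. ext \<alpha> \<tau> x = feedback v \<tau> x)"
      using opt by eventually_elim (auto simp: ext_def)
    show "((\<lambda>s. p s $ x) has_real_derivative (\<Sum>z\<in>UNIV. p s $ z * feedback v s z $ x)) (at s within {0..})"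
      if "0 \<le> s" for s x by (rule p(1)[unfolded kolmogorov_def, rule_format, OF that])
  qed
  ultimately show ?thesis by (rule trans[OF sym])
qed

lemma kolmogorov_C1: "kolmogorov u \<mu> \<Longrightarrow> simplex_flow \<mu> \<Longrightarrow> continuous_on {0..} u \<Longrightarrow> C1_flow \<mu>"
  unfolding C1_flow_def simplex_flow_def
proof (intro conjI exI)
  assume k: "kolmogorov u \<mu>" and u: "continuous_on {0..} u"
  show "\<forall>t\<ge>0. (\<mu> has_vector_derivative (\<Sum>y\<in>UNIV. \<mu> t $ y *\<^sub>R G y (Delta y (u t)))) (at t within {0..})"
    using k by (simp add: kolmogorov_iff)
  show "continuous_on {0..} (\<lambda>t. \<Sum>y\<in>UNIV. \<mu> t $ y *\<^sub>R G y (Delta y (u t)))"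
    by (intro continuous_on_sum continuous_on_scaleR continuous_on_component kolmogorov_continuous[OF k]
        feedback_continuous u)
qed

theorem solution_gives_equilibrium:
  assumes r: "0 < r" and s: "bounded_sol r u \<mu>" and init: "\<mu> 0 = axis x0 1"
  shows "mf_equilibrium al au f F r x0 (feedback u) \<mu>"
proof -
  have s: "hjb r u \<mu>" "kolmogorov u \<mu>" "simplex_flow \<mu>" "bounded (u ` {0..})"
    using s by (auto simp: bounded_sol_def sol_def)
  note uc = hjb_continuous[OF s(1)] and \<mu>c = kolmogorov_continuous[OF s(2)]
  note fb = feedback_control[OF uc]
  interpret U: verification H G F al au LF f r "feedback u" \<mu> u
    by (rule verificationI[OF r fb s(3) \<mu>c s(1,4)])
  have "cost au f F r 0 x0 (feedback u) \<mu> \<le> cost au f F r 0 x0 \<alpha>' \<mu>" if \<alpha>': "\<alpha>' \<in> controls al au" for \<alpha>'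
  proof -
    interpret A: verification H G F al au LF f r \<alpha>' \<mu> u
      by (rule verificationI[OF r \<alpha>' s(3) \<mu>c s(1,4)])
    have "cost au f F r 0 x0 (feedback u) \<mu> = ereal (exp (- r * 0) * u 0 $ x0)"
      by (rule U.cost_of_optimal) auto
    also have "\<dots> \<le> cost au f F r 0 x0 \<alpha>' \<mu>"
      unfolding A.cost_eq[OF order_refl] by (simp add: ereal_le_add_self enn2ereal_nonneg)
    finally show ?thesis .
  qed
  note optimal = this
  have law: "\<P>(\<omega> in jump_noise au. jump_process (feedback u) 0 x0 \<omega> t = x) = \<mu> t $ x" if "0 \<le> t" for t x
    by (rule law_of_optimal[OF fb uc _ s(2) init that]) simp
  show ?thesis
    unfolding mf_equilibrium_def
    by (intro conjI ballI allI impI fb kolmogorov_C1[OF s(2,3) uc] law optimal)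
qed

text \<open>The value function \<open>v\<close> is constructed from the flow alone. Its feedback is a competitor with cost
  \<open>v\<close>, so the equilibrium control costs no more and must be this feedback at almost all times. The flow,
  being the law of the process, is then the solution of the forward equation with these rates.\<close>

theorem equilibrium_gives_solution:
  assumes r: "0 < r" and eq: "mf_equilibrium al au f F r x0 \<alpha> \<mu>"
  shows "\<exists>v. bounded_sol r v \<mu> \<and> \<mu> 0 = axis x0 1 \<and>
    (\<forall>t\<ge>0. \<forall>x. cost au f F r t x \<alpha> \<mu> = ereal (exp (- r * t) * v t $ x))"
proof -
  have \<alpha>: "\<alpha> \<in> controls al au" and C1: "C1_flow \<mu>"
    and law: "\<And>t x. 0 \<le> t \<Longrightarrow> \<P>(\<omega> in jump_noise au. jump_process \<alpha> 0 x0 \<omega> t = x) = \<mu> t $ x"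
    and opt: "\<And>\<alpha>'. \<alpha>' \<in> controls al au \<Longrightarrow> cost au f F r 0 x0 \<alpha> \<mu> \<le> cost au f F r 0 x0 \<alpha>' \<mu>"
    using eq by (auto simp: mf_equilibrium_def)
  have \<mu>: "simplex_flow \<mu>" using C1 by (auto simp: C1_flow_def simplex_flow_def)
  have \<mu>c: "continuous_on {0..} \<mu>"
  proof -
    obtain \<mu>' where "\<forall>t\<ge>0. (\<mu> has_vector_derivative \<mu>' t) (at t within {0..})"
      using C1 unfolding C1_flow_def by blast
    then show ?thesis by (intro ode_continuous_on[where x' = \<mu>']) simp
  qed
  obtain v where v: "hjb r v \<mu>" "bounded (v ` {0..})" using hjb_exists[OF r \<mu> \<mu>c] by blast
  note vc = hjb_continuous[OF v(1)]
  note fb = feedback_control[OF vc]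
  interpret A: verification H G F al au LF f r \<alpha> \<mu> v by (rule verificationI[OF r \<alpha> \<mu> \<mu>c v])
  interpret B: verification H G F al au LF f r "feedback v" \<mu> v by (rule verificationI[OF r fb \<mu> \<mu>c v])
  have "cost au f F r 0 x0 (feedback v) \<mu> = ereal (exp (- r * 0) * v 0 $ x0)"
    by (rule B.cost_of_optimal) auto
  then have "cost au f F r 0 x0 \<alpha> \<mu> \<le> ereal (v 0 $ x0)" using opt[OF fb] by simp
  then have ae: "AE t in lborel. 0 \<le> t \<longrightarrow> (\<forall>x. \<alpha> t x = feedback v t x)" by (rule A.optimal_of_cost)
  obtain p where p: "kolmogorov v p" "p 0 = axis x0 1" using kolmogorov_exists[OF vc] by blast
  have \<mu>p: "\<mu> t = p t" if "0 \<le> t" for t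
    using law_of_optimal[OF \<alpha> vc ae p that] law[OF that] by (simp add: vec_eq_iff)
  have "kolmogorov v \<mu>"
    unfolding kolmogorov_def
  proof (intro allI impI)
    fix t :: real and x assume t: "0 \<le> t"
    have "((\<lambda>s. p s $ x) has_real_derivative (\<Sum>y\<in>UNIV. \<mu> t $ y * G y (Delta y (v t)) $ x)) (at t within {0..})"
      using p(1) t \<mu>p[OF t] by (simp add: kolmogorov_def)
    then show "((\<lambda>s. \<mu> s $ x) has_real_derivative (\<Sum>y\<in>UNIV. \<mu> t $ y * G y (Delta y (v t)) $ x)) (at t within {0..})"
      by (rule has_field_derivative_transform_within[of _ _ _ _ 1]) (use t \<mu>p in auto)
  qed
  then have "bounded_sol r v \<mu>" using v \<mu> by (simp add: bounded_sol_def sol_def)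
  moreover have "\<mu> 0 = axis x0 1" using \<mu>p[of 0] p(2) by simp
  ultimately show ?thesis using A.cost_of_optimal[OF ae] by (intro exI[of _ v] conjI allI impI)
qed

end

section \<open>The discounted mean field game\<close>

text \<open>The gradient of the Hamiltonian is the minimiser; the constant of strong concavity is half the
  Hessian bound.\<close>

lemma game_of_assumptions:
  fixes f F :: "'n::finite \<Rightarrow> real^'n \<Rightarrow> real" and al au :: real
  assumes d: "CARD('n) \<ge> 2"
    and f_meas: "\<And>x. f x \<in> borel_measurable borel"
    and A1: "0 < al" "al < au"
    and A2: "\<And>x p. \<exists>!a. is_minimizer al au f x p a"
    and A3: "\<And>x. \<exists>D. simplex_C1 (F x) D"
    and A4: "\<And>\<eta> \<eta>'. \<eta> \<in> prob_simplex \<Longrightarrow> \<eta>' \<in> prob_simplex \<Longrightarrow>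
               (\<Sum>x\<in>UNIV. (F x \<eta> - F x \<eta>') * (\<eta> $ x - \<eta>' $ x)) \<ge> 0"
    and A5: "regular_hamiltonian (hamiltonian al au f)"
  shows "\<exists>LF. game (hamiltonian al au f) (gamma_star al au f) F al au LF f"
proof -
  let ?H = "hamiltonian al au f" and ?G = "gamma_star al au f"
  obtain DH D2H where H: "\<And>x p. (?H x has_derivative (\<lambda>\<xi>. DH x p \<bullet> \<xi>)) (at p)"
    "\<And>x p. (DH x has_derivative (\<lambda>\<xi>. D2H x p *v \<xi>)) (at p)"
    and K: "\<And>K. K > 0 \<Longrightarrow> (\<exists>L. \<forall>x. L-lipschitz_on (cube K) (DH x) \<and> L-lipschitz_on (cube K) (D2H x)) \<and>
      (\<exists>C>0. \<forall>x. \<forall>p\<in>cube K. \<forall>\<xi>. \<xi> $ x = 0 \<longrightarrow> \<xi> \<bullet> (D2H x p *v \<xi>) \<le> - C * (norm \<xi>)\<^sup>2)"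
    using A5 unfolding regular_hamiltonian_def Let_def cube_alt by blast
  have DH: "DH x p = ?G x p" for x p by (rule hamiltonian_gradient[OF A2 H(1)])
  have "\<forall>x. \<exists>M\<ge>0. \<forall>\<eta>\<in>prob_simplex. \<forall>\<eta>'\<in>prob_simplex. \<bar>F x \<eta> - F x \<eta>'\<bar> \<le> M * l1 (\<eta> - \<eta>')"
    using A3 simplex_C1_lipschitz by blast
  then obtain M where M: "\<And>x. M x \<ge> 0"
    "\<And>x \<eta> \<eta>'. \<eta> \<in> prob_simplex \<Longrightarrow> \<eta>' \<in> prob_simplex \<Longrightarrow> \<bar>F x \<eta> - F x \<eta>'\<bar> \<le> M x * l1 (\<eta> - \<eta>')" by metis
  define LF where "LF = (\<Sum>x\<in>UNIV. M x)"
  have MLF: "M x \<le> LF" for x unfolding LF_def using M(1) by (intro member_le_sum) auto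
  have "game ?H ?G F al au LF f"
  proof
    show "CARD('n) \<ge> 2" "0 < al" "al < au" by (fact d, fact A1, fact A1)
    show "?G x p \<in> rate_vectors al au x" for x p by (rule gamma_star_minimizes(1)[OF A2])
    show "(?H x has_derivative (\<lambda>\<xi>. ?G x p \<bullet> \<xi>)) (at p)" for x p using H(1)[of x p] by (simp add: DH)
    \<comment> \<open>The regularity assumption concerns positive \<open>K\<close>, hence \<open>max K 1\<close>.\<close>
    show "\<exists>c>0. \<forall>x. \<forall>p\<in>cube K. \<forall>q\<in>cube K. p $ x = q $ x \<longrightarrow>
        ?H x q \<le> ?H x p + ?G x p \<bullet> (q - p) - c * (norm (q - p))\<^sup>2" for K
    proof -
      obtain C where C: "C > 0" "\<And>x p \<xi>. p \<in> cube (max K 1) \<Longrightarrow> \<xi> $ x = 0 \<Longrightarrow> \<xi> \<bullet> (D2H x p *v \<xi>) \<le> - C * (norm \<xi>)\<^sup>2"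
      proof -
        have "0 < max K 1" by simp
        from K[OF this] show ?thesis using that by blast
      qed
      have "?H x q \<le> ?H x p + DH x p \<bullet> (q - p) - C / 2 * (norm (q - p))\<^sup>2"
        if "p \<in> cube K" "q \<in> cube K" "p $ x = q $ x" for x p q
        by (rule regular_strong_concavity[OF H C(2)]) (use that in \<open>auto intro: cube_mono\<close>)
      then show ?thesis using C(1) by (intro exI[of _ "C / 2"]) (auto simp: DH)
    qed
    show "\<exists>L\<ge>0. \<forall>x. \<forall>p\<in>cube K. \<forall>q\<in>cube K. norm (?G x p - ?G x q) \<le> L * norm (p - q)" for K
    proof -
      obtain L where L: "\<And>x. L-lipschitz_on (cube (max K 1)) (DH x)"
      proof -
        have "0 < max K 1" by simp
        from K[OF this] show ?thesis using that by blast
      qed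
      have "norm (?G x p - ?G x q) \<le> L * norm (p - q)" if "p \<in> cube K" "q \<in> cube K" for x p q
      proof -
        have c: "p \<in> cube (max K 1)" "q \<in> cube (max K 1)" using that by (auto intro: cube_mono)
        show ?thesis using lipschitz_onD[OF L[of x] c] by (simp only: dist_norm DH)
      qed
      then show ?thesis using lipschitz_on_nonneg[OF L] by blast
    qed
    show "0 \<le> LF" unfolding LF_def using M(1) by (intro sum_nonneg)
    show "\<bar>F x \<eta> - F x \<eta>'\<bar> \<le> LF * l1 (\<eta> - \<eta>')" if "\<eta> \<in> prob_simplex" "\<eta>' \<in> prob_simplex" for x \<eta> \<eta>'
      using M(2)[OF that, of x] mult_right_mono[OF MLF[of x] l1_ge_0[of "\<eta> - \<eta>'"]] by linarith
    show "(\<Sum>x\<in>UNIV. (F x \<eta> - F x \<eta>') * (\<eta> $ x - \<eta>' $ x)) \<ge> 0" if "\<eta> \<in> prob_simplex" "\<eta>' \<in> prob_simplex" for \<eta> \<eta>'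
      by (rule A4[OF that])
    show "f x \<in> borel_measurable borel" for x by (rule f_meas)
    show "?H x p \<le> f x a + a \<bullet> p" if "a \<in> rate_vectors al au x" for x a p by (rule hamiltonian_le[OF A2 that])
    show "?H x p = f x (?G x p) + ?G x p \<bullet> p" for x p by (rule hamiltonian_eq[OF A2])
    show "a = ?G x p" if a: "a \<in> rate_vectors al au x" "f x a + a \<bullet> p = ?H x p" for x a p
    proof -
      have "is_minimizer al au f x p a"
        unfolding is_minimizer_def is_arg_min_linorder using a hamiltonian_le[OF A2] by auto
      then show ?thesis using gamma_star_minimizes(3)[OF A2] by simp
    qed
  qed
  then show ?thesis by blast
qed

theorem proposition2p2:
  fixes f F :: "'n::finite \<Rightarrow> real^'n \<Rightarrow> real" and al au :: real
  assumes d: "CARD('n) \<ge> 2"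
    and f_meas: "\<And>x. f x \<in> borel_measurable borel"
    and F_meas: "\<And>x. F x \<in> borel_measurable (restrict_space borel prob_simplex)"
    and f_indep: "\<And>x a b. (\<And>y. y \<noteq> x \<Longrightarrow> a $ y = b $ y) \<Longrightarrow> f x a = f x b"
    and A1: "0 < al" "al < au"
    and A2: "\<And>x p. \<exists>!a. is_minimizer al au f x p a"
      "\<And>x. gamma_star al au f x \<in> borel_measurable borel"
    and A3: "\<And>x. \<exists>D. simplex_C1 (F x) D \<and>
               (\<forall>y z. y \<noteq> z \<longrightarrow> (\<exists>L. L-lipschitz_on prob_simplex (D y z)))"
    and A4: "\<And>\<eta> \<eta>'. \<eta> \<in> prob_simplex \<Longrightarrow> \<eta>' \<in> prob_simplex \<Longrightarrow>
               (\<Sum>x\<in>UNIV. (F x \<eta> - F x \<eta>') * (\<eta> $ x - \<eta>' $ x)) \<ge> 0"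
    and A5: "regular_hamiltonian (hamiltonian al au f)"
  shows "\<exists>r0>0.
    \<comment> \<open>(i)\<close>
    (\<forall>r\<in>{0<..<r0}. \<forall>\<mu>0\<in>prob_simplex.
       (\<exists>u \<mu>. mfg_solution al au f F r \<mu>0 u \<mu>) \<and>
       (\<forall>u \<mu> u' \<mu>'. mfg_solution al au f F r \<mu>0 u \<mu> \<and> mfg_solution al au f F r \<mu>0 u' \<mu>' \<longrightarrow>
          (\<forall>t\<ge>0. u t = u' t \<and> \<mu> t = \<mu>' t))) \<and>
    \<comment> \<open>(ii)\<close>
    (\<exists>\<gamma>>0. \<exists>C>0. \<forall>r\<in>{0<..<r0}. \<exists>ubar \<mu>bar.
       stationary_solution al au f F r ubar \<mu>bar \<and>
       (\<forall>u \<mu>. stationary_solution al au f F r u \<mu> \<longrightarrow> u = ubar \<and> \<mu> = \<mu>bar) \<and>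
       ((\<forall>x. \<forall>a\<in>rate_vectors al au x. \<forall>\<eta>\<in>prob_simplex. 0 < f x a + F x \<eta>) \<longrightarrow>
          (\<forall>x. 0 < ubar $ x)) \<and>
       (\<forall>\<mu>0\<in>prob_simplex. \<forall>u \<mu>. mfg_solution al au f F r \<mu>0 u \<mu> \<longrightarrow>
          (\<forall>t\<ge>0. norm (\<mu> t - \<mu>bar) + norm (u t - ubar) \<le> C * exp (- \<gamma> * t)))) \<and>
    \<comment> \<open>(iii)\<close>
    (\<exists>\<gamma>>0. \<exists>C>0. \<forall>r\<in>{0<..<r0}. \<forall>\<mu>0\<in>prob_simplex. \<forall>\<mu>0'\<in>prob_simplex. \<forall>u \<mu> u' \<mu>'.
       mfg_solution al au f F r \<mu>0 u \<mu> \<and> mfg_solution al au f F r \<mu>0' u' \<mu>' \<longrightarrow>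
       (\<forall>t\<ge>0. norm (\<mu> t - \<mu>' t) + norm (u t - u' t) \<le> C * exp (- \<gamma> * t) * norm (\<mu>0 - \<mu>0'))) \<and>
    \<comment> \<open>(iv)\<close>
    (\<forall>r\<in>{0<..<r0}. \<forall>x0.
       (\<forall>u \<mu>. mfg_solution al au f F r (axis x0 1) u \<mu> \<longrightarrow>
          mf_equilibrium al au f F r x0 (\<lambda>t x. gamma_star al au f x (Delta x (u t))) \<mu>) \<and>
       (\<forall>\<alpha> \<mu>. mf_equilibrium al au f F r x0 \<alpha> \<mu> \<longrightarrow>
          (\<forall>t\<ge>0. \<forall>x. \<bar>cost au f F r t x \<alpha> \<mu>\<bar> \<noteq> \<infinity>) \<and>
          mfg_solution al au f F r (axis x0 1)
            (\<lambda>t. \<chi> x. exp (r * t) * real_of_ereal (cost au f F r t x \<alpha> \<mu>)) \<mu>))"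
proof -
  obtain LF where game: "game (hamiltonian al au f) (gamma_star al au f) F al au LF f"
  proof -
    have "\<exists>D. simplex_C1 (F x) D" for x using A3 by blast
    from game_of_assumptions[OF d f_meas A1 A2(1) this A4 A5] show ?thesis using that by blast
  qed
  interpret game "hamiltonian al au f" "gamma_star al au f" F al au LF f by (fact game)
  have sol_iff: "mfg_solution al au f F r \<mu>0 u \<mu> \<longleftrightarrow> bounded_sol r u \<mu> \<and> \<mu> 0 = \<mu>0" for r \<mu>0 u \<mu>
  proof -
    have eq: "- (- r * a + b + c) = r * a - b - c" for a b c :: real by simp
    show ?thesis
      unfolding mfg_solution_def eq bounded_sol_def sol_def hjb_def kolmogorov_def simplex_flow_def by blast
  qed
  have stat_iff: "stationary_solution al au f F r u \<mu> \<longleftrightarrow> bounded_sol r (\<lambda>_. u) (\<lambda>_. \<mu>)" for r u \<mu>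
  proof -
    have "- r * u $ x + h + F x \<mu> = 0 \<longleftrightarrow> r * u $ x - h - F x \<mu> = 0" for x h by auto
    then show ?thesis unfolding stationary_solution_def constant_bounded_sol_iff by simp
  qed
  obtain r0 \<gamma> C where const: "r0 > 0" "\<gamma> > 0" "C > 0"
    and stable0: "\<forall>r\<in>{0<..<r0}. \<forall>u \<mu> u' \<mu>'. bounded_sol r u \<mu> \<longrightarrow> bounded_sol r u' \<mu>' \<longrightarrow>
     (\<forall>t\<ge>0. l1 (\<mu> t - \<mu>' t) + supn (u t - u' t) \<le> C * exp (- \<gamma> * t) * l1 (\<mu> 0 - \<mu>' 0))"
    using exponential_stability by blast
  note stable = stable0[rule_format]
  \<comment> \<open>One factor \<open>N\<close> for each change of norms, on the two sides of the estimate.\<close>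
  define C' where "C' = N * (C * N)"
  have C': "C' > 0" using const N by (simp add: C'_def)
  have stable': "norm (\<mu> t - \<mu>' t) + norm (u t - u' t) \<le> C' * exp (- \<gamma> * t) * norm (\<mu> 0 - \<mu>' 0)"
    if "r \<in> {0<..<r0}" "bounded_sol r u \<mu>" "bounded_sol r u' \<mu>'" "0 \<le> t" for r u \<mu> u' \<mu>' t
  proof -
    have "norm (\<mu> t - \<mu>' t) + norm (u t - u' t) \<le> N * l1 (\<mu> t - \<mu>' t) + N * supn (u t - u' t)"
    proof (rule add_mono)
      have "1 * l1 (\<mu> t - \<mu>' t) \<le> N * l1 (\<mu> t - \<mu>' t)" using N by (intro mult_right_mono l1_ge_0) auto
      then show "norm (\<mu> t - \<mu>' t) \<le> N * l1 (\<mu> t - \<mu>' t)" using norm_le_l1_vec[of "\<mu> t - \<mu>' t"] by simp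
      show "norm (u t - u' t) \<le> N * supn (u t - u' t)" unfolding N_def by (rule norm_le_supn)
    qed
    also have "\<dots> \<le> N * (C * exp (- \<gamma> * t) * l1 (\<mu> 0 - \<mu>' 0))"
      unfolding distrib_left[symmetric] using stable[OF that] N by (intro mult_left_mono) auto
    also have "\<dots> \<le> N * (C * exp (- \<gamma> * t) * (N * norm (\<mu> 0 - \<mu>' 0)))"
      using N const l1_le_card_norm[of "\<mu> 0 - \<mu>' 0"] by (intro mult_left_mono) (auto simp: N_def)
    finally show ?thesis by (simp add: C'_def mult_ac)
  qed
  have unique: "u t = u' t \<and> \<mu> t = \<mu>' t"
    if "r \<in> {0<..<r0}" "bounded_sol r u \<mu>" "bounded_sol r u' \<mu>'" "\<mu> 0 = \<mu>' 0" "0 \<le> t" for r u \<mu> u' \<mu>' t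
  proof -
    have "norm (\<mu> t - \<mu>' t) + norm (u t - u' t) \<le> 0" using stable'[OF that(1-3,5)] that(4) by simp
    then have "norm (\<mu> t - \<mu>' t) = 0" "norm (u t - u' t) = 0"
      using norm_ge_zero[of "\<mu> t - \<mu>' t"] norm_ge_zero[of "u t - u' t"] by linarith+
    then show ?thesis by simp
  qed
  have part1: "(\<exists>u \<mu>. mfg_solution al au f F r \<mu>0 u \<mu>) \<and>
       (\<forall>u \<mu> u' \<mu>'. mfg_solution al au f F r \<mu>0 u \<mu> \<and> mfg_solution al au f F r \<mu>0 u' \<mu>' \<longrightarrow>
          (\<forall>t\<ge>0. u t = u' t \<and> \<mu> t = \<mu>' t))" if "r \<in> {0<..<r0}" "\<mu>0 \<in> prob_simplex" for r \<mu>0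
    unfolding sol_iff
  proof (intro conjI allI impI)
    show "\<exists>u \<mu>. bounded_sol r u \<mu> \<and> \<mu> 0 = \<mu>0" by (rule bounded_sol_exists) (use that in auto)
    fix u \<mu> u' \<mu>' and t :: real
    assume s: "(bounded_sol r u \<mu> \<and> \<mu> 0 = \<mu>0) \<and> bounded_sol r u' \<mu>' \<and> \<mu>' 0 = \<mu>0" and t: "0 \<le> t"
    then have b: "bounded_sol r u \<mu>" "bounded_sol r u' \<mu>'" and init: "\<mu> 0 = \<mu>' 0" by simp_all
    show "u t = u' t" "\<mu> t = \<mu>' t" using unique[OF that(1) b init t] by (rule conjunct1, rule conjunct2)
  qed
  have part2: "\<exists>ubar \<mu>bar. stationary_solution al au f F r ubar \<mu>bar \<and>
       (\<forall>u \<mu>. stationary_solution al au f F r u \<mu> \<longrightarrow> u = ubar \<and> \<mu> = \<mu>bar) \<and>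
       ((\<forall>x. \<forall>a\<in>rate_vectors al au x. \<forall>\<eta>\<in>prob_simplex. 0 < f x a + F x \<eta>) \<longrightarrow> (\<forall>x. 0 < ubar $ x)) \<and>
       (\<forall>\<mu>0\<in>prob_simplex. \<forall>u \<mu>. mfg_solution al au f F r \<mu>0 u \<mu> \<longrightarrow>
          (\<forall>t\<ge>0. norm (\<mu> t - \<mu>bar) + norm (u t - ubar) \<le> (2 * C') * exp (- \<gamma> * t)))"
    if r: "r \<in> {0<..<r0}" for r
  proof -
    obtain ub mb where b: "bounded_sol r (\<lambda>_. ub) (\<lambda>_. mb)"
    proof -
      have "\<exists>ub mb. bounded_sol r (\<lambda>_. ub) (\<lambda>_. mb)"
      proof (rule constant_solution_exists[where C = C, OF _ const(2)])
        show "0 < r" using r by simp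
        show "l1 (\<mu> t - \<mu>' t) + supn (u t - u' t) \<le> C * exp (- \<gamma> * t) * l1 (\<mu> 0 - \<mu>' 0)"
          if "bounded_sol r u \<mu>" "bounded_sol r u' \<mu>'" "0 \<le> t" for u \<mu> u' \<mu>' t
          by (rule stable[OF r that])
      qed
      then show ?thesis using that by blast
    qed
    have bs: "mb \<in> prob_simplex" "\<And>x. r * ub $ x = hamiltonian al au f x (Delta x ub) + F x mb"
      using b unfolding constant_bounded_sol_iff by (auto simp: algebra_simps)
    have decay: "norm (\<mu> t - mb) + norm (u t - ub) \<le> (2 * C') * exp (- \<gamma> * t)"
      if s: "bounded_sol r u \<mu>" and t: "0 \<le> t" for u \<mu> t
    proof -
      have "\<mu> 0 \<in> prob_simplex" using s by (auto simp: bounded_sol_def sol_def simplex_flow_def)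
      from l1_simplex[OF this] have "norm (\<mu> 0 - mb) \<le> 2"
        using norm_triangle_ineq4[of "\<mu> 0" mb] norm_le_l1_vec[of "\<mu> 0"] norm_le_l1_vec[of mb] l1_simplex[OF bs(1)] by linarith
      then have "C' * exp (- \<gamma> * t) * norm (\<mu> 0 - mb) \<le> C' * exp (- \<gamma> * t) * 2"
        using C' by (intro mult_left_mono) auto
      then show ?thesis using stable'[OF r s b t] by simp
    qed
    have uniq: "u = ub \<and> \<mu> = mb" if s: "bounded_sol r (\<lambda>_. u) (\<lambda>_. \<mu>)" for u \<mu>
    proof -
      have "norm (\<mu> - mb) + norm (u - ub) \<le> (2 * C') * exp (- \<gamma> * real n)" for n :: nat
        using decay[OF s, of "real n"] by simp
      moreover have "((\<lambda>n. (2 * C') * exp (- \<gamma> * real n)) \<longlongrightarrow> 0) sequentially" using const(2) by real_asymp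
      ultimately have "norm (\<mu> - mb) + norm (u - ub) \<le> 0"
        by (intro tendsto_lowerbound[of "\<lambda>n. (2 * C') * exp (- \<gamma> * real n)"]) auto
      then have "norm (\<mu> - mb) = 0" "norm (u - ub) = 0"
        using norm_ge_zero[of "\<mu> - mb"] norm_ge_zero[of "u - ub"] by linarith+
      then show ?thesis by simp
    qed
    \<comment> \<open>At a state minimising \<open>ub\<close> all differences are nonnegative, so \<open>r\<close> times the value there is at least the
      running cost of the optimal rates.\<close>
    have pos: "0 < ub $ x" if p: "\<forall>x. \<forall>a\<in>rate_vectors al au x. \<forall>\<eta>\<in>prob_simplex. 0 < f x a + F x \<eta>" for x
    proof -
      obtain z where z: "\<And>y. ub $ z \<le> ub $ y"
      proof -
        have "Min (range (\<lambda>y. ub $ y)) \<in> range (\<lambda>y. ub $ y)" by (rule Min_in) auto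
        then obtain z where "ub $ z = Min (range (\<lambda>y. ub $ y))" by (metis rangeE)
        then show ?thesis using that[of z] by simp
      qed
      let ?g = "gamma_star al au f z (Delta z ub)"
      have "0 < f z ?g + F z mb" using p G_rate bs(1) by blast
      also have "\<dots> \<le> f z ?g + ?g \<bullet> Delta z ub + F z mb"
        using rate_at_minimum[OF G_rate[where x = z and p = "Delta z ub"] less_imp_le[OF al] z, of z] by simp
      also have "\<dots> = r * ub $ z" unfolding bs(2) H_eq[where x = z and p = "Delta z ub"] ..
      finally have "0 < ub $ z" using r by (simp add: zero_less_mult_iff)
      then show ?thesis using z[of x] by linarith
    qed
    show ?thesis
      unfolding stat_iff sol_iff
    proof (rule exI[of _ ub], rule exI[of _ mb], intro conjI allI impI ballI)
      show "bounded_sol r (\<lambda>_. ub) (\<lambda>_. mb)" by (fact b)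
      show "u = ub" if "bounded_sol r (\<lambda>_. u) (\<lambda>_. \<mu>)" for u \<mu> using uniq[OF that] by (rule conjunct1)
      show "\<mu> = mb" if "bounded_sol r (\<lambda>_. u) (\<lambda>_. \<mu>)" for u \<mu> using uniq[OF that] by (rule conjunct2)
      show "0 < ub $ x" if "\<forall>x. \<forall>a\<in>rate_vectors al au x. \<forall>\<eta>\<in>prob_simplex. 0 < f x a + F x \<eta>" for x
        by (rule pos[OF that])
      show "norm (\<mu> t - mb) + norm (u t - ub) \<le> (2 * C') * exp (- \<gamma> * t)"
        if "bounded_sol r u \<mu> \<and> \<mu> 0 = \<mu>0" "0 \<le> t" for \<mu>0 u \<mu> t
        by (rule decay[OF conjunct1[OF that(1)] that(2)])
    qed
  qed
  have part4: "(\<forall>u \<mu>. mfg_solution al au f F r (axis x0 1) u \<mu> \<longrightarrow>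
          mf_equilibrium al au f F r x0 (\<lambda>t x. gamma_star al au f x (Delta x (u t))) \<mu>) \<and>
       (\<forall>\<alpha> \<mu>. mf_equilibrium al au f F r x0 \<alpha> \<mu> \<longrightarrow>
          (\<forall>t\<ge>0. \<forall>x. \<bar>cost au f F r t x \<alpha> \<mu>\<bar> \<noteq> \<infinity>) \<and>
          mfg_solution al au f F r (axis x0 1)
            (\<lambda>t. \<chi> x. exp (r * t) * real_of_ereal (cost au f F r t x \<alpha> \<mu>)) \<mu>)"
    if "r \<in> {0<..<r0}" for r x0
  proof (intro conjI allI impI)
    have r: "0 < r" using that by simp
    show "mf_equilibrium al au f F r x0 (\<lambda>t x. gamma_star al au f x (Delta x (u t))) \<mu>"
      if "mfg_solution al au f F r (axis x0 1) u \<mu>" for u \<mu>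
      using solution_gives_equilibrium[OF r] that unfolding sol_iff by blast
    fix \<alpha> \<mu> assume "mf_equilibrium al au f F r x0 \<alpha> \<mu>"
    then obtain v where v: "bounded_sol r v \<mu>" "\<mu> 0 = axis x0 1"
      and cost: "\<And>t x. 0 \<le> t \<Longrightarrow> cost au f F r t x \<alpha> \<mu> = ereal (exp (- r * t) * v t $ x)"
      using equilibrium_gives_solution[OF r] by blast
    show "\<bar>cost au f F r t x \<alpha> \<mu>\<bar> \<noteq> \<infinity>" if "0 \<le> t" for t x using cost[OF that, of x] by simp
    define u where "u t = (\<chi> x. exp (r * t) * real_of_ereal (cost au f F r t x \<alpha> \<mu>))" for t
    have uv: "u t = v t" if "0 \<le> t" for t
      unfolding u_def using cost[OF that] by (simp add: vec_eq_iff mult.assoc[symmetric] exp_add[symmetric])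
    have "bounded_sol r u \<mu>"
      unfolding bounded_sol_def sol_def
    proof (intro conjI)
      have v': "simplex_flow \<mu>" "hjb r v \<mu>" "kolmogorov v \<mu>" "bounded (v ` {0..})"
        using v by (auto simp: bounded_sol_def sol_def)
      show "simplex_flow \<mu>" by (fact v')
      have "u ` {0..} = v ` {0..}" using uv by (intro image_cong) auto
      then show "bounded (u ` {0..})" using v'(4) by simp
      show "kolmogorov u \<mu>" using v'(3) uv by (simp add: kolmogorov_def)
      show "hjb r u \<mu>"
        unfolding hjb_def
      proof (intro allI impI)
        fix t :: real and x assume t: "0 \<le> t"
        have "((\<lambda>s. v s $ x) has_real_derivative (r * u t $ x - hamiltonian al au f x (Delta x (u t)) - F x (\<mu> t))) (at t within {0..})"
          using v'(2) t uv[OF t] by (simp add: hjb_def)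
        then show "((\<lambda>s. u s $ x) has_real_derivative (r * u t $ x - hamiltonian al au f x (Delta x (u t)) - F x (\<mu> t))) (at t within {0..})"
          by (rule has_field_derivative_transform_within[of _ _ _ _ 1]) (use t uv in auto)
      qed
    qed
    then show "mfg_solution al au f F r (axis x0 1) (\<lambda>t. \<chi> x. exp (r * t) * real_of_ereal (cost au f F r t x \<alpha> \<mu>)) \<mu>"
      unfolding sol_iff u_def[abs_def] using v(2) by simp
  qed
  show ?thesis
  proof (rule exI[of _ r0], intro conjI)
    show "r0 > 0" by (fact const)
    show "\<forall>r\<in>{0<..<r0}. \<forall>\<mu>0\<in>prob_simplex. (\<exists>u \<mu>. mfg_solution al au f F r \<mu>0 u \<mu>) \<and>
       (\<forall>u \<mu> u' \<mu>'. mfg_solution al au f F r \<mu>0 u \<mu> \<and> mfg_solution al au f F r \<mu>0 u' \<mu>' \<longrightarrow>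
          (\<forall>t\<ge>0. u t = u' t \<and> \<mu> t = \<mu>' t))"
      by (intro ballI, erule (1) part1)
    show "\<exists>\<gamma>>0. \<exists>C>0. \<forall>r\<in>{0<..<r0}. \<exists>ubar \<mu>bar.
       stationary_solution al au f F r ubar \<mu>bar \<and>
       (\<forall>u \<mu>. stationary_solution al au f F r u \<mu> \<longrightarrow> u = ubar \<and> \<mu> = \<mu>bar) \<and>
       ((\<forall>x. \<forall>a\<in>rate_vectors al au x. \<forall>\<eta>\<in>prob_simplex. 0 < f x a + F x \<eta>) \<longrightarrow> (\<forall>x. 0 < ubar $ x)) \<and>
       (\<forall>\<mu>0\<in>prob_simplex. \<forall>u \<mu>. mfg_solution al au f F r \<mu>0 u \<mu> \<longrightarrow>
          (\<forall>t\<ge>0. norm (\<mu> t - \<mu>bar) + norm (u t - ubar) \<le> C * exp (- \<gamma> * t)))"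
    proof (rule exI[of _ \<gamma>], rule conjI[OF const(2)], rule exI[of _ "2 * C'"], rule conjI)
      show "2 * C' > 0" using C' by simp
    qed (rule ballI, erule part2)
    show "\<exists>\<gamma>>0. \<exists>C>0. \<forall>r\<in>{0<..<r0}. \<forall>\<mu>0\<in>prob_simplex. \<forall>\<mu>0'\<in>prob_simplex. \<forall>u \<mu> u' \<mu>'.
       mfg_solution al au f F r \<mu>0 u \<mu> \<and> mfg_solution al au f F r \<mu>0' u' \<mu>' \<longrightarrow>
       (\<forall>t\<ge>0. norm (\<mu> t - \<mu>' t) + norm (u t - u' t) \<le> C * exp (- \<gamma> * t) * norm (\<mu>0 - \<mu>0'))"
    proof (rule exI[of _ \<gamma>], rule conjI[OF const(2)], rule exI[of _ C'], rule conjI[OF C'], intro ballI allI impI)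
      fix r t :: real and \<mu>0 \<mu>0' u \<mu> u' \<mu>'
      assume r: "r \<in> {0<..<r0}" and t: "0 \<le> t"
        and s: "mfg_solution al au f F r \<mu>0 u \<mu> \<and> mfg_solution al au f F r \<mu>0' u' \<mu>'"
      from s have b: "bounded_sol r u \<mu>" "bounded_sol r u' \<mu>'" and init: "\<mu> 0 = \<mu>0" "\<mu>' 0 = \<mu>0'"
        unfolding sol_iff by auto
      show "norm (\<mu> t - \<mu>' t) + norm (u t - u' t) \<le> C' * exp (- \<gamma> * t) * norm (\<mu>0 - \<mu>0')"
        using stable'[OF r b t] unfolding init .
    qed
    show "\<forall>r\<in>{0<..<r0}. \<forall>x0.
       (\<forall>u \<mu>. mfg_solution al au f F r (axis x0 1) u \<mu> \<longrightarrow>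
          mf_equilibrium al au f F r x0 (\<lambda>t x. gamma_star al au f x (Delta x (u t))) \<mu>) \<and>
       (\<forall>\<alpha> \<mu>. mf_equilibrium al au f F r x0 \<alpha> \<mu> \<longrightarrow>
          (\<forall>t\<ge>0. \<forall>x. \<bar>cost au f F r t x \<alpha> \<mu>\<bar> \<noteq> \<infinity>) \<and>
          mfg_solution al au f F r (axis x0 1)
            (\<lambda>t. \<chi> x. exp (r * t) * real_of_ereal (cost au f F r t x \<alpha> \<mu>)) \<mu>)"
      by (intro ballI allI, erule part4)
  qed
qed

end
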